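(* Let $V$ be the $2$-dimensional representation of the additive group $\mathbb{C}^+$ over $\mathbb{C}$ given by $x\mapsto \begin{pmatrix}1&x\\0&1\end{pmatrix}$, and let $Alg_0=\mathcal{P}(Rep_{\mathbb{C}}(\mathbb{C}^+,V))$. Let $Diag_0$ be the oriented symmetric planar algebra over $\mathbb{C}$ presented by three generators $$G_1: V\to \mathbf 1,\qquad G_2: V\to V^*,\qquad G_3: V^*\to V$$ and the relations $(E_1)$ $G_2\circ G_3=1_{V^*}$; $(E_2)$ $G_1\circ G_3\circ G_1^{*}=0$; $(E_3)$ the oriented circle equals $2$, i.e. $\epsilon\circ\tau\circ\eta=2$; $(E_4)$ $G_2^{*}=-G_2$; $(E_5)$ $\tau_{V,V}=1_V\otimes 1_V+(1_V\otimes G_3)\circ\eta\circ\epsilon\circ(G_2\otimes 1_V)$. Then there is an isomorphism of planar algebras $Diag_0\to Alg_0$.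
   Context: Oriented symmetric planar algebras (OSPAs). An oriented symmetric planar tangle (OSPT) consists of an output disc, finitely many disjoint input discs in its interior, and finitely many oriented strands (immersed arcs or closed curves, allowed to cross transversally) in the complement of the input discs, whose ends lie on the boundaries of the discs; each disc has a marked boundary interval $\star$. OSPTs are considered up to regular isotopy, Reidemeister moves I, II, III, and naturality (a strand may be moved across an input disc). The boundary of each disc, read from $\star$, gives a sequence of signs recording orientations, called its type; inserting a tangle into an input disc of matching type makes OSPTs a coloured operad. An OSPA over a field $k$ is a family of $k$-vector spaces (box spaces) $\beta_\sigma$, indexed by finite sequences $\sigma$ of signs $\pm$, with a multilinear action of the operad of OSPTs. A map of OSPAs is a family of linear maps of box spaces commuting with the action; it is an isomorphism if each linear map is bijective. In this statement "planar algebra" means OSPA. Presentations. A vertex is a labelled disc with a sequence of signs (its degree). The OSPA freely generated by a set of vertices has as elements the linear combinations of OSPTs whose input discs are labelled by vertices of matching degree. A planar ideal is a family of subspaces of the box spaces closed under the operad action (if one input lies in the ideal, so does the output). The OSPA presented by generators and relations is the quotient of the free OSPA by the planar ideal generated by the relations. Morphism notation. For $\sigma=(\sigma_1,\dots,\sigma_n)$ put $V^{\otimes\sigma}=V^{\sigma_1}\otimes\cdots\otimes V^{\sigma_n}$ with $V^+=V$, $V^-=V^*$, and $\sigma^*=(-\sigma_n,\dots,-\sigma_1)$. In any OSPA an element of $\beta_{\alpha\cdot\beta^*}$ is written as a morphism $V^{\otimes\alpha}\to V^{\otimes\beta}$ (formal symbols; diagrams are read upwards, an upward strand is $V$ and a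 downward strand is $V^*$); $\circ$ is vertical gluing, $\otimes$ is horizontal juxtaposition, and $\mathbf 1$ corresponds to the empty sequence. The tangles without input discs give identities $1_V,1_{V^*}$, crossings $\tau$, caps $\epsilon:V^*\otimes V\to\mathbf 1$, $\epsilon'=\epsilon\circ\tau: V\otimes V^*\to\mathbf 1$, and cups $\eta:\mathbf 1\to V\otimes V^*$, $\eta'=\tau\circ\eta:\mathbf 1\to V^*\otimes V$. Set $G_1^*=(G_1\otimes 1_{V^*})\circ\eta:\mathbf 1\to V^*$ and let $G_2^*=(1_{V^*}\otimes\epsilon)\circ(1_{V^*}\otimes G_2\otimes 1_V)\circ(\eta'\otimes 1_V):V\to V^*$ (the rotation of $G_2$ by $\pi$). The OSPA $\mathcal{P}(Rep_k(G,V))$. For a group $G$ and a finite-dimensional representation $V$ over $k$, its box space $\beta_\sigma$ is $\mathrm{Hom}_G(V^{\otimes\sigma},\mathbf 1)$ with $\mathbf 1=k$ the trivial representation; the operad acts by interpreting caps as evaluation $\epsilon$, cups as coevaluation $\eta(1)=\sum_i v_i\otimes v_i^*$, crossings as the flip, gluing as composition and juxtaposition as tensor product. *)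

theory Defs
  imports "HOL-Analysis.Analysis" "HOL-Algebra.Module" "HOL-Algebra.AbelCoset"
begin

section \<open>Oriented symmetric planar tangles\<close>

datatype sign = Pos | Neg

fun neg :: "sign \<Rightarrow> sign" where
  "neg Pos = Neg"
| "neg Neg = Pos"

definition dual :: "sign list \<Rightarrow> sign list" where
  "dual \<sigma> = rev (map neg \<sigma>)"

text \<open>
  Tangle diagrams are given in sliced form, i.e. in general position with respect to the height
  function, and are read upwards.  A \<open>Pos\<close> is an upward strand (\<open>V\<close>) and a \<open>Neg\<close> is a downward
  strand (\<open>V\<^sup>*\<close>).  Up to isotopy every input disc may be placed with all its strands leaving
  downwards and its marked interval to the left of them; \<open>Disc l \<sigma>\<close> is the input disc with label
  \<open>l\<close> and type \<open>\<sigma>\<close> in this position.  The output disc is treated in the same way, so that a tangle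
  of type \<open>\<sigma>\<close> is a diagram with lower boundary \<open>\<sigma>\<close> and empty upper boundary.  The labels are
  numbers when the tangle acts as an operation, and vertices in the free planar algebra.
\<close>

datatype 'l diagram =
    Strands "sign list"
  | Crossing sign sign
  | Cap sign
  | Cup sign
  | Disc 'l "sign list"
  | Comp "'l diagram" "'l diagram"  (infixr "\<circ>\<^sub>t" 60)
  | Juxt "'l diagram" "'l diagram"  (infixr "\<otimes>\<^sub>t" 70)

primrec src :: "'l diagram \<Rightarrow> sign list" where
  "src (Strands \<sigma>) = \<sigma>"
| "src (Crossing a b) = [a, b]"
| "src (Cap s) = [s, neg s]"
| "src (Cup s) = []"
| "src (Disc l \<sigma>) = \<sigma>"
| "src (g \<circ>\<^sub>t f) = src f"
| "src (f \<otimes>\<^sub>t g) = src f @ src g"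

primrec tgt :: "'l diagram \<Rightarrow> sign list" where
  "tgt (Strands \<sigma>) = \<sigma>"
| "tgt (Crossing a b) = [b, a]"
| "tgt (Cap s) = []"
| "tgt (Cup s) = [s, neg s]"
| "tgt (Disc l \<sigma>) = []"
| "tgt (g \<circ>\<^sub>t f) = tgt g"
| "tgt (f \<otimes>\<^sub>t g) = tgt f @ tgt g"

primrec wf_diagram :: "'l diagram \<Rightarrow> bool" where
  "wf_diagram (Strands \<sigma>) = True"
| "wf_diagram (Crossing a b) = True"
| "wf_diagram (Cap s) = True"
| "wf_diagram (Cup s) = True"
| "wf_diagram (Disc l \<sigma>) = True"
| "wf_diagram (g \<circ>\<^sub>t f) = (wf_diagram g \<and> wf_diagram f \<and> src g = tgt f)"
| "wf_diagram (f \<otimes>\<^sub>t g) = (wf_diagram f \<and> wf_diagram g)"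

primrec discs :: "'l diagram \<Rightarrow> ('l \<times> sign list) list" where
  "discs (Strands \<sigma>) = []"
| "discs (Crossing a b) = []"
| "discs (Cap s) = []"
| "discs (Cup s) = []"
| "discs (Disc l \<sigma>) = [(l, \<sigma>)]"
| "discs (g \<circ>\<^sub>t f) = discs g @ discs f"
| "discs (f \<otimes>\<^sub>t g) = discs f @ discs g"

abbreviation labels :: "'l diagram \<Rightarrow> 'l set" where
  "labels t \<equiv> fst ` set (discs t)"

text \<open>Nested cups and nested caps.\<close>

primrec coev :: "sign list \<Rightarrow> 'l diagram" where  \<comment> \<open>\<open>[] \<rightarrow> \<sigma> @ dual \<sigma>\<close>\<close>
  "coev [] = Strands []"
| "coev (s # \<sigma>) = (Strands [s] \<otimes>\<^sub>t coev \<sigma> \<otimes>\<^sub>t Strands [neg s]) \<circ>\<^sub>t Cup s"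

primrec ev :: "sign list \<Rightarrow> 'l diagram" where  \<comment> \<open>\<open>\<sigma> @ dual \<sigma> \<rightarrow> []\<close>\<close>
  "ev [] = Strands []"
| "ev (s # \<sigma>) = Cap s \<circ>\<^sub>t (Strands [s] \<otimes>\<^sub>t ev \<sigma> \<otimes>\<^sub>t Strands [neg s])"

text \<open>A single strand crossing a bundle of parallel strands.\<close>

primrec pass :: "sign \<Rightarrow> sign list \<Rightarrow> 'l diagram" where  \<comment> \<open>\<open>s # \<sigma> \<rightarrow> \<sigma> @ [s]\<close>\<close>
  "pass s [] = Strands [s]"
| "pass s (a # \<sigma>) = (Strands [a] \<otimes>\<^sub>t pass s \<sigma>) \<circ>\<^sub>t (Crossing s a \<otimes>\<^sub>t Strands \<sigma>)"

text \<open>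
  Equality of tangles: the congruence generated by planar isotopy, the Reidemeister moves and
  naturality.  The rules from \<open>comp_assoc\<close> to \<open>interchange\<close> identify the different ways of
  slicing a diagram; the next four are the isotopies which do not preserve the slicing:
  straightening a strand, turning a crossing, and turning a disc by a full rotation (equivalently,
  the two half turns of a disc agree).
\<close>

inductive tangle_eq :: "'l diagram \<Rightarrow> 'l diagram \<Rightarrow> bool"  (infix "\<approx>\<^sub>t" 50) where
  refl: "wf_diagram f \<Longrightarrow> f \<approx>\<^sub>t f"
| sym: "f \<approx>\<^sub>t g \<Longrightarrow> g \<approx>\<^sub>t f"
| trans: "f \<approx>\<^sub>t g \<Longrightarrow> g \<approx>\<^sub>t h \<Longrightarrow> f \<approx>\<^sub>t h"
| cong_comp: "g \<approx>\<^sub>t g' \<Longrightarrow> f \<approx>\<^sub>t f' \<Longrightarrow> src g = tgt f \<Longrightarrow> g \<circ>\<^sub>t f \<approx>\<^sub>t g' \<circ>\<^sub>t f'"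
| cong_juxt: "f \<approx>\<^sub>t f' \<Longrightarrow> g \<approx>\<^sub>t g' \<Longrightarrow> f \<otimes>\<^sub>t g \<approx>\<^sub>t f' \<otimes>\<^sub>t g'"

| comp_assoc: "wf_diagram ((h \<circ>\<^sub>t g) \<circ>\<^sub>t f) \<Longrightarrow> (h \<circ>\<^sub>t g) \<circ>\<^sub>t f \<approx>\<^sub>t h \<circ>\<^sub>t (g \<circ>\<^sub>t f)"
| comp_strands_left: "wf_diagram f \<Longrightarrow> Strands (tgt f) \<circ>\<^sub>t f \<approx>\<^sub>t f"
| comp_strands_right: "wf_diagram f \<Longrightarrow> f \<circ>\<^sub>t Strands (src f) \<approx>\<^sub>t f"
| juxt_assoc: "wf_diagram ((f \<otimes>\<^sub>t g) \<otimes>\<^sub>t h) \<Longrightarrow> (f \<otimes>\<^sub>t g) \<otimes>\<^sub>t h \<approx>\<^sub>t f \<otimes>\<^sub>t (g \<otimes>\<^sub>t h)"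
| juxt_empty_left: "wf_diagram f \<Longrightarrow> Strands [] \<otimes>\<^sub>t f \<approx>\<^sub>t f"
| juxt_empty_right: "wf_diagram f \<Longrightarrow> f \<otimes>\<^sub>t Strands [] \<approx>\<^sub>t f"
| juxt_strands: "Strands \<alpha> \<otimes>\<^sub>t Strands \<beta> \<approx>\<^sub>t Strands (\<alpha> @ \<beta>)"
| interchange: "wf_diagram (g \<circ>\<^sub>t f) \<Longrightarrow> wf_diagram (g' \<circ>\<^sub>t f') \<Longrightarrow>
    (g \<circ>\<^sub>t f) \<otimes>\<^sub>t (g' \<circ>\<^sub>t f') \<approx>\<^sub>t (g \<otimes>\<^sub>t g') \<circ>\<^sub>t (f \<otimes>\<^sub>t f')"

| straighten_left:
    "(Strands [s] \<otimes>\<^sub>t Cap (neg s)) \<circ>\<^sub>t (Cup s \<otimes>\<^sub>t Strands [s]) \<approx>\<^sub>t Strands [s]"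
| straighten_right:
    "(Cap s \<otimes>\<^sub>t Strands [s]) \<circ>\<^sub>t (Strands [s] \<otimes>\<^sub>t Cup (neg s)) \<approx>\<^sub>t Strands [s]"
| turn_crossing:
    "(Cap (neg a) \<otimes>\<^sub>t Strands [b, neg a]) \<circ>\<^sub>t (Strands [neg a] \<otimes>\<^sub>t Crossing b a \<otimes>\<^sub>t Strands [neg a])
       \<circ>\<^sub>t (Strands [neg a, b] \<otimes>\<^sub>t Cup a) \<approx>\<^sub>t Crossing (neg a) b"
| turn_disc:
    "(Disc l \<sigma> \<otimes>\<^sub>t Strands (dual \<sigma>)) \<circ>\<^sub>t coev \<sigma> \<approx>\<^sub>t (Strands (dual \<sigma>) \<otimes>\<^sub>t Disc l \<sigma>) \<circ>\<^sub>t coev (dual \<sigma>)"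

| Reidemeister_1_left:
    "(Cap (neg s) \<otimes>\<^sub>t Strands [s]) \<circ>\<^sub>t (Strands [neg s] \<otimes>\<^sub>t Crossing s s)
       \<circ>\<^sub>t (Cup (neg s) \<otimes>\<^sub>t Strands [s]) \<approx>\<^sub>t Strands [s]"
| Reidemeister_1_right:
    "(Strands [s] \<otimes>\<^sub>t Cap s) \<circ>\<^sub>t (Crossing s s \<otimes>\<^sub>t Strands [neg s])
       \<circ>\<^sub>t (Strands [s] \<otimes>\<^sub>t Cup s) \<approx>\<^sub>t Strands [s]"
| Reidemeister_2: "Crossing b a \<circ>\<^sub>t Crossing a b \<approx>\<^sub>t Strands [a, b]"
| Reidemeister_3:
    "(Crossing b c \<otimes>\<^sub>t Strands [a]) \<circ>\<^sub>t (Strands [b] \<otimes>\<^sub>t Crossing a c) \<circ>\<^sub>t (Crossing a b \<otimes>\<^sub>t Strands [c])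
       \<approx>\<^sub>t (Strands [c] \<otimes>\<^sub>t Crossing a b) \<circ>\<^sub>t (Crossing a c \<otimes>\<^sub>t Strands [b]) \<circ>\<^sub>t (Strands [a] \<otimes>\<^sub>t Crossing b c)"

| naturality:
    "(Disc l \<sigma> \<otimes>\<^sub>t Strands [s]) \<circ>\<^sub>t pass s \<sigma> \<approx>\<^sub>t Strands [s] \<otimes>\<^sub>t Disc l \<sigma>"

definition tangle :: "sign list \<Rightarrow> nat diagram \<Rightarrow> bool" where
  "tangle \<sigma> T \<longleftrightarrow> wf_diagram T \<and> src T = \<sigma> \<and> tgt T = [] \<and> distinct (map fst (discs T))"

text \<open>Substitution of diagrams for discs; \<open>h l\<close> has to have the type of the disc \<open>l\<close>.\<close>

primrec fill :: "('l \<Rightarrow> sign list \<Rightarrow> 'm diagram) \<Rightarrow> 'l diagram \<Rightarrow> 'm diagram" where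
  "fill h (Strands \<sigma>) = Strands \<sigma>"
| "fill h (Crossing a b) = Crossing a b"
| "fill h (Cap s) = Cap s"
| "fill h (Cup s) = Cup s"
| "fill h (Disc l \<sigma>) = h l \<sigma>"
| "fill h (g \<circ>\<^sub>t f) = fill h g \<circ>\<^sub>t fill h f"
| "fill h (f \<otimes>\<^sub>t g) = fill h f \<otimes>\<^sub>t fill h g"

definition insert_tangle :: "nat \<Rightarrow> nat diagram \<Rightarrow> nat diagram \<Rightarrow> nat diagram" where
  "insert_tangle l S T = fill (\<lambda>i \<sigma>. if i = l then S else Disc i \<sigma>) T"


section \<open>Oriented symmetric planar algebras\<close>

definition scalars :: "'k::field ring" where
  "scalars = \<lparr>carrier = UNIV, monoid.mult = (*), one = 1, zero = 0, add = (+)\<rparr>"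

definition linear_map :: "('k::field, 'v) module \<Rightarrow> ('k, 'w) module \<Rightarrow> ('v \<Rightarrow> 'w) \<Rightarrow> bool" where
  "linear_map M N f \<longleftrightarrow> f \<in> carrier M \<rightarrow> carrier N \<and>
     (\<forall>x\<in>carrier M. \<forall>y\<in>carrier M. f (x \<oplus>\<^bsub>M\<^esub> y) = f x \<oplus>\<^bsub>N\<^esub> f y) \<and>
     (\<forall>a. \<forall>x\<in>carrier M. f (smult M a x) = smult N a (f x))"

record ('k, 'v) ospa_data =
  box_space :: "sign list \<Rightarrow> ('k, 'v) module"
  act :: "nat diagram \<Rightarrow> (nat \<Rightarrow> 'v) \<Rightarrow> 'v"

definition inputs :: "('k, 'v) ospa_data \<Rightarrow> nat diagram \<Rightarrow> (nat \<Rightarrow> 'v) \<Rightarrow> bool" where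
  "inputs P T v \<longleftrightarrow> (\<forall>(l, \<sigma>)\<in>set (discs T). v l \<in> carrier (box_space P \<sigma>))"

text \<open>
  The input discs of a tangle are labelled by arbitrary distinct numbers, so the symmetric group
  action of the operad becomes invariance under relabelling.
\<close>

locale ospa =
  fixes P :: "('k::field, 'v) ospa_data"
  assumes vector_space: "module scalars (box_space P \<sigma>)"
    and act_closed: "tangle \<sigma> T \<Longrightarrow> inputs P T v \<Longrightarrow> act P T v \<in> carrier (box_space P \<sigma>)"
    and act_cong: "tangle \<sigma> T \<Longrightarrow> inputs P T v \<Longrightarrow> (\<And>l. l \<in> labels T \<Longrightarrow> v l = w l) \<Longrightarrow>
      act P T v = act P T w"
    and act_multilinear: "tangle \<sigma> T \<Longrightarrow> inputs P T v \<Longrightarrow> (l, \<tau>) \<in> set (discs T) \<Longrightarrow>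
      linear_map (box_space P \<tau>) (box_space P \<sigma>) (\<lambda>x. act P T (v(l := x)))"
    and act_tangle_eq: "tangle \<sigma> T \<Longrightarrow> T \<approx>\<^sub>t T' \<Longrightarrow> inputs P T v \<Longrightarrow> act P T v = act P T' v"
    and act_relabel: "tangle \<sigma> T \<Longrightarrow> inj_on \<pi> (labels T) \<Longrightarrow> inputs P (map_diagram \<pi> T) v \<Longrightarrow>
      act P (map_diagram \<pi> T) v = act P T (v \<circ> \<pi>)"
    and act_unit: "x \<in> carrier (box_space P \<sigma>) \<Longrightarrow> act P (Disc l \<sigma>) (\<lambda>_. x) = x"
    and act_insert: "tangle \<sigma> T \<Longrightarrow> (l, \<tau>) \<in> set (discs T) \<Longrightarrow> tangle \<tau> S \<Longrightarrow>
      (labels T - {l}) \<inter> labels S = {} \<Longrightarrow> inputs P (insert_tangle l S T) v \<Longrightarrow>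
      act P (insert_tangle l S T) v = act P T (v(l := act P S v))"

definition ospa_hom ::
  "('k::field, 'v) ospa_data \<Rightarrow> ('k, 'w) ospa_data \<Rightarrow> (sign list \<Rightarrow> 'v \<Rightarrow> 'w) \<Rightarrow> bool" where
  "ospa_hom P Q \<phi> \<longleftrightarrow> ospa P \<and> ospa Q \<and> (\<forall>\<sigma>. linear_map (box_space P \<sigma>) (box_space Q \<sigma>) (\<phi> \<sigma>)) \<and>
     (\<forall>\<sigma> T v w. tangle \<sigma> T \<longrightarrow> inputs P T v \<longrightarrow> (\<forall>(l, \<tau>)\<in>set (discs T). w l = \<phi> \<tau> (v l)) \<longrightarrow>
        \<phi> \<sigma> (act P T v) = act Q T w)"

definition ospa_iso ::
  "('k::field, 'v) ospa_data \<Rightarrow> ('k, 'w) ospa_data \<Rightarrow> (sign list \<Rightarrow> 'v \<Rightarrow> 'w) \<Rightarrow> bool" where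
  "ospa_iso P Q \<phi> \<longleftrightarrow> ospa_hom P Q \<phi> \<and>
     (\<forall>\<sigma>. bij_betw (\<phi> \<sigma>) (carrier (box_space P \<sigma>)) (carrier (box_space Q \<sigma>)))"


section \<open>Presentations\<close>

text \<open>The free planar algebra on a type \<open>'g\<close> of vertices with degrees \<open>deg\<close>.\<close>

definition tangle_class :: "'g diagram \<Rightarrow> 'g diagram set" where
  "tangle_class t = {t'. t \<approx>\<^sub>t t'}"

definition vertex_tangles :: "('g \<Rightarrow> sign list) \<Rightarrow> sign list \<Rightarrow> 'g diagram set set" where
  "vertex_tangles deg \<sigma> = tangle_class ` {t. wf_diagram t \<and> src t = \<sigma> \<and> tgt t = [] \<and>
     (\<forall>(g, \<tau>)\<in>set (discs t). \<tau> = deg g)}"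

definition insert_classes :: "nat diagram \<Rightarrow> (nat \<Rightarrow> 'g diagram set) \<Rightarrow> 'g diagram set" where
  "insert_classes T c = {t. \<exists>s. (\<forall>l\<in>labels T. s l \<in> c l) \<and> fill (\<lambda>l _. s l) T \<approx>\<^sub>t t}"

definition support :: "('a \<Rightarrow> 'k::zero) \<Rightarrow> 'a set" where
  "support f = {x. f x \<noteq> 0}"

definition free_ospa ::
  "('g \<Rightarrow> sign list) \<Rightarrow> ('k::field, 'g diagram set \<Rightarrow> 'k) ospa_data" where
  "free_ospa deg = \<lparr>
     box_space = (\<lambda>\<sigma>. \<lparr>carrier = {f. finite (support f) \<and> support f \<subseteq> vertex_tangles deg \<sigma>},
       monoid.mult = undefined, one = undefined,
       zero = (\<lambda>_. 0), add = (\<lambda>f g c. f c + g c), smult = (\<lambda>a f c. a * f c)\<rparr>),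
     act = (\<lambda>T v c. \<Sum>d | d \<in> (\<Pi>\<^sub>E l\<in>labels T. support (v l)) \<and> insert_classes T d = c.
       \<Prod>l\<in>labels T. v l (d l))\<rparr>"

definition planar_ideal :: "('k::field, 'v) ospa_data \<Rightarrow> (sign list \<Rightarrow> 'v set) \<Rightarrow> bool" where
  "planar_ideal P I \<longleftrightarrow> (\<forall>\<sigma>. submodule (I \<sigma>) (scalars :: 'k ring) (box_space P \<sigma>)) \<and>
     (\<forall>\<sigma> T v l \<tau>. tangle \<sigma> T \<longrightarrow> inputs P T v \<longrightarrow> (l, \<tau>) \<in> set (discs T) \<longrightarrow> v l \<in> I \<tau> \<longrightarrow>
        act P T v \<in> I \<sigma>)"

definition generated_ideal ::
  "('k::field, 'v) ospa_data \<Rightarrow> (sign list \<Rightarrow> 'v set) \<Rightarrow> sign list \<Rightarrow> 'v set" where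
  "generated_ideal P R \<sigma> = \<Inter>{I \<sigma> | I. planar_ideal P I \<and> (\<forall>\<tau>. R \<tau> \<subseteq> I \<tau>)}"

definition quotient_module :: "('k::field, 'v) module \<Rightarrow> 'v set \<Rightarrow> ('k, 'v set) module" where
  "quotient_module M N = \<lparr>carrier = a_rcosets\<^bsub>M\<^esub> N,
     monoid.mult = undefined, one = undefined,
     zero = N, add = set_add M, smult = (\<lambda>a X. \<Union>x\<in>X. N +>\<^bsub>M\<^esub> smult M a x)\<rparr>"

definition quotient_ospa ::
  "('k::field, 'v) ospa_data \<Rightarrow> (sign list \<Rightarrow> 'v set) \<Rightarrow> ('k, 'v set) ospa_data" where
  "quotient_ospa P I = \<lparr>
     box_space = (\<lambda>\<sigma>. quotient_module (box_space P \<sigma>) (I \<sigma>)),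
     act = (\<lambda>T X. I (src T) +>\<^bsub>box_space P (src T)\<^esub> act P T (\<lambda>l. SOME x. x \<in> X l))\<rparr>"

definition presented_ospa :: "('g \<Rightarrow> sign list) \<Rightarrow>
    (sign list \<Rightarrow> ('g diagram set \<Rightarrow> 'k::field) set) \<Rightarrow> ('k, ('g diagram set \<Rightarrow> 'k) set) ospa_data" where
  "presented_ospa deg R = quotient_ospa (free_ospa deg) (generated_ideal (free_ospa deg) R)"

text \<open>
  The passage between diagrams \<open>\<alpha> \<rightarrow> \<beta>\<close> and diagrams of type \<open>\<alpha> @ dual \<beta>\<close>: the upper strands are
  bent down on the right, and the last strands of a vertex are bent up on the right.
\<close>

definition bend_down :: "'l diagram \<Rightarrow> 'l diagram" where
  "bend_down t = ev (tgt t) \<circ>\<^sub>t (t \<otimes>\<^sub>t Strands (dual (tgt t)))"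

definition vertex :: "'g \<Rightarrow> sign list \<Rightarrow> sign list \<Rightarrow> 'g diagram" where
  "vertex g \<alpha> \<beta> = (Disc g (\<alpha> @ dual \<beta>) \<otimes>\<^sub>t Strands \<beta>) \<circ>\<^sub>t (Strands \<alpha> \<otimes>\<^sub>t coev (dual \<beta>))"

text \<open>The element of the free planar algebra given by a linear combination of diagrams \<open>\<alpha> \<rightarrow> \<beta>\<close>.\<close>

definition combination :: "('k::field \<times> 'g diagram) list \<Rightarrow> 'g diagram set \<Rightarrow> 'k" where
  "combination xs = (\<lambda>c. \<Sum>(a, t)\<leftarrow>xs. if c = tangle_class (bend_down t) then a else 0)"


section \<open>The planar algebra of a representation\<close>

text \<open>
  A representation on \<open>V = 'k ^ 'n\<close> is given by its matrices.  A tensor in \<open>V\<^sup>\<sigma>\<close> is given by its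
  coordinates with respect to the tensor products of the standard basis and its dual basis, which
  are indexed by the lists of length \<open>length \<sigma>\<close>.
\<close>

definition tensors :: "sign list \<Rightarrow> ('n list \<Rightarrow> 'k::field) set" where
  "tensors \<sigma> = {w. \<forall>I. length I \<noteq> length \<sigma> \<longrightarrow> w I = 0}"

definition basis_tensor :: "'n list \<Rightarrow> 'n list \<Rightarrow> 'k::field" where
  "basis_tensor I = (\<lambda>J. if J = I then 1 else 0)"

definition signed_rep :: "('g, 'b) monoid_scheme \<Rightarrow> ('g \<Rightarrow> 'k::field ^ 'n ^ 'n) \<Rightarrow>
    sign \<Rightarrow> 'g \<Rightarrow> 'k ^ 'n ^ 'n" where
  "signed_rep G \<rho> s g = (case s of Pos \<Rightarrow> \<rho> g | Neg \<Rightarrow> transpose (\<rho> (inv\<^bsub>G\<^esub> g)))"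

definition tensor_rep :: "('g, 'b) monoid_scheme \<Rightarrow> ('g \<Rightarrow> 'k::field ^ 'n ^ 'n) \<Rightarrow>
    sign list \<Rightarrow> 'g \<Rightarrow> ('n list \<Rightarrow> 'k) \<Rightarrow> 'n list \<Rightarrow> 'k" where
  "tensor_rep G \<rho> \<sigma> g w = (\<lambda>I. if length I = length \<sigma>
     then \<Sum>J | length J = length \<sigma>.
       (\<Prod>p<length \<sigma>. signed_rep G \<rho> (\<sigma> ! p) g $ (I ! p) $ (J ! p)) * w J
     else 0)"

definition invariant_functionals :: "('g, 'b) monoid_scheme \<Rightarrow> ('g \<Rightarrow> 'k::field ^ 'n ^ 'n) \<Rightarrow>
    sign list \<Rightarrow> (('n list \<Rightarrow> 'k) \<Rightarrow> 'k) set" where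
  "invariant_functionals G \<rho> \<sigma> = {f \<in> extensional (tensors \<sigma>).
     (\<forall>w\<in>tensors \<sigma>. \<forall>w'\<in>tensors \<sigma>. f (\<lambda>I. w I + w' I) = f w + f w') \<and>
     (\<forall>a. \<forall>w\<in>tensors \<sigma>. f (\<lambda>I. a * w I) = a * f w) \<and>
     (\<forall>g\<in>carrier G. \<forall>w\<in>tensors \<sigma>. f (tensor_rep G \<rho> \<sigma> g w) = f w)}"

text \<open>The map \<open>F \<otimes> H\<close> for \<open>F : V\<^sup>\<alpha> \<rightarrow> V\<^sup>\<beta>\<close> and \<open>H : V\<^sup>\<gamma> \<rightarrow> V\<^sup>\<delta>\<close>.\<close>

definition tensor_map :: "sign list \<Rightarrow> sign list \<Rightarrow> sign list \<Rightarrow>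
    (('n list \<Rightarrow> 'k::field) \<Rightarrow> 'n list \<Rightarrow> 'k) \<Rightarrow> (('n list \<Rightarrow> 'k) \<Rightarrow> 'n list \<Rightarrow> 'k) \<Rightarrow>
    ('n list \<Rightarrow> 'k) \<Rightarrow> 'n list \<Rightarrow> 'k" where
  "tensor_map \<alpha> \<gamma> \<beta> F H w = (\<lambda>K. \<Sum>I | length I = length \<alpha>. \<Sum>J | length J = length \<gamma>.
     w (I @ J) * F (basis_tensor I) (take (length \<beta>) K) * H (basis_tensor J) (drop (length \<beta>) K))"

text \<open>The linear map \<open>V\<^sup>\<alpha> \<rightarrow> V\<^sup>\<beta>\<close> given by a diagram \<open>\<alpha> \<rightarrow> \<beta>\<close> whose discs are filled with functionals.\<close>

primrec interp :: "('l \<Rightarrow> ('n::finite list \<Rightarrow> 'k::field) \<Rightarrow> 'k) \<Rightarrow> 'l diagram \<Rightarrow>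
    ('n list \<Rightarrow> 'k) \<Rightarrow> 'n list \<Rightarrow> 'k" where
  "interp v (Strands \<sigma>) = (\<lambda>w. w)"
| "interp v (Crossing a b) = (\<lambda>w I. case I of [i, j] \<Rightarrow> w [j, i] | _ \<Rightarrow> 0)"
| "interp v (Cap s) = (\<lambda>w I. if I = [] then \<Sum>i\<in>UNIV. w [i, i] else 0)"
| "interp v (Cup s) = (\<lambda>w I. case I of [i, j] \<Rightarrow> if i = j then w [] else 0 | _ \<Rightarrow> 0)"
| "interp v (Disc l \<sigma>) = (\<lambda>w I. if I = [] then v l w else 0)"
| "interp v (g \<circ>\<^sub>t f) = interp v g \<circ> interp v f"
| "interp v (f \<otimes>\<^sub>t g) = tensor_map (src f) (src g) (tgt f) (interp v f) (interp v g)"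

definition rep_ospa :: "('g, 'b) monoid_scheme \<Rightarrow> ('g \<Rightarrow> 'k::field ^ 'n ^ 'n) \<Rightarrow>
    ('k, ('n::finite list \<Rightarrow> 'k) \<Rightarrow> 'k) ospa_data" where
  "rep_ospa G \<rho> = \<lparr>
     box_space = (\<lambda>\<sigma>. \<lparr>carrier = invariant_functionals G \<rho> \<sigma>,
       monoid.mult = undefined, one = undefined,
       zero = (\<lambda>w\<in>tensors \<sigma>. 0), add = (\<lambda>f h. \<lambda>w\<in>tensors \<sigma>. f w + h w),
       smult = (\<lambda>a f. \<lambda>w\<in>tensors \<sigma>. a * f w)\<rparr>),
     act = (\<lambda>T v. \<lambda>w\<in>tensors (src T). interp v T w [])\<rparr>"


section \<open>The two planar algebras\<close>

definition additive_complex :: "complex monoid" where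
  "additive_complex = \<lparr>carrier = UNIV, monoid.mult = (+), one = 0\<rparr>"

definition unipotent_rep :: "complex \<Rightarrow> complex ^ 2 ^ 2" where
  "unipotent_rep x = vector [vector [1, x], vector [0, 1]]"

definition Alg0 :: "(complex, (2 list \<Rightarrow> complex) \<Rightarrow> complex) ospa_data" where
  "Alg0 = rep_ospa additive_complex unipotent_rep"

datatype generator = Gen1 | Gen2 | Gen3

fun generator_degree :: "generator \<Rightarrow> sign list" where
  "generator_degree Gen1 = [Pos] @ dual []"
| "generator_degree Gen2 = [Pos] @ dual [Neg]"
| "generator_degree Gen3 = [Neg] @ dual [Pos]"

abbreviation G1 :: "generator diagram" where "G1 \<equiv> vertex Gen1 [Pos] []"
abbreviation G2 :: "generator diagram" where "G2 \<equiv> vertex Gen2 [Pos] [Neg]"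
abbreviation G3 :: "generator diagram" where "G3 \<equiv> vertex Gen3 [Neg] [Pos]"

abbreviation id_V :: "'l diagram" where "id_V \<equiv> Strands [Pos]"
abbreviation id_Vd :: "'l diagram" where "id_Vd \<equiv> Strands [Neg]"
abbreviation eps :: "'l diagram" where "eps \<equiv> Cap Neg"
abbreviation eta :: "'l diagram" where "eta \<equiv> Cup Pos"
abbreviation eta' :: "'l diagram" where "eta' \<equiv> Crossing Pos Neg \<circ>\<^sub>t eta"

definition G1_star :: "generator diagram" where
  "G1_star = (G1 \<otimes>\<^sub>t id_Vd) \<circ>\<^sub>t eta"

definition G2_star :: "generator diagram" where
  "G2_star = (id_Vd \<otimes>\<^sub>t eps) \<circ>\<^sub>t (id_Vd \<otimes>\<^sub>t G2 \<otimes>\<^sub>t id_V) \<circ>\<^sub>t (eta' \<otimes>\<^sub>t id_V)"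

definition E1 :: "generator diagram set \<Rightarrow> complex" where
  "E1 = combination [(1, G2 \<circ>\<^sub>t G3), (- 1, id_Vd)]"

definition E2 :: "generator diagram set \<Rightarrow> complex" where
  "E2 = combination [(1, G1 \<circ>\<^sub>t G3 \<circ>\<^sub>t G1_star)]"

definition E3 :: "generator diagram set \<Rightarrow> complex" where
  "E3 = combination [(1, eps \<circ>\<^sub>t Crossing Pos Neg \<circ>\<^sub>t eta), (- 2, Strands [])]"

definition E4 :: "generator diagram set \<Rightarrow> complex" where
  "E4 = combination [(1, G2_star), (1, G2)]"

definition E5 :: "generator diagram set \<Rightarrow> complex" where
  "E5 = combination [(1, Crossing Pos Pos), (- 1, id_V \<otimes>\<^sub>t id_V),
     (- 1, (id_V \<otimes>\<^sub>t G3) \<circ>\<^sub>t eta \<circ>\<^sub>t eps \<circ>\<^sub>t (G2 \<otimes>\<^sub>t id_V))]"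

definition relations :: "sign list \<Rightarrow> (generator diagram set \<Rightarrow> complex) set" where
  "relations \<sigma> = {r. (\<sigma>, r) \<in> {([Neg] @ dual [Neg], E1), ([], E2), ([], E3), ([Pos] @ dual [Neg], E4),
     ([Pos, Pos] @ dual [Pos, Pos], E5)}}"

definition Diag0 :: "(complex, (generator diagram set \<Rightarrow> complex) set) ospa_data" where
  "Diag0 = presented_ospa generator_degree relations"

end

theory Submission
  imports Defs
begin

text \<open>
  Send \<open>G\<^sub>1\<close> to the invariant coordinate function, \<open>G\<^sub>2\<close> to the symplectic form \<open>\<omega>\<close> on \<open>V\<close> and \<open>G\<^sub>3\<close>
  to its inverse.  The kernel of the evaluation of free diagrams is a planar ideal containing the
  relations, so it remains to compare normal forms with invariants.

  By \<open>E\<^sub>1\<close>, \<open>E\<^sub>3\<close> and \<open>E\<^sub>4\<close> the cap and the cup obtained from \<open>G\<^sub>2\<close> and \<open>G\<^sub>3\<close> satisfy the Temperley--Lieb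
  relations with loop value \<open>-2\<close>; \<open>E\<^sub>5\<close> removes crossings, \<open>E\<^sub>2\<close> removes arcs joining two copies of
  \<open>G\<^sub>1\<close>, and \<open>G\<^sub>3\<close> turns every \<open>V\<^sup>*\<close> into a \<open>V\<close>.  Hence the quotient of \<open>\<beta>\<^sub>\<sigma>\<close> is spanned by planar
  diagrams of caps and copies of \<open>G\<^sub>1\<close> in which no \<open>G\<^sub>1\<close> lies below a cap; these are indexed by ballot
  words of length \<open>n = |\<sigma>|\<close>.

  The functionals \<open>N\<^sub>r\<close> of the ballot words satisfy \<open>N\<^bsub>r2\<^esub>(w \<otimes> v\<^sub>2) = N\<^sub>r(w)\<close>, \<open>N\<^bsub>r2\<^esub>(w \<otimes> v\<^sub>1) = 0\<close> and
  \<open>N\<^bsub>r1\<^esub>(w \<otimes> v\<^sub>1) = -N\<^sub>r(w)\<close>, where \<open>2\<close> opens and \<open>1\<close> closes.  Linear independence follows by induction on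
  \<open>n\<close>.  For an invariant functional \<open>f\<close> put \<open>f\<^sub>i(w) = f(w \<otimes> v\<^sub>i)\<close>; then \<open>f\<^sub>1\<close> is invariant and
  \<open>f\<^sub>2(g\<^sub>x w) = f\<^sub>2(w) - x f\<^sub>1(w)\<close>.  Subtracting functionals \<open>N\<^bsub>r1\<^esub>\<close> we may assume that \<open>f\<^sub>1\<close> is a combination of
  functionals of completely matched words.  The coordinates of these form vectors invariant under
  \<open>SL\<^sub>2\<close>, so the complex conjugate \<open>u\<close> of \<open>f\<^sub>1\<close> is an invariant vector, whence \<open>f\<^sub>1(u) = 0\<close>, i.e.
  \<open>f\<^sub>1 = 0\<close>.  Then \<open>f\<^sub>2\<close> is invariant, and the induction hypothesis applies.
\<close>

section \<open>Tangles up to equality\<close>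

text \<open>The rules postulated for a single disc, naturality and the full rotation, must hold for
  every box before substitution of diagrams can respect tangle equality; \<open>slide\<close> and
  \<open>turn_block\<close> provide this, and the operad laws of the free planar algebra rest on it.

  In the spanning argument a crossing is never removed inside a given diagram. Instead, attaching
  any elementary piece below a normal form is shown to give a combination of normal forms again. A
  \<open>G1\<close> attached under a cap is first moved to the right by naturality, at the price of
  crossings which \<open>E5\<close> then removes.

  On the side of the invariants the group is replaced by its single element x = 1. A completely
  matched word is a product of symplectic forms, hence also invariant under the transposed shear, so
  it gives an invariant functional and an invariant vector at once. Its weights are real, so
  conjugation affects the coefficients only, and positivity of the squared norm of
  \<open>f\<^sub>1\<close> turns \<open>f\<^sub>1(u) = 0\<close> into
  \<open>f\<^sub>1 = 0\<close>.\<close>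

lemma neg_neg [simp]: "neg (neg s) = s"
  by (cases s) auto

lemma dual_simps [simp]:
  "dual [] = []" "dual (s # \<sigma>) = dual \<sigma> @ [neg s]" "dual (\<alpha> @ \<beta>) = dual \<beta> @ dual \<alpha>"
  "dual (dual \<sigma>) = \<sigma>" "length (dual \<sigma>) = length \<sigma>"
  by (auto simp: dual_def rev_map[symmetric] map_idI comp_def)

lemma coev_typed: "wf_diagram (coev \<sigma> :: 'l diagram) \<and> src (coev \<sigma> :: 'l diagram) = [] \<and> tgt (coev \<sigma> :: 'l diagram) = \<sigma> @ dual \<sigma>"
  by (induction \<sigma>) auto

lemma ev_typed: "wf_diagram (ev \<sigma> :: 'l diagram) \<and> src (ev \<sigma> :: 'l diagram) = \<sigma> @ dual \<sigma> \<and> tgt (ev \<sigma> :: 'l diagram) = []"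
  by (induction \<sigma>) auto

lemma pass_typed: "wf_diagram (pass s \<sigma> :: 'l diagram) \<and> src (pass s \<sigma> :: 'l diagram) = s # \<sigma> \<and> tgt (pass s \<sigma> :: 'l diagram) = \<sigma> @ [s]"
  by (induction \<sigma>) auto

lemma discs_coev [simp]: "discs (coev \<sigma>) = []"
  by (induction \<sigma>) auto

lemma discs_ev [simp]: "discs (ev \<sigma>) = []"
  by (induction \<sigma>) auto

lemma discs_pass [simp]: "discs (pass s \<sigma>) = []"
  by (induction \<sigma>) auto

lemmas typed = coev_typed ev_typed pass_typed

text \<open>Only the multiset of discs is invariant, not their list: \<open>interchange\<close>
  permutes the discs of its four factors.\<close>

lemma tangle_eq_typed:
  "f \<approx>\<^sub>t g \<Longrightarrow> wf_diagram f \<and> wf_diagram g \<and> src f = src g \<and> tgt f = tgt g \<and> mset (discs f) = mset (discs g)"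
  by (induction rule: tangle_eq.induct) (auto simp: typed)

definition tangle_eqv :: "'l diagram \<Rightarrow> 'l diagram \<Rightarrow> bool" where
  "tangle_eqv f g \<longleftrightarrow> f \<approx>\<^sub>t g \<or> \<not> wf_diagram f \<and> \<not> wf_diagram g"

text \<open>All ill-formed diagrams are identified, which makes most of the laws of a strict monoidal
  category hold unconditionally as equations between terms.\<close>

quotient_type 'l morph = "'l diagram" / tangle_eqv
proof (rule equivpI)
  show "reflp (tangle_eqv :: 'l diagram \<Rightarrow> _)"
    by (auto simp: reflp_def tangle_eqv_def intro: tangle_eq.refl)
  show "symp (tangle_eqv :: 'l diagram \<Rightarrow> _)"
    by (auto simp: symp_def tangle_eqv_def intro: tangle_eq.sym)
  show "transp (tangle_eqv :: 'l diagram \<Rightarrow> _)"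
    by (auto simp: transp_def tangle_eqv_def intro: tangle_eq.trans dest: tangle_eq_typed)
qed

lift_definition ok :: "'l morph \<Rightarrow> bool" is wf_diagram
  by (auto simp: tangle_eqv_def dest: tangle_eq_typed)

text \<open>The default \<open>[]\<close> makes the function constant on the one class of ill-formed
  diagrams; \<open>cod\<close> and \<open>vertices\<close> follow the same pattern.\<close>

lift_definition dom :: "'l morph \<Rightarrow> sign list" is "\<lambda>t. if wf_diagram t then src t else []"
  by (auto simp: tangle_eqv_def dest: tangle_eq_typed)

lift_definition cod :: "'l morph \<Rightarrow> sign list" is "\<lambda>t. if wf_diagram t then tgt t else []"
  by (auto simp: tangle_eqv_def dest: tangle_eq_typed)

lift_definition vertices :: "'l morph \<Rightarrow> ('l \<times> sign list) multiset"
  is "\<lambda>t. if wf_diagram t then mset (discs t) else {#}"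
  by (auto simp: tangle_eqv_def dest: tangle_eq_typed)

lift_definition strands :: "sign list \<Rightarrow> 'l morph" is Strands .
lift_definition cross :: "sign \<Rightarrow> sign \<Rightarrow> 'l morph" is Crossing .
lift_definition cap :: "sign \<Rightarrow> 'l morph" is Cap .
lift_definition cup :: "sign \<Rightarrow> 'l morph" is Cup .
lift_definition disc :: "'l \<Rightarrow> sign list \<Rightarrow> 'l morph" is Disc .

lift_definition comp :: "'l morph \<Rightarrow> 'l morph \<Rightarrow> 'l morph"  (infixr "\<cdot>" 60) is "(\<circ>\<^sub>t)"
  unfolding tangle_eqv_def by (metis tangle_eq.cong_comp tangle_eq_typed wf_diagram.simps(6))

lift_definition juxt :: "'l morph \<Rightarrow> 'l morph \<Rightarrow> 'l morph"  (infixr "\<boxtimes>" 70) is "(\<otimes>\<^sub>t)"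
  by (auto simp: tangle_eqv_def dest: tangle_eq_typed intro!: tangle_eq.cong_juxt)

text \<open>Written with whiskers, a diagram becomes a composite of single pieces acting at known
  positions. Calculations are then rewritings of words, in which \<open>exchange\<close> moves
  pieces to different heights.\<close>

definition whisker :: "sign list \<Rightarrow> 'l morph \<Rightarrow> sign list \<Rightarrow> 'l morph" where
  "whisker \<gamma> f \<delta> = strands \<gamma> \<boxtimes> f \<boxtimes> strands \<delta>"

lift_definition mcoev :: "sign list \<Rightarrow> 'l morph" is coev .
lift_definition mev :: "sign list \<Rightarrow> 'l morph" is ev .
lift_definition mpass :: "sign \<Rightarrow> sign list \<Rightarrow> 'l morph" is pass .

lemma ok_simps [simp]:
  "ok (strands \<sigma>)" "ok (cross a b)" "ok (cap s)" "ok (cup s)" "ok (disc l \<sigma>)"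
  "ok (g \<cdot> f) \<longleftrightarrow> ok g \<and> ok f \<and> dom g = cod f"
  "ok (f \<boxtimes> g) \<longleftrightarrow> ok f \<and> ok g"
  "ok (mcoev \<sigma>)" "ok (mev \<sigma>)" "ok (mpass s \<sigma>)"
  by (transfer; auto simp: typed)+

lemma dom_simps [simp]:
  "dom (strands \<sigma>) = \<sigma>" "dom (cross a b) = [a, b]" "dom (cap s) = [s, neg s]" "dom (cup s) = []"
  "dom (disc l \<sigma>) = \<sigma>"
  "ok (g \<cdot> f) \<Longrightarrow> dom (g \<cdot> f) = dom f" "ok f \<Longrightarrow> ok g \<Longrightarrow> dom (f \<boxtimes> g) = dom f @ dom g"
  "dom (mcoev \<sigma>) = []" "dom (mev \<sigma>) = \<sigma> @ dual \<sigma>" "dom (mpass s \<sigma>) = s # \<sigma>"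
  by (transfer; auto simp: typed)+

lemma cod_simps [simp]:
  "cod (strands \<sigma>) = \<sigma>" "cod (cross a b) = [b, a]" "cod (cap s) = []" "cod (cup s) = [s, neg s]"
  "cod (disc l \<sigma>) = []"
  "ok (g \<cdot> f) \<Longrightarrow> cod (g \<cdot> f) = cod g" "ok f \<Longrightarrow> ok g \<Longrightarrow> cod (f \<boxtimes> g) = cod f @ cod g"
  "cod (mcoev \<sigma>) = \<sigma> @ dual \<sigma>" "cod (mev \<sigma>) = []" "cod (mpass s \<sigma>) = \<sigma> @ [s]"
  by (transfer; auto simp: typed)+

lemma vertices_simps [simp]:
  "vertices (strands \<sigma>) = {#}" "vertices (cross a b) = {#}" "vertices (cap s) = {#}"
  "vertices (cup s) = {#}" "vertices (disc l \<sigma>) = {#(l, \<sigma>)#}"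
  "ok (g \<cdot> f) \<Longrightarrow> vertices (g \<cdot> f) = vertices g + vertices f"
  "ok f \<Longrightarrow> ok g \<Longrightarrow> vertices (f \<boxtimes> g) = vertices f + vertices g"
  "vertices (mcoev \<sigma>) = {#}" "vertices (mev \<sigma>) = {#}" "vertices (mpass s \<sigma>) = {#}"
  by (transfer; auto simp: typed)+

lemma whisker_typed [simp]:
  "ok (whisker \<gamma> f \<delta>) = ok f" "ok f \<Longrightarrow> dom (whisker \<gamma> f \<delta>) = \<gamma> @ dom f @ \<delta>"
  "ok f \<Longrightarrow> cod (whisker \<gamma> f \<delta>) = \<gamma> @ cod f @ \<delta>" "ok f \<Longrightarrow> vertices (whisker \<gamma> f \<delta>) = vertices f"
  by (auto simp: whisker_def)

section \<open>Laws of a strict symmetric monoidal category with duals\<close>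

lemma comp_assoc: "(h \<cdot> g) \<cdot> f = h \<cdot> (g \<cdot> f)"
  by transfer (auto simp: tangle_eqv_def intro!: tangle_eq.comp_assoc)

lemma comp_id_left [simp]: "ok f \<Longrightarrow> cod f = \<beta> \<Longrightarrow> strands \<beta> \<cdot> f = f"
  by transfer (auto simp: tangle_eqv_def intro!: tangle_eq.comp_strands_left)

lemma comp_id_right [simp]: "ok f \<Longrightarrow> dom f = \<alpha> \<Longrightarrow> f \<cdot> strands \<alpha> = f"
  by transfer (auto simp: tangle_eqv_def intro!: tangle_eq.comp_strands_right)

lemma juxt_assoc: "(f \<boxtimes> g) \<boxtimes> h = f \<boxtimes> (g \<boxtimes> h)"
  by transfer (auto simp: tangle_eqv_def intro!: tangle_eq.juxt_assoc)

lemma juxt_empty [simp]: "strands [] \<boxtimes> f = f" "f \<boxtimes> strands [] = f"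
  by (transfer; auto simp: tangle_eqv_def intro!: tangle_eq.juxt_empty_left tangle_eq.juxt_empty_right)+

lemma juxt_strands: "strands \<alpha> \<boxtimes> strands \<beta> = strands (\<alpha> @ \<beta>)"
  by transfer (auto simp: tangle_eqv_def intro!: tangle_eq.juxt_strands)

lemma juxt_strands2: "strands \<alpha> \<boxtimes> strands \<beta> \<boxtimes> f = strands (\<alpha> @ \<beta>) \<boxtimes> f"
  by (simp flip: juxt_assoc juxt_strands)

lemma interchange: "ok (g \<cdot> f) \<Longrightarrow> ok (g' \<cdot> f') \<Longrightarrow> (g \<cdot> f) \<boxtimes> (g' \<cdot> f') = (g \<boxtimes> g') \<cdot> (f \<boxtimes> f')"
  by transfer (auto simp: tangle_eqv_def intro!: tangle_eq.interchange)

lemma juxt_strands_comp: "ok (g \<cdot> f) \<Longrightarrow> strands \<gamma> \<boxtimes> (g \<cdot> f) = (strands \<gamma> \<boxtimes> g) \<cdot> (strands \<gamma> \<boxtimes> f)"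
  using interchange[of "strands \<gamma>" "strands \<gamma>" g f] by simp

lemma comp_juxt_strands: "ok (g \<cdot> f) \<Longrightarrow> (g \<cdot> f) \<boxtimes> strands \<gamma> = (g \<boxtimes> strands \<gamma>) \<cdot> (f \<boxtimes> strands \<gamma>)"
  using interchange[of g f "strands \<gamma>" "strands \<gamma>"] by simp

lemma whisker_comp: "ok (g \<cdot> f) \<Longrightarrow> whisker \<gamma> (g \<cdot> f) \<delta> = whisker \<gamma> g \<delta> \<cdot> whisker \<gamma> f \<delta>"
  unfolding whisker_def by (simp add: comp_juxt_strands juxt_strands_comp)

lemma whisker_whisker: "whisker \<gamma> (whisker \<gamma>' f \<delta>') \<delta> = whisker (\<gamma> @ \<gamma>') f (\<delta>' @ \<delta>)"
  unfolding whisker_def by (simp add: juxt_assoc juxt_strands juxt_strands2)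

lemma whisker_strands: "whisker \<gamma> (strands \<alpha>) \<delta> = strands (\<gamma> @ \<alpha> @ \<delta>)"
  unfolding whisker_def by (simp add: juxt_strands)

lemma whisker_empty [simp]: "whisker [] f [] = f"
  by (simp add: whisker_def)

lemma juxt_whisker: "ok f \<Longrightarrow> ok g \<Longrightarrow> f \<boxtimes> g = whisker [] f (cod g) \<cdot> whisker (dom f) g []"
  using interchange[of f "strands (dom f)" "strands (cod g)" g] by (simp add: whisker_def)

lemma juxt_whisker': "ok f \<Longrightarrow> ok g \<Longrightarrow> f \<boxtimes> g = whisker (cod f) g [] \<cdot> whisker [] f (dom g)"
  using interchange[of "strands (cod f)" f g "strands (dom g)"] by (simp add: whisker_def)

text \<open>Pieces on disjoint groups of strands slide past each other in height; the
  \<open>\<delta>\<close> strands lie between them. The surrounding types change with the height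
  because a piece need not preserve the number of strands.\<close>

lemma exchange:
  assumes "ok f" "ok g"
  shows "whisker \<gamma> f (\<delta> @ cod g @ \<zeta>) \<cdot> whisker (\<gamma> @ dom f @ \<delta>) g \<zeta> =
    whisker (\<gamma> @ cod f @ \<delta>) g \<zeta> \<cdot> whisker \<gamma> f (\<delta> @ dom g @ \<zeta>)"
proof -
  have "whisker [] f (\<delta> @ cod g) \<cdot> whisker (dom f @ \<delta>) g [] = whisker (cod f @ \<delta>) g [] \<cdot> whisker [] f (\<delta> @ dom g)"
    using juxt_whisker[of f "whisker \<delta> g []"] juxt_whisker'[of f "whisker \<delta> g []"] assms
    by (simp add: whisker_whisker)
  from arg_cong[OF this, of "\<lambda>t. whisker \<gamma> t \<zeta>"] show ?thesis
    using assms by (simp add: whisker_comp whisker_whisker)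
qed

lemmas whisker_norm = juxt_whisker whisker_comp whisker_whisker whisker_strands comp_assoc

lemma straighten_left: "whisker [s] (cap (neg s)) [] \<cdot> whisker [] (cup s) [s] = strands [s]"
  unfolding whisker_def juxt_empty by transfer (auto simp: tangle_eqv_def intro!: tangle_eq.straighten_left)

lemma straighten_right: "whisker [] (cap s) [s] \<cdot> whisker [s] (cup (neg s)) [] = strands [s]"
  unfolding whisker_def juxt_empty by transfer (auto simp: tangle_eqv_def intro!: tangle_eq.straighten_right)

lemma turn_crossing:
  "whisker [] (cap (neg a)) [b, neg a] \<cdot> whisker [neg a] (cross b a) [neg a] \<cdot> whisker [neg a, b] (cup a) []
   = cross (neg a) b"
  unfolding whisker_def juxt_empty by transfer (auto simp: tangle_eqv_def intro!: tangle_eq.turn_crossing)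

lemma turn_disc:
  "whisker [] (disc l \<sigma>) (dual \<sigma>) \<cdot> mcoev \<sigma> = whisker (dual \<sigma>) (disc l \<sigma>) [] \<cdot> mcoev (dual \<sigma>)"
  unfolding whisker_def juxt_empty by transfer (auto simp: tangle_eqv_def intro!: tangle_eq.turn_disc)

lemma Reidemeister_1_left:
  "whisker [] (cap (neg s)) [s] \<cdot> whisker [neg s] (cross s s) [] \<cdot> whisker [] (cup (neg s)) [s] = strands [s]"
  unfolding whisker_def juxt_empty by transfer (auto simp: tangle_eqv_def intro!: tangle_eq.Reidemeister_1_left)

lemma Reidemeister_2: "cross b a \<cdot> cross a b = strands [a, b]"
  by transfer (auto simp: tangle_eqv_def intro!: tangle_eq.Reidemeister_2)

lemma Reidemeister_3:
  "whisker [] (cross b c) [a] \<cdot> whisker [b] (cross a c) [] \<cdot> whisker [] (cross a b) [c] =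
   whisker [c] (cross a b) [] \<cdot> whisker [] (cross a c) [b] \<cdot> whisker [a] (cross b c) []"
  unfolding whisker_def juxt_empty by transfer (auto simp: tangle_eqv_def intro!: tangle_eq.Reidemeister_3)

lemma disc_naturality:
  "whisker [] (disc l \<sigma>) [s] \<cdot> mpass s \<sigma> = whisker [s] (disc l \<sigma>) []"
  unfolding whisker_def juxt_empty by transfer (auto simp: tangle_eqv_def intro!: tangle_eq.naturality)

lemma mcoev_simps [simp]:
  "mcoev [] = strands []" "mcoev (s # \<sigma>) = whisker [s] (mcoev \<sigma>) [neg s] \<cdot> cup s"
  unfolding whisker_def by (transfer; auto simp: tangle_eqv_def typed intro!: tangle_eq.refl)+

lemma mev_simps [simp]:
  "mev [] = strands []" "mev (s # \<sigma>) = cap s \<cdot> whisker [s] (mev \<sigma>) [neg s]"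
  unfolding whisker_def by (transfer; auto simp: tangle_eqv_def typed intro!: tangle_eq.refl)+

lemma mpass_Nil [simp]: "mpass s [] = strands [s]"
  by (transfer; auto simp: tangle_eqv_def typed intro!: tangle_eq.refl)+

lemma mpass_Cons: "mpass s (a # \<sigma>) = whisker [a] (mpass s \<sigma>) [] \<cdot> whisker [] (cross s a) \<sigma>"
  unfolding whisker_def juxt_empty by (transfer; auto simp: tangle_eqv_def typed intro!: tangle_eq.refl)+

subsection \<open>Sliding strands and turning boxes\<close>

lemma morph_induct [consumes 1, case_names strands cross cap cup disc comp juxt]:
  assumes "ok f"
    and "\<And>\<sigma>. P (strands \<sigma>)" "\<And>a b. P (cross a b)" "\<And>s. P (cap s)" "\<And>s. P (cup s)" "\<And>l \<sigma>. P (disc l \<sigma>)"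
    and comp: "\<And>g f. ok g \<Longrightarrow> ok f \<Longrightarrow> dom g = cod f \<Longrightarrow> P g \<Longrightarrow> P f \<Longrightarrow> P (g \<cdot> f)"
    and juxt: "\<And>f g. ok f \<Longrightarrow> ok g \<Longrightarrow> P f \<Longrightarrow> P g \<Longrightarrow> P (f \<boxtimes> g)"
  shows "P f"
proof -
  obtain t where t: "f = abs_morph t" using Quotient3_abs_rep[OF Quotient3_morph] by metis
  have "P (abs_morph t)" if "ok (abs_morph t)" for t
    using that
  proof (induction t)
    case (Comp g f)
    then show ?case using comp[of "abs_morph g" "abs_morph f"] by (simp flip: comp.abs_eq)
  next
    case (Juxt g f)
    then show ?case using juxt[of "abs_morph g" "abs_morph f"] by (simp flip: juxt.abs_eq)
  qed (use assms in \<open>simp_all flip: strands.abs_eq cross.abs_eq cap.abs_eq cup.abs_eq disc.abs_eq\<close>)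
  then show ?thesis using assms(1) t by simp
qed

text \<open>Composites are kept nested to the right, so an equation between their initial parts is
  applied through forms with a tail \<open>x\<close>.\<close>

lemma comp_tail: "g \<cdot> f = h \<Longrightarrow> g \<cdot> f \<cdot> x = h \<cdot> x"
  by (simp flip: comp_assoc)

lemma comp_tail2: "g \<cdot> f = h \<cdot> k \<Longrightarrow> g \<cdot> f \<cdot> x = h \<cdot> k \<cdot> x"
  by (metis comp_assoc)

lemma comp_tail3: "g \<cdot> f \<cdot> e = h \<Longrightarrow> g \<cdot> f \<cdot> e \<cdot> x = h \<cdot> x"
  by (metis comp_assoc)

lemma whisker_eq:
  assumes "g \<cdot> f = h" "ok (g \<cdot> f)"
  shows "whisker \<gamma> g \<delta> \<cdot> whisker \<gamma> f \<delta> = whisker \<gamma> h \<delta>"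
  using assms whisker_comp by metis

lemma whisker_eq3:
  assumes "g \<cdot> f \<cdot> e = h" "ok (g \<cdot> f \<cdot> e)"
  shows "whisker \<gamma> g \<delta> \<cdot> whisker \<gamma> f \<delta> \<cdot> whisker \<gamma> e \<delta> = whisker \<gamma> h \<delta>"
  using assms(2) unfolding assms(1)[symmetric] by (simp add: whisker_comp)

lemma cross_cancel: "whisker \<gamma> (cross b a) \<delta> \<cdot> whisker \<gamma> (cross a b) \<delta> = strands (\<gamma> @ [a, b] @ \<delta>)"
  using whisker_eq[OF Reidemeister_2] by (simp add: whisker_strands)

lemma zigzag_left: "whisker (\<gamma> @ [s]) (cap (neg s)) \<delta> \<cdot> whisker \<gamma> (cup s) (s # \<delta>) = strands (\<gamma> @ [s] @ \<delta>)"
  using whisker_eq[OF straighten_left, of s \<gamma> \<delta>] by (simp add: whisker_norm)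

lemma zigzag_right: "whisker \<gamma> (cap s) (s # \<delta>) \<cdot> whisker (\<gamma> @ [s]) (cup (neg s)) \<delta> = strands (\<gamma> @ [s] @ \<delta>)"
  using whisker_eq[OF straighten_right, of s \<gamma> \<delta>] by (simp add: whisker_norm)

lemma turn_crossing_whisker:
  "whisker \<gamma> (cross (neg a) b) \<delta> = whisker \<gamma> (cap (neg a)) (b # neg a # \<delta>) \<cdot>
     whisker (\<gamma> @ [neg a]) (cross b a) (neg a # \<delta>) \<cdot> whisker (\<gamma> @ [neg a, b]) (cup a) \<delta>"
  using whisker_eq3[OF turn_crossing[where 'a='a], of a b \<gamma> \<delta>] by (simp add: whisker_norm)

text \<open>\<open>turn_crossing\<close> presents the crossing on the left as a rotated one. The cup
  that this introduces forms a zigzag with the outer cap, and straightening it leaves the right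
  side.\<close>

lemma cross_cap:
  "whisker [b] (cap (neg a)) [] \<cdot> whisker [] (cross (neg a) b) [a] =
   whisker [] (cap (neg a)) [b] \<cdot> whisker [neg a] (cross b a) []"
proof -
  have e1: "whisker [b] (cap (neg a)) [] \<cdot> whisker [] (cap (neg a)) [b, neg a, a] = (whisker [] (cap (neg a)) [b] \<cdot> whisker [neg a, a, b] (cap (neg a)) [] :: 'a morph)"
    using exchange[of "cap (neg a) :: 'a morph" "cap (neg a) :: 'a morph" "[]" "[b]" "[]"] by simp
  have e2: "whisker [neg a, a, b] (cap (neg a)) [] \<cdot> whisker [neg a] (cross b a) [neg a, a] = (whisker [neg a] (cross b a) [] \<cdot> whisker [neg a, b, a] (cap (neg a)) [] :: 'a morph)"
    using exchange[of "cross b a :: 'a morph" "cap (neg a) :: 'a morph" "[neg a]" "[]" "[]"] by simp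
  have e3: "whisker [neg a, b, a] (cap (neg a)) [] \<cdot> whisker [neg a, b] (cup a) [a] = (strands [neg a, b, a] :: 'a morph)"
    using zigzag_left[where 'a='a, of "[neg a, b]" a "[]"] by simp
  show ?thesis
    by (simp add: turn_crossing_whisker comp_tail2[OF e1] comp_tail2[OF e2] e3 comp_assoc)
qed

lemma cross_cup:
  "whisker [a] (cross (neg a) b) [] \<cdot> whisker [] (cup a) [b] =
   whisker [] (cross b a) [neg a] \<cdot> whisker [b] (cup a) []"
proof -
  have e1: "whisker [a, neg a, b] (cup a) [] \<cdot> whisker [] (cup a) [b] = (whisker [] (cup a) [b, a, neg a] \<cdot> whisker [b] (cup a) [] :: 'a morph)"
    using exchange[of "cup a :: 'a morph" "cup a :: 'a morph" "[]" "[b]" "[]"] by simp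
  have e2: "whisker [a, neg a] (cross b a) [neg a] \<cdot> whisker [] (cup a) [b, a, neg a] = (whisker [] (cup a) [a, b, neg a] \<cdot> whisker [] (cross b a) [neg a] :: 'a morph)"
    using exchange[of "cup a :: 'a morph" "cross b a :: 'a morph" "[]" "[]" "[neg a]"] by simp
  have e3: "whisker [a] (cap (neg a)) [b, neg a] \<cdot> whisker [] (cup a) [a, b, neg a] = (strands [a, b, neg a] :: 'a morph)"
    using zigzag_left[where 'a='a, of "[]" a "[b, neg a]"] by simp
  show ?thesis
    by (simp add: turn_crossing_whisker e1 comp_tail2[OF e2] comp_tail[OF e3] comp_assoc)
qed

lemma mpass_append: "mpass s (\<alpha> @ \<beta>) = whisker \<alpha> (mpass s \<beta>) [] \<cdot> whisker [] (mpass s \<alpha>) \<beta>"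
  by (induction \<alpha>) (simp_all add: whisker_strands mpass_Cons whisker_norm)

text \<open>Naturality of the symmetry, piece by piece: for a crossing it is Reidemeister III, for
  caps and cups it is \<open>cross_cap\<close> and \<open>cross_cup\<close> with Reidemeister II,
  and for a disc it is the postulated rule. A strand may therefore be pulled across any
  diagram.\<close>

theorem slide: "ok (f :: 'a morph) \<Longrightarrow> whisker [] f [s] \<cdot> mpass s (dom f) = mpass s (cod f) \<cdot> whisker [s] f []"
proof (induction f rule: morph_induct)
  case (cross a b)
  then show ?case
    using Reidemeister_3[where 'a='a, of a b s] by (simp add: mpass_Cons whisker_norm)
next
  case (cap a)
  have "whisker [] (cap a) [s] \<cdot> whisker [a] (cross s (neg a)) [] \<cdot> whisker [] (cross s a) [neg a]
      = (whisker [s] (cap a) [] :: 'a morph)"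
    using comp_tail2[OF cross_cap[where 'a='a, of s "neg a", symmetric]] cross_cancel[where 'a='a, of "[]" a s "[neg a]"] by simp
  then show ?case by (simp add: mpass_Cons whisker_norm)
next
  case (cup a)
  have "whisker [a] (cross s (neg a)) [] \<cdot> whisker [] (cross s a) [neg a] \<cdot> whisker [s] (cup a) []
      = (whisker [] (cup a) [s] :: 'a morph)"
    using comp_tail[OF cross_cancel[where 'a='a, of "[a]" s "neg a" "[]"]] by (simp flip: cross_cup)
  then show ?case by (simp add: mpass_Cons whisker_norm)
next
  case (disc l \<sigma>)
  then show ?case by (simp add: disc_naturality)
next
  case (comp g f)
  then show ?case
    using comp.IH(1) by (simp add: whisker_norm comp_tail2[OF comp.IH(1)[unfolded comp.hyps(3)]])
next
  case (juxt f g)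
  have e1: "whisker [] f (cod g @ [s]) \<cdot> whisker (dom f) (mpass s (cod g)) [] = (whisker (cod f) (mpass s (cod g)) [] \<cdot> whisker [] f (s # cod g) :: 'a morph)"
    using exchange[of "f :: 'a morph" "mpass s (cod g) :: 'a morph" "[]" "[]" "[]"] juxt by simp
  have e2: "whisker (dom f @ [s]) g [] \<cdot> whisker [] (mpass s (dom f)) (dom g) = (whisker [] (mpass s (dom f)) (cod g) \<cdot> whisker (s # dom f) g [] :: 'a morph)"
    using exchange[of "mpass s (dom f) :: 'a morph" "g :: 'a morph" "[]" "[]" "[]"] juxt by simp
  have e3: "whisker (dom f) g [s] \<cdot> whisker (dom f) (mpass s (dom g)) [] = (whisker (dom f) (mpass s (cod g)) [] \<cdot> whisker (dom f @ [s]) g [] :: 'a morph)"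
    using arg_cong[OF juxt.IH(2), of "\<lambda>t. whisker (dom f) t []"] juxt.hyps by (simp add: whisker_norm)
  have e4: "whisker [] f (s # cod g) \<cdot> whisker [] (mpass s (dom f)) (cod g) = (whisker [] (mpass s (cod f)) (cod g) \<cdot> whisker [s] f (cod g) :: 'a morph)"
    using arg_cong[OF juxt.IH(1), of "\<lambda>t. whisker [] t (cod g)"] juxt.hyps by (simp add: whisker_norm)
  show ?case
    using juxt.hyps
    by (simp add: whisker_norm mpass_append comp_tail2[OF e3] e2 comp_tail2[OF e1] comp_tail2[OF e4])
qed (simp_all add: whisker_strands)

text \<open>Rotating the crossing turns the left side into a cup with a kink, which Reidemeister I
  removes.\<close>

lemma cross_cup_turn: "cross (neg s) s \<cdot> cup (neg s) = cup s"
proof -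
  have e1: "whisker [neg s, s] (cup s) [] \<cdot> cup (neg s) = (whisker [] (cup (neg s)) [s, neg s] \<cdot> cup s :: 'a morph)"
    using exchange[of "cup (neg s) :: 'a morph" "cup s :: 'a morph" "[]" "[]" "[]"] by simp
  have e2: "whisker [] (cap (neg s)) [s, neg s] \<cdot> whisker [neg s] (cross s s) [neg s] \<cdot>
      whisker [] (cup (neg s)) [s, neg s] = (strands [s, neg s] :: 'a morph)"
    using whisker_eq3[OF Reidemeister_1_left[where 'a='a], of s "[]" "[neg s]"] by (simp add: whisker_norm)
  show ?thesis
    using turn_crossing_whisker[where 'a='a, of "[]" s s "[]"] by (simp add: e1 comp_tail3[OF e2] comp_assoc)
qed

text \<open>The symmetry exchanging the bundles \<open>\<beta>\<close> and \<open>\<tau>\<close>,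
  built from one strand of \<open>\<beta>\<close> at a time.\<close>

primrec block :: "sign list \<Rightarrow> sign list \<Rightarrow> 'l morph" where
  "block [] \<tau> = strands \<tau>"
| "block (n # \<beta>) \<tau> = whisker [] (mpass n \<tau>) \<beta> \<cdot> whisker [n] (block \<beta> \<tau>) []"

lemma block_typed [simp]:
  "ok (block \<beta> \<tau> :: 'l morph) \<and> dom (block \<beta> \<tau> :: 'l morph) = \<beta> @ \<tau> \<and> cod (block \<beta> \<tau> :: 'l morph) = \<tau> @ \<beta>"
  by (induction \<beta>) auto

lemma block_Nil: "block \<beta> [] = strands \<beta>"
  by (induction \<beta>) (auto simp: whisker_strands)

lemma block_snoc: "block \<beta> (\<tau> @ [n]) = whisker \<tau> (block \<beta> [n]) [] \<cdot> whisker [] (block \<beta> \<tau>) [n]"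
proof (induction \<beta>)
  case (Cons m \<beta>)
  have e: "whisker [] (mpass m \<tau>) (n # \<beta>) \<cdot> whisker (m # \<tau>) (block \<beta> [n]) [] = (whisker (\<tau> @ [m]) (block \<beta> [n]) [] \<cdot> whisker [] (mpass m \<tau>) (\<beta> @ [n]) :: 'a morph)"
    using exchange[of "mpass m \<tau> :: 'a morph" "block \<beta> [n] :: 'a morph" "[]" "[]" "[]"] by simp
  show ?case
    by (simp add: Cons.IH mpass_append whisker_norm comp_tail2[OF e])
qed (simp add: whisker_strands)

lemma block_mpass: "block \<beta> [n] \<cdot> mpass n \<beta> = strands (n # \<beta>)"
proof (induction \<beta>)
  case (Cons m \<beta>)
  have e: "whisker [m] (block \<beta> [n]) [] \<cdot> whisker [m] (mpass n \<beta>) [] = (strands (m # n # \<beta>) :: 'a morph)"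
    using whisker_eq[OF Cons.IH, of "[m]" "[]"] by (simp add: whisker_strands)
  then show ?case
    using cross_cancel[where 'a='a, of "[]" m n \<beta>] by (simp add: mpass_Cons whisker_norm comp_tail[OF e])
qed simp

text \<open>The strand \<open>n\<close> crosses \<open>\<beta>\<close> and \<open>\<tau>\<close>,
  and then \<open>\<beta>\<close> crosses back over it. The double crossings with
  \<open>\<beta>\<close> cancel by Reidemeister II and only those with \<open>\<tau>\<close>
  remain.\<close>

lemma block_mpass_append: "block \<beta> (\<tau> @ [n]) \<cdot> mpass n (\<beta> @ \<tau>) = block (n # \<beta>) \<tau>"
proof -
  have e: "whisker [] (block \<beta> \<tau>) [n] \<cdot> mpass n (\<beta> @ \<tau>) = (mpass n (\<tau> @ \<beta>) \<cdot> whisker [n] (block \<beta> \<tau>) [] :: 'a morph)"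
    using slide[of "block \<beta> \<tau>" n] by simp
  have e2: "whisker \<tau> (block \<beta> [n]) [] \<cdot> whisker \<tau> (mpass n \<beta>) [] = (strands (\<tau> @ n # \<beta>) :: 'a morph)"
    using whisker_eq[OF block_mpass[where 'a='a], of \<beta> n \<tau> "[]"] by (simp add: whisker_strands)
  show ?thesis
    by (simp only: block_snoc comp_assoc e) (simp add: mpass_append comp_assoc comp_tail[OF e2])
qed

lemma mcoev_snoc: "mcoev (\<tau> @ [a]) = whisker \<tau> (cup a) (dual \<tau>) \<cdot> mcoev \<tau>"
  by (induction \<tau>) (simp_all add: whisker_norm)

text \<open>Rotation of a box that still has outputs, which the block crossing carries to the other
  side. The outputs are there for the induction: the inputs of \<open>g\<close> are bent round one
  at a time, and each becomes a new output.\<close>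

lemma turn_block:
  "ok (g :: 'a morph) \<Longrightarrow> dom g = \<sigma> \<Longrightarrow>
     block (cod g) (dual \<sigma>) \<cdot> whisker [] g (dual \<sigma>) \<cdot> mcoev \<sigma> = whisker (dual \<sigma>) g [] \<cdot> mcoev (dual \<sigma>)"
proof (induction \<sigma> arbitrary: g)
  case Nil
  then show ?case by (simp add: block_Nil)
next
  case (Cons s \<sigma> g)
  \<comment> \<open>\<open>g'\<close> bends the first leg up on the left, \<open>f\<close> bends all
    the others up on the right. Bending the remaining legs of either one gives the same diagram
    (\<open>1\<close>), and \<open>2\<close> pulls the bent first leg across the box, with
    Reidemeister I entering through \<open>cross_cup_turn\<close>.\<close>
  define g' where "g' = whisker [neg s] g [] \<cdot> whisker [] (cup (neg s)) \<sigma>"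
  define f where "f = whisker [] g (dual \<sigma>) \<cdot> whisker [s] (mcoev \<sigma>) []"
  have ty: "ok g'" "dom g' = \<sigma>" "cod g' = neg s # cod g" "ok f" "dom f = [s]" "cod f = cod g @ dual \<sigma>"
    using Cons.prems by (auto simp: g'_def f_def)
  have ex: "whisker [neg s, s] (mcoev \<sigma>) [] \<cdot> cup (neg s) = (whisker [] (cup (neg s)) (\<sigma> @ dual \<sigma>) \<cdot> mcoev \<sigma> :: 'a morph)"
    using exchange[of "cup (neg s) :: 'a morph" "mcoev \<sigma> :: 'a morph" "[]" "[]" "[]"] by simp
  have 1: "whisker [neg s] f [] \<cdot> cup (neg s) = whisker [] g' (dual \<sigma>) \<cdot> mcoev \<sigma>"
    using Cons.prems by (simp add: f_def g'_def whisker_norm ex)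
  have 2: "whisker [] f [neg s] \<cdot> cup s = mpass (neg s) (cod f) \<cdot> whisker [neg s] f [] \<cdot> cup (neg s)"
    using comp_tail2[OF slide[OF ty(4), of "neg s"], of "cup (neg s)"] ty cross_cup_turn[where 'a='a, of s]
    by (simp add: mpass_Cons comp_assoc whisker_strands)
  have "block (cod g) (dual (s # \<sigma>)) \<cdot> whisker [] g (dual (s # \<sigma>)) \<cdot> mcoev (s # \<sigma>) = (block (cod g) (dual \<sigma> @ [neg s]) \<cdot> whisker [] f [neg s] \<cdot> cup s :: 'a morph)"
    using Cons.prems by (simp add: f_def whisker_norm)
  also have "\<dots> = (block (neg s # cod g) (dual \<sigma>) \<cdot> whisker [] g' (dual \<sigma>) \<cdot> mcoev \<sigma> :: 'a morph)"
    using ty by (simp only: 1 2 comp_tail[OF block_mpass_append])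
  also have "\<dots> = (whisker (dual \<sigma>) g' [] \<cdot> mcoev (dual \<sigma>) :: 'a morph)"
    using Cons.IH[OF ty(1,2)] ty by simp
  also have "\<dots> = (whisker (dual (s # \<sigma>)) g [] \<cdot> mcoev (dual (s # \<sigma>)) :: 'a morph)"
    using Cons.prems by (simp add: g'_def whisker_norm mcoev_snoc)
  finally show ?case .
qed

text \<open>The rule \<open>turn_disc\<close> for an arbitrary box; together with
  \<open>slide_box\<close> it allows a disc to be replaced by a diagram.\<close>

corollary turn_box:
  assumes "ok t" and "dom t = \<sigma>" and "cod t = []"
  shows "whisker [] t (dual \<sigma>) \<cdot> mcoev \<sigma> = whisker (dual \<sigma>) t [] \<cdot> mcoev (dual \<sigma>)"
  using turn_block[OF assms(1,2)] assms by simp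

corollary slide_box:
  assumes "ok t" and "dom t = \<sigma>" and "cod t = []"
  shows "whisker [] t [s] \<cdot> mpass s \<sigma> = whisker [s] t []"
  using slide[of t s] assms by simp

subsection \<open>Substitution\<close>

lemma abs_morph_eq_iff: "wf_diagram t \<Longrightarrow> abs_morph t = abs_morph t' \<longleftrightarrow> t \<approx>\<^sub>t t'"
  by (auto simp: morph.abs_eq_iff tangle_eqv_def)

lemmas abs_morph_simps =
  strands.abs_eq[symmetric] cross.abs_eq[symmetric] cap.abs_eq[symmetric] cup.abs_eq[symmetric]
  disc.abs_eq[symmetric] comp.abs_eq[symmetric] juxt.abs_eq[symmetric] mcoev.abs_eq[symmetric]
  mev.abs_eq[symmetric] mpass.abs_eq[symmetric]

definition fits :: "('l \<Rightarrow> sign list \<Rightarrow> 'm diagram) \<Rightarrow> 'l diagram \<Rightarrow> bool" where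
  "fits h T \<longleftrightarrow> (\<forall>(l, \<sigma>)\<in>set (discs T). wf_diagram (h l \<sigma>) \<and> src (h l \<sigma>) = \<sigma> \<and> tgt (h l \<sigma>) = [])"

lemma fits_simps [simp]:
  "fits h (Strands \<sigma>)" "fits h (Crossing a b)" "fits h (Cap s)" "fits h (Cup s)"
  "fits h (Disc l \<sigma>) \<longleftrightarrow> wf_diagram (h l \<sigma>) \<and> src (h l \<sigma>) = \<sigma> \<and> tgt (h l \<sigma>) = []"
  "fits h (g \<circ>\<^sub>t f) \<longleftrightarrow> fits h g \<and> fits h f" "fits h (f \<otimes>\<^sub>t g) \<longleftrightarrow> fits h f \<and> fits h g"
  "fits h (coev \<sigma>)" "fits h (pass s \<sigma>)"
  by (auto simp: fits_def)

lemma fits_tangle_eq: "T \<approx>\<^sub>t T' \<Longrightarrow> fits h T \<longleftrightarrow> fits h T'"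
  using tangle_eq_typed[of T T', THEN conjunct2, THEN conjunct2, THEN conjunct2, THEN conjunct2,
      THEN mset_eq_setD] by (simp add: fits_def)

lemma fill_typed:
  "fits h T \<Longrightarrow> src (fill h T) = src T \<and> tgt (fill h T) = tgt T \<and> (wf_diagram T \<longrightarrow> wf_diagram (fill h T))"
  by (induction T) auto

lemma fill_coev [simp]: "fill h (coev \<sigma>) = coev \<sigma>"
  by (induction \<sigma>) auto

lemma fill_pass [simp]: "fill h (pass s \<sigma>) = pass s \<sigma>"
  by (induction \<sigma>) auto

text \<open>\<open>turn_disc\<close> and \<open>naturality\<close> are the rules that mention a
  disc; after substitution they become \<open>turn_box\<close> and \<open>slide_box\<close>. The
  other rules survive because \<open>fill\<close> preserves the shape and the type of a
  diagram.\<close>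

lemma fill_tangle_eq: "T \<approx>\<^sub>t T' \<Longrightarrow> fits h T \<Longrightarrow> fill h T \<approx>\<^sub>t fill h T'"
proof (induction rule: tangle_eq.induct)
  case (turn_disc l \<sigma>)
  then have t: "wf_diagram (h l \<sigma>)" "src (h l \<sigma>) = \<sigma>" "tgt (h l \<sigma>) = []" by auto
  then have "whisker [] (abs_morph (h l \<sigma>)) (dual \<sigma>) \<cdot> mcoev \<sigma> =
      whisker (dual \<sigma>) (abs_morph (h l \<sigma>)) [] \<cdot> mcoev (dual \<sigma>)"
    by (intro turn_box) (auto simp: ok.abs_eq dom.abs_eq cod.abs_eq)
  with t show ?case
    by (subst abs_morph_eq_iff[symmetric]) (auto simp: typed whisker_def abs_morph_simps)
next
  case (naturality l \<sigma> s)
  then have t: "wf_diagram (h l \<sigma>)" "src (h l \<sigma>) = \<sigma>" "tgt (h l \<sigma>) = []" by auto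
  then have "whisker [] (abs_morph (h l \<sigma>)) [s] \<cdot> mpass s \<sigma> = whisker [s] (abs_morph (h l \<sigma>)) []"
    by (intro slide_box) (auto simp: ok.abs_eq dom.abs_eq cod.abs_eq)
  with t show ?case
    by (subst abs_morph_eq_iff[symmetric]) (auto simp: typed whisker_def abs_morph_simps)
next
  case (sym f g)
  then show ?case using fits_tangle_eq tangle_eq.sym by blast
next
  case (trans f g h)
  then show ?case using fits_tangle_eq tangle_eq.trans by blast
next
  case (cong_comp g g' f f')
  then show ?case by (auto simp: fill_typed intro: tangle_eq.cong_comp)
next
  case (comp_strands_left f)
  then show ?case using tangle_eq.comp_strands_left[of "fill h f"] by (simp add: fill_typed)
next
  case (comp_strands_right f)
  then show ?case using tangle_eq.comp_strands_right[of "fill h f"] by (simp add: fill_typed)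
qed (auto simp: fill_typed intro: tangle_eq.intros)

lemma fill_cong:
  "wf_diagram T \<Longrightarrow> fits h T \<Longrightarrow> (\<And>l \<sigma>. (l, \<sigma>) \<in> set (discs T) \<Longrightarrow> h l \<sigma> \<approx>\<^sub>t k l \<sigma>) \<Longrightarrow> fill h T \<approx>\<^sub>t fill k T"
proof (induction T)
  case (Comp g f)
  then show ?case by (auto simp: fill_typed intro!: tangle_eq.cong_comp)
qed (auto intro: tangle_eq.refl tangle_eq.cong_juxt)

lemma fill_fill: "fill h (fill k T) = fill (\<lambda>l \<sigma>. fill h (k l \<sigma>)) T"
  by (induction T) auto

lemma fill_Disc [simp]: "fill Disc T = T"
  by (induction T) auto

lemma fill_cong_eq: "(\<And>l \<sigma>. (l, \<sigma>) \<in> set (discs T) \<Longrightarrow> h l \<sigma> = k l \<sigma>) \<Longrightarrow> fill h T = fill k T"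
  by (induction T) auto

lemma fill_map: "fill h (map_diagram \<pi> T) = fill (\<lambda>l. h (\<pi> l)) T"
  by (induction T) auto

lemma set_discs_fill: "set (discs (fill h T)) = (\<Union>(l, \<sigma>)\<in>set (discs T). set (discs (h l \<sigma>)))"
  by (induction T) auto

lemma map_diagram_simps [simp]:
  "discs (map_diagram \<pi> T) = map (map_prod \<pi> id) (discs T)"
  "src (map_diagram \<pi> T) = src T" "tgt (map_diagram \<pi> T) = tgt T"
proof -
  show "discs (map_diagram \<pi> T) = map (map_prod \<pi> id) (discs T)" by (induction T) auto
  show "src (map_diagram \<pi> T) = src T" by (induction T) auto
  show "tgt (map_diagram \<pi> T) = tgt T" by (induction T) auto
qed

lemma wf_map_diagram [simp]: "wf_diagram (map_diagram \<pi> T) = wf_diagram T"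
  by (induction T) auto

lemma tangle_map: "tangle \<sigma> T \<Longrightarrow> inj_on \<pi> (labels T) \<Longrightarrow> tangle \<sigma> (map_diagram \<pi> T)"
proof -
  have "map fst (discs (map_diagram \<pi> T)) = map \<pi> (map fst (discs T))"
    by simp
  moreover assume "tangle \<sigma> T" "inj_on \<pi> (labels T)"
  ultimately show ?thesis
    unfolding tangle_def by (simp only: distinct_map[of \<pi>]) simp
qed

lemma tangle_tangle_eq: "tangle \<sigma> T \<Longrightarrow> T \<approx>\<^sub>t T' \<Longrightarrow> tangle \<sigma> T' \<and> set (discs T') = set (discs T)"
  using tangle_eq_typed[of T T'] mset_eq_setD[of "discs T" "discs T'"]
    mset_eq_imp_distinct_iff[of "map fst (discs T)" "map fst (discs T')"]
  by (simp add: tangle_def)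

lemma discs_insert_tangle:
  assumes "(l, \<tau>) \<in> set (discs T)"
  shows "set (discs (insert_tangle l S T)) = {(j, \<rho>) \<in> set (discs T). j \<noteq> l} \<union> set (discs S)"
proof (rule Set.set_eqI)
  fix x
  have "x \<in> set (discs (insert_tangle l S T)) \<longleftrightarrow>
      (\<exists>(j, \<rho>)\<in>set (discs T). if j = l then x \<in> set (discs S) else x = (j, \<rho>))"
    unfolding insert_tangle_def set_discs_fill UN_iff by (rule bex_cong) auto
  also have "\<dots> \<longleftrightarrow> x \<in> {(j, \<rho>) \<in> set (discs T). j \<noteq> l} \<union> set (discs S)"
    using assms by (cases x) (auto split: if_splits intro: bexI[of _ x] bexI[of _ "(l, \<tau>)"])
  finally show "x \<in> set (discs (insert_tangle l S T)) \<longleftrightarrow>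
      x \<in> {(j, \<rho>) \<in> set (discs T). j \<noteq> l} \<union> set (discs S)" .
qed

lemma labels_insert_tangle:
  "labels (insert_tangle l S T) = (labels T - {l}) \<union> (if l \<in> labels T then labels S else {})"
proof (induction T)
  case (Comp g f)
  have "labels (insert_tangle l S (g \<circ>\<^sub>t f)) = labels (insert_tangle l S g) \<union> labels (insert_tangle l S f)"
    by (simp add: insert_tangle_def image_Un)
  then show ?case unfolding Comp.IH by (simp add: image_Un Un_Diff Un_ac)
next
  case (Juxt f g)
  have "labels (insert_tangle l S (f \<otimes>\<^sub>t g)) = labels (insert_tangle l S f) \<union> labels (insert_tangle l S g)"
    by (simp add: insert_tangle_def image_Un)
  then show ?case unfolding Juxt.IH by (simp add: image_Un Un_Diff Un_ac)
qed (simp_all add: insert_tangle_def)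

lemma distinct_insert_tangle:
  assumes "distinct (map fst (discs T))" "distinct (map fst (discs S))" "(labels T - {l}) \<inter> labels S = {}"
  shows "distinct (map fst (discs (insert_tangle l S T)))"
proof -
  \<comment> \<open>\<open>A\<close> and \<open>B\<close> are the labels of the two parts of a
    tangle and \<open>C\<close> those of \<open>S\<close>. As \<open>l\<close> occurs in at most one
    part, the inserted labels appear on one side only.\<close>
  have disj: "((A - {l}) \<union> (if l \<in> A then C else {})) \<inter> ((B - {l}) \<union> (if l \<in> B then C else {})) = {}"
    if "A \<inter> B = {}" "((A \<union> B) - {l}) \<inter> C = {}" for A B C :: "nat set"
    using that by auto
  have "(labels T - {l}) \<inter> labels S = {} \<Longrightarrow> distinct (map fst (discs T)) \<Longrightarrow>
      distinct (map fst (discs (insert_tangle l S T)))"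
  proof (induction T)
    case (Comp g f)
    have 1: "labels g \<inter> labels f = {}" "((labels g \<union> labels f) - {l}) \<inter> labels S = {}"
        "(labels g - {l}) \<inter> labels S = {}" "(labels f - {l}) \<inter> labels S = {}"
      using Comp.prems by (simp_all add: image_Un Un_Diff Int_Un_distrib2)
    have "labels (insert_tangle l S g) \<inter> labels (insert_tangle l S f) = {}"
      using disj[OF 1(1,2)] by (simp only: labels_insert_tangle)
    with Comp 1 show ?case by (simp add: insert_tangle_def)
  next
    case (Juxt g f)
    have 1: "labels g \<inter> labels f = {}" "((labels g \<union> labels f) - {l}) \<inter> labels S = {}"
        "(labels g - {l}) \<inter> labels S = {}" "(labels f - {l}) \<inter> labels S = {}"
      using Juxt.prems by (simp_all add: image_Un Un_Diff Int_Un_distrib2)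
    have "labels (insert_tangle l S g) \<inter> labels (insert_tangle l S f) = {}"
      using disj[OF 1(1,2)] by (simp only: labels_insert_tangle)
    with Juxt 1 show ?case by (simp add: insert_tangle_def)
  qed (use assms(2) in \<open>auto simp: insert_tangle_def\<close>)
  then show ?thesis using assms by blast
qed

lemma tangle_insert_tangle:
  assumes "tangle \<sigma> T" "(l, \<tau>) \<in> set (discs T)" "tangle \<tau> S" "(labels T - {l}) \<inter> labels S = {}"
  shows "tangle \<sigma> (insert_tangle l S T)"
proof -
  have *: "\<rho> = \<tau>" if "(l, \<rho>) \<in> set (discs T)" for \<rho>
    using assms that unfolding tangle_def by (metis eq_key_imp_eq_value)
  have "fits (\<lambda>i \<sigma>. if i = l then S else Disc i \<sigma>) T"
    unfolding fits_def
  proof (rule ballI, rule case_prodI2)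
    fix p j \<rho>
    assume "p \<in> set (discs T)" "p = (j, \<rho>)"
    then show "wf_diagram (if j = l then S else Disc j \<rho>) \<and>
        src (if j = l then S else Disc j \<rho>) = \<rho> \<and> tgt (if j = l then S else Disc j \<rho>) = []"
      using assms(3) * by (cases "j = l") (simp_all add: tangle_def)
  qed
  from fill_typed[OF this] show ?thesis
    using assms distinct_insert_tangle[of T S l] unfolding tangle_def insert_tangle_def by simp
qed

section \<open>Multilinear functions and the free planar algebra\<close>

lemma cring_scalars: "cring (scalars :: 'k::field ring)"
proof (rule cringI)
  show "abelian_group (scalars :: 'k ring)"
    by (rule abelian_groupI) (auto simp: scalars_def algebra_simps intro: exI[of _ "- _"] add.left_inverse)
  show "Group.comm_monoid (scalars :: 'k ring)"
    by unfold_locales (auto simp: scalars_def algebra_simps)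
qed (auto simp: scalars_def algebra_simps)

lemma scalars_simps [simp]:
  "carrier scalars = UNIV" "a \<oplus>\<^bsub>scalars\<^esub> b = a + b" "a \<otimes>\<^bsub>scalars\<^esub> b = a * b"
  "\<one>\<^bsub>scalars\<^esub> = 1" "\<zero>\<^bsub>scalars\<^esub> = 0"
  by (simp_all add: scalars_def)

definition single :: "'c \<Rightarrow> 'c \<Rightarrow> 'k::field" where
  "single b = (\<lambda>c. if c = b then 1 else 0)"

lemma support_single [simp]: "support (single b :: 'c \<Rightarrow> 'k::field) = {b}"
  by (auto simp: support_def single_def)

definition finsupp :: "'c set \<Rightarrow> ('c \<Rightarrow> 'k::field) set" where
  "finsupp B = {f. finite (support f) \<and> support f \<subseteq> B}"

lemma finsupp_zero [simp]: "(\<lambda>_. 0) \<in> finsupp B"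
  by (simp add: finsupp_def support_def)

lemma finsupp_lincomb: "x \<in> finsupp B \<Longrightarrow> y \<in> finsupp B \<Longrightarrow> (\<lambda>c. a * x c + y c) \<in> finsupp B"
proof -
  assume *: "x \<in> finsupp B" "y \<in> finsupp B"
  have "support (\<lambda>c. a * x c + y c) \<subseteq> support x \<union> support y"
    by (auto simp: support_def)
  with * show ?thesis
    unfolding finsupp_def by (auto intro: finite_subset)
qed

lemma finsupp_single [simp]: "single b \<in> finsupp B \<longleftrightarrow> b \<in> B"
  by (simp add: finsupp_def)

lemma finsupp_linear_zero:
  fixes F :: "('c \<Rightarrow> 'k::field) \<Rightarrow> 'k"
  assumes lin: "\<And>a x y. x \<in> finsupp B \<Longrightarrow> y \<in> finsupp B \<Longrightarrow> F (\<lambda>c. a * x c + y c) = a * F x + F y"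
    and basis: "\<And>b. b \<in> B \<Longrightarrow> F (single b) = 0" and x: "x \<in> finsupp B"
  shows "F x = 0"
proof -
  \<comment> \<open>With a = -1 and x = y = 0 the linearity law reads F 0 = - F 0 + F 0.\<close>
  have zero: "F (\<lambda>_. 0) = 0"
    using lin[of "\<lambda>_. 0" "\<lambda>_. 0" "-1"] by simp
  have "finite S \<Longrightarrow> S \<subseteq> B \<Longrightarrow> (\<forall>x. support x \<subseteq> S \<longrightarrow> F x = 0)" for S
  proof (induction S rule: finite_induct)
    case empty
    have "x = (\<lambda>_. 0)" if "support x \<subseteq> {}" for x :: "'c \<Rightarrow> 'k"
      using that by (auto simp: support_def)
    with zero show ?case by metis
  next
    case (insert b S)
    show ?case
    proof (intro allI impI)
      fix x :: "'c \<Rightarrow> 'k" assume x: "support x \<subseteq> insert b S"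
      have sub: "support (x(b := 0)) \<subseteq> S"
        using x by (auto simp: support_def)
      have "finite S" "S \<subseteq> B" "b \<in> B" using insert by auto
      then have "x(b := 0) \<in> finsupp B" "single b \<in> (finsupp B :: ('c \<Rightarrow> 'k) set)"
        using sub by (auto simp: finsupp_def intro: finite_subset)
      then have "F (\<lambda>c. x b * single b c + (x(b := 0)) c) = x b * F (single b) + F (x(b := 0))"
        using lin by metis
      moreover have "(\<lambda>c. x b * single b c + (x(b := 0)) c) = x"
        by (auto simp: single_def)
      moreover have "F (x(b := 0)) = 0"
        using insert sub by auto
      ultimately show "F x = 0"
        using basis[OF \<open>b \<in> B\<close>] by simp
    qed
  qed
  with x show ?thesis unfolding finsupp_def by auto
qed

text \<open>The induction is on the set \<open>M\<close> of arguments that may be arbitrary, the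
  others being basis vectors. Freeing one more argument is \<open>finsupp_linear_zero\<close> in
  that slot.\<close>

lemma multilinear_zero:
  fixes D :: "('i \<Rightarrow> 'c \<Rightarrow> 'k::field) \<Rightarrow> 'k"
  assumes "finite L"
    and lin: "\<And>v l a x y. (\<And>j. j \<in> L \<Longrightarrow> v j \<in> finsupp (B j)) \<Longrightarrow> l \<in> L \<Longrightarrow> x \<in> finsupp (B l) \<Longrightarrow>
      y \<in> finsupp (B l) \<Longrightarrow> D (v(l := \<lambda>c. a * x c + y c)) = a * D (v(l := x)) + D (v(l := y))"
    and basis: "\<And>v. (\<And>j. j \<in> L \<Longrightarrow> \<exists>b\<in>B j. v j = single b) \<Longrightarrow> D v = 0"
    and v: "\<And>j. j \<in> L \<Longrightarrow> v j \<in> finsupp (B j)"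
  shows "D v = 0"
proof -
  have "finite M \<Longrightarrow> M \<subseteq> L \<Longrightarrow>
      (\<forall>v. (\<forall>j\<in>L. v j \<in> finsupp (B j)) \<longrightarrow> (\<forall>j\<in>L - M. \<exists>b\<in>B j. v j = single b) \<longrightarrow> D v = 0)" for M
  proof (induction M rule: finite_induct)
    case empty
    then show ?case using basis by simp
  next
    case (insert l M)
    show ?case
    proof (intro allI impI)
      fix v :: "'i \<Rightarrow> 'c \<Rightarrow> 'k"
      assume v: "\<forall>j\<in>L. v j \<in> finsupp (B j)" "\<forall>j\<in>L - insert l M. \<exists>b\<in>B j. v j = single b"
      have l: "l \<in> L" using insert by auto
      have "D (v(l := v l)) = 0"
      proof (rule finsupp_linear_zero[where B = "B l" and F = "\<lambda>x. D (v(l := x))"])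
        fix b assume "b \<in> B l"
        then have "\<forall>j\<in>L. (v(l := single b)) j \<in> finsupp (B j)"
            "\<forall>j\<in>L - M. \<exists>c\<in>B j. (v(l := single b)) j = single c"
          using v by auto
        then show "D (v(l := single b)) = 0"
          using insert by blast
      qed (use lin v l in auto)
      then show "D v = 0" by simp
    qed
  qed
  from this[OF assms(1) subset_refl] v show ?thesis by auto
qed

section \<open>The free planar algebra on a set of vertices\<close>

definition vertex_diagrams :: "('g \<Rightarrow> sign list) \<Rightarrow> sign list \<Rightarrow> 'g diagram set" where
  "vertex_diagrams deg \<sigma> =
     {t. wf_diagram t \<and> src t = \<sigma> \<and> tgt t = [] \<and> (\<forall>(g, \<tau>)\<in>set (discs t). \<tau> = deg g)}"

lemma vertex_tangles_eq: "vertex_tangles deg \<sigma> = tangle_class ` vertex_diagrams deg \<sigma>"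
  by (simp add: vertex_tangles_def vertex_diagrams_def)

lemma tangle_class_eq_iff: "wf_diagram t \<Longrightarrow> tangle_class t = tangle_class t' \<longleftrightarrow> t \<approx>\<^sub>t t'"
  unfolding tangle_class_def using tangle_eq.refl tangle_eq.sym tangle_eq.trans by blast

lemma tangle_class_eq: "t \<approx>\<^sub>t t' \<Longrightarrow> tangle_class t = tangle_class t'"
  using tangle_class_eq_iff tangle_eq_typed by blast

lemma vertex_diagrams_tangle_eq: "t \<approx>\<^sub>t t' \<Longrightarrow> t \<in> vertex_diagrams deg \<sigma> \<Longrightarrow> t' \<in> vertex_diagrams deg \<sigma>"
  unfolding vertex_diagrams_def using tangle_eq_typed[of t t'] mset_eq_setD[of "discs t" "discs t'"] by auto

abbreviation (input) basis_input :: "(nat \<Rightarrow> 'g diagram) \<Rightarrow> nat \<Rightarrow> 'g diagram set \<Rightarrow> 'k::field" where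
  "basis_input s \<equiv> \<lambda>l. single (tangle_class (s l))"

definition fits_vertices :: "('g \<Rightarrow> sign list) \<Rightarrow> nat diagram \<Rightarrow> (nat \<Rightarrow> 'g diagram) \<Rightarrow> bool" where
  "fits_vertices deg T s \<longleftrightarrow> (\<forall>(l, \<tau>)\<in>set (discs T). s l \<in> vertex_diagrams deg \<tau>)"

lemma fits_verticesD: "fits_vertices deg T s \<Longrightarrow> fits (\<lambda>l _. s l) T"
  by (auto simp: fits_vertices_def fits_def vertex_diagrams_def)

lemma fill_vertices:
  assumes "wf_diagram T" "tgt T = []" "fits_vertices deg T s"
  shows "fill (\<lambda>l _. s l) T \<in> vertex_diagrams deg (src T)"
proof -
  have "\<forall>(g, \<tau>)\<in>set (discs (fill (\<lambda>l _. s l) T)). \<tau> = deg g"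
    using assms(3) unfolding set_discs_fill fits_vertices_def vertex_diagrams_def by fastforce
  with fill_typed[OF fits_verticesD[OF assms(3)]] assms(1,2) show ?thesis
    by (simp add: vertex_diagrams_def)
qed

lemma insert_classes_cong: "(\<And>l. l \<in> labels T \<Longrightarrow> c l = d l) \<Longrightarrow> insert_classes T c = insert_classes T d"
  unfolding insert_classes_def by simp

text \<open>\<open>insert_classes\<close> varies all representatives at once; by
  \<open>fill_cong\<close> the results are equal tangles, so they form a single class.\<close>

lemma insert_classes_fill:
  assumes "wf_diagram T" "fits_vertices deg T s"
  shows "insert_classes T (\<lambda>l. tangle_class (s l)) = tangle_class (fill (\<lambda>l _. s l) T)"
proof -
  have "fill (\<lambda>l _. s l) T \<approx>\<^sub>t fill (\<lambda>l _. s' l) T"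
    if "\<forall>l\<in>labels T. s' l \<in> tangle_class (s l)" for s'
    using that fits_verticesD[OF assms(2)] by (intro fill_cong assms(1)) (force simp: tangle_class_def)+
  moreover have "\<forall>l\<in>labels T. s l \<in> tangle_class (s l)"
    using fits_verticesD[OF assms(2)] by (auto simp: tangle_class_def fits_def intro!: tangle_eq.refl)
  ultimately show ?thesis
    unfolding insert_classes_def tangle_class_def
    using tangle_eq.trans tangle_eq.sym by blast
qed

lemma carrier_free: "carrier (box_space (free_ospa deg) \<sigma>) = finsupp (vertex_tangles deg \<sigma>)"
  by (simp add: free_ospa_def finsupp_def)

lemma module_free:
  "module scalars (box_space (free_ospa deg) \<sigma> :: ('k::field, 'g diagram set \<Rightarrow> 'k) module)"
proof (rule moduleI)
  show "abelian_group (box_space (free_ospa deg) \<sigma> :: ('k::field, 'g diagram set \<Rightarrow> 'k) module)"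
  proof (rule abelian_groupI)
    fix x :: "'g diagram set \<Rightarrow> 'k" assume "x \<in> carrier (box_space (free_ospa deg) \<sigma>)"
    then have "(\<lambda>c. (-1) * x c + 0) \<in> carrier (box_space (free_ospa deg) \<sigma>)"
      unfolding carrier_free by (intro finsupp_lincomb) auto
    then show "\<exists>y\<in>carrier (box_space (free_ospa deg) \<sigma>).
        y \<oplus>\<^bsub>box_space (free_ospa deg) \<sigma>\<^esub> x = \<zero>\<^bsub>box_space (free_ospa deg) \<sigma>\<^esub>"
      by (intro bexI[of _ "\<lambda>c. (-1) * x c + 0"]) (auto simp: free_ospa_def)
  next
    fix x y :: "'g diagram set \<Rightarrow> 'k"
    assume "x \<in> carrier (box_space (free_ospa deg) \<sigma>)" "y \<in> carrier (box_space (free_ospa deg) \<sigma>)"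
    then show "x \<oplus>\<^bsub>box_space (free_ospa deg) \<sigma>\<^esub> y \<in> carrier (box_space (free_ospa deg) \<sigma>)"
      using finsupp_lincomb[of x _ y 1] unfolding carrier_free by (simp add: free_ospa_def)
  next
    show "\<zero>\<^bsub>box_space (free_ospa deg) \<sigma>\<^esub> \<in>
        carrier (box_space (free_ospa deg) \<sigma> :: ('k, 'g diagram set \<Rightarrow> 'k) module)"
      unfolding carrier_free using finsupp_zero by (simp add: free_ospa_def)
  qed (auto simp: free_ospa_def algebra_simps)
next
  fix a :: 'k and x :: "'g diagram set \<Rightarrow> 'k"
  assume "x \<in> carrier (box_space (free_ospa deg) \<sigma>)"
  then show "smult (box_space (free_ospa deg) \<sigma>) a x \<in> carrier (box_space (free_ospa deg) \<sigma>)"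
    using finsupp_lincomb[of x _ "\<lambda>_. 0" a] unfolding carrier_free by (simp add: free_ospa_def)
qed (auto simp: cring_scalars free_ospa_def algebra_simps)

text \<open>Letting the sum run over any finite sets that contain the supports puts the values at
  different inputs over one index set, so that linearity can be compared term by term.\<close>

lemma act_free_superset:
  assumes "\<And>l. l \<in> labels T \<Longrightarrow> finite (A l)" "\<And>l. l \<in> labels T \<Longrightarrow> support (v l) \<subseteq> A l"
  shows "act (free_ospa deg) T v c =
    (\<Sum>d\<in>PiE (labels T) A. if insert_classes T d = c then \<Prod>l\<in>labels T. v l (d l) else 0)"
proof -
  have "finite (PiE (labels T) A)" using assms by (auto intro: finite_PiE)
  moreover have "PiE (labels T) (\<lambda>l. support (v l)) \<subseteq> PiE (labels T) A"
    using assms by (intro PiE_mono) auto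
  moreover have "(\<Prod>l\<in>labels T. v l (d l)) = 0" if "d \<in> PiE (labels T) A - PiE (labels T) (\<lambda>l. support (v l))" for d
  proof -
    have "\<exists>l\<in>labels T. d l \<notin> support (v l)"
      using that unfolding Diff_iff PiE_iff by blast
    then obtain l where "l \<in> labels T" "v l (d l) = 0"
      unfolding support_def by blast
    then show ?thesis by (meson List.finite_set finite_imageI prod_zero)
  qed
  ultimately have "(\<Sum>d\<in>PiE (labels T) A. if insert_classes T d = c then \<Prod>l\<in>labels T. v l (d l) else 0) =
    (\<Sum>d\<in>PiE (labels T) (\<lambda>l. support (v l)). if insert_classes T d = c then \<Prod>l\<in>labels T. v l (d l) else 0)"
    by (intro sum.mono_neutral_right) auto
  also have "\<dots> = act (free_ospa deg) T v c"
    using finite_subset[OF \<open>PiE (labels T) (\<lambda>l. support (v l)) \<subseteq> _\<close> \<open>finite (PiE (labels T) A)\<close>]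
    unfolding free_ospa_def ospa_data.simps by (rule sum.inter_filter[symmetric])
  finally show ?thesis ..
qed

lemma inputs_free:
  "inputs (free_ospa deg) T v \<longleftrightarrow> (\<forall>(l, \<tau>)\<in>set (discs T). v l \<in> finsupp (vertex_tangles deg \<tau>))"
  by (simp add: inputs_def carrier_free)

lemma act_free_cong:
  assumes "\<And>l. l \<in> labels T \<Longrightarrow> v l = w l"
  shows "act (free_ospa deg) T v = act (free_ospa deg) T w"
proof -
  have "PiE (labels T) (\<lambda>l. support (v l)) = PiE (labels T) (\<lambda>l. support (w l))"
    using assms by (intro PiE_cong) auto
  moreover have "(\<Prod>l\<in>labels T. v l (d l)) = (\<Prod>l\<in>labels T. w l (d l))" for d
    using assms by (intro prod.cong) auto
  ultimately show ?thesis by (simp add: free_ospa_def)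
qed

lemma act_free_linear:
  assumes v: "\<And>j. j \<in> labels T \<Longrightarrow> j \<noteq> l \<Longrightarrow> finite (support (v j))" and l: "l \<in> labels T"
    and "finite (support x)" "finite (support y)"
  shows "act (free_ospa deg) T (v(l := \<lambda>c. a * x c + y c)) c =
    a * act (free_ospa deg) T (v(l := x)) c + act (free_ospa deg) T (v(l := y)) c"
proof -
  define A where "A j = (if j = l then support x \<union> support y else support (v j))" for j
  have fin: "finite (A j)" if "j \<in> labels T" for j
    using that v assms unfolding A_def inputs_free finsupp_def by auto
  have *: "act (free_ospa deg) T (v(l := z)) c =
      (\<Sum>d\<in>PiE (labels T) A. if insert_classes T d = c then z (d l) * (\<Prod>j\<in>labels T - {l}. v j (d j)) else 0)"
    if "support z \<subseteq> support x \<union> support y" for z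
  proof -
    have eq: "(\<Prod>j\<in>labels T. (v(l := z)) j (d j)) = z (d l) * (\<Prod>j\<in>labels T - {l}. v j (d j))" for d
      using l by (subst prod.remove[of _ l]) (auto intro!: prod.cong)
    show ?thesis
      unfolding eq[symmetric] using that fin by (intro act_free_superset) (auto simp: A_def)
  qed
  show ?thesis
    by (subst (1 2 3) *)
      (auto simp: support_def sum_distrib_left sum.distrib[symmetric] algebra_simps intro!: sum.cong)
qed

text \<open>On basis vectors the action is substitution of diagrams: exactly one family of classes
  contributes, with coefficient 1.\<close>

lemma act_free_basis:
  assumes "wf_diagram T" "fits_vertices deg T s" "\<And>l. l \<in> labels T \<Longrightarrow> v l = single (tangle_class (s l))"
  shows "act (free_ospa deg) T v = single (tangle_class (fill (\<lambda>l _. s l) T))"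
proof
  fix c
  let ?k = "\<lambda>l. tangle_class (s l)"
  have PiE: "PiE L (\<lambda>l. {k l}) = {restrict k L}" for L :: "nat set" and k :: "nat \<Rightarrow> 'a diagram set"
    by (auto simp: PiE_iff extensional_def fun_eq_iff split: if_splits)
  have "insert_classes T (restrict ?k (labels T)) = insert_classes T ?k"
    by (rule insert_classes_cong) simp
  then have ins: "insert_classes T (restrict ?k (labels T)) = tangle_class (fill (\<lambda>l _. s l) T)"
    using insert_classes_fill[OF assms(1,2)] by simp
  have one: "(\<Prod>l\<in>labels T. v l (restrict ?k (labels T) l)) = 1"
    by (intro prod.neutral ballI) (simp only: assms(3) restrict_apply' single_def, simp)
  have "act (free_ospa deg) T v c = (\<Sum>d\<in>PiE (labels T) (\<lambda>l. {?k l}).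
      if insert_classes T d = c then \<Prod>l\<in>labels T. v l (d l) else 0)"
    by (rule act_free_superset) (simp_all only: assms(3) support_single, simp_all)
  also have "\<dots> = (if insert_classes T (restrict ?k (labels T)) = c
      then \<Prod>l\<in>labels T. v l (restrict ?k (labels T) l) else 0)"
    unfolding PiE by simp
  also have "\<dots> = single (tangle_class (fill (\<lambda>l _. s l) T)) c"
    unfolding ins one single_def by auto
  finally show "act (free_ospa deg) T v c = single (tangle_class (fill (\<lambda>l _. s l) T)) c" .
qed

lemma act_free_closed:
  assumes T: "tangle \<sigma> T" and v: "inputs (free_ospa deg) T v"
  shows "act (free_ospa deg) T v \<in> finsupp (vertex_tangles deg \<sigma>)"
proof -
  let ?P = "PiE (labels T) (\<lambda>l. support (v l))"
  have "finite ?P" using v by (auto simp: inputs_free finsupp_def intro!: finite_PiE)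
  moreover have "support (act (free_ospa deg) T v) \<subseteq> insert_classes T ` ?P"
  proof
    fix c assume "c \<in> support (act (free_ospa deg) T v)"
    then have "{d. d \<in> ?P \<and> insert_classes T d = c} \<noteq> {}"
      unfolding support_def free_ospa_def by (auto simp del: Collect_empty_eq)
    then show "c \<in> insert_classes T ` ?P" by blast
  qed
  moreover have "insert_classes T d \<in> vertex_tangles deg \<sigma>" if d: "d \<in> ?P" for d
  proof -
    have "\<exists>s. \<forall>(l, \<tau>)\<in>set (discs T). s l \<in> vertex_diagrams deg \<tau> \<and> d l = tangle_class (s l)"
    proof (intro exI ballI, clarify)
      fix l \<tau> assume l: "(l, \<tau>) \<in> set (discs T)"
      then have "d l \<in> vertex_tangles deg \<tau>"
        using d v by (force simp: inputs_free finsupp_def PiE_def Pi_def)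
      then obtain t where t: "t \<in> vertex_diagrams deg \<tau>" "d l = tangle_class t"
        by (auto simp: vertex_tangles_eq)
      then have "t \<in> d l" by (simp add: tangle_class_def vertex_diagrams_def tangle_eq.refl)
      then have "(SOME t. t \<in> d l) \<in> d l" by (rule someI)
      with t have "t \<approx>\<^sub>t (SOME t. t \<in> d l)" by (simp add: tangle_class_def)
      with t show "(SOME t. t \<in> d l) \<in> vertex_diagrams deg \<tau> \<and> d l = tangle_class (SOME t. t \<in> d l)"
        using vertex_diagrams_tangle_eq tangle_class_eq by metis
    qed
    then obtain s where s: "fits_vertices deg T s" "\<forall>l\<in>labels T. d l = tangle_class (s l)"
      unfolding fits_vertices_def by fastforce
    have "insert_classes T d = insert_classes T (\<lambda>l. tangle_class (s l))"
      using s(2) by (intro insert_classes_cong) blast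
    also have "\<dots> = tangle_class (fill (\<lambda>l _. s l) T)"
      using insert_classes_fill[of T deg s] s(1) T by (simp add: tangle_def)
    finally have "insert_classes T d = tangle_class (fill (\<lambda>l _. s l) T)" .
    with s fill_vertices[of T deg s] T show ?thesis
      by (auto simp: vertex_tangles_eq tangle_def)
  qed
  ultimately show ?thesis
    unfolding finsupp_def by (auto intro: finite_subset)
qed

text \<open>Multilinear expressions that agree on diagrams agree. This reduces the operad laws of
  the free planar algebra, and later the compatibility with evaluation, to statements about
  \<open>fill\<close>.\<close>

lemma free_eqI:
  fixes F G :: "(nat \<Rightarrow> 'g diagram set \<Rightarrow> 'k::field) \<Rightarrow> 'k"
  assumes T: "distinct (map fst (discs T))"
    and F: "\<And>v l \<tau> a x y. inputs (free_ospa deg) T v \<Longrightarrow> (l, \<tau>) \<in> set (discs T) \<Longrightarrow>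
      x \<in> finsupp (vertex_tangles deg \<tau>) \<Longrightarrow> y \<in> finsupp (vertex_tangles deg \<tau>) \<Longrightarrow>
      F (v(l := \<lambda>c. a * x c + y c)) = a * F (v(l := x)) + F (v(l := y))"
    and G: "\<And>v l \<tau> a x y. inputs (free_ospa deg) T v \<Longrightarrow> (l, \<tau>) \<in> set (discs T) \<Longrightarrow>
      x \<in> finsupp (vertex_tangles deg \<tau>) \<Longrightarrow> y \<in> finsupp (vertex_tangles deg \<tau>) \<Longrightarrow>
      G (v(l := \<lambda>c. a * x c + y c)) = a * G (v(l := x)) + G (v(l := y))"
    and basis: "\<And>v s. fits_vertices deg T s \<Longrightarrow>
      (\<And>l. l \<in> labels T \<Longrightarrow> v l = single (tangle_class (s l))) \<Longrightarrow> F v = G v"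
    and v: "inputs (free_ospa deg) T v"
  shows "F v = G v"
proof -
  define B where "B l = vertex_tangles deg (the (map_of (discs T) l))" for l
  have B: "B l = vertex_tangles deg \<tau>" if "(l, \<tau>) \<in> set (discs T)" for l \<tau>
    using that T by (simp add: B_def)
  have inp: "inputs (free_ospa deg) T w \<longleftrightarrow> (\<forall>l\<in>labels T. w l \<in> finsupp (B l))"
    for w :: "nat \<Rightarrow> 'g diagram set \<Rightarrow> 'k"
    unfolding inputs_free using B by fastforce
  have "F v - G v = 0"
  proof (rule multilinear_zero[where L = "labels T" and B = B and D = "\<lambda>v. F v - G v"])
    fix w :: "nat \<Rightarrow> 'g diagram set \<Rightarrow> 'k" and l a and x y :: "'g diagram set \<Rightarrow> 'k"
    assume w: "\<And>j. j \<in> labels T \<Longrightarrow> w j \<in> finsupp (B j)" and l: "l \<in> labels T"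
      and xy: "x \<in> finsupp (B l)" "y \<in> finsupp (B l)"
    from l obtain \<tau> where \<tau>: "(l, \<tau>) \<in> set (discs T)" by auto
    have "inputs (free_ospa deg) T w" using w inp by blast
    from F[OF this \<tau>, of x y a] G[OF this \<tau>, of x y a] xy
    show "F (w(l := \<lambda>c. a * x c + y c)) - G (w(l := \<lambda>c. a * x c + y c)) =
      a * (F (w(l := x)) - G (w(l := x))) + (F (w(l := y)) - G (w(l := y)))"
      by (simp add: B[OF \<tau>] algebra_simps)
  next
    fix w :: "nat \<Rightarrow> 'g diagram set \<Rightarrow> 'k"
    assume w: "\<And>j. j \<in> labels T \<Longrightarrow> \<exists>b\<in>B j. w j = single b"
    have "\<forall>j\<in>labels T. \<exists>t. t \<in> vertex_diagrams deg (the (map_of (discs T) j)) \<and> w j = single (tangle_class t)"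
      using w unfolding B_def vertex_tangles_eq by blast
    then obtain s where s: "\<And>j. j \<in> labels T \<Longrightarrow>
        s j \<in> vertex_diagrams deg (the (map_of (discs T) j)) \<and> w j = single (tangle_class (s j))"
      by metis
    have "fits_vertices deg T s"
      unfolding fits_vertices_def using s T by force
    then have "F w = G w" using s by (intro basis) auto
    then show "F w - G w = 0" by simp
  qed (use v inp in auto)
  then show ?thesis by simp
qed

lemma act_free_zero:
  assumes "\<And>j. j \<in> labels T \<Longrightarrow> j \<noteq> l \<Longrightarrow> finite (support (v j))" "l \<in> labels T"
  shows "act (free_ospa deg) T (v(l := \<lambda>_. 0)) = (\<lambda>_. 0)"
  using act_free_linear[of T l v "\<lambda>_. 0" "\<lambda>_. 0" deg "-1"] assms by (auto simp: support_def fun_eq_iff)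

lemma inputs_free_finite: "inputs (free_ospa deg) T v \<Longrightarrow> j \<in> labels T \<Longrightarrow> finite (support (v j))"
  by (auto simp: inputs_free finsupp_def)

lemma inputs_free_upd:
  "inputs (free_ospa deg) T v \<Longrightarrow> distinct (map fst (discs T)) \<Longrightarrow> (l, \<tau>) \<in> set (discs T) \<Longrightarrow>
   x \<in> finsupp (vertex_tangles deg \<tau>) \<Longrightarrow> inputs (free_ospa deg) T (v(l := x))"
  unfolding inputs_free by (auto dest: eq_key_imp_eq_value)

lemma free_box_simps:
  "x \<oplus>\<^bsub>box_space (free_ospa deg) \<sigma>\<^esub> y = (\<lambda>c. x c + y c)"
  "smult (box_space (free_ospa deg) \<sigma>) a x = (\<lambda>c. a * x c)"
  "\<zero>\<^bsub>box_space (free_ospa deg) \<sigma>\<^esub> = (\<lambda>_. 0)"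
  by (simp_all add: free_ospa_def)

lemma act_free_multilinear:
  assumes "tangle \<sigma> T" "inputs (free_ospa deg) T v" "(l, \<tau>) \<in> set (discs T)"
  shows "linear_map (box_space (free_ospa deg) \<tau>) (box_space (free_ospa deg) \<sigma>)
    (\<lambda>x. act (free_ospa deg) T (v(l := x)) :: 'g diagram set \<Rightarrow> 'k::field)"
proof -
  have l: "l \<in> labels T" using assms(3) by force
  note fin = inputs_free_finite[OF assms(2)]
  have lin: "act (free_ospa deg) T (v(l := \<lambda>c. a * x c + y c)) c =
      a * act (free_ospa deg) T (v(l := x)) c + act (free_ospa deg) T (v(l := y)) c"
    if "x \<in> finsupp (vertex_tangles deg \<tau>)" "y \<in> finsupp (vertex_tangles deg \<tau>)"
    for a c and x y :: "'g diagram set \<Rightarrow> 'k"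
    using that fin l by (intro act_free_linear) (auto simp: finsupp_def)
  have zero: "act (free_ospa deg) T (v(l := \<lambda>_. 0)) = (\<lambda>_. 0)"
    using fin l by (intro act_free_zero)
  have "act (free_ospa deg) T (v(l := x)) \<in> finsupp (vertex_tangles deg \<sigma>)"
    if "x \<in> finsupp (vertex_tangles deg \<tau>)" for x
    using that assms by (intro act_free_closed inputs_free_upd) (auto simp: tangle_def)
  with lin[where a = 1] lin[where y = "\<lambda>_. 0"] zero show ?thesis
    unfolding linear_map_def carrier_free free_box_simps by (auto simp: fun_eq_iff)
qed

lemma act_free_insert:
  assumes T: "tangle \<sigma> T" "(l, \<tau>) \<in> set (discs T)" and S: "tangle \<tau> S"
    and disj: "(labels T - {l}) \<inter> labels S = {}"
    and v: "inputs (free_ospa deg) (insert_tangle l S T) v"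
  shows "act (free_ospa deg) (insert_tangle l S T) v =
    (act (free_ospa deg) T (v(l := act (free_ospa deg) S v)) :: 'g diagram set \<Rightarrow> 'k::field)"
proof
  fix c
  let ?T = "insert_tangle l S T"
  have T': "tangle \<sigma> ?T" using tangle_insert_tangle[OF T S disj] .
  note D = discs_insert_tangle[OF T(2), of S]
  have l: "l \<in> labels T" using T(2) by force
  have inS: "inputs (free_ospa deg) S w" if "inputs (free_ospa deg) ?T w" for w :: "nat \<Rightarrow> 'g diagram set \<Rightarrow> 'k"
    using that unfolding inputs_free D by blast
  have finT: "finite (support (w j))" if "inputs (free_ospa deg) ?T w" "j \<in> labels T" "j \<noteq> l"
    for w :: "nat \<Rightarrow> 'g diagram set \<Rightarrow> 'k" and j
    using inputs_free_finite[OF that(1)] that(2,3) by (simp add: labels_insert_tangle)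
  have finS: "finite (support (act (free_ospa deg) S w))" if "inputs (free_ospa deg) ?T w"
    for w :: "nat \<Rightarrow> 'g diagram set \<Rightarrow> 'k"
    using act_free_closed[OF S inS[OF that]] by (simp add: finsupp_def)
  have dT: "distinct (map fst (discs ?T))" using T' by (simp add: tangle_def)
  show "act (free_ospa deg) ?T v c = act (free_ospa deg) T (v(l := act (free_ospa deg) S v)) c"
  proof (rule free_eqI[OF dT, where F = "\<lambda>v. act (free_ospa deg) ?T v c" and
        G = "\<lambda>v. act (free_ospa deg) T (v(l := act (free_ospa deg) S v)) c" and deg = deg])
    fix w :: "nat \<Rightarrow> 'g diagram set \<Rightarrow> 'k" and j \<rho> a and x y :: "'g diagram set \<Rightarrow> 'k"
    assume w: "inputs (free_ospa deg) ?T w" and j: "(j, \<rho>) \<in> set (discs ?T)"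
      and xy: "x \<in> finsupp (vertex_tangles deg \<rho>)" "y \<in> finsupp (vertex_tangles deg \<rho>)"
    have fxy: "finite (support x)" "finite (support y)" using xy by (auto simp: finsupp_def)
    have jl: "j \<in> labels ?T" using j by force
    show "act (free_ospa deg) ?T (w(j := \<lambda>c. a * x c + y c)) c =
        a * act (free_ospa deg) ?T (w(j := x)) c + act (free_ospa deg) ?T (w(j := y)) c"
      using inputs_free_finite[OF w] jl fxy by (intro act_free_linear)
    let ?G = "\<lambda>z. act (free_ospa deg) T ((w(j := z))(l := act (free_ospa deg) S (w(j := z)))) c"
    \<comment> \<open>An input of \<open>S\<close> enters \<open>T\<close> only through the slot
      \<open>l\<close>; any other input belongs to \<open>T\<close> alone. The label
      \<open>l\<close> itself may be used again in \<open>S\<close>, which is why it is excluded in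
      the second case.\<close>
    consider "j \<in> labels S" | "j \<in> labels T" "j \<noteq> l" "j \<notin> labels S"
      using jl disj l unfolding labels_insert_tangle by auto
    then show "?G (\<lambda>c. a * x c + y c) = a * ?G x + ?G y"
    proof cases
      case 1
      have eq: "act (free_ospa deg) T ((w(j := z))(l := u)) = act (free_ospa deg) T (w(l := u))" for z u
        using 1 disj by (intro act_free_cong) auto
      have S: "act (free_ospa deg) S (w(j := \<lambda>c. a * x c + y c)) =
          (\<lambda>c. a * act (free_ospa deg) S (w(j := x)) c + act (free_ospa deg) S (w(j := y)) c)"
        using inputs_free_finite[OF inS[OF w]] 1 fxy by (intro ext act_free_linear)
      obtain \<rho>' where \<rho>': "(j, \<rho>') \<in> set (discs S)" using 1 by auto
      then have "(j, \<rho>') \<in> set (discs ?T)" by (simp add: D)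
      with j have "\<rho>' = \<rho>" using dT eq_key_imp_eq_value by fast
      then have "inputs (free_ospa deg) ?T (w(j := x))" "inputs (free_ospa deg) ?T (w(j := y))"
        using w j xy dT by (auto intro: inputs_free_upd)
      then show ?thesis
        unfolding eq S using finT[OF w] l finS by (intro act_free_linear) auto
    next
      case 2
      have eq: "act (free_ospa deg) S (w(j := z)) = act (free_ospa deg) S w" for z
        using 2(3) by (intro act_free_cong) (metis fun_upd_other)
      have "act (free_ospa deg) T ((w(l := act (free_ospa deg) S w))(j := \<lambda>c. a * x c + y c)) c =
          a * act (free_ospa deg) T ((w(l := act (free_ospa deg) S w))(j := x)) c +
          act (free_ospa deg) T ((w(l := act (free_ospa deg) S w))(j := y)) c"
        using finT[OF w] finS[OF w] 2 fxy by (intro act_free_linear) auto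
      then show ?thesis unfolding eq fun_upd_twist[OF 2(2)] .
    qed
  next
    fix w :: "nat \<Rightarrow> 'g diagram set \<Rightarrow> 'k" and s
    assume s: "fits_vertices deg ?T s" and w: "\<And>j. j \<in> labels ?T \<Longrightarrow> w j = single (tangle_class (s j))"
    define s' where "s' = s(l := fill (\<lambda>i _. s i) S)"
    have sS: "fits_vertices deg S s"
      using s unfolding fits_vertices_def D by blast
    have w': "w j = single (tangle_class (s j))" if "j \<in> labels S" for j
      using that w l by (simp add: labels_insert_tangle)
    have 1: "act (free_ospa deg) S w = single (tangle_class (fill (\<lambda>i _. s i) S))"
      using S sS w' by (intro act_free_basis) (auto simp: tangle_def)
    have \<tau>: "\<rho> = \<tau>" if "(l, \<rho>) \<in> set (discs T)" for \<rho>
      using that T by (metis eq_key_imp_eq_value tangle_def)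
    have "fits_vertices deg T s'"
      using s fill_vertices[OF _ _ sS] S \<tau> unfolding fits_vertices_def D ball_Un
      by (auto simp: s'_def tangle_def)
    moreover have "(w(l := act (free_ospa deg) S w)) j = single (tangle_class (s' j))" if "j \<in> labels T" for j
      using that w[of j] 1 by (simp add: s'_def labels_insert_tangle)
    ultimately have "act (free_ospa deg) T (w(l := act (free_ospa deg) S w)) =
        single (tangle_class (fill (\<lambda>i _. s' i) T))"
      using T by (intro act_free_basis) (auto simp: tangle_def)
    also have "fill (\<lambda>i _. s' i) T = fill (\<lambda>i _. s i) ?T"
      unfolding insert_tangle_def fill_fill by (rule fill_cong_eq) (simp add: s'_def)
    also have "single (tangle_class (fill (\<lambda>i _. s i) ?T)) = act (free_ospa deg) ?T w"
      using T' s w by (intro act_free_basis[symmetric]) (auto simp: tangle_def)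
    finally show "act (free_ospa deg) ?T w c = act (free_ospa deg) T (w(l := act (free_ospa deg) S w)) c"
      by (simp only:)
  qed (use v in auto)
qed

text \<open>On basis inputs invariance under equality of tangles becomes
  \<open>fill_tangle_eq\<close>, and relabelling becomes \<open>fill_map\<close>.\<close>

theorem ospa_free: "ospa (free_ospa deg :: ('k::field, 'g diagram set \<Rightarrow> 'k) ospa_data)"
proof (rule ospa.intro)
  fix \<sigma> T and v :: "nat \<Rightarrow> 'g diagram set \<Rightarrow> 'k" and T'
  assume T: "tangle \<sigma> T" and eq: "T \<approx>\<^sub>t T'" and v: "inputs (free_ospa deg) T v"
  have T': "tangle \<sigma> T'" "set (discs T') = set (discs T)" using tangle_tangle_eq[OF T eq] by auto
  show "act (free_ospa deg) T v = act (free_ospa deg) T' v"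
  proof
    fix c
    have "distinct (map fst (discs T))" using T by (simp add: tangle_def)
    then show "act (free_ospa deg) T v c = act (free_ospa deg) T' v c"
    proof (rule free_eqI[where F = "\<lambda>v. act (free_ospa deg) T v c" and
        G = "\<lambda>v. act (free_ospa deg) T' v c" and deg = deg])
      fix w :: "nat \<Rightarrow> 'g diagram set \<Rightarrow> 'k" and s
      assume s: "fits_vertices deg T s" and w: "\<And>j. j \<in> labels T \<Longrightarrow> w j = single (tangle_class (s j))"
      have s': "fits_vertices deg T' s" using s T' by (simp add: fits_vertices_def)
      have "act (free_ospa deg) T w = single (tangle_class (fill (\<lambda>l _. s l) T))"
        using T s w by (intro act_free_basis) (auto simp: tangle_def)
      also have "tangle_class (fill (\<lambda>l _. s l) T) = tangle_class (fill (\<lambda>l _. s l) T')"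
        using fill_tangle_eq[OF eq fits_verticesD[OF s]] by (rule tangle_class_eq)
      also have "single \<dots> = act (free_ospa deg) T' w"
        using T' s' w by (intro act_free_basis[symmetric]) (auto simp: tangle_def)
      finally show "act (free_ospa deg) T w c = act (free_ospa deg) T' w c" by simp
    next
      fix w :: "nat \<Rightarrow> 'g diagram set \<Rightarrow> 'k" and j \<rho> a and x y :: "'g diagram set \<Rightarrow> 'k"
      assume w: "inputs (free_ospa deg) T w" and j: "(j, \<rho>) \<in> set (discs T)"
        and xy: "x \<in> finsupp (vertex_tangles deg \<rho>)" "y \<in> finsupp (vertex_tangles deg \<rho>)"
      have j': "j \<in> labels T" using j by force
      show "act (free_ospa deg) T (w(j := \<lambda>c. a * x c + y c)) c =
          a * act (free_ospa deg) T (w(j := x)) c + act (free_ospa deg) T (w(j := y)) c"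
        using inputs_free_finite[OF w] j' xy by (intro act_free_linear) (auto simp: finsupp_def)
      show "act (free_ospa deg) T' (w(j := \<lambda>c. a * x c + y c)) c =
          a * act (free_ospa deg) T' (w(j := x)) c + act (free_ospa deg) T' (w(j := y)) c"
        using inputs_free_finite[OF w] j' xy T'(2) by (intro act_free_linear) (auto simp: finsupp_def)
    qed (use v in auto)
  qed
next
  fix \<sigma> T and v :: "nat \<Rightarrow> 'g diagram set \<Rightarrow> 'k" and \<pi>
  assume T: "tangle \<sigma> T" and \<pi>: "inj_on \<pi> (labels T)" and v: "inputs (free_ospa deg) (map_diagram \<pi> T) v"
  have T': "tangle \<sigma> (map_diagram \<pi> T)" using tangle_map[OF T \<pi>] .
  have lab: "labels (map_diagram \<pi> T) = \<pi> ` labels T" by (simp add: image_image)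
  show "act (free_ospa deg) (map_diagram \<pi> T) v = act (free_ospa deg) T (v \<circ> \<pi>)"
  proof
    fix c
    have "distinct (map fst (discs (map_diagram \<pi> T)))" using T' by (simp only: tangle_def)
    then show "act (free_ospa deg) (map_diagram \<pi> T) v c = act (free_ospa deg) T (v \<circ> \<pi>) c"
    proof (rule free_eqI[where F = "\<lambda>v. act (free_ospa deg) (map_diagram \<pi> T) v c" and
        G = "\<lambda>v. act (free_ospa deg) T (v \<circ> \<pi>) c" and deg = deg])
      fix w :: "nat \<Rightarrow> 'g diagram set \<Rightarrow> 'k" and s
      assume s: "fits_vertices deg (map_diagram \<pi> T) s"
        and w: "\<And>j. j \<in> labels (map_diagram \<pi> T) \<Longrightarrow> w j = single (tangle_class (s j))"
      have s': "fits_vertices deg T (\<lambda>l. s (\<pi> l))" using s by (auto simp: fits_vertices_def)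
      have "act (free_ospa deg) (map_diagram \<pi> T) w = single (tangle_class (fill (\<lambda>l _. s l) (map_diagram \<pi> T)))"
        using T' s w by (intro act_free_basis) (auto simp: tangle_def)
      also have "fill (\<lambda>l _. s l) (map_diagram \<pi> T) = fill (\<lambda>l _. s (\<pi> l)) T"
        by (simp add: fill_map)
      also have "single (tangle_class \<dots>) = act (free_ospa deg) T (w \<circ> \<pi>)"
        using T s' w by (intro act_free_basis[symmetric]) (auto simp: tangle_def lab simp del: map_diagram_simps)
      finally show "act (free_ospa deg) (map_diagram \<pi> T) w c = act (free_ospa deg) T (w \<circ> \<pi>) c" by simp
    next
      fix w :: "nat \<Rightarrow> 'g diagram set \<Rightarrow> 'k" and j \<rho> a and x y :: "'g diagram set \<Rightarrow> 'k"
      assume w: "inputs (free_ospa deg) (map_diagram \<pi> T) w" and j: "(j, \<rho>) \<in> set (discs (map_diagram \<pi> T))"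
        and xy: "x \<in> finsupp (vertex_tangles deg \<rho>)" "y \<in> finsupp (vertex_tangles deg \<rho>)"
      have j': "j \<in> labels (map_diagram \<pi> T)" using j by (rule image_eqI[rotated]) simp
      show "act (free_ospa deg) (map_diagram \<pi> T) (w(j := \<lambda>c. a * x c + y c)) c =
          a * act (free_ospa deg) (map_diagram \<pi> T) (w(j := x)) c + act (free_ospa deg) (map_diagram \<pi> T) (w(j := y)) c"
        using inputs_free_finite[OF w] j' xy by (intro act_free_linear) (auto simp: finsupp_def)
      obtain i where i: "i \<in> labels T" "j = \<pi> i" using j' lab by auto
      have upd: "act (free_ospa deg) T (w(j := z) \<circ> \<pi>) = act (free_ospa deg) T ((w \<circ> \<pi>)(i := z))" for z
        using i \<pi> by (intro act_free_cong) (auto dest: inj_onD)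
      have "finite (support ((w \<circ> \<pi>) k))" if "k \<in> labels T" for k
        using inputs_free_finite[OF w] that lab by auto
      then show "act (free_ospa deg) T (w(j := \<lambda>c. a * x c + y c) \<circ> \<pi>) c =
          a * act (free_ospa deg) T (w(j := x) \<circ> \<pi>) c + act (free_ospa deg) T (w(j := y) \<circ> \<pi>) c"
        unfolding upd using i xy by (intro act_free_linear) (auto simp: finsupp_def)
    qed (use v in auto)
  qed
next
  fix x :: "'g diagram set \<Rightarrow> 'k" and \<sigma> l
  assume "x \<in> carrier (box_space (free_ospa deg) \<sigma>)"
  then have x: "x \<in> finsupp (vertex_tangles deg \<sigma>)" by (simp add: carrier_free)
  show "act (free_ospa deg) (Disc l \<sigma>) (\<lambda>_. x) = x"
  proof
    fix c
    have d: "distinct (map fst (discs (Disc l \<sigma>)))" by simp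
    have "act (free_ospa deg) (Disc l \<sigma>) (\<lambda>_. x) c = (\<lambda>_. x) l c"
    proof (rule free_eqI[OF d, where F = "\<lambda>v. act (free_ospa deg) (Disc l \<sigma>) v c" and
        G = "\<lambda>v. v l c" and deg = deg])
      fix w :: "nat \<Rightarrow> 'g diagram set \<Rightarrow> 'k" and s
      assume s: "fits_vertices deg (Disc l \<sigma>) s"
        and w: "\<And>j. j \<in> labels (Disc l \<sigma>) \<Longrightarrow> w j = single (tangle_class (s j))"
      have "act (free_ospa deg) (Disc l \<sigma>) w = single (tangle_class (fill (\<lambda>l _. s l) (Disc l \<sigma>)))"
        using s w by (intro act_free_basis) auto
      then show "act (free_ospa deg) (Disc l \<sigma>) w c = w l c"
        using w by simp
    next
      fix w :: "nat \<Rightarrow> 'g diagram set \<Rightarrow> 'k" and j \<rho> a and x y :: "'g diagram set \<Rightarrow> 'k"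
      assume w: "inputs (free_ospa deg) (Disc l \<sigma>) w" and j: "(j, \<rho>) \<in> set (discs (Disc l \<sigma>))"
        and xy: "x \<in> finsupp (vertex_tangles deg \<rho>)" "y \<in> finsupp (vertex_tangles deg \<rho>)"
      show "act (free_ospa deg) (Disc l \<sigma>) (w(j := \<lambda>c. a * x c + y c)) c =
          a * act (free_ospa deg) (Disc l \<sigma>) (w(j := x)) c + act (free_ospa deg) (Disc l \<sigma>) (w(j := y)) c"
        using inputs_free_finite[OF w] j xy by (intro act_free_linear) (auto simp: finsupp_def)
      show "(w(j := \<lambda>c. a * x c + y c)) l c = a * (w(j := x)) l c + (w(j := y)) l c"
        using j by simp
    qed (use x in \<open>auto simp: inputs_free\<close>)
    then show "act (free_ospa deg) (Disc l \<sigma>) (\<lambda>_. x) c = x c" .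
  qed
next
  fix \<sigma> T and v w :: "nat \<Rightarrow> 'g diagram set \<Rightarrow> 'k"
  assume "\<And>l. l \<in> labels T \<Longrightarrow> v l = w l"
  then show "act (free_ospa deg) T v = act (free_ospa deg) T w" by (rule act_free_cong)
qed (simp_all only: module_free act_free_closed carrier_free act_free_multilinear act_free_insert)

section \<open>Quotients by planar ideals\<close>

locale planar_quotient = ospa P for P :: "('k::field, 'v) ospa_data" +
  fixes I :: "sign list \<Rightarrow> 'v set"
  assumes ideal: "planar_ideal P I"
begin

abbreviation M :: "sign list \<Rightarrow> ('k, 'v) module" where "M \<equiv> box_space P"
abbreviation coset :: "sign list \<Rightarrow> 'v \<Rightarrow> 'v set" where "coset \<sigma> x \<equiv> I \<sigma> +>\<^bsub>M \<sigma>\<^esub> x"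
abbreviation Q :: "('k, 'v set) ospa_data" where "Q \<equiv> quotient_ospa P I"
text \<open>The choice of representative made in \<open>quotient_ospa\<close>;
  \<open>act_Q_coset\<close> shows that the action does not depend on it.\<close>

definition rep :: "'v set \<Rightarrow> 'v" where "rep X = (SOME x. x \<in> X)"

lemma submod: "submodule (I \<sigma>) scalars (M \<sigma>)"
  using ideal by (simp add: planar_ideal_def)

lemma abelian_group_M: "abelian_group (M \<sigma>)"
  using vector_space module.axioms(2) by blast

lemma abelian_subgroup_I: "abelian_subgroup (I \<sigma>) (M \<sigma>)"
  using submodule.axioms(1)[OF submod] abelian_group_M
  by (intro abelian_subgroupI3 additive_subgroup.intro)

lemma I_sub: "x \<in> I \<sigma> \<Longrightarrow> x \<in> carrier (M \<sigma>)"
  using additive_subgroup.a_subset[OF abelian_subgroup.axioms(1)[OF abelian_subgroup_I]] by auto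

lemma I_add: "x \<in> I \<sigma> \<Longrightarrow> y \<in> I \<sigma> \<Longrightarrow> x \<oplus>\<^bsub>M \<sigma>\<^esub> y \<in> I \<sigma>"
  using additive_subgroup.a_closed[OF abelian_subgroup.axioms(1)[OF abelian_subgroup_I]] by auto

lemma I_smult: "x \<in> I \<sigma> \<Longrightarrow> smult (M \<sigma>) a x \<in> I \<sigma>"
  using submodule.smult_closed[OF submod, of a x] by simp

lemma I_act: "tangle \<sigma> T \<Longrightarrow> inputs P T v \<Longrightarrow> (l, \<tau>) \<in> set (discs T) \<Longrightarrow> v l \<in> I \<tau> \<Longrightarrow> act P T v \<in> I \<sigma>"
  using ideal unfolding planar_ideal_def by blast

lemma coset_self: "x \<in> carrier (M \<sigma>) \<Longrightarrow> x \<in> coset \<sigma> x"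
  using abelian_subgroup.a_rcos_self[OF abelian_subgroup_I] .

lemma coset_sub: "x \<in> carrier (M \<sigma>) \<Longrightarrow> y \<in> coset \<sigma> x \<Longrightarrow> y \<in> carrier (M \<sigma>)"
  using abelian_monoid.a_r_coset_subset_G[of "M \<sigma>" "I \<sigma>" x] abelian_group_M I_sub
  unfolding abelian_group_def by blast

lemma coset_iff: "y \<in> coset \<sigma> x \<longleftrightarrow> (\<exists>h\<in>I \<sigma>. y = h \<oplus>\<^bsub>M \<sigma>\<^esub> x)"
  by (auto simp: a_r_coset_def')

lemma coset_eqI: "x \<in> carrier (M \<sigma>) \<Longrightarrow> y \<in> coset \<sigma> x \<Longrightarrow> coset \<sigma> x = coset \<sigma> y"
  by (rule abelian_subgroup.a_repr_independence'[OF abelian_subgroup_I])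

lemma coset_eq_iff:
  assumes "x \<in> carrier (M \<sigma>)" "y \<in> carrier (M \<sigma>)"
  shows "coset \<sigma> x = coset \<sigma> y \<longleftrightarrow> (\<exists>h\<in>I \<sigma>. x = h \<oplus>\<^bsub>M \<sigma>\<^esub> y)"
  using coset_self[OF assms(1)] coset_eqI[OF assms(2)] coset_iff by metis

lemma coset_absorb:
  assumes "h \<in> I \<sigma>" "x \<in> carrier (M \<sigma>)"
  shows "coset \<sigma> (h \<oplus>\<^bsub>M \<sigma>\<^esub> x) = coset \<sigma> x"
  using coset_eqI[OF assms(2)] coset_iff assms by metis

lemma carrier_Q: "carrier (box_space Q \<sigma>) = coset \<sigma> ` carrier (M \<sigma>)"
  by (auto simp: quotient_ospa_def quotient_module_def A_RCOSETS_def RCOSETS_def a_r_coset_def)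

lemma coset_in_Q: "x \<in> carrier (M \<sigma>) \<Longrightarrow> coset \<sigma> x \<in> carrier (box_space Q \<sigma>)"
  by (simp add: carrier_Q)

lemma rep:
  assumes "X \<in> carrier (box_space Q \<sigma>)"
  shows "rep X \<in> carrier (M \<sigma>)" "coset \<sigma> (rep X) = X"
proof -
  obtain x where x: "x \<in> carrier (M \<sigma>)" "X = coset \<sigma> x" using assms by (auto simp: carrier_Q)
  then have "rep X \<in> X" unfolding rep_def using coset_self[OF x(1)] someI[of "\<lambda>z. z \<in> X" x] by simp
  then have X: "rep X \<in> coset \<sigma> x" using x(2) by simp
  show "rep X \<in> carrier (M \<sigma>)"
    by (rule coset_sub[OF x(1) X])
  show "coset \<sigma> (rep X) = X"
    by (rule HOL.trans[OF coset_eqI[OF x(1) X, symmetric] x(2)[symmetric]])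
qed

lemma add_Q:
  assumes "x \<in> carrier (M \<sigma>)" "y \<in> carrier (M \<sigma>)"
  shows "coset \<sigma> x \<oplus>\<^bsub>box_space Q \<sigma>\<^esub> coset \<sigma> y = coset \<sigma> (x \<oplus>\<^bsub>M \<sigma>\<^esub> y)"
  using abelian_subgroup.a_rcos_sum[OF abelian_subgroup_I assms]
  by (simp add: quotient_ospa_def quotient_module_def)

text \<open>The union by which \<open>quotient_module\<close> defines scalar multiples runs over
  representatives that all give the same coset.\<close>

lemma smult_Q:
  assumes x: "x \<in> carrier (M \<sigma>)"
  shows "smult (box_space Q \<sigma>) a (coset \<sigma> x) = coset \<sigma> (smult (M \<sigma>) a x)"
proof -
  interpret module scalars "M \<sigma>" using vector_space .
  have "coset \<sigma> (smult (M \<sigma>) a z) = coset \<sigma> (smult (M \<sigma>) a x)" if z: "z \<in> coset \<sigma> x" for z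
  proof -
    obtain h where h: "h \<in> I \<sigma>" "z = h \<oplus>\<^bsub>M \<sigma>\<^esub> x"
      using z coset_iff[of z \<sigma> x] by auto
    then have "smult (M \<sigma>) a z = smult (M \<sigma>) a h \<oplus>\<^bsub>M \<sigma>\<^esub> smult (M \<sigma>) a x"
      using x I_sub by (simp add: smult_r_distr)
    then show ?thesis using h x by (simp add: coset_absorb I_smult)
  qed
  with coset_self[OF x] have "(\<Union>z\<in>coset \<sigma> x. coset \<sigma> (smult (M \<sigma>) a z)) = coset \<sigma> (smult (M \<sigma>) a x)"
    by blast
  then show ?thesis by (simp add: quotient_ospa_def quotient_module_def)
qed

lemma module_Q: "module scalars (box_space Q \<sigma>)"
proof (rule moduleI)
  interpret module scalars "M \<sigma>" using vector_space .
  show "abelian_group (box_space Q \<sigma>)"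
  proof (rule abelian_groupI)
    have zero: "\<zero>\<^bsub>box_space Q \<sigma>\<^esub> = coset \<sigma> \<zero>\<^bsub>M \<sigma>\<^esub>"
      using abelian_group.a_coset_add_zero[OF abelian_group_M subsetI[OF I_sub]]
      by (simp add: quotient_ospa_def quotient_module_def)
    then show "\<zero>\<^bsub>box_space Q \<sigma>\<^esub> \<in> carrier (box_space Q \<sigma>)"
      by (simp add: coset_in_Q)
    fix X Y Z
    assume "X \<in> carrier (box_space Q \<sigma>)" "Y \<in> carrier (box_space Q \<sigma>)"
    then obtain x y where x: "x \<in> carrier (M \<sigma>)" "X = coset \<sigma> x"
      and y: "y \<in> carrier (M \<sigma>)" "Y = coset \<sigma> y" by (auto simp: carrier_Q)
    show "X \<oplus>\<^bsub>box_space Q \<sigma>\<^esub> Y \<in> carrier (box_space Q \<sigma>)"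
      using x y by (simp add: add_Q coset_in_Q)
    show "X \<oplus>\<^bsub>box_space Q \<sigma>\<^esub> Y = Y \<oplus>\<^bsub>box_space Q \<sigma>\<^esub> X"
      using x y M.a_comm[of x y] by (simp add: add_Q)
    show "\<zero>\<^bsub>box_space Q \<sigma>\<^esub> \<oplus>\<^bsub>box_space Q \<sigma>\<^esub> X = X"
      using x by (simp add: zero add_Q)
    show "\<exists>Y\<in>carrier (box_space Q \<sigma>). Y \<oplus>\<^bsub>box_space Q \<sigma>\<^esub> X = \<zero>\<^bsub>box_space Q \<sigma>\<^esub>"
      using x by (intro bexI[of _ "coset \<sigma> (\<ominus>\<^bsub>M \<sigma>\<^esub> x)"]) (simp_all add: zero add_Q coset_in_Q M.l_neg)
    assume "Z \<in> carrier (box_space Q \<sigma>)"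
    then obtain z where z: "z \<in> carrier (M \<sigma>)" "Z = coset \<sigma> z" by (auto simp: carrier_Q)
    show "X \<oplus>\<^bsub>box_space Q \<sigma>\<^esub> Y \<oplus>\<^bsub>box_space Q \<sigma>\<^esub> Z = X \<oplus>\<^bsub>box_space Q \<sigma>\<^esub> (Y \<oplus>\<^bsub>box_space Q \<sigma>\<^esub> Z)"
      using x y z M.a_assoc[of x y z] by (simp add: add_Q)
  qed
  fix a b :: 'k and X assume "X \<in> carrier (box_space Q \<sigma>)"
  then obtain x where x: "x \<in> carrier (M \<sigma>)" "X = coset \<sigma> x" by (auto simp: carrier_Q)
  show "smult (box_space Q \<sigma>) a X \<in> carrier (box_space Q \<sigma>)"
    using x by (simp add: smult_Q coset_in_Q)
  show "smult (box_space Q \<sigma>) (a \<oplus>\<^bsub>scalars\<^esub> b) X =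
      smult (box_space Q \<sigma>) a X \<oplus>\<^bsub>box_space Q \<sigma>\<^esub> smult (box_space Q \<sigma>) b X"
    using x smult_l_distr[of a b x] by (simp add: smult_Q add_Q)
  show "smult (box_space Q \<sigma>) (a \<otimes>\<^bsub>scalars\<^esub> b) X = smult (box_space Q \<sigma>) a (smult (box_space Q \<sigma>) b X)"
    using x smult_assoc1[of a b x] by (simp add: smult_Q)
  show "smult (box_space Q \<sigma>) \<one>\<^bsub>scalars\<^esub> X = X"
    using x smult_one[of x] by (simp add: smult_Q)
next
  interpret module scalars "M \<sigma>" using vector_space .
  fix a :: 'k and X Y assume "X \<in> carrier (box_space Q \<sigma>)" "Y \<in> carrier (box_space Q \<sigma>)"
  then obtain x y where "x \<in> carrier (M \<sigma>)" "X = coset \<sigma> x" "y \<in> carrier (M \<sigma>)" "Y = coset \<sigma> y"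
    by (auto simp: carrier_Q)
  then show "smult (box_space Q \<sigma>) a (X \<oplus>\<^bsub>box_space Q \<sigma>\<^esub> Y) =
      smult (box_space Q \<sigma>) a X \<oplus>\<^bsub>box_space Q \<sigma>\<^esub> smult (box_space Q \<sigma>) a Y"
    using smult_r_distr[of a x y] by (simp add: smult_Q add_Q)
qed (rule cring_scalars)

lemma act_add:
  assumes "tangle \<sigma> T" "inputs P T v" "(l, \<tau>) \<in> set (discs T)" "x \<in> carrier (M \<tau>)" "y \<in> carrier (M \<tau>)"
  shows "act P T (v(l := x \<oplus>\<^bsub>M \<tau>\<^esub> y)) = act P T (v(l := x)) \<oplus>\<^bsub>M \<sigma>\<^esub> act P T (v(l := y))"
  using act_multilinear[OF assms(1-3)] assms(4,5) by (simp add: linear_map_def)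

lemma act_smult:
  assumes "tangle \<sigma> T" "inputs P T v" "(l, \<tau>) \<in> set (discs T)" "x \<in> carrier (M \<tau>)"
  shows "act P T (v(l := smult (M \<tau>) a x)) = smult (M \<sigma>) a (act P T (v(l := x)))"
  using act_multilinear[OF assms(1-3)] assms(4) by (simp add: linear_map_def)

lemma inputs_upd:
  "tangle \<sigma> T \<Longrightarrow> inputs P T v \<Longrightarrow> (l, \<tau>) \<in> set (discs T) \<Longrightarrow> x \<in> carrier (M \<tau>) \<Longrightarrow> inputs P T (v(l := x))"
  unfolding inputs_def tangle_def by (auto dest: eq_key_imp_eq_value)

text \<open>Inputs are exchanged one label at a time. By linearity an exchange changes the value by
  the action on a family with an ideal element in one slot, and this lies in the ideal.\<close>

lemma coset_act_cong:
  assumes T: "tangle \<sigma> T" and v: "inputs P T v" and w: "inputs P T w"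
    and eq: "\<And>l \<tau>. (l, \<tau>) \<in> set (discs T) \<Longrightarrow> coset \<tau> (v l) = coset \<tau> (w l)"
  shows "coset \<sigma> (act P T v) = coset \<sigma> (act P T w)"
proof -
  define u where "u L = (\<lambda>l. if l \<in> L then w l else v l)" for L
  have inp: "inputs P T (u L)" for L
    using v w by (auto simp: inputs_def u_def)
  have "finite L \<Longrightarrow> L \<subseteq> labels T \<Longrightarrow> coset \<sigma> (act P T (u L)) = coset \<sigma> (act P T v)" for L
  proof (induction L rule: finite_induct)
    case empty
    then show ?case by (simp add: u_def)
  next
    case (insert l L)
    then obtain \<tau> where l: "(l, \<tau>) \<in> set (discs T)" by auto
    have car: "v l \<in> carrier (M \<tau>)" "w l \<in> carrier (M \<tau>)" using v w l by (auto simp: inputs_def)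
    obtain h where h: "h \<in> I \<tau>" "w l = h \<oplus>\<^bsub>M \<tau>\<^esub> v l"
      using eq[OF l] coset_eq_iff[OF car(2,1)] by auto
    have "u (insert l L) = (u L)(l := h \<oplus>\<^bsub>M \<tau>\<^esub> v l)" "(u L)(l := v l) = u L"
      using h(2) insert.hyps by (auto simp: u_def)
    then have "act P T (u (insert l L)) = act P T ((u L)(l := h)) \<oplus>\<^bsub>M \<sigma>\<^esub> act P T (u L)"
      using act_add[OF T inp[of L] l I_sub[OF h(1)] car(1)] by simp
    moreover have "act P T ((u L)(l := h)) \<in> I \<sigma>"
      using I_act[OF T inputs_upd[OF T inp l I_sub[OF h(1)]] l] h by simp
    ultimately show ?case
      using insert coset_absorb act_closed[OF T inp] by auto
  qed
  from this[of "labels T"] have "coset \<sigma> (act P T (u (labels T))) = coset \<sigma> (act P T v)" by simp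
  moreover have "act P T (u (labels T)) = act P T w"
    by (rule act_cong[OF T inp]) (simp add: u_def)
  ultimately show ?thesis by simp
qed

lemma act_Q: "tangle \<sigma> T \<Longrightarrow> act Q T X = coset \<sigma> (act P T (\<lambda>l. rep (X l)))"
  by (simp add: quotient_ospa_def tangle_def rep_def)

lemma inputs_rep: "inputs Q T X \<Longrightarrow> inputs P T (\<lambda>l. rep (X l))"
  using rep(1) by (fastforce simp: inputs_def)

lemma act_Q_coset:
  assumes "tangle \<sigma> T" "inputs P T v" "\<And>l \<tau>. (l, \<tau>) \<in> set (discs T) \<Longrightarrow> X l = coset \<tau> (v l)"
  shows "act Q T X = coset \<sigma> (act P T v)"
proof -
  have X: "X l \<in> carrier (box_space Q \<tau>)" if "(l, \<tau>) \<in> set (discs T)" for l \<tau>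
    using assms(2,3) that by (auto simp: inputs_def carrier_Q)
  then have "inputs Q T X" by (auto simp: inputs_def)
  then show ?thesis
    unfolding act_Q[OF assms(1)] using rep(2)[OF X] assms(3)
    by (intro coset_act_cong[OF assms(1) inputs_rep assms(2)]) auto
qed

theorem ospa_Q: "ospa Q"
proof (rule ospa.intro)
  fix \<sigma> T X and Y :: "nat \<Rightarrow> 'v set"
  assume T: "tangle \<sigma> T" and X: "inputs Q T X"
  note X' = inputs_rep[OF X]
  show "act Q T X \<in> carrier (box_space Q \<sigma>)"
    unfolding act_Q[OF T] using act_closed[OF T X'] by (rule coset_in_Q)
  show "act Q T X = act Q T Y" if "\<And>l. l \<in> labels T \<Longrightarrow> X l = Y l"
    unfolding act_Q[OF T] using act_cong[OF T X', of "\<lambda>l. rep (Y l)"] that by simp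
  show "act Q T X = act Q T' X" if "T \<approx>\<^sub>t T'" for T'
    using act_Q[OF T] act_Q[of \<sigma> T'] tangle_tangle_eq[OF T that] act_tangle_eq[OF T that X'] by simp
  fix l \<tau> assume l: "(l, \<tau>) \<in> set (discs T)"
  have *: "act Q T (X(l := coset \<tau> x)) = coset \<sigma> (act P T ((\<lambda>l. rep (X l))(l := x)))"
    if "x \<in> carrier (M \<tau>)" for x
  proof (rule act_Q_coset[OF T inputs_upd[OF T X' l that]])
    fix j \<rho> assume j: "(j, \<rho>) \<in> set (discs T)"
    show "(X(l := coset \<tau> x)) j = coset \<rho> (((\<lambda>l. rep (X l))(l := x)) j)"
    proof (cases "j = l")
      case True
      then have "\<rho> = \<tau>" using j l T unfolding tangle_def by (metis eq_key_imp_eq_value)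
      with True show ?thesis by simp
    next
      case False
      then show ?thesis using rep(2)[of "X j" \<rho>] X j by (auto simp: inputs_def)
    qed
  qed
  have car: "act P T ((\<lambda>l. rep (X l))(l := x)) \<in> carrier (M \<sigma>)" if "x \<in> carrier (M \<tau>)" for x
    using act_closed[OF T inputs_upd[OF T X' l that]] .
  interpret N: module scalars "M \<tau>" using vector_space .
  show "linear_map (box_space Q \<tau>) (box_space Q \<sigma>) (\<lambda>Y. act Q T (X(l := Y)))"
    unfolding linear_map_def carrier_Q
    using act_add[OF T X' l] act_smult[OF T X' l]
    by (auto simp: * add_Q smult_Q car)
next
  fix \<sigma> T \<pi> X
  assume T: "tangle \<sigma> T" and \<pi>: "inj_on \<pi> (labels T)" and X: "inputs Q (map_diagram \<pi> T) X"
  show "act Q (map_diagram \<pi> T) X = act Q T (X \<circ> \<pi>)"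
    using act_relabel[OF T \<pi> inputs_rep[OF X]]
    unfolding act_Q[OF tangle_map[OF T \<pi>]] act_Q[OF T] by (simp add: o_def)
next
  fix X \<sigma> l assume X: "X \<in> carrier (box_space Q \<sigma>)"
  have "tangle \<sigma> (Disc l \<sigma>)" by (simp add: tangle_def)
  then show "act Q (Disc l \<sigma>) (\<lambda>_. X) = X"
    using rep[OF X] by (simp add: act_Q act_unit)
next
  fix \<sigma> T l \<tau> S X
  assume T: "tangle \<sigma> T" and l: "(l, \<tau>) \<in> set (discs T)" and S: "tangle \<tau> S"
    and disj: "(labels T - {l}) \<inter> labels S = {}" and X: "inputs Q (insert_tangle l S T) X"
  note D = discs_insert_tangle[OF l, of S]
  let ?x = "\<lambda>l. rep (X l)"
  have inS: "inputs P S ?x"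
    using inputs_rep[OF X] unfolding inputs_def D by auto
  have uniq: "\<rho> = \<tau>" if "(l, \<rho>) \<in> set (discs T)" for \<rho>
    using that l T unfolding tangle_def by (metis eq_key_imp_eq_value)
  have "inputs P T (?x(l := act P S ?x))"
    using inputs_rep[OF X] act_closed[OF S inS] uniq unfolding inputs_def D ball_Un by auto
  moreover have "(X(l := act Q S X)) j = coset \<rho> ((?x(l := act P S ?x)) j)" if "(j, \<rho>) \<in> set (discs T)" for j \<rho>
    using that uniq act_Q[OF S] rep(2)[of "X j" \<rho>] X unfolding inputs_def D ball_Un by auto
  ultimately have "act Q T (X(l := act Q S X)) = coset \<sigma> (act P T (?x(l := act P S ?x)))"
    by (rule act_Q_coset[OF T])
  then show "act Q (insert_tangle l S T) X = act Q T (X(l := act Q S X))"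
    using act_Q[OF tangle_insert_tangle[OF T l S disj]] act_insert[OF T l S disj inputs_rep[OF X]] by simp
qed (rule module_Q)

end

lemma (in ospa) planar_ideal_generated:
  assumes R: "\<And>\<sigma>. R \<sigma> \<subseteq> carrier (box_space P \<sigma>)"
  shows "planar_ideal P (generated_ideal P R)"
proof -
  let ?F = "{I. planar_ideal P I \<and> (\<forall>\<tau>. R \<tau> \<subseteq> I \<tau>)}"
  have gen: "generated_ideal P R \<sigma> = (\<Inter>I\<in>?F. I \<sigma>)" for \<sigma>
    unfolding generated_ideal_def by blast
  \<comment> \<open>The family of all box spaces is itself an ideal containing the relations, so the
    intersection is over a nonempty family and stays inside the carriers.\<close>
  have car: "(\<lambda>\<sigma>. carrier (box_space P \<sigma>)) \<in> ?F"
    using R vector_space act_closed unfolding planar_ideal_def by (auto intro!: module.carrier_is_submodule)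
  show ?thesis
    unfolding planar_ideal_def
  proof (intro conjI allI impI)
    fix \<sigma>
    interpret module scalars "box_space P \<sigma>" using vector_space .
    have sub: "submodule (I \<sigma>) scalars (box_space P \<sigma>)" if "I \<in> ?F" for I
      using that by (auto simp: planar_ideal_def)
    show "submodule (generated_ideal P R \<sigma>) scalars (box_space P \<sigma>)"
    proof (rule submoduleI)
      show "generated_ideal P R \<sigma> \<subseteq> carrier (box_space P \<sigma>)"
        using car unfolding gen by blast
      show "\<zero>\<^bsub>box_space P \<sigma>\<^esub> \<in> generated_ideal P R \<sigma>"
        unfolding gen using subgroup.one_closed[OF submodule.axioms(1)[OF sub]] by auto
    qed (use submoduleE[OF sub] in \<open>auto simp: gen\<close>)
  next
    fix \<sigma> T v l \<tau>
    assume "tangle \<sigma> T" "inputs P T v" "(l, \<tau>) \<in> set (discs T)" "v l \<in> generated_ideal P R \<tau>"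
    then show "act P T v \<in> generated_ideal P R \<sigma>"
      unfolding gen planar_ideal_def by blast
  qed
qed

lemma generated_ideal_superset: "R \<sigma> \<subseteq> generated_ideal P R \<sigma>"
  unfolding generated_ideal_def by blast

lemma generated_ideal_least:
  "planar_ideal P I \<Longrightarrow> (\<And>\<tau>. R \<tau> \<subseteq> I \<tau>) \<Longrightarrow> generated_ideal P R \<sigma> \<subseteq> I \<sigma>"
  unfolding generated_ideal_def by blast

section \<open>Matrices of diagrams\<close>

lemma finite_lists [simp]: "finite {K :: 'n::finite list. length K = n}"
  using finite_lists_length_eq[of "UNIV :: 'n set" n] by simp

lemma sum_lists_0 [simp]: "(\<Sum>K | length K = 0. f K) = f []"
  by simp

lemma sum_lists_append:
  "(\<Sum>K | length K = m + n. f (K :: 'n::finite list)) =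
   (\<Sum>K | length K = m. \<Sum>L | length L = n. f (K @ L))"
proof -
  have "(\<Sum>(K, L)\<in>{K. length K = m} \<times> {L. length L = n}. f (K @ L)) = (\<Sum>K | length K = m + n. f K)"
    by (rule sum.reindex_bij_witness[where i = "\<lambda>K. (take m K, drop m K)" and j = "\<lambda>(K, L). K @ L"]) auto
  then show ?thesis by (simp add: sum.cartesian_product)
qed

lemma sum_lists_1: "(\<Sum>K | length K = Suc 0. f (K :: 'n::finite list)) = (\<Sum>i\<in>UNIV. f [i])"
  by (rule sum.reindex_bij_witness[where j = hd and i = "\<lambda>i. [i]"]) (auto simp: length_Suc_conv)

lemma sum_lists_Suc:
  "(\<Sum>K | length K = Suc n. f (K :: 'n::finite list)) = (\<Sum>i\<in>UNIV. \<Sum>K | length K = n. f (i # K))"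
  using sum_lists_append[of f 1 n] by (simp add: sum_lists_1)

text \<open>The matrix of \<open>interp\<close>: the first index belongs to the upper boundary, the
  second to the lower one, and indices of the wrong length give 0 (\<open>entry_zero\<close>). In
  this form the tangle moves become identities between finite sums.\<close>

primrec entry :: "('l \<Rightarrow> ('n::finite list \<Rightarrow> 'k::field) \<Rightarrow> 'k) \<Rightarrow> 'l diagram \<Rightarrow> 'n list \<Rightarrow> 'n list \<Rightarrow> 'k" where
  "entry v (Strands \<sigma>) = (\<lambda>I J. if I = J \<and> length I = length \<sigma> then 1 else 0)"
| "entry v (Crossing a b) = (\<lambda>I J. if \<exists>i j. I = [i, j] \<and> J = [j, i] then 1 else 0)"
| "entry v (Cap s) = (\<lambda>I J. if I = [] \<and> (\<exists>i. J = [i, i]) then 1 else 0)"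
| "entry v (Cup s) = (\<lambda>I J. if J = [] \<and> (\<exists>i. I = [i, i]) then 1 else 0)"
| "entry v (Disc l \<sigma>) = (\<lambda>I J. if I = [] \<and> length J = length \<sigma> then v l (basis_tensor J) else 0)"
| "entry v (g \<circ>\<^sub>t f) = (\<lambda>I J. \<Sum>K | length K = length (src g). entry v g I K * entry v f K J)"
| "entry v (f \<otimes>\<^sub>t g) = (\<lambda>I J. entry v f (take (length (tgt f)) I) (take (length (src f)) J) *
     entry v g (drop (length (tgt f)) I) (drop (length (src f)) J))"

lemma entry_zero:
  "wf_diagram t \<Longrightarrow> length I \<noteq> length (tgt t) \<or> length J \<noteq> length (src t) \<Longrightarrow> entry v t I J = 0"
proof (induction t arbitrary: I J)
  case (Comp g f)
  then show ?case by (auto intro!: sum.neutral)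
next
  case (Juxt f g)
  show ?case
  proof (cases "length (take (length (tgt f)) I) \<noteq> length (tgt f) \<or> length (take (length (src f)) J) \<noteq> length (src f)")
    case True
    then show ?thesis using Juxt by auto
  next
    case False
    then have "length (drop (length (tgt f)) I) \<noteq> length (tgt g) \<or> length (drop (length (src f)) J) \<noteq> length (src g)"
      using Juxt.prems by (auto simp: min_def split: if_splits)
    then show ?thesis using Juxt by auto
  qed
qed auto

lemma entry_eqI:
  fixes v :: "'l \<Rightarrow> ('n::finite list \<Rightarrow> 'k::field) \<Rightarrow> 'k"
  assumes "wf_diagram t" "wf_diagram t'" "src t = src t'" "tgt t = tgt t'"
    and "\<And>I J. length I = length (tgt t) \<Longrightarrow> length J = length (src t) \<Longrightarrow> entry v t I J = entry v t' I J"
  shows "entry v t = entry v t'"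
proof (intro ext)
  fix I J
  show "entry v t I J = entry v t' I J"
    using assms entry_zero[of t I J v] entry_zero[of t' I J v]
    by (cases "length I = length (tgt t) \<and> length J = length (src t)") auto
qed

lemma entry_comp_delta:
  fixes v :: "'l \<Rightarrow> ('n::finite list \<Rightarrow> 'k::field) \<Rightarrow> 'k"
  assumes "\<And>K. length K = length (src g) \<Longrightarrow> entry v f K J = (if K = K0 then 1 else 0)" "length K0 = length (src g)"
  shows "entry v (g \<circ>\<^sub>t f) I J = entry v g I K0"
proof -
  have "entry v (g \<circ>\<^sub>t f) I J = (\<Sum>K | length K = length (src g). if K = K0 then entry v g I K else 0)"
    unfolding entry.simps by (rule sum.cong) (simp_all add: assms(1))
  then show ?thesis using assms(2) by (simp add: sum.delta)
qed

lemma entry_comp_delta_left: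
  fixes v :: "'l \<Rightarrow> ('n::finite list \<Rightarrow> 'k::field) \<Rightarrow> 'k"
  assumes "\<And>K. length K = length (src g) \<Longrightarrow> entry v g I K = (if K = K0 then 1 else 0)" "length K0 = length (src g)"
  shows "entry v (g \<circ>\<^sub>t f) I J = entry v f K0 J"
proof -
  have "entry v (g \<circ>\<^sub>t f) I J = (\<Sum>K | length K = length (src g). if K = K0 then entry v f K J else 0)"
    unfolding entry.simps by (rule sum.cong) (simp_all add: assms(1))
  then show ?thesis using assms(2) by (simp add: sum.delta)
qed

lemma entry_pass:
  fixes v :: "'l \<Rightarrow> ('n::finite list \<Rightarrow> 'k::field) \<Rightarrow> 'k"
  shows "entry v (pass s \<sigma>) K (a # J) = (if length J = length \<sigma> \<and> K = J @ [a] then 1 else 0)"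
proof (induction \<sigma> arbitrary: K J)
  case Nil
  then show ?case by auto
next
  case (Cons b \<sigma>)
  show ?case
  proof (cases "length J = Suc (length \<sigma>) \<and> length K = Suc (Suc (length \<sigma>))")
    case False
    then show ?thesis
      using entry_zero[of "pass s (b # \<sigma>)" K "a # J" v] by (auto simp: typed)
  next
    case True
    then obtain c J' d K' where J: "J = c # J'" "length J' = length \<sigma>" and K: "K = d # K'"
      by (auto simp: length_Suc_conv)
    have "entry v (pass s (b # \<sigma>)) K (a # J) = entry v (Strands [b] \<otimes>\<^sub>t pass s \<sigma>) K (c # a # J')"
    proof (unfold pass.simps, rule entry_comp_delta)
      fix L :: "'n list" assume "length L = length (src (Strands [b] \<otimes>\<^sub>t pass s \<sigma> :: 'l diagram))"
      then obtain x y L' where "L = x # y # L'" "length L' = length \<sigma>" by (auto simp: length_Suc_conv typed)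
      then show "entry v (Crossing s b \<otimes>\<^sub>t Strands \<sigma>) L (a # J) = (if L = c # a # J' then 1 else 0)"
        using J by auto
    qed (use J in \<open>simp add: typed\<close>)
    also have "\<dots> = (if length J = length (b # \<sigma>) \<and> K = J @ [a] then 1 else 0)"
      using J K Cons.IH[of K' J'] by auto
    finally show ?thesis .
  qed
qed

lemma sum_ind_both:
  "(\<Sum>i\<in>UNIV. if a = i \<and> b = i \<and> P then 1 else 0) = (if a = b \<and> P then 1 else (0::'k::field))"
  for a :: "'n::finite"
proof -
  have "(\<Sum>i\<in>UNIV. if a = i \<and> b = i \<and> P then 1 else 0) =
      (\<Sum>i\<in>UNIV. if i = a then (if a = b \<and> P then 1 else (0::'k)) else 0)"
    by (intro sum.cong) auto
  then show ?thesis by simp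
qed

lemma entry_comp_Cup:
  fixes v :: "'l \<Rightarrow> ('n::finite list \<Rightarrow> 'k::field) \<Rightarrow> 'k"
  assumes "length (src g) = Suc (Suc 0)"
  shows "entry v (g \<circ>\<^sub>t Cup s) I [] = (\<Sum>i\<in>UNIV. entry v g I [i, i])"
proof -
  have "entry v (g \<circ>\<^sub>t Cup s) I [] = (\<Sum>i\<in>UNIV. \<Sum>j\<in>UNIV. entry v g I [i, j] * (if j = i then 1 else 0))"
    unfolding entry.simps assms by (auto simp: sum_lists_Suc intro!: sum.cong)
  also have "\<dots> = (\<Sum>i\<in>UNIV. \<Sum>j\<in>UNIV. if j = i then entry v g I [i, j] else 0)"
    by (intro sum.cong) simp_all
  finally show ?thesis by (simp add: sum.delta)
qed

text \<open>Nested cups pair each strand with its mirror image, whence the reversal.\<close>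

lemma entry_coev:
  fixes v :: "'l \<Rightarrow> ('n::finite list \<Rightarrow> 'k::field) \<Rightarrow> 'k"
  shows "entry v (coev \<sigma>) K [] = (if \<exists>I. length I = length \<sigma> \<and> K = I @ rev I then 1 else 0)"
proof (induction \<sigma> arbitrary: K)
  case Nil
  then show ?case by auto
next
  case (Cons s \<sigma>)
  let ?g = "Strands [s] \<otimes>\<^sub>t coev \<sigma> \<otimes>\<^sub>t Strands [neg s] :: 'l diagram"
  have "entry v (coev (s # \<sigma>)) K [] = (\<Sum>i\<in>UNIV. entry v ?g K [i, i])"
    unfolding coev.simps by (rule entry_comp_Cup) (simp add: typed)
  also have "\<dots> = (if \<exists>I. length I = length (s # \<sigma>) \<and> K = I @ rev I then 1 else 0)"
  proof (cases "length K = Suc (Suc (length \<sigma> + length \<sigma>))")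
    case False
    then have z: "entry v ?g K [i, i] = 0" for i by (intro entry_zero) (auto simp: typed)
    have "\<not> (\<exists>I. length I = length (s # \<sigma>) \<and> K = I @ rev I)" using False by auto
    then show ?thesis by (simp only: z sum.neutral_const if_False)
  next
    case True
    then obtain a L where "K = a # L" "length L = Suc (length \<sigma> + length \<sigma>)" by (auto simp: length_Suc_conv)
    then obtain L' b where K: "K = a # L' @ [b]" and L': "length L' = length \<sigma> + length \<sigma>"
      by (cases L rule: rev_cases) auto
    have ent: "entry v ?g K [i, i] = (if a = i \<and> b = i \<and> (\<exists>I. length I = length \<sigma> \<and> L' = I @ rev I) then 1 else 0)" for i
      using L' by (simp add: K typed Cons.IH)
    have ex: "(\<exists>I. length I = length (s # \<sigma>) \<and> K = I @ rev I) \<longleftrightarrow>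
        a = b \<and> (\<exists>I. length I = length \<sigma> \<and> L' = I @ rev I)"
    proof
      assume "\<exists>I. length I = length (s # \<sigma>) \<and> K = I @ rev I"
      then obtain I where "length I = length (s # \<sigma>)" "K = I @ rev I" by auto
      then show "a = b \<and> (\<exists>I. length I = length \<sigma> \<and> L' = I @ rev I)"
        using K by (cases I) auto
    next
      assume "a = b \<and> (\<exists>I. length I = length \<sigma> \<and> L' = I @ rev I)"
      then obtain I where "a = b" "length I = length \<sigma>" "L' = I @ rev I" by auto
      then show "\<exists>I. length I = length (s # \<sigma>) \<and> K = I @ rev I"
        using K by (intro exI[of _ "a # I"]) auto
    qed
    show ?thesis unfolding ent ex by (rule sum_ind_both)
  qed
  finally show ?case .
qed

lemma length_2: "length I = Suc (Suc 0) \<longleftrightarrow> (\<exists>i j. I = [i, j])"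
  by (auto simp: length_Suc_conv)

lemma length_1: "length I = Suc 0 \<longleftrightarrow> (\<exists>i. I = [i])"
  by (auto simp: length_Suc_conv)

lemma length_3: "length I = Suc (Suc (Suc 0)) \<longleftrightarrow> (\<exists>i j k. I = [i, j, k])"
  by (auto simp: length_Suc_conv)

text \<open>Rules that collapse a sum over an index fixed by an indicator. With them each move on
  boxes of known width reduces to an equality of indicators.\<close>

lemma sum_ind_conj:
  fixes f :: "'n::finite \<Rightarrow> 'k::field"
  shows "(\<Sum>i\<in>UNIV. if i = a \<and> P i then f i else 0) = (if P a then f a else 0)"
    and "(\<Sum>i\<in>UNIV. if a = i \<and> P i then f i else 0) = (if P a then f a else 0)"
    and "(\<Sum>i\<in>UNIV. if Q \<and> P i then f i else 0) = (if Q then (\<Sum>i\<in>UNIV. if P i then f i else 0) else 0)"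
    and "(\<Sum>i\<in>UNIV. if Q then f i else 0) = (if Q then (\<Sum>i\<in>UNIV. f i) else 0)"
    and "(if Q then if R then x else 0 else 0) = (if Q \<and> R then x else (0::'k))"
    and "(if Q then 1 else 0) * x = (if Q then x else 0)"
proof -
  have "(\<Sum>i\<in>UNIV. if i = a \<and> P i then f i else 0) = (\<Sum>i\<in>UNIV. if i = a then (if P a then f a else 0) else 0)"
    by (intro sum.cong) auto
  then show 1: "(\<Sum>i\<in>UNIV. if i = a \<and> P i then f i else 0) = (if P a then f a else 0)" by simp
  show "(\<Sum>i\<in>UNIV. if a = i \<and> P i then f i else 0) = (if P a then f a else 0)"
    using 1 by (simp only: eq_commute[of a])
qed auto

text \<open>For \<open>turn_disc\<close> both sides evaluate the disc on the reversed index
  \<open>rev K\<close>; \<open>naturality\<close> follows from the permutation matrix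
  \<open>entry_pass\<close>. The moves without discs compare indicators, and the slicing rules are
  matrix algebra.\<close>

lemma entry_tangle_eq:
  fixes v :: "'l \<Rightarrow> ('n::finite list \<Rightarrow> 'k::field) \<Rightarrow> 'k"
  shows "T \<approx>\<^sub>t T' \<Longrightarrow> entry v T = entry v T'"
proof (induction rule: tangle_eq.induct)
  case (comp_assoc h g f)
  show ?case
  proof (intro ext)
    fix I J :: "'n list"
    have "entry v ((h \<circ>\<^sub>t g) \<circ>\<^sub>t f) I J =
        (\<Sum>K | length K = length (src g). \<Sum>L | length L = length (src h). entry v h I L * entry v g L K * entry v f K J)"
      by (simp add: sum_distrib_right)
    also have "\<dots> = entry v (h \<circ>\<^sub>t g \<circ>\<^sub>t f) I J"
      by (subst sum.swap) (simp add: sum_distrib_left mult.assoc)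
    finally show "entry v ((h \<circ>\<^sub>t g) \<circ>\<^sub>t f) I J = entry v (h \<circ>\<^sub>t g \<circ>\<^sub>t f) I J" .
  qed
next
  case (comp_strands_left f)
  then show ?case by (intro entry_eqI) (auto intro: entry_comp_delta_left simp del: entry.simps(6))
next
  case (comp_strands_right f)
  then show ?case by (intro entry_eqI) (auto intro: entry_comp_delta simp del: entry.simps(6))
next
  case (juxt_assoc f g h)
  then show ?case by (intro ext) (simp add: take_drop drop_drop take_take min_def add.commute mult.assoc)
next
  case (juxt_empty_left f)
  then show ?case by (intro ext) simp
next
  case (juxt_empty_right f)
  then show ?case by (intro entry_eqI) auto
next
  case (juxt_strands \<alpha> \<beta>)
  show ?case
  proof (intro entry_eqI)
    fix I J :: "'n list"
    assume "length I = length (tgt (Strands \<alpha> \<otimes>\<^sub>t Strands \<beta>))" "length J = length (src (Strands \<alpha> \<otimes>\<^sub>t Strands \<beta>))"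
    then show "entry v (Strands \<alpha> \<otimes>\<^sub>t Strands \<beta>) I J = entry v (Strands (\<alpha> @ \<beta>)) I J"
      using append_take_drop_id[of "length \<alpha>" I] append_take_drop_id[of "length \<alpha>" J] by auto (metis append_take_drop_id)
  qed auto
next
  case (interchange g f g' f')
  show ?case
  proof (intro ext)
    fix I J :: "'n list"
    let ?I = "take (length (tgt g)) I" and ?I' = "drop (length (tgt g)) I"
    let ?J = "take (length (src f)) J" and ?J' = "drop (length (src f)) J"
    have "entry v ((g \<otimes>\<^sub>t g') \<circ>\<^sub>t (f \<otimes>\<^sub>t f')) I J =
      (\<Sum>K | length K = length (src g). \<Sum>L | length L = length (src g').
        entry v g ?I K * entry v f K ?J * (entry v g' ?I' L * entry v f' L ?J'))"
      using interchange by (simp add: sum_lists_append mult.assoc mult.left_commute)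
    also have "\<dots> = entry v ((g \<circ>\<^sub>t f) \<otimes>\<^sub>t (g' \<circ>\<^sub>t f')) I J"
      by (simp add: sum_product)
    finally show "entry v ((g \<circ>\<^sub>t f) \<otimes>\<^sub>t (g' \<circ>\<^sub>t f')) I J = entry v ((g \<otimes>\<^sub>t g') \<circ>\<^sub>t (f \<otimes>\<^sub>t f')) I J" ..
  qed
next
  case (turn_disc l \<sigma>)
  show ?case
  proof (rule entry_eqI)
    let ?n = "length \<sigma>"
    fix K J :: "'n list"
    assume "length K = length (tgt ((Disc l \<sigma> \<otimes>\<^sub>t Strands (dual \<sigma>)) \<circ>\<^sub>t coev \<sigma>))"
      "length J = length (src ((Disc l \<sigma> \<otimes>\<^sub>t Strands (dual \<sigma>)) \<circ>\<^sub>t coev \<sigma>))"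
    then have K: "length K = ?n" and J: "J = []" by (auto simp: typed)
    have ex: "(\<exists>I. length I = ?n \<and> A @ B = I @ rev I) \<longleftrightarrow> B = rev A" if "length A = ?n" for A B :: "'n list"
      using that by auto
    have "entry v ((Disc l \<sigma> \<otimes>\<^sub>t Strands (dual \<sigma>)) \<circ>\<^sub>t coev \<sigma>) K J =
        (\<Sum>A | length A = ?n. \<Sum>B | length B = ?n. if B = K \<and> K = rev A then v l (basis_tensor A) else 0)"
      using K J by (auto simp: sum_lists_append entry_coev ex intro!: sum.cong)
    also have "\<dots> = (\<Sum>A | length A = ?n. if A = rev K then v l (basis_tensor A) else 0)"
    proof (intro sum.cong HOL.refl)
      fix A :: "'n list"
      have "(\<Sum>B | length B = ?n. if B = K \<and> K = rev A then v l (basis_tensor A) else 0) =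
          (\<Sum>B | length B = ?n. if B = K then (if A = rev K then v l (basis_tensor A) else 0) else 0)"
        by (intro sum.cong) auto
      then show "(\<Sum>B | length B = ?n. if B = K \<and> K = rev A then v l (basis_tensor A) else 0) =
          (if A = rev K then v l (basis_tensor A) else 0)"
        using K by simp
    qed
    also have "\<dots> = v l (basis_tensor (rev K))" using K by simp
    finally have 1: "entry v ((Disc l \<sigma> \<otimes>\<^sub>t Strands (dual \<sigma>)) \<circ>\<^sub>t coev \<sigma>) K J = v l (basis_tensor (rev K))" .
    have "entry v ((Strands (dual \<sigma>) \<otimes>\<^sub>t Disc l \<sigma>) \<circ>\<^sub>t coev (dual \<sigma>)) K J =
        (\<Sum>A | length A = ?n. \<Sum>B | length B = ?n. if B = rev K \<and> A = K then v l (basis_tensor B) else 0)"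
      using K J by (auto simp: sum_lists_append entry_coev ex intro!: sum.cong)
    also have "\<dots> = (\<Sum>A | length A = ?n. if A = K then v l (basis_tensor (rev K)) else 0)"
    proof (intro sum.cong HOL.refl)
      fix A :: "'n list"
      have "(\<Sum>B | length B = ?n. if B = rev K \<and> A = K then v l (basis_tensor B) else 0) =
          (\<Sum>B | length B = ?n. if B = rev K then (if A = K then v l (basis_tensor B) else 0) else 0)"
        by (intro sum.cong) auto
      then show "(\<Sum>B | length B = ?n. if B = rev K \<and> A = K then v l (basis_tensor B) else 0) =
          (if A = K then v l (basis_tensor (rev K)) else 0)"
        using K by simp
    qed
    also have "\<dots> = v l (basis_tensor (rev K))" using K by simp
    finally show "entry v ((Disc l \<sigma> \<otimes>\<^sub>t Strands (dual \<sigma>)) \<circ>\<^sub>t coev \<sigma>) K J =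
        entry v ((Strands (dual \<sigma>) \<otimes>\<^sub>t Disc l \<sigma>) \<circ>\<^sub>t coev (dual \<sigma>)) K J"
      using 1 by simp
  qed (auto simp: typed)
next
  case (naturality l \<sigma> s)
  show ?case
  proof (rule entry_eqI)
    fix I J :: "'n list"
    assume "length I = length (tgt ((Disc l \<sigma> \<otimes>\<^sub>t Strands [s]) \<circ>\<^sub>t pass s \<sigma>))"
      "length J = length (src ((Disc l \<sigma> \<otimes>\<^sub>t Strands [s]) \<circ>\<^sub>t pass s \<sigma>))"
    then obtain i a J' where I: "I = [i]" and J: "J = a # J'" "length J' = length \<sigma>"
      by (auto simp: typed length_Suc_conv)
    have "entry v ((Disc l \<sigma> \<otimes>\<^sub>t Strands [s]) \<circ>\<^sub>t pass s \<sigma>) I J =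
        entry v (Disc l \<sigma> \<otimes>\<^sub>t Strands [s]) I (J' @ [a])"
      by (rule entry_comp_delta) (use J in \<open>auto simp: entry_pass\<close>)
    then show "entry v ((Disc l \<sigma> \<otimes>\<^sub>t Strands [s]) \<circ>\<^sub>t pass s \<sigma>) I J = entry v (Strands [s] \<otimes>\<^sub>t Disc l \<sigma>) I J"
      using I J by auto
  qed (auto simp: typed)
next
  case (straighten_left s)
  show ?case
    proof (rule entry_eqI, goal_cases)
    case (5 I J)
    then obtain i j where "I = [i]" "J = [j]" by (auto simp: length_1)
    then show ?case by (simp add: sum_lists_Suc sum_ind_conj cong: if_cong; auto)
  qed auto
next
  case (straighten_right s)
  show ?case
    proof (rule entry_eqI, goal_cases)
    case (5 I J)
    then obtain i j where "I = [i]" "J = [j]" by (auto simp: length_1)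
    then show ?case by (simp add: sum_lists_Suc sum_ind_conj cong: if_cong; auto)
  qed auto
next
  case (turn_crossing a b)
  show ?case
    proof (rule entry_eqI, goal_cases)
    case (5 I J)
    then obtain i i' j j' where "I = [i, i']" "J = [j, j']" by (auto simp: length_2)
    then show ?case by (simp add: sum_lists_Suc sum_ind_conj cong: if_cong; auto)
  qed auto
next
  case (Reidemeister_1_left s)
  show ?case
    proof (rule entry_eqI, goal_cases)
    case (5 I J)
    then obtain i j where "I = [i]" "J = [j]" by (auto simp: length_1)
    then show ?case by (simp add: sum_lists_Suc sum_ind_conj cong: if_cong; auto)
  qed auto
next
  case (Reidemeister_1_right s)
  show ?case
    proof (rule entry_eqI, goal_cases)
    case (5 I J)
    then obtain i j where "I = [i]" "J = [j]" by (auto simp: length_1)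
    then show ?case by (simp add: sum_lists_Suc sum_ind_conj cong: if_cong; auto)
  qed auto
next
  case (Reidemeister_2 b a)
  show ?case
    proof (rule entry_eqI, goal_cases)
    case (5 I J)
    then obtain i i' j j' where "I = [i, i']" "J = [j, j']" by (auto simp: length_2)
    then show ?case by (simp add: sum_lists_Suc sum_ind_conj cong: if_cong; auto)
  qed auto
next
  case (Reidemeister_3 b c a)
  show ?case
    proof (rule entry_eqI, goal_cases)
    case (5 I J)
    then obtain i i' i'' j j' j'' where "I = [i, i', i'']" "J = [j, j', j'']" by (auto simp: length_3)
    then show ?case by (simp add: sum_lists_Suc sum_ind_conj cong: if_cong; auto)
  qed auto
next
  case (cong_comp g g' f f')
  then show ?case using tangle_eq_typed[of g g'] by simp
next
  case (cong_juxt f f' g g')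
  then show ?case using tangle_eq_typed[of f f'] by simp
qed auto

lemma entry_cong:
  assumes "\<And>l \<sigma> J. (l, \<sigma>) \<in> set (discs T) \<Longrightarrow> length J = length \<sigma> \<Longrightarrow> v l (basis_tensor J) = w l (basis_tensor J)"
  shows "entry v T = entry w T"
  using assms
proof (induction T)
  case (Comp g f)
  have "entry v g = entry w g" by (rule Comp.IH(1), rule Comp.prems) auto
  moreover have "entry v f = entry w f" by (rule Comp.IH(2), rule Comp.prems) auto
  ultimately show ?case by simp
next
  case (Juxt g f)
  have "entry v g = entry w g" by (rule Juxt.IH(1), rule Juxt.prems) auto
  moreover have "entry v f = entry w f" by (rule Juxt.IH(2), rule Juxt.prems) auto
  ultimately show ?case by simp
qed (auto intro!: ext)

lemma entry_map: "entry v (map_diagram \<pi> T) = entry (\<lambda>l. v (\<pi> l)) T"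
  by (induction T) auto

lemma entry_fill:
  fixes v :: "'m \<Rightarrow> ('n::finite list \<Rightarrow> 'k::field) \<Rightarrow> 'k"
  assumes "fits h T"
    and "\<And>l \<sigma> J. (l, \<sigma>) \<in> set (discs T) \<Longrightarrow> length J = length \<sigma> \<Longrightarrow> v' l (basis_tensor J) = entry v (h l \<sigma>) [] J"
  shows "entry v (fill h T) = entry v' T"
  using assms
proof (induction T)
  case (Disc l \<sigma>)
  show ?case
  proof (intro ext)
    fix I J :: "'n list"
    show "entry v (fill h (Disc l \<sigma>)) I J = entry v' (Disc l \<sigma>) I J"
      using Disc entry_zero[of "h l \<sigma>" I J v] by (cases "I = [] \<and> length J = length \<sigma>") auto
  qed
next
  case (Comp g f)
  then show ?case using fill_typed[of h g] by simp
next
  case (Juxt g f)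
  then show ?case using fill_typed[of h g] by simp
qed auto

text \<open>A matrix reads a disc only on basis tensors, so the relation between \<open>x\<close>,
  \<open>y\<close> and \<open>z\<close> is asked for there. Distinct labels ensure that the slot
  occurs in one factor only.\<close>

lemma entry_linear:
  fixes v :: "'l \<Rightarrow> ('n::finite list \<Rightarrow> 'k::field) \<Rightarrow> 'k"
  assumes "distinct (map fst (discs T))" "(l, \<tau>) \<in> set (discs T)"
    and z: "\<And>J. length J = length \<tau> \<Longrightarrow> z (basis_tensor J) = a * x (basis_tensor J) + y (basis_tensor J)"
  shows "entry (v(l := z)) T I J = a * entry (v(l := x)) T I J + entry (v(l := y)) T I J"
proof -
  define X Y Z where XYZ: "X = v(l := x)" "Y = v(l := y)" "Z = v(l := z)"
  have l: "X l = x" "Y l = y" "Z l = z" by (simp_all add: XYZ)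
  have upd: "entry X T = entry v T \<and> entry Y T = entry v T \<and> entry Z T = entry v T"
    if "l \<notin> labels T" for T :: "'l diagram"
    unfolding XYZ using that by (intro conjI; intro entry_cong; force)
  have "entry Z T I J = a * entry X T I J + entry Y T I J"
    using assms(1,2)
  proof (induction T arbitrary: I J)
    case (Disc j \<sigma>)
    then show ?case using z l by auto
  next
    case (Comp g f)
    have disj: "labels g \<inter> labels f = {}" using Comp.prems by simp
    consider "(l, \<tau>) \<in> set (discs g)" "l \<notin> labels f" | "(l, \<tau>) \<in> set (discs f)" "l \<notin> labels g"
      using Comp.prems(2) disj by force
    then show ?case
    proof cases
      case 1
      then show ?thesis
        using Comp upd[OF 1(2)] by (simp add: sum_distrib_left sum.distrib distrib_right mult.assoc)
    next
      case 2
      then show ?thesis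
        using Comp upd[OF 2(2)]
        by (simp add: sum_distrib_left sum.distrib distrib_left mult.assoc mult.left_commute)
    qed
  next
    case (Juxt g f)
    have disj: "labels g \<inter> labels f = {}" using Juxt.prems by simp
    consider "(l, \<tau>) \<in> set (discs g)" "l \<notin> labels f" | "(l, \<tau>) \<in> set (discs f)" "l \<notin> labels g"
      using Juxt.prems(2) disj by force
    then show ?case
    proof cases
      case 1
      then show ?thesis
        using Juxt upd[OF 1(2)] by (simp add: algebra_simps)
    next
      case 2
      then show ?thesis
        using Juxt upd[OF 2(2)] by (simp add: algebra_simps)
    qed
  qed auto
  then show ?thesis by (simp add: XYZ)
qed

definition functional :: "sign list \<Rightarrow> ('n::finite list \<Rightarrow> 'k::field) \<Rightarrow> ('n list \<Rightarrow> 'k) \<Rightarrow> 'k" where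
  "functional \<sigma> c = (\<lambda>w\<in>tensors \<sigma>. \<Sum>J | length J = length \<sigma>. c J * w J)"

lemma basis_tensor_in [simp]: "basis_tensor J \<in> tensors \<sigma> \<longleftrightarrow> length J = length \<sigma>"
  by (auto simp: tensors_def basis_tensor_def)

lemma sum_basis_tensor:
  "length I = n \<Longrightarrow> (\<Sum>J | length J = n. f J * basis_tensor I J) = (f I :: 'k::field)" for I :: "'n::finite list"
proof -
  assume "length I = n"
  moreover have "(\<Sum>J | length J = n. f J * basis_tensor I J) = (\<Sum>J | length J = n. if J = I then f J else 0)"
    by (intro sum.cong) (auto simp: basis_tensor_def)
  ultimately show ?thesis by simp
qed

lemma functional_basis [simp]: "length J = length \<sigma> \<Longrightarrow> functional \<sigma> c (basis_tensor J) = c J"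
  by (simp add: functional_def sum_basis_tensor)

lemma functional_ext: "functional \<sigma> c \<in> extensional (tensors \<sigma>)"
  by (simp add: functional_def)

lemma functional_eqI: "(\<And>J. length J = length \<sigma> \<Longrightarrow> c J = d J) \<Longrightarrow> functional \<sigma> c = functional \<sigma> d"
  unfolding functional_def by (intro restrict_ext sum.cong) auto

lemma linear_functional:
  fixes f :: "('n::finite list \<Rightarrow> 'k::field) \<Rightarrow> 'k"
  assumes ext: "f \<in> extensional (tensors \<sigma>)"
    and add: "\<And>w w'. w \<in> tensors \<sigma> \<Longrightarrow> w' \<in> tensors \<sigma> \<Longrightarrow> f (\<lambda>I. w I + w' I) = f w + f w'"
    and smult: "\<And>a w. w \<in> tensors \<sigma> \<Longrightarrow> f (\<lambda>I. a * w I) = a * f w"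
  shows "f = functional \<sigma> (\<lambda>J. f (basis_tensor J))"
proof
  fix w
  show "f w = functional \<sigma> (\<lambda>J. f (basis_tensor J)) w"
  proof (cases "w \<in> tensors \<sigma>")
    case False
    then show ?thesis using ext by (simp add: functional_def extensional_def)
  next
    case w: True
    let ?w = "\<lambda>S I. if I \<in> S then w I else 0"
    have zero: "f (\<lambda>_. 0) = 0" using smult[of w 0] w by simp
    have "finite S \<Longrightarrow> S \<subseteq> {J. length J = length \<sigma>} \<Longrightarrow> f (?w S) = (\<Sum>J\<in>S. f (basis_tensor J) * w J)" for S
    proof (induction S rule: finite_induct)
      case empty
      then show ?case using zero by simp
    next
      case (insert J S)
      have "?w (insert J S) = (\<lambda>I. ?w S I + w J * basis_tensor J I)"
        using insert.hyps by (auto simp: basis_tensor_def)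
      moreover have "?w S \<in> tensors \<sigma>" "basis_tensor J \<in> (tensors \<sigma> :: ('n list \<Rightarrow> 'k) set)"
        using insert w by (auto simp: tensors_def basis_tensor_def)
      moreover have "(\<lambda>I. w J * basis_tensor J I) \<in> tensors \<sigma>"
        using insert.prems by (auto simp: tensors_def basis_tensor_def)
      ultimately have "f (?w (insert J S)) = f (?w S) + w J * f (basis_tensor J)"
        using add[of "?w S" "\<lambda>I. w J * basis_tensor J I"] smult[of "basis_tensor J" "w J"] by simp
      then show ?case using insert by (simp add: mult.commute)
    qed
    from this[of "{J. length J = length \<sigma>}"] have "f (?w {J. length J = length \<sigma>}) = functional \<sigma> (\<lambda>J. f (basis_tensor J)) w"
      using w by (simp add: functional_def)
    moreover have "?w {J. length J = length \<sigma>} = w"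
      using w by (auto simp: tensors_def fun_eq_iff)
    ultimately show ?thesis by simp
  qed
qed

text \<open>The second hypothesis says that the discs carry linear functionals. In the case of a
  composite, \<open>entry_zero\<close> ensures that the intermediate value is again a tensor of the
  right type.\<close>

lemma interp_entry:
  fixes v :: "'l \<Rightarrow> ('n::finite list \<Rightarrow> 'k::field) \<Rightarrow> 'k"
  assumes "wf_diagram t"
    and "\<And>l \<sigma>. (l, \<sigma>) \<in> set (discs t) \<Longrightarrow> v l = functional \<sigma> (\<lambda>J. v l (basis_tensor J))"
    and "w \<in> tensors (src t)"
  shows "interp v t w = (\<lambda>I. \<Sum>J | length J = length (src t). entry v t I J * w J)"
  using assms
proof (induction t arbitrary: w)
  case (Strands \<sigma>)
  show ?case
  proof
    fix I
    have "(\<Sum>J | length J = length \<sigma>. entry v (Strands \<sigma>) I J * w J) =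
        (\<Sum>J | length J = length \<sigma>. if J = I then w I else 0)"
      by (intro sum.cong) auto
    then show "interp v (Strands \<sigma>) w I = (\<Sum>J | length J = length (src (Strands \<sigma>)). entry v (Strands \<sigma>) I J * w J)"
      using Strands.prems by (auto simp: tensors_def)
  qed
next
  case (Crossing a b)
  show ?case
  proof
    fix I
    show "interp v (Crossing a b) w I = (\<Sum>J | length J = length (src (Crossing a b)). entry v (Crossing a b) I J * w J)"
    proof (cases "\<exists>i j. I = [i, j]")
      case True
      then obtain i j where "I = [i, j]" by auto
      then show ?thesis by (simp add: sum_lists_Suc sum_ind_conj sum.delta)
    next
      case False
      then show ?thesis by (auto split: list.splits)
    qed
  qed
next
  case (Cap s)
  show ?case
  proof
    fix I
    show "interp v (Cap s) w I = (\<Sum>J | length J = length (src (Cap s)). entry v (Cap s) I J * w J)"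
      by (cases I) (simp_all add: sum_lists_Suc sum_ind_conj sum.delta')
  qed
next
  case (Cup s)
  show ?case
  proof
    fix I
    show "interp v (Cup s) w I = (\<Sum>J | length J = length (src (Cup s)). entry v (Cup s) I J * w J)"
      by (auto split: list.splits)
  qed
next
  case (Disc l \<sigma>)
  have "v l w = (\<Sum>J | length J = length \<sigma>. v l (basis_tensor J) * w J)"
    using Disc.prems(2)[of l \<sigma>] Disc.prems(3) by (simp add: functional_def) (metis (no_types, lifting) restrict_apply')
  then show ?case by (auto simp: fun_eq_iff)
next
  case (Comp g f)
  have f: "interp v f w = (\<lambda>I. \<Sum>J | length J = length (src f). entry v f I J * w J)"
    using Comp by auto
  then have "interp v f w \<in> tensors (src g)"
    using Comp.prems(1) by (auto simp: tensors_def entry_zero)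
  then have "interp v g (interp v f w) = (\<lambda>I. \<Sum>K | length K = length (src g). entry v g I K * interp v f w K)"
    using Comp by auto
  then show ?case
    by (simp add: f sum_distrib_left sum_distrib_right fun_eq_iff mult.assoc)
      (subst sum.swap, simp)
next
  case (Juxt f g)
  have b: "interp v t (basis_tensor I) = (\<lambda>K. entry v t K I)"
    if "t = f \<or> t = g" "length I = length (src t)" for t and I :: "'n list"
  proof -
    have "interp v t (basis_tensor I) = (\<lambda>K. \<Sum>J | length J = length (src t). entry v t K J * basis_tensor I J)"
      using that Juxt by auto
    then show ?thesis using that by (simp add: sum_basis_tensor)
  qed
  show ?case
    by (auto simp: tensor_map_def sum_lists_append b fun_eq_iff mult_ac intro!: sum.cong)
qed

subsection \<open>Equivariance\<close>

text \<open>The dual is acted on by the transposed inverse, so this relation is what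
  \<open>signed_rep_contract\<close> uses to make caps and cups equivariant.\<close>

locale matrix_rep =
  fixes G :: "('g, 'b) monoid_scheme" and \<rho> :: "'g \<Rightarrow> 'k::field ^ 'n::finite ^ 'n"
  assumes inv_rep: "g \<in> carrier G \<Longrightarrow> \<rho> (inv\<^bsub>G\<^esub> g) ** \<rho> g = mat 1"
begin

definition tmat :: "sign list \<Rightarrow> 'g \<Rightarrow> 'n list \<Rightarrow> 'n list \<Rightarrow> 'k" where
  "tmat \<sigma> g I J = (\<Prod>p<length \<sigma>. signed_rep G \<rho> (\<sigma> ! p) g $ (I ! p) $ (J ! p))"

lemma tmat_simps [simp]:
  "tmat [] g I J = 1"
  "tmat (s # \<sigma>) g (i # I) (j # J) = signed_rep G \<rho> s g $ i $ j * tmat \<sigma> g I J"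
  by (simp_all add: tmat_def prod.lessThan_Suc_shift del: prod.lessThan_Suc)

lemma tmat_append:
  "length I = length \<alpha> \<Longrightarrow> length J = length \<alpha> \<Longrightarrow> tmat (\<alpha> @ \<beta>) g (I @ I') (J @ J') = tmat \<alpha> g I J * tmat \<beta> g I' J'"
proof (induction \<alpha> arbitrary: I J)
  case (Cons a \<alpha>)
  then show ?case by (cases I; cases J) (auto simp: mult.assoc)
qed auto

lemma signed_rep_contract:
  assumes "g \<in> carrier G"
  shows "(\<Sum>k\<in>UNIV. signed_rep G \<rho> s g $ k $ i * signed_rep G \<rho> (neg s) g $ k $ j) = (if i = j then 1 else 0)"
    and "(\<Sum>k\<in>UNIV. signed_rep G \<rho> s g $ i $ k * signed_rep G \<rho> (neg s) g $ j $ k) = (if i = j then 1 else 0)"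
proof -
  have 1: "(\<Sum>k\<in>UNIV. \<rho> (inv\<^bsub>G\<^esub> g) $ i $ k * \<rho> g $ k $ j) = (if i = j then 1 else 0)" for i j
    using arg_cong[OF inv_rep[OF assms], of "\<lambda>A. A $ i $ j"] by (simp add: matrix_matrix_mult_def mat_def)
  have "\<rho> g ** \<rho> (inv\<^bsub>G\<^esub> g) = mat 1"
    using inv_rep[OF assms] by (simp add: matrix_left_right_inverse)
  from arg_cong[OF this, of "\<lambda>A. A $ i $ j"]
  have 2: "(\<Sum>k\<in>UNIV. \<rho> g $ i $ k * \<rho> (inv\<^bsub>G\<^esub> g) $ k $ j) = (if i = j then 1 else 0)" for i j
    using arg_cong[OF \<open>\<rho> g ** \<rho> (inv\<^bsub>G\<^esub> g) = mat 1\<close>, of "\<lambda>A. A $ i $ j"]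
    by (simp add: matrix_matrix_mult_def mat_def)
  show "(\<Sum>k\<in>UNIV. signed_rep G \<rho> s g $ k $ i * signed_rep G \<rho> (neg s) g $ k $ j) = (if i = j then 1 else 0)"
    using 1[of j i] 1[of i j] by (cases s) (auto simp: signed_rep_def transpose_def mult.commute)
  show "(\<Sum>k\<in>UNIV. signed_rep G \<rho> s g $ i $ k * signed_rep G \<rho> (neg s) g $ j $ k) = (if i = j then 1 else 0)"
    using 2[of j i] 2[of i j] by (cases s) (auto simp: signed_rep_def transpose_def mult.commute)
qed

text \<open>Equivariance passes through composition and juxtaposition; caps and cups have it by
  \<open>signed_rep_contract\<close>, discs by assumption. With an empty upper boundary it says that
  the functional of a tangle is invariant.\<close>

lemma entry_equivariant:
  assumes g: "g \<in> carrier G" and "wf_diagram t"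
    and inv: "\<And>l \<sigma> J. (l, \<sigma>) \<in> set (discs t) \<Longrightarrow> length J = length \<sigma> \<Longrightarrow>
      (\<Sum>I | length I = length \<sigma>. v l (basis_tensor I) * tmat \<sigma> g I J) = v l (basis_tensor J)"
    and "length I = length (tgt t)" "length J = length (src t)"
  shows "(\<Sum>K | length K = length (src t). entry v t I K * tmat (src t) g K J) =
    (\<Sum>K | length K = length (tgt t). tmat (tgt t) g I K * entry v t K J)"
  using assms(2-)
proof (induction t arbitrary: I J)
  case (Strands \<sigma>)
  have "(\<Sum>K | length K = length \<sigma>. entry v (Strands \<sigma>) I K * tmat \<sigma> g K J) =
      (\<Sum>K | length K = length \<sigma>. if K = I then tmat \<sigma> g K J else 0)"
    using Strands by (intro sum.cong) auto
  moreover have "(\<Sum>K | length K = length \<sigma>. tmat \<sigma> g I K * entry v (Strands \<sigma>) K J) =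
      (\<Sum>K | length K = length \<sigma>. if K = J then tmat \<sigma> g I K else 0)"
    using Strands by (intro sum.cong) auto
  ultimately show ?case using Strands by simp
next
  case (Crossing a b)
  then obtain i j k l where "I = [i, j]" "J = [k, l]" by (auto simp: length_2)
  then show ?case by (simp add: sum_lists_Suc sum_ind_conj mult.commute)
next
  case (Cap s)
  then obtain k l where "I = []" "J = [k, l]" by (auto simp: length_2)
  then show ?case using signed_rep_contract(1)[OF g, of s k l]
    by (simp add: sum_lists_Suc sum_ind_conj sum.delta')
next
  case (Cup s)
  then obtain k l where "J = []" "I = [k, l]" by (auto simp: length_2)
  then show ?case using signed_rep_contract(2)[OF g, of s k l]
    by (simp add: sum_lists_Suc sum_ind_conj sum.delta' if_distrib[of "\<lambda>x. _ * x"] cong: if_cong)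
next
  case (Disc l \<sigma>)
  then show ?case by simp
next
  case (Comp h f)
  have "(\<Sum>K | length K = length (src f). entry v (h \<circ>\<^sub>t f) I K * tmat (src f) g K J) =
      (\<Sum>L | length L = length (src h). entry v h I L * (\<Sum>K | length K = length (src f). entry v f L K * tmat (src f) g K J))"
    by (simp add: sum_distrib_left sum_distrib_right mult.assoc) (subst sum.swap, simp)
  also have "\<dots> = (\<Sum>L | length L = length (src h). entry v h I L *
      (\<Sum>K | length K = length (src h). tmat (src h) g L K * entry v f K J))"
    using Comp by (intro sum.cong) auto
  also have "\<dots> = (\<Sum>K | length K = length (src h).
      (\<Sum>L | length L = length (src h). entry v h I L * tmat (src h) g L K) * entry v f K J)"
    by (simp add: sum_distrib_left sum_distrib_right mult.assoc) (subst sum.swap, simp)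
  also have "\<dots> = (\<Sum>K | length K = length (src h).
      (\<Sum>L | length L = length (tgt h). tmat (tgt h) g I L * entry v h L K) * entry v f K J)"
    using Comp by (intro sum.cong) auto
  also have "\<dots> = (\<Sum>K | length K = length (tgt h). tmat (tgt h) g I K * entry v (h \<circ>\<^sub>t f) K J)"
    by (simp add: sum_distrib_left sum_distrib_right mult.assoc) (subst sum.swap, simp)
  finally show ?case by simp
next
  case (Juxt f h)
  obtain I1 I2 where I: "I = I1 @ I2" "length I1 = length (tgt f)" "length I2 = length (tgt h)"
    using Juxt.prems(3) that[of "take (length (tgt f)) I" "drop (length (tgt f)) I"] by auto
  obtain J1 J2 where J: "J = J1 @ J2" "length J1 = length (src f)" "length J2 = length (src h)"
    using Juxt.prems(4) that[of "take (length (src f)) J" "drop (length (src f)) J"] by auto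
  have "(\<Sum>K | length K = length (src (f \<otimes>\<^sub>t h)). entry v (f \<otimes>\<^sub>t h) I K * tmat (src (f \<otimes>\<^sub>t h)) g K J) =
      (\<Sum>K | length K = length (src f). entry v f I1 K * tmat (src f) g K J1) *
      (\<Sum>K | length K = length (src h). entry v h I2 K * tmat (src h) g K J2)"
    using I J by (auto simp: sum_lists_append sum_product tmat_append mult_ac intro!: sum.cong)
  also have "\<dots> = (\<Sum>K | length K = length (tgt f). tmat (tgt f) g I1 K * entry v f K J1) *
      (\<Sum>K | length K = length (tgt h). tmat (tgt h) g I2 K * entry v h K J2)"
    using Juxt I J by simp
  also have "\<dots> = (\<Sum>K | length K = length (tgt (f \<otimes>\<^sub>t h)). tmat (tgt (f \<otimes>\<^sub>t h)) g I K * entry v (f \<otimes>\<^sub>t h) K J)"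
    using I J by (auto simp: sum_lists_append sum_product tmat_append mult_ac intro!: sum.cong)
  finally show ?case .
qed

end

section \<open>The planar algebra of a representation\<close>

lemma tensors_lincomb: "w \<in> tensors \<sigma> \<Longrightarrow> w' \<in> tensors \<sigma> \<Longrightarrow> (\<lambda>I. w I + w' I) \<in> tensors \<sigma>"
  "w \<in> tensors \<sigma> \<Longrightarrow> (\<lambda>I. a * w I) \<in> tensors \<sigma>"
  by (auto simp: tensors_def)

lemma functional_add: "(\<lambda>w\<in>tensors \<sigma>. functional \<sigma> c w + functional \<sigma> d w) = functional \<sigma> (\<lambda>J. c J + d J)"
  by (auto simp: functional_def sum.distrib distrib_right intro!: restrict_ext)

lemma functional_smult: "(\<lambda>w\<in>tensors \<sigma>. a * functional \<sigma> c w) = functional \<sigma> (\<lambda>J. a * c J)"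
  by (auto simp: functional_def sum_distrib_left mult.assoc intro!: restrict_ext)

context matrix_rep
begin

abbreviation A :: "('k, ('n list \<Rightarrow> 'k) \<Rightarrow> 'k) ospa_data" where "A \<equiv> rep_ospa G \<rho>"

lemma tensor_rep_tmat:
  "tensor_rep G \<rho> \<sigma> g w = (\<lambda>I. if length I = length \<sigma> then \<Sum>J | length J = length \<sigma>. tmat \<sigma> g I J * w J else 0)"
  unfolding tensor_rep_def tmat_def by (rule HOL.refl)

lemma tensor_rep_in [simp]: "tensor_rep G \<rho> \<sigma> g w \<in> tensors \<sigma>"
  by (simp add: tensor_rep_def tensors_def)

lemma invariant_functional:
  assumes "f \<in> invariant_functionals G \<rho> \<sigma>"
  shows "f = functional \<sigma> (\<lambda>J. f (basis_tensor J))"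
  using assms unfolding invariant_functionals_def by (intro linear_functional) auto

lemma invariant_coeffs:
  assumes f: "f \<in> invariant_functionals G \<rho> \<sigma>" and g: "g \<in> carrier G" and J: "length J = length \<sigma>"
  shows "(\<Sum>I | length I = length \<sigma>. f (basis_tensor I) * tmat \<sigma> g I J) = f (basis_tensor J)"
proof -
  have t: "tensor_rep G \<rho> \<sigma> g (basis_tensor J) = (\<lambda>I. if length I = length \<sigma> then tmat \<sigma> g I J else 0)"
    using J by (simp add: tensor_rep_tmat sum_basis_tensor cong: if_cong)
  have "f (basis_tensor J) = f (tensor_rep G \<rho> \<sigma> g (basis_tensor J))"
    using f g J by (simp add: invariant_functionals_def)
  also have "\<dots> = functional \<sigma> (\<lambda>J. f (basis_tensor J)) (tensor_rep G \<rho> \<sigma> g (basis_tensor J))"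
    using invariant_functional[OF f] by metis
  also have "\<dots> = (\<Sum>I | length I = length \<sigma>. f (basis_tensor I) * tmat \<sigma> g I J)"
    unfolding functional_def restrict_apply'[OF tensor_rep_in] by (simp add: t)
  finally show ?thesis ..
qed

lemma functional_invariant:
  assumes "\<And>g J. g \<in> carrier G \<Longrightarrow> length J = length \<sigma> \<Longrightarrow> (\<Sum>I | length I = length \<sigma>. c I * tmat \<sigma> g I J) = c J"
  shows "functional \<sigma> c \<in> invariant_functionals G \<rho> \<sigma>"
proof -
  have "functional \<sigma> c (tensor_rep G \<rho> \<sigma> g w) = functional \<sigma> c w" if "g \<in> carrier G" "w \<in> tensors \<sigma>" for g w
  proof -
    have "functional \<sigma> c (tensor_rep G \<rho> \<sigma> g w) =
        (\<Sum>I | length I = length \<sigma>. c I * (\<Sum>J | length J = length \<sigma>. tmat \<sigma> g I J * w J))"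
      unfolding functional_def restrict_apply'[OF tensor_rep_in] by (simp add: tensor_rep_tmat)
    also have "\<dots> = (\<Sum>J | length J = length \<sigma>. (\<Sum>I | length I = length \<sigma>. c I * tmat \<sigma> g I J) * w J)"
      by (simp add: sum_distrib_left sum_distrib_right mult.assoc) (subst sum.swap, simp)
    also have "\<dots> = functional \<sigma> c w"
      using that by (simp add: functional_def assms)
    finally show ?thesis .
  qed
  then show ?thesis
    unfolding invariant_functionals_def
    by (auto simp: functional_ext functional_def tensors_lincomb sum.distrib distrib_left sum_distrib_left mult_ac)
qed

lemma carrier_A: "carrier (box_space A \<sigma>) = invariant_functionals G \<rho> \<sigma>"
  by (simp add: rep_ospa_def)

lemma box_A_simps:
  "f \<oplus>\<^bsub>box_space A \<sigma>\<^esub> h = (\<lambda>w\<in>tensors \<sigma>. f w + h w)"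
  "smult (box_space A \<sigma>) a f = (\<lambda>w\<in>tensors \<sigma>. a * f w)"
  "\<zero>\<^bsub>box_space A \<sigma>\<^esub> = (\<lambda>w\<in>tensors \<sigma>. 0)"
  by (simp_all add: rep_ospa_def)

lemma invariant_add:
  assumes "f \<in> invariant_functionals G \<rho> \<sigma>" "h \<in> invariant_functionals G \<rho> \<sigma>"
  shows "(\<lambda>w\<in>tensors \<sigma>. f w + h w) \<in> invariant_functionals G \<rho> \<sigma>"
  using assms unfolding invariant_functionals_def by (auto simp: tensors_lincomb distrib_left)

lemma invariant_smult:
  assumes "f \<in> invariant_functionals G \<rho> \<sigma>"
  shows "(\<lambda>w\<in>tensors \<sigma>. a * f w) \<in> invariant_functionals G \<rho> \<sigma>"
  using assms unfolding invariant_functionals_def by (auto simp: tensors_lincomb distrib_left mult_ac)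

lemma invariant_zero: "(\<lambda>w\<in>tensors \<sigma>. 0) \<in> invariant_functionals G \<rho> \<sigma>"
  unfolding invariant_functionals_def by (auto simp: tensors_lincomb)

lemma invariant_ext: "f \<in> invariant_functionals G \<rho> \<sigma> \<Longrightarrow> f \<in> extensional (tensors \<sigma>)"
  by (simp add: invariant_functionals_def)

lemma module_A: "module scalars (box_space A \<sigma>)"
proof (rule moduleI)
  show "abelian_group (box_space A \<sigma>)"
  proof (rule abelian_groupI)
    fix f assume f: "f \<in> carrier (box_space A \<sigma>)"
    show "\<zero>\<^bsub>box_space A \<sigma>\<^esub> \<oplus>\<^bsub>box_space A \<sigma>\<^esub> f = f"
      using invariant_ext[OF f[unfolded carrier_A]]
      by (auto simp: box_A_simps fun_eq_iff extensional_def)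
    show "\<exists>h\<in>carrier (box_space A \<sigma>). h \<oplus>\<^bsub>box_space A \<sigma>\<^esub> f = \<zero>\<^bsub>box_space A \<sigma>\<^esub>"
      using invariant_smult[OF f[unfolded carrier_A], of "-1"]
      by (intro bexI[of _ "\<lambda>w\<in>tensors \<sigma>. -1 * f w"]) (auto simp: box_A_simps carrier_A intro!: restrict_ext)
  qed (auto simp: carrier_A box_A_simps invariant_add invariant_zero add_ac intro!: restrict_ext)
next
  fix f assume f: "f \<in> carrier (box_space A \<sigma>)"
  show "smult (box_space A \<sigma>) \<one>\<^bsub>scalars\<^esub> f = f"
    using invariant_ext[OF f[unfolded carrier_A]]
    by (auto simp: box_A_simps fun_eq_iff extensional_def)
qed (auto simp: cring_scalars carrier_A box_A_simps invariant_smult algebra_simps intro!: restrict_ext)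

lemma inputs_A: "inputs A T v \<longleftrightarrow> (\<forall>(l, \<tau>)\<in>set (discs T). v l \<in> invariant_functionals G \<rho> \<tau>)"
  by (simp add: inputs_def carrier_A)

lemma act_A_eq:
  assumes "tangle \<sigma> T" "\<And>l \<tau>. (l, \<tau>) \<in> set (discs T) \<Longrightarrow> v l = functional \<tau> (\<lambda>J. v l (basis_tensor J))"
  shows "act A T v = functional \<sigma> (entry v T [])"
  using assms interp_entry[of T v]
  by (auto simp: rep_ospa_def functional_def tangle_def intro!: restrict_ext)

lemma act_A:
  assumes "tangle \<sigma> T" "inputs A T v"
  shows "act A T v = functional \<sigma> (entry v T [])"
  using assms invariant_functional unfolding inputs_A by (intro act_A_eq) auto

lemma act_A_closed:
  assumes T: "tangle \<sigma> T" and v: "inputs A T v"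
  shows "act A T v \<in> invariant_functionals G \<rho> \<sigma>"
  unfolding act_A[OF T v]
proof (rule functional_invariant)
  fix g J assume g: "g \<in> carrier G" and J: "length (J :: 'n list) = length \<sigma>"
  have "(\<Sum>K | length K = length (src T). entry v T [] K * tmat (src T) g K J) =
      (\<Sum>K | length K = length (tgt T). tmat (tgt T) g [] K * entry v T K J)"
    using T J v invariant_coeffs[OF _ g] unfolding inputs_A
    by (intro entry_equivariant[OF g]) (auto simp: tangle_def)
  then show "(\<Sum>I | length I = length \<sigma>. entry v T [] I * tmat \<sigma> g I J) = entry v T [] J"
    using T by (simp add: tangle_def)
qed

theorem ospa_A: "ospa A"
proof (rule ospa.intro)
  fix \<sigma> T and v w :: "nat \<Rightarrow> ('n list \<Rightarrow> 'k) \<Rightarrow> 'k"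
  assume T: "tangle \<sigma> T" and v: "inputs A T v"
  have wf: "wf_diagram T" "distinct (map fst (discs T))" using T by (auto simp: tangle_def)
  show "act A T v \<in> carrier (box_space A \<sigma>)"
    unfolding carrier_A by (rule act_A_closed[OF T v])
  show "act A T v = act A T w" if "\<And>l. l \<in> labels T \<Longrightarrow> v l = w l"
  proof -
    have "inputs A T w" using v that unfolding inputs_A by force
    moreover have "entry v T = entry w T" using that by (intro entry_cong) force
    ultimately show ?thesis using act_A[OF T] v by simp
  qed
  show "act A T v = act A T' v" if "T \<approx>\<^sub>t T'" for T'
  proof -
    have "tangle \<sigma> T'" "inputs A T' v"
      using tangle_tangle_eq[OF T that] v by (auto simp: inputs_A)
    then show ?thesis using act_A[OF T v] act_A[of \<sigma> T' v] entry_tangle_eq[OF that] by metis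
  qed
  fix l \<tau> assume l: "(l, \<tau>) \<in> set (discs T)"
  have inp: "inputs A T (v(l := x))" if "x \<in> invariant_functionals G \<rho> \<tau>" for x
    using v that l wf(2) unfolding inputs_A by (auto dest: eq_key_imp_eq_value)
  have lin: "entry (v(l := z)) T [] J = a * entry (v(l := x)) T [] J + entry (v(l := y)) T [] J"
    if "\<And>J. length J = length \<tau> \<Longrightarrow> z (basis_tensor J) = a * x (basis_tensor J) + y (basis_tensor J)"
    for a x y z J
    by (rule entry_linear[OF wf(2) l]) (rule that)
  show "linear_map (box_space A \<tau>) (box_space A \<sigma>) (\<lambda>x. act A T (v(l := x)))"
    unfolding linear_map_def carrier_A box_A_simps
  proof (intro conjI ballI allI)
    show "(\<lambda>x. act A T (v(l := x))) \<in> invariant_functionals G \<rho> \<tau> \<rightarrow> invariant_functionals G \<rho> \<sigma>"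
      using act_A_closed[OF T inp] by auto
  next
    fix x y assume x: "x \<in> invariant_functionals G \<rho> \<tau>" and y: "y \<in> invariant_functionals G \<rho> \<tau>"
    show "act A T (v(l := \<lambda>w\<in>tensors \<tau>. x w + y w)) = (\<lambda>w\<in>tensors \<sigma>. act A T (v(l := x)) w + act A T (v(l := y)) w)"
      unfolding act_A[OF T inp[OF x]] act_A[OF T inp[OF y]] act_A[OF T inp[OF invariant_add[OF x y]]] functional_add
      by (intro functional_eqI, subst lin[where a = 1 and x = x and y = y]) auto
  next
    fix a x assume x: "x \<in> invariant_functionals G \<rho> \<tau>"
    have 0: "entry (v(l := \<lambda>_. 0)) T [] J = 0" for J
      using lin[of "\<lambda>_. 0" "-1" "\<lambda>_. 0" "\<lambda>_. 0" J] by simp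
    show "act A T (v(l := \<lambda>w\<in>tensors \<tau>. a * x w)) = (\<lambda>w\<in>tensors \<sigma>. a * act A T (v(l := x)) w)"
      unfolding act_A[OF T inp[OF x]] act_A[OF T inp[OF invariant_smult[OF x]]] functional_smult
      by (intro functional_eqI, subst lin[where a = a and x = x and y = "\<lambda>_. 0"]) (auto simp: 0)
  qed
next
  fix \<sigma> T \<pi> and v :: "nat \<Rightarrow> ('n list \<Rightarrow> 'k) \<Rightarrow> 'k"
  assume T: "tangle \<sigma> T" and \<pi>: "inj_on \<pi> (labels T)" and v: "inputs A (map_diagram \<pi> T) v"
  have "inputs A T (v \<circ> \<pi>)" using v by (auto simp: inputs_A)
  then show "act A (map_diagram \<pi> T) v = act A T (v \<circ> \<pi>)"
    using act_A[OF tangle_map[OF T \<pi>] v] act_A[OF T] by (simp add: entry_map o_def)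
next
  fix x :: "('n list \<Rightarrow> 'k) \<Rightarrow> 'k" and \<sigma> l
  assume x: "x \<in> carrier (box_space A \<sigma>)"
  have "act A (Disc l \<sigma>) (\<lambda>_. x) = (\<lambda>w\<in>tensors \<sigma>. x w)"
    by (simp add: rep_ospa_def)
  then show "act A (Disc l \<sigma>) (\<lambda>_. x) = x"
    using invariant_ext[OF x[unfolded carrier_A]] by (simp add: extensional_restrict)
next
  fix \<sigma> T l \<tau> S and v :: "nat \<Rightarrow> ('n list \<Rightarrow> 'k) \<Rightarrow> 'k"
  assume T: "tangle \<sigma> T" and l: "(l, \<tau>) \<in> set (discs T)" and S: "tangle \<tau> S"
    and disj: "(labels T - {l}) \<inter> labels S = {}" and v: "inputs A (insert_tangle l S T) v"
  note D = discs_insert_tangle[OF l, of S]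
  have uniq: "\<rho> = \<tau>" if "(l, \<rho>) \<in> set (discs T)" for \<rho>
    using that l T unfolding tangle_def by (metis eq_key_imp_eq_value)
  have vS: "inputs A S v" using v unfolding inputs_A D by auto
  have vT: "inputs A T (v(l := act A S v))"
    using v act_A_closed[OF S vS] uniq unfolding inputs_A D ball_Un by auto
  have "entry v (insert_tangle l S T) = entry (v(l := act A S v)) T"
    unfolding insert_tangle_def
  proof (rule entry_fill)
    show "fits (\<lambda>i \<sigma>. if i = l then S else Disc i \<sigma>) T"
      using S uniq unfolding fits_def tangle_def by (auto split: if_splits)
    fix j \<rho> and J :: "'n list"
    assume "(j, \<rho>) \<in> set (discs T)" "length J = length \<rho>"
    then show "(v(l := act A S v)) j (basis_tensor J) = entry v (if j = l then S else Disc j \<rho>) [] J"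
      using uniq act_A[OF S vS] by auto
  qed
  then show "act A (insert_tangle l S T) v = act A T (v(l := act A S v))"
    using act_A[OF tangle_insert_tangle[OF T l S disj] v] act_A[OF T vT] by simp
qed (rule module_A)

end

section \<open>Maps out of a presented planar algebra\<close>

locale evaluation = matrix_rep G \<rho>
  for G :: "('g, 'b) monoid_scheme" and \<rho> :: "'g \<Rightarrow> 'k::field ^ 'n::finite ^ 'n" +
  fixes deg :: "'v \<Rightarrow> sign list" and val :: "'v \<Rightarrow> ('n list \<Rightarrow> 'k) \<Rightarrow> 'k"
  assumes val_invariant: "val g \<in> invariant_functionals G \<rho> (deg g)"
begin

abbreviation F :: "('k, 'v diagram set \<Rightarrow> 'k) ospa_data" where "F \<equiv> free_ospa deg"

definition class_entry :: "'v diagram set \<Rightarrow> 'n list \<Rightarrow> 'k" where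
  "class_entry c = entry val (SOME t. t \<in> c) []"

definition coeffs :: "('v diagram set \<Rightarrow> 'k) \<Rightarrow> 'n list \<Rightarrow> 'k" where
  "coeffs x J = (\<Sum>c\<in>support x. x c * class_entry c J)"

definition eval_map :: "sign list \<Rightarrow> ('v diagram set \<Rightarrow> 'k) \<Rightarrow> ('n list \<Rightarrow> 'k) \<Rightarrow> 'k" where
  "eval_map \<sigma> x = functional \<sigma> (coeffs x)"

lemma class_entry: "wf_diagram t \<Longrightarrow> class_entry (tangle_class t) = entry val t []"
proof -
  assume "wf_diagram t"
  then have "t \<in> tangle_class t" by (simp add: tangle_class_def tangle_eq.refl)
  then have "(SOME t'. t' \<in> tangle_class t) \<in> tangle_class t" by (rule someI)
  then have "t \<approx>\<^sub>t (SOME t'. t' \<in> tangle_class t)" by (simp add: tangle_class_def)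
  then show ?thesis by (simp add: class_entry_def entry_tangle_eq)
qed

lemma coeffs_superset: "finite S \<Longrightarrow> support x \<subseteq> S \<Longrightarrow> coeffs x J = (\<Sum>c\<in>S. x c * class_entry c J)"
  unfolding coeffs_def by (rule sum.mono_neutral_left) (auto simp: support_def)

lemma coeffs_lincomb:
  assumes "finite (support x)" "finite (support y)"
  shows "coeffs (\<lambda>c. a * x c + y c) J = a * coeffs x J + coeffs y J"
proof -
  let ?S = "support x \<union> support y"
  have "support (\<lambda>c. a * x c + y c) \<subseteq> ?S" by (auto simp: support_def)
  then show ?thesis
    using assms coeffs_superset[of ?S x J] coeffs_superset[of ?S y J]
      coeffs_superset[of ?S "\<lambda>c. a * x c + y c" J]
    by (simp add: sum_distrib_left sum.distrib distrib_right mult.assoc)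
qed

lemma coeffs_single: "wf_diagram t \<Longrightarrow> coeffs (single (tangle_class t)) J = entry val t [] J"
  by (simp add: coeffs_def class_entry) (simp add: single_def)

lemma vertex_val: "t \<in> vertex_diagrams deg \<sigma> \<Longrightarrow> (l, \<tau>) \<in> set (discs t) \<Longrightarrow> val l \<in> invariant_functionals G \<rho> \<tau>"
  using val_invariant by (auto simp: vertex_diagrams_def)

lemma eval_map_closed:
  assumes x: "x \<in> finsupp (vertex_tangles deg \<sigma>)"
  shows "eval_map \<sigma> x \<in> invariant_functionals G \<rho> \<sigma>"
  unfolding eval_map_def
proof (rule functional_invariant)
  fix g and J :: "'n list" assume g: "g \<in> carrier G" and J: "length J = length \<sigma>"
  have inv: "(\<Sum>I | length I = length \<sigma>. class_entry c I * tmat \<sigma> g I J) = class_entry c J" if c: "c \<in> support x" for c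
  proof -
    obtain t where t: "t \<in> vertex_diagrams deg \<sigma>" "c = tangle_class t"
      using x c by (auto simp: finsupp_def vertex_tangles_eq)
    have "(\<Sum>K | length K = length (src t). entry val t [] K * tmat (src t) g K J) =
        (\<Sum>K | length K = length (tgt t). tmat (tgt t) g [] K * entry val t K J)"
      using t J invariant_coeffs[OF vertex_val[OF t(1)] g]
      by (intro entry_equivariant[OF g]) (auto simp: vertex_diagrams_def)
    then show ?thesis using t by (simp add: vertex_diagrams_def class_entry)
  qed
  have "(\<Sum>I | length I = length \<sigma>. coeffs x I * tmat \<sigma> g I J) =
      (\<Sum>c\<in>support x. x c * (\<Sum>I | length I = length \<sigma>. class_entry c I * tmat \<sigma> g I J))"
    unfolding coeffs_def by (simp add: sum_distrib_left sum_distrib_right mult.assoc) (subst sum.swap, simp)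
  then show "(\<Sum>I | length I = length \<sigma>. coeffs x I * tmat \<sigma> g I J) = coeffs x J"
    by (simp add: inv coeffs_def)
qed

lemma eval_map_lincomb:
  assumes "x \<in> finsupp (vertex_tangles deg \<sigma>)" "y \<in> finsupp (vertex_tangles deg \<sigma>)"
  shows "eval_map \<sigma> (\<lambda>c. a * x c + y c) = functional \<sigma> (\<lambda>J. a * coeffs x J + coeffs y J)"
  unfolding eval_map_def using assms by (intro functional_eqI) (simp add: coeffs_lincomb finsupp_def)

lemma eval_map_zero_iff: "eval_map \<sigma> x = \<zero>\<^bsub>box_space A \<sigma>\<^esub> \<longleftrightarrow> (\<forall>J. length J = length \<sigma> \<longrightarrow> coeffs x J = 0)"
proof
  assume *: "eval_map \<sigma> x = \<zero>\<^bsub>box_space A \<sigma>\<^esub>"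
  show "\<forall>J. length J = length \<sigma> \<longrightarrow> coeffs x J = 0"
  proof (intro allI impI)
    fix J :: "'n list" assume J: "length J = length \<sigma>"
    from * have "eval_map \<sigma> x (basis_tensor J) = \<zero>\<^bsub>box_space A \<sigma>\<^esub> (basis_tensor J)" by simp
    with J show "coeffs x J = 0" by (simp add: eval_map_def box_A_simps)
  qed
next
  assume "\<forall>J. length J = length \<sigma> \<longrightarrow> coeffs x J = 0"
  then show "eval_map \<sigma> x = \<zero>\<^bsub>box_space A \<sigma>\<^esub>"
    unfolding eval_map_def box_A_simps functional_def by (intro restrict_ext) simp
qed

text \<open>Both sides are multilinear in \<open>v\<close>. On diagrams the claim is
  \<open>entry_fill\<close>: substituting diagrams and then evaluating equals evaluating with the
  discs replaced by the functionals of those diagrams.\<close>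

lemma eval_map_act:
  assumes T: "tangle \<sigma> T" and v: "inputs F T v"
    and w: "\<And>l \<tau>. (l, \<tau>) \<in> set (discs T) \<Longrightarrow> w l = eval_map \<tau> (v l)"
  shows "eval_map \<sigma> (act F T v) = act A T w"
proof -
  have wf: "wf_diagram T" "distinct (map fst (discs T))" using T by (auto simp: tangle_def)
  define ty where "ty l = the (map_of (discs T) l)" for l
  have ty: "ty l = \<tau>" if "(l, \<tau>) \<in> set (discs T)" for l \<tau>
    using that wf by (simp add: ty_def)
  have main: "coeffs (act F T v) J = entry (\<lambda>l. eval_map (ty l) (v l)) T [] J" for J
  proof (rule free_eqI[OF wf(2), where F = "\<lambda>v. coeffs (act F T v) J" and deg = deg and
        G = "\<lambda>v. entry (\<lambda>l. eval_map (ty l) (v l)) T [] J"])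
    fix v :: "nat \<Rightarrow> 'v diagram set \<Rightarrow> 'k" and l \<tau> a and x y :: "'v diagram set \<Rightarrow> 'k"
    assume v: "inputs F T v" and l: "(l, \<tau>) \<in> set (discs T)"
      and xy: "x \<in> finsupp (vertex_tangles deg \<tau>)" "y \<in> finsupp (vertex_tangles deg \<tau>)"
    have l': "l \<in> labels T" using l by force
    have "act F T (v(l := \<lambda>c. a * x c + y c)) = (\<lambda>c. a * act F T (v(l := x)) c + act F T (v(l := y)) c)"
      using inputs_free_finite[OF v] l' xy by (intro ext act_free_linear) (auto simp: finsupp_def)
    moreover have "finite (support (act F T (v(l := z))))" if "z \<in> finsupp (vertex_tangles deg \<tau>)" for z
      using act_free_closed[OF T inputs_free_upd[OF v wf(2) l that]] by (simp add: finsupp_def)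
    ultimately show "coeffs (act F T (v(l := \<lambda>c. a * x c + y c))) J =
        a * coeffs (act F T (v(l := x))) J + coeffs (act F T (v(l := y))) J"
      using xy by (simp add: coeffs_lincomb)
    have upd: "(\<lambda>j. eval_map (ty j) ((v(l := z)) j)) = (\<lambda>j. eval_map (ty j) (v j))(l := eval_map \<tau> z)" for z
      using ty[OF l] by auto
    show "entry (\<lambda>j. eval_map (ty j) ((v(l := \<lambda>c. a * x c + y c)) j)) T [] J =
        a * entry (\<lambda>j. eval_map (ty j) ((v(l := x)) j)) T [] J + entry (\<lambda>j. eval_map (ty j) ((v(l := y)) j)) T [] J"
      unfolding upd
    proof (rule entry_linear[OF wf(2) l])
      fix K :: "'n list" assume "length K = length \<tau>"
      then show "eval_map \<tau> (\<lambda>c. a * x c + y c) (basis_tensor K) =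
          a * eval_map \<tau> x (basis_tensor K) + eval_map \<tau> y (basis_tensor K)"
        using xy by (simp add: eval_map_def coeffs_lincomb finsupp_def)
    qed
  next
    fix v :: "nat \<Rightarrow> 'v diagram set \<Rightarrow> 'k" and s
    assume s: "fits_vertices deg T s" and v: "\<And>l. l \<in> labels T \<Longrightarrow> v l = single (tangle_class (s l))"
    have "wf_diagram (fill (\<lambda>l _. s l) T)" using fill_typed[OF fits_verticesD[OF s]] wf by simp
    then have "coeffs (act F T v) J = entry val (fill (\<lambda>l _. s l) T) [] J"
      using act_free_basis[OF wf(1) s v] by (simp add: coeffs_single)
    also have "entry val (fill (\<lambda>l _. s l) T) = entry (\<lambda>l. eval_map (ty l) (v l)) T"
    proof (rule entry_fill[OF fits_verticesD[OF s]])
      fix l \<tau> and K :: "'n list" assume l: "(l, \<tau>) \<in> set (discs T)" "length K = length \<tau>"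
      have "wf_diagram (s l)" using s l unfolding fits_vertices_def vertex_diagrams_def by auto
      moreover have "v l = single (tangle_class (s l))" using l by (intro v) force
      ultimately show "eval_map (ty l) (v l) (basis_tensor K) = entry val (s l) [] K"
        using l ty by (simp add: eval_map_def coeffs_single)
    qed
    finally show "coeffs (act F T v) J = entry (\<lambda>l. eval_map (ty l) (v l)) T [] J" .
  qed (rule v)
  have "inputs A T w"
    unfolding inputs_A using w v eval_map_closed unfolding inputs_free by auto
  then have "act A T w = functional \<sigma> (entry w T [])" by (rule act_A[OF T])
  also have "entry w T = entry (\<lambda>l. eval_map (ty l) (v l)) T"
    using w ty by (intro entry_cong) auto
  finally show ?thesis
    unfolding eval_map_def main by simp
qed

lemma kernel_ideal:
  "planar_ideal F (\<lambda>\<sigma>. {x \<in> carrier (box_space F \<sigma>). eval_map \<sigma> x = \<zero>\<^bsub>box_space A \<sigma>\<^esub>})"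
  unfolding planar_ideal_def
proof (intro conjI allI impI)
  fix \<sigma>
  interpret module scalars "box_space F \<sigma>" by (rule module_free)
  have lin: "(\<lambda>c. a * x c + y c) \<in> {x \<in> carrier (box_space F \<sigma>). eval_map \<sigma> x = \<zero>\<^bsub>box_space A \<sigma>\<^esub>}"
    if "x \<in> {x \<in> carrier (box_space F \<sigma>). eval_map \<sigma> x = \<zero>\<^bsub>box_space A \<sigma>\<^esub>}"
      "y \<in> {x \<in> carrier (box_space F \<sigma>). eval_map \<sigma> x = \<zero>\<^bsub>box_space A \<sigma>\<^esub>}" for a x y
    using that by (auto simp: carrier_free eval_map_zero_iff coeffs_lincomb finsupp_def finsupp_lincomb[unfolded finsupp_def, simplified])
  have zero: "(\<lambda>_. 0) \<in> {x \<in> carrier (box_space F \<sigma>). eval_map \<sigma> x = \<zero>\<^bsub>box_space A \<sigma>\<^esub>}"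
    by (auto simp: carrier_free eval_map_zero_iff coeffs_def support_def)
  show "submodule {x \<in> carrier (box_space F \<sigma>). eval_map \<sigma> x = \<zero>\<^bsub>box_space A \<sigma>\<^esub>} scalars (box_space F \<sigma>)"
  proof (rule submoduleI)
    fix x assume x: "x \<in> {x \<in> carrier (box_space F \<sigma>). eval_map \<sigma> x = \<zero>\<^bsub>box_space A \<sigma>\<^esub>}"
    have "\<ominus>\<^bsub>box_space F \<sigma>\<^esub> x = smult (box_space F \<sigma>) (-1) x"
      using x finsupp_lincomb[of x _ "\<lambda>_. 0" "-1"]
      by (intro minus_equality) (auto simp: free_box_simps carrier_free)
    also have "\<dots> = (\<lambda>c. -1 * x c + 0)" by (simp add: free_box_simps)
    finally show "\<ominus>\<^bsub>box_space F \<sigma>\<^esub> x \<in> {x \<in> carrier (box_space F \<sigma>). eval_map \<sigma> x = \<zero>\<^bsub>box_space A \<sigma>\<^esub>}"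
      using lin[OF x zero, of "-1"] by simp
  next
    fix x y assume xy: "x \<in> {x \<in> carrier (box_space F \<sigma>). eval_map \<sigma> x = \<zero>\<^bsub>box_space A \<sigma>\<^esub>}"
      "y \<in> {x \<in> carrier (box_space F \<sigma>). eval_map \<sigma> x = \<zero>\<^bsub>box_space A \<sigma>\<^esub>}"
    show "x \<oplus>\<^bsub>box_space F \<sigma>\<^esub> y \<in> {x \<in> carrier (box_space F \<sigma>). eval_map \<sigma> x = \<zero>\<^bsub>box_space A \<sigma>\<^esub>}"
      using lin[OF xy, of 1] by (simp add: free_box_simps)
  next
    fix a x assume x: "x \<in> {x \<in> carrier (box_space F \<sigma>). eval_map \<sigma> x = \<zero>\<^bsub>box_space A \<sigma>\<^esub>}"
    show "smult (box_space F \<sigma>) a x \<in> {x \<in> carrier (box_space F \<sigma>). eval_map \<sigma> x = \<zero>\<^bsub>box_space A \<sigma>\<^esub>}"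
      using lin[OF x zero, of a] by (simp add: free_box_simps)
  qed (use zero in \<open>auto simp: free_box_simps\<close>)
next
  fix \<sigma> T v l \<tau>
  assume T: "tangle \<sigma> T" and v: "inputs F T v" and l: "(l, \<tau>) \<in> set (discs T)"
    and z: "v l \<in> {x \<in> carrier (box_space F \<tau>). eval_map \<tau> x = \<zero>\<^bsub>box_space A \<tau>\<^esub>}"
  have dist: "distinct (map fst (discs T))" using T by (simp add: tangle_def)
  define w where "w j = eval_map (the (map_of (discs T) j)) (v j)" for j
  have w: "w j = eval_map \<rho> (v j)" if "(j, \<rho>) \<in> set (discs T)" for j \<rho>
    using that dist by (simp add: w_def)
  have wl: "w l (basis_tensor J) = 0" if "length J = length \<tau>" for J
    using z that by (simp add: w[OF l] box_A_simps)
  \<comment> \<open>As \<open>w l\<close> vanishes on basis tensors it equals - \<open>w l\<close> +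
    \<open>w l\<close> there, and linearity in this slot gives E = - E + E for the entry.\<close>
  have "entry (w(l := w l)) T [] J = -1 * entry (w(l := w l)) T [] J + entry (w(l := w l)) T [] J" for J
    by (rule entry_linear[OF dist l]) (simp add: wl)
  then have "entry w T [] J = 0" for J by simp
  moreover have "eval_map \<sigma> (act F T v) = functional \<sigma> (entry w T [])"
    using eval_map_act[OF T v w] act_A[OF T] v w eval_map_closed
    unfolding inputs_A inputs_free by (metis (no_types, lifting) case_prodD case_prodI2)
  ultimately have "eval_map \<sigma> (act F T v) = \<zero>\<^bsub>box_space A \<sigma>\<^esub>"
    by (auto simp: functional_def box_A_simps intro!: restrict_ext)
  then show "act F T v \<in> {x \<in> carrier (box_space F \<sigma>). eval_map \<sigma> x = \<zero>\<^bsub>box_space A \<sigma>\<^esub>}"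
    using act_free_closed[OF T v] by (simp add: carrier_free)
qed

text \<open>\<open>R0\<close> puts the generated ideal inside the kernel, so that evaluation
  descends to the quotient. What remains for a particular presentation are the two statements
  \<open>surj\<close> and \<open>inj\<close>.\<close>

theorem presented_iso:
  assumes R: "\<And>\<sigma>. R \<sigma> \<subseteq> carrier (box_space F \<sigma>)"
    and R0: "\<And>\<sigma> r. r \<in> R \<sigma> \<Longrightarrow> eval_map \<sigma> r = \<zero>\<^bsub>box_space A \<sigma>\<^esub>"
    and surj: "\<And>\<sigma> f. f \<in> invariant_functionals G \<rho> \<sigma> \<Longrightarrow> \<exists>x\<in>finsupp (vertex_tangles deg \<sigma>). eval_map \<sigma> x = f"
    and inj: "\<And>\<sigma> x. x \<in> finsupp (vertex_tangles deg \<sigma>) \<Longrightarrow> eval_map \<sigma> x = \<zero>\<^bsub>box_space A \<sigma>\<^esub> \<Longrightarrow>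
      x \<in> generated_ideal F R \<sigma>"
  shows "\<exists>\<phi>. ospa_iso (presented_ospa deg R) A \<phi>"
proof -
  interpret FQ: planar_quotient F "generated_ideal F R"
    using ospa_free ospa.planar_ideal_generated[OF ospa_free R]
    by (simp add: planar_quotient_def planar_quotient_axioms_def)
  have ker: "eval_map \<sigma> h = \<zero>\<^bsub>box_space A \<sigma>\<^esub>" if "h \<in> generated_ideal F R \<sigma>" for h \<sigma>
    using generated_ideal_least[OF kernel_ideal, of R \<sigma>] R R0 that by auto
  have cong: "eval_map \<sigma> x = eval_map \<sigma> y"
    if x: "x \<in> carrier (box_space F \<sigma>)" and y: "y \<in> carrier (box_space F \<sigma>)"
      and e: "FQ.coset \<sigma> x = FQ.coset \<sigma> y" for \<sigma> x y
  proof -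
    obtain h where h: "h \<in> generated_ideal F R \<sigma>" "x = (\<lambda>c. 1 * h c + y c)"
      using e FQ.coset_eq_iff[OF x y] by (auto simp: free_box_simps)
    have "coeffs x J = coeffs y J" if "length J = length \<sigma>" for J
      using h ker[OF h(1)] that FQ.I_sub[OF h(1)] y coeffs_lincomb[of h y 1 J]
      by (simp add: eval_map_zero_iff carrier_free finsupp_def)
    then show ?thesis unfolding eval_map_def by (rule functional_eqI)
  qed
  define \<phi> where "\<phi> \<sigma> X = eval_map \<sigma> (FQ.rep X)" for \<sigma> X
  have \<phi>: "\<phi> \<sigma> (FQ.coset \<sigma> x) = eval_map \<sigma> x" if "x \<in> carrier (box_space F \<sigma>)" for \<sigma> x
    unfolding \<phi>_def using FQ.rep[OF FQ.coset_in_Q[OF that]] that by (intro cong) auto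
  have lin: "linear_map (box_space FQ.Q \<sigma>) (box_space A \<sigma>) (\<phi> \<sigma>)" for \<sigma>
    unfolding linear_map_def
  proof (intro conjI ballI allI)
    show "\<phi> \<sigma> \<in> carrier (box_space FQ.Q \<sigma>) \<rightarrow> carrier (box_space A \<sigma>)"
      using FQ.rep(1) eval_map_closed by (auto simp: \<phi>_def carrier_A carrier_free)
  next
    fix X Y assume "X \<in> carrier (box_space FQ.Q \<sigma>)" "Y \<in> carrier (box_space FQ.Q \<sigma>)"
    then obtain x y where x: "x \<in> carrier (box_space F \<sigma>)" "X = FQ.coset \<sigma> x"
      and y: "y \<in> carrier (box_space F \<sigma>)" "Y = FQ.coset \<sigma> y" by (auto simp: FQ.carrier_Q)
    have xy: "x \<oplus>\<^bsub>box_space F \<sigma>\<^esub> y \<in> carrier (box_space F \<sigma>)"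
      using x y finsupp_lincomb[of x _ y 1] by (simp add: carrier_free free_box_simps)
    have "\<phi> \<sigma> (X \<oplus>\<^bsub>box_space FQ.Q \<sigma>\<^esub> Y) = eval_map \<sigma> (x \<oplus>\<^bsub>box_space F \<sigma>\<^esub> y)"
      using x y xy by (simp add: FQ.add_Q \<phi>)
    also have "\<dots> = functional \<sigma> (\<lambda>J. coeffs x J + coeffs y J)"
      using x y eval_map_lincomb[of x \<sigma> y 1] by (simp add: carrier_free free_box_simps)
    also have "\<dots> = \<phi> \<sigma> X \<oplus>\<^bsub>box_space A \<sigma>\<^esub> \<phi> \<sigma> Y"
      using x y by (simp add: \<phi> box_A_simps eval_map_def functional_add)
    finally show "\<phi> \<sigma> (X \<oplus>\<^bsub>box_space FQ.Q \<sigma>\<^esub> Y) = \<phi> \<sigma> X \<oplus>\<^bsub>box_space A \<sigma>\<^esub> \<phi> \<sigma> Y" .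
  next
    fix a X assume "X \<in> carrier (box_space FQ.Q \<sigma>)"
    then obtain x where x: "x \<in> carrier (box_space F \<sigma>)" "X = FQ.coset \<sigma> x" by (auto simp: FQ.carrier_Q)
    have ax: "smult (box_space F \<sigma>) a x \<in> carrier (box_space F \<sigma>)"
      using x finsupp_lincomb[of x _ "\<lambda>_. 0" a] by (simp add: carrier_free free_box_simps)
    have "\<phi> \<sigma> (smult (box_space FQ.Q \<sigma>) a X) = eval_map \<sigma> (smult (box_space F \<sigma>) a x)"
      using x ax by (simp add: FQ.smult_Q \<phi>)
    also have "\<dots> = functional \<sigma> (\<lambda>J. a * coeffs x J)"
      using x eval_map_lincomb[of x \<sigma> "\<lambda>_. 0" a]
      by (simp add: carrier_free free_box_simps) (simp add: coeffs_def support_def)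
    also have "\<dots> = smult (box_space A \<sigma>) a (\<phi> \<sigma> X)"
      using x by (simp add: \<phi> box_A_simps eval_map_def functional_smult)
    finally show "\<phi> \<sigma> (smult (box_space FQ.Q \<sigma>) a X) = smult (box_space A \<sigma>) a (\<phi> \<sigma> X)" .
  qed
  have hom: "\<phi> \<sigma> (act FQ.Q T X) = act A T w"
    if T: "tangle \<sigma> T" and X: "inputs FQ.Q T X" and w: "\<forall>(l, \<tau>)\<in>set (discs T). w l = \<phi> \<tau> (X l)" for \<sigma> T X w
  proof -
    note X' = FQ.inputs_rep[OF X]
    have "\<phi> \<sigma> (act FQ.Q T X) = eval_map \<sigma> (act F T (\<lambda>l. FQ.rep (X l)))"
      using act_free_closed[OF T X'] by (simp add: FQ.act_Q[OF T] \<phi> carrier_free)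
    also have "\<dots> = act A T w"
      using w by (intro eval_map_act[OF T X']) (auto simp: \<phi>_def)
    finally show ?thesis .
  qed
  have "bij_betw (\<phi> \<sigma>) (carrier (box_space FQ.Q \<sigma>)) (carrier (box_space A \<sigma>))" for \<sigma>
    unfolding bij_betw_def
  proof
    show "inj_on (\<phi> \<sigma>) (carrier (box_space FQ.Q \<sigma>))"
    proof (rule inj_onI)
      fix X Y assume "X \<in> carrier (box_space FQ.Q \<sigma>)" "Y \<in> carrier (box_space FQ.Q \<sigma>)" and eq: "\<phi> \<sigma> X = \<phi> \<sigma> Y"
      then obtain x y where x: "x \<in> carrier (box_space F \<sigma>)" "X = FQ.coset \<sigma> x"
        and y: "y \<in> carrier (box_space F \<sigma>)" "Y = FQ.coset \<sigma> y" by (auto simp: FQ.carrier_Q)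
      let ?d = "\<lambda>c. -1 * y c + x c"
      have e: "eval_map \<sigma> x = eval_map \<sigma> y" using eq x y by (simp add: \<phi>)
      have "coeffs x J = coeffs y J" if "length J = length \<sigma>" for J
        using arg_cong[OF e, of "\<lambda>f. f (basis_tensor J)"] that by (simp add: eval_map_def)
      then have "eval_map \<sigma> ?d = \<zero>\<^bsub>box_space A \<sigma>\<^esub>"
        using x y coeffs_lincomb[of y x "-1"] by (simp add: eval_map_zero_iff carrier_free finsupp_def)
      then have "?d \<in> generated_ideal F R \<sigma>"
        using x y by (intro inj finsupp_lincomb) (auto simp: carrier_free)
      moreover have "x = ?d \<oplus>\<^bsub>box_space F \<sigma>\<^esub> y" by (simp add: free_box_simps)
      ultimately show "X = Y" using x y FQ.coset_eq_iff[OF x(1) y(1)] by blast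
    qed
    show "\<phi> \<sigma> ` carrier (box_space FQ.Q \<sigma>) = carrier (box_space A \<sigma>)"
    proof
      show "\<phi> \<sigma> ` carrier (box_space FQ.Q \<sigma>) \<subseteq> carrier (box_space A \<sigma>)"
        using lin[of \<sigma>] unfolding linear_map_def by auto
      show "carrier (box_space A \<sigma>) \<subseteq> \<phi> \<sigma> ` carrier (box_space FQ.Q \<sigma>)"
      proof
        fix f assume "f \<in> carrier (box_space A \<sigma>)"
        then obtain x where x: "x \<in> carrier (box_space F \<sigma>)" "eval_map \<sigma> x = f"
          using surj by (auto simp: carrier_A carrier_free)
        then show "f \<in> \<phi> \<sigma> ` carrier (box_space FQ.Q \<sigma>)"
          using \<phi>[OF x(1)] FQ.coset_in_Q[OF x(1)] by force
      qed
    qed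
  qed
  with lin hom FQ.ospa_Q ospa_A have "ospa_iso FQ.Q A \<phi>"
    unfolding ospa_iso_def ospa_hom_def by auto
  then show ?thesis unfolding presented_ospa_def by auto
qed

end

section \<open>Linear relations between diagrams\<close>

lemma set_diagram_labels: "set_diagram t = labels t"
  by (induction t) (auto simp: image_Un)

text \<open>Vertices may repeat in a diagram whereas the discs of an operad tangle carry distinct
  numbers. The interval bounds let the two parts of a diagram be numbered from disjoint
  ranges.\<close>

lemma relabel_distinct:
  "\<exists>T s m. map_diagram s T = (t :: 'a diagram) \<and> distinct (map fst (discs T)) \<and> labels T \<subseteq> {n..<m} \<and> n \<le> (m::nat)"
proof (induction t arbitrary: n)
  case (Disc l \<sigma>)
  show ?case
    by (rule exI[of _ "Disc n \<sigma>"], rule exI[of _ "\<lambda>_. l"], rule exI[of _ "Suc n"]) auto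
next
  case (Comp g f)
  obtain T1 s1 m1 where 1: "map_diagram s1 T1 = g" "distinct (map fst (discs T1))" "labels T1 \<subseteq> {n..<m1}" "n \<le> m1"
    using Comp.IH(1) by blast
  obtain T2 s2 m2 where 2: "map_diagram s2 T2 = f" "distinct (map fst (discs T2))" "labels T2 \<subseteq> {m1..<m2}" "m1 \<le> m2"
    using Comp.IH(2) by blast
  define s where "s i = (if i < m1 then s1 i else s2 i)" for i
  have "s i = s1 i" if "i \<in> set_diagram T1" for i
    using that 1(3) unfolding set_diagram_labels s_def by (metis atLeastLessThan_iff subsetD)
  then have "map_diagram s T1 = map_diagram s1 T1" by (intro diagram.map_cong0)
  moreover have "s i = s2 i" if "i \<in> set_diagram T2" for i
    using that 2(3) unfolding set_diagram_labels s_def by (metis atLeastLessThan_iff subsetD leD)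
  then have "map_diagram s T2 = map_diagram s2 T2" by (intro diagram.map_cong0)
  moreover have "labels T1 \<inter> labels T2 = {}" using 1(3) 2(3) by fastforce
  moreover have "labels (T1 \<circ>\<^sub>t T2) \<subseteq> {n..<m2}" using 1(3,4) 2(3,4) by (simp add: image_Un) fastforce
  ultimately have "map_diagram s (T1 \<circ>\<^sub>t T2) = g \<circ>\<^sub>t f \<and> distinct (map fst (discs (T1 \<circ>\<^sub>t T2))) \<and>
      labels (T1 \<circ>\<^sub>t T2) \<subseteq> {n..<m2} \<and> n \<le> m2"
    using 1 2 by simp
  then show ?case by blast
next
  case (Juxt g f)
  obtain T1 s1 m1 where 1: "map_diagram s1 T1 = g" "distinct (map fst (discs T1))" "labels T1 \<subseteq> {n..<m1}" "n \<le> m1"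
    using Juxt.IH(1) by blast
  obtain T2 s2 m2 where 2: "map_diagram s2 T2 = f" "distinct (map fst (discs T2))" "labels T2 \<subseteq> {m1..<m2}" "m1 \<le> m2"
    using Juxt.IH(2) by blast
  define s where "s i = (if i < m1 then s1 i else s2 i)" for i
  have "s i = s1 i" if "i \<in> set_diagram T1" for i
    using that 1(3) unfolding set_diagram_labels s_def by (metis atLeastLessThan_iff subsetD)
  then have "map_diagram s T1 = map_diagram s1 T1" by (intro diagram.map_cong0)
  moreover have "s i = s2 i" if "i \<in> set_diagram T2" for i
    using that 2(3) unfolding set_diagram_labels s_def by (metis atLeastLessThan_iff subsetD leD)
  then have "map_diagram s T2 = map_diagram s2 T2" by (intro diagram.map_cong0)
  moreover have "labels T1 \<inter> labels T2 = {}" using 1(3) 2(3) by fastforce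
  moreover have "labels (T1 \<otimes>\<^sub>t T2) \<subseteq> {n..<m2}" using 1(3,4) 2(3,4) by (simp add: image_Un) fastforce
  ultimately have "map_diagram s (T1 \<otimes>\<^sub>t T2) = g \<otimes>\<^sub>t f \<and> distinct (map fst (discs (T1 \<otimes>\<^sub>t T2))) \<and>
      labels (T1 \<otimes>\<^sub>t T2) \<subseteq> {n..<m2} \<and> n \<le> m2"
    using 1 2 by simp
  then show ?case by blast
next
  case (Strands \<sigma>)
  show ?case by (rule exI[of _ "Strands \<sigma>"]) auto
next
  case (Crossing a b)
  show ?case by (rule exI[of _ "Crossing a b"]) auto
next
  case (Cap s)
  show ?case by (rule exI[of _ "Cap s"]) auto
next
  case (Cup s)
  show ?case by (rule exI[of _ "Cup s"]) auto
qed

text \<open>Contexts are diagrams with one distinguished disc, labelled \<open>None\<close>.\<close>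

definition hole_context :: "('g \<Rightarrow> sign list) \<Rightarrow> sign list \<Rightarrow> 'g option diagram \<Rightarrow> bool" where
  "hole_context deg \<tau> C \<longleftrightarrow> wf_diagram C \<and> tgt C = [] \<and>
     (\<forall>(h, \<rho>)\<in>set (discs C). \<rho> = (case h of None \<Rightarrow> \<tau> | Some g \<Rightarrow> deg g)) \<and>
     length (filter (\<lambda>p. fst p = None) (discs C)) = 1"

fun plug :: "'g diagram \<Rightarrow> 'g option \<Rightarrow> sign list \<Rightarrow> 'g diagram" where
  "plug u None \<rho> = u"
| "plug u (Some g) \<rho> = Disc g \<rho>"

lemma plug_map_Some [simp]: "fill (plug u) (map_diagram Some t) = t"
  by (induction t) auto

text \<open>The zigzag identity for a bundle, peeling off one strand at a time. It undoes the
  bending in \<open>bend_down\<close>.\<close>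

lemma mev_mcoev: "whisker [] (mev \<beta>) \<beta> \<cdot> whisker \<beta> (mcoev (dual \<beta>)) [] = (strands \<beta> :: 'a morph)"
proof (induction \<beta>)
  case (Cons s \<beta>)
  have e: "whisker [s] (mev \<beta>) (neg s # s # \<beta>) \<cdot> whisker (s # \<beta> @ dual \<beta>) (cup (neg s)) \<beta> =
      (whisker [s] (cup (neg s)) \<beta> \<cdot> whisker [s] (mev \<beta>) \<beta> :: 'a morph)"
    using exchange[of "mev \<beta> :: 'a morph" "cup (neg s)" "[s]" "[]" \<beta>] by simp
  have IH: "whisker [s] (mev \<beta>) \<beta> \<cdot> whisker (s # \<beta>) (mcoev (dual \<beta>)) [] = (strands (s # \<beta>) :: 'a morph)"
    using arg_cong[OF Cons.IH, of "\<lambda>t. whisker [s] t []"] by (simp add: whisker_norm)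
  have z: "whisker [] (cap s) (s # \<beta>) \<cdot> whisker [s] (cup (neg s)) \<beta> = (strands (s # \<beta>) :: 'a morph)"
    using zigzag_right[where 'a = 'a, of "[]" s \<beta>] by simp
  show ?case
    by (simp add: whisker_norm mcoev_snoc comp_tail2[OF e] IH z)
qed (simp add: whisker_strands)

locale diagram_calculus =
  fixes deg :: "'g \<Rightarrow> sign list" and I :: "sign list \<Rightarrow> ('g diagram set \<Rightarrow> 'k::field) set"
  assumes ideal: "planar_ideal (free_ospa deg) I"
begin

lemma I_sub: "x \<in> I \<sigma> \<Longrightarrow> x \<in> finsupp (vertex_tangles deg \<sigma>)"
  and I_lin: "x \<in> I \<sigma> \<Longrightarrow> y \<in> I \<sigma> \<Longrightarrow> (\<lambda>c. a * x c + y c) \<in> I \<sigma>"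
  and I_zero: "(\<lambda>_. 0) \<in> I \<sigma>"
proof -
  interpret FQ: planar_quotient "free_ospa deg" I
    using ospa_free ideal by (simp add: planar_quotient_def planar_quotient_axioms_def)
  show "x \<in> I \<sigma> \<Longrightarrow> x \<in> finsupp (vertex_tangles deg \<sigma>)"
    using FQ.I_sub[of x \<sigma>] by (simp add: carrier_free)
  show "x \<in> I \<sigma> \<Longrightarrow> y \<in> I \<sigma> \<Longrightarrow> (\<lambda>c. a * x c + y c) \<in> I \<sigma>"
    using FQ.I_add[OF FQ.I_smult[of x \<sigma> a], of y] by (simp add: free_box_simps)
  show "(\<lambda>_. 0) \<in> I \<sigma>"
    using subgroup.one_closed[OF submodule.axioms(1)[OF FQ.submod[of \<sigma>]]] by (simp add: free_box_simps)
qed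

text \<open>The properties of the map between box spaces that arises by inserting an element into a
  fixed context.\<close>

definition ideal_map ::
  "sign list \<Rightarrow> sign list \<Rightarrow> (('g diagram set \<Rightarrow> 'k) \<Rightarrow> 'g diagram set \<Rightarrow> 'k) \<Rightarrow> bool" where
  "ideal_map \<tau> \<zeta> \<Phi> \<longleftrightarrow> (\<forall>a x y. x \<in> finsupp (vertex_tangles deg \<tau>) \<longrightarrow> y \<in> finsupp (vertex_tangles deg \<tau>) \<longrightarrow>
       \<Phi> (\<lambda>c. a * x c + y c) = (\<lambda>c. a * \<Phi> x c + \<Phi> y c)) \<and> (\<forall>x\<in>I \<tau>. \<Phi> x \<in> I \<zeta>)"

text \<open>The context is renumbered to an operad tangle and every disc except the hole is filled
  with its own vertex. A planar ideal is closed under the operation of the hole that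
  results.\<close>

lemma hole_map:
  assumes C: "hole_context deg \<tau> C"
  shows "\<exists>\<Phi>. ideal_map \<tau> (src C) \<Phi> \<and>
    (\<forall>u\<in>vertex_diagrams deg \<tau>. \<Phi> (single (tangle_class u)) = single (tangle_class (fill (plug u) C)))"
proof -
  obtain T :: "nat diagram" and s where T: "map_diagram s T = C" "distinct (map fst (discs T))"
    using relabel_distinct[of C 0] by blast
  have wf: "wf_diagram T" "src T = src C" "tgt T = []"
    using C T(1)[symmetric] by (auto simp: hole_context_def)
  have tan: "tangle (src C) T" using T wf by (simp add: tangle_def)
  have ty: "\<rho> = (case s l of None \<Rightarrow> \<tau> | Some g \<Rightarrow> deg g)" if "(l, \<rho>) \<in> set (discs T)" for l \<rho>
    using C T(1)[symmetric] that by (force simp: hole_context_def)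
  have "length (filter (\<lambda>p. s (fst p) = None) (discs T)) = 1"
    using C T(1)[symmetric] by (simp add: hole_context_def filter_map o_def)
  then obtain p where p: "filter (\<lambda>p. s (fst p) = None) (discs T) = [p]"
    by (metis One_nat_def length_0_conv length_Suc_conv)
  obtain l0 \<rho>0 where l0: "p = (l0, \<rho>0)" by (cases p)
  have "p \<in> set (filter (\<lambda>p. s (fst p) = None) (discs T))" by (simp add: p)
  then have l0T: "(l0, \<tau>) \<in> set (discs T)" "s l0 = None" using ty l0 by force+
  have uniq: "l = l0" if l: "l \<in> labels T" "s l = None" for l
  proof -
    obtain \<rho> where "(l, \<rho>) \<in> set (discs T)" using l by auto
    then have "(l, \<rho>) \<in> set (filter (\<lambda>p. s (fst p) = None) (discs T))" using l by simp
    then show "l = l0" by (simp add: p l0)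
  qed
  \<comment> \<open>The zero at the hole is a placeholder: it makes \<open>v\<close> an admissible
    input and is overwritten in \<open>\<Phi>\<close>.\<close>
  define v :: "nat \<Rightarrow> 'g diagram set \<Rightarrow> 'k" where
    "v l = (case s l of None \<Rightarrow> (\<lambda>_. 0) | Some g \<Rightarrow> single (tangle_class (Disc g (deg g))))" for l
  define \<Phi> where "\<Phi> x = act (free_ospa deg) T (v(l0 := x))" for x
  have v: "inputs (free_ospa deg) T v"
    unfolding inputs_free
  proof (rule ballI, rule case_prodI2)
    fix p l \<rho> assume "p \<in> set (discs T)" "p = (l, \<rho>)"
    then show "v l \<in> finsupp (vertex_tangles deg \<rho>)"
      using ty[of l \<rho>] by (cases "s l") (auto simp: v_def vertex_tangles_eq vertex_diagrams_def)
  qed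
  have l0': "l0 \<in> labels T" using l0T(1) by force
  show ?thesis
    unfolding ideal_map_def
  proof (intro exI[of _ \<Phi>] conjI allI impI ballI)
    fix a and x y :: "'g diagram set \<Rightarrow> 'k"
    assume "x \<in> finsupp (vertex_tangles deg \<tau>)" "y \<in> finsupp (vertex_tangles deg \<tau>)"
    then show "\<Phi> (\<lambda>c. a * x c + y c) = (\<lambda>c. a * \<Phi> x c + \<Phi> y c)"
      unfolding \<Phi>_def using inputs_free_finite[OF v] l0' by (intro ext act_free_linear) (auto simp: finsupp_def)
  next
    fix x assume x: "x \<in> I \<tau>"
    have "inputs (free_ospa deg) T (v(l0 := x))"
      by (rule inputs_free_upd[OF v T(2) l0T(1) I_sub[OF x]])
    moreover have "(v(l0 := x)) l0 \<in> I \<tau>" using x by simp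
    ultimately show "\<Phi> x \<in> I (src C)"
      using ideal tan l0T(1) unfolding planar_ideal_def \<Phi>_def by blast
  next
    fix u assume u: "u \<in> vertex_diagrams deg \<tau>"
    define w where "w l = (case s l of None \<Rightarrow> u | Some g \<Rightarrow> Disc g (deg g))" for l
    have "w l \<in> vertex_diagrams deg \<rho>" if "(l, \<rho>) \<in> set (discs T)" for l \<rho>
      using ty[OF that] u by (cases "s l") (auto simp: w_def vertex_diagrams_def)
    then have "fits_vertices deg T w" by (auto simp: fits_vertices_def)
    moreover have "(v(l0 := single (tangle_class u))) l = single (tangle_class (w l))" if "l \<in> labels T" for l
      using uniq[OF that] l0T(2) by (cases "s l") (auto simp: v_def w_def)
    ultimately have "\<Phi> (single (tangle_class u)) = single (tangle_class (fill (\<lambda>l _. w l) T))"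
      unfolding \<Phi>_def by (rule act_free_basis[OF wf(1)])
    also have "fill (\<lambda>l _. w l) T = fill (plug u) C"
      unfolding T(1)[symmetric] fill_map
    proof (rule fill_cong_eq)
      fix l \<rho> assume "(l, \<rho>) \<in> set (discs T)"
      then show "w l = plug u (s l) \<rho>" using ty[of l \<rho>] by (cases "s l") (auto simp: w_def)
    qed
    finally show "\<Phi> (single (tangle_class u)) = single (tangle_class (fill (plug u) C))" .
  qed
qed

section \<open>Linear relations between morphisms modulo a planar ideal\<close>

definition vhom :: "'g morph \<Rightarrow> sign list \<Rightarrow> sign list \<Rightarrow> bool" where
  "vhom f \<alpha> \<beta> \<longleftrightarrow> ok f \<and> dom f = \<alpha> \<and> cod f = \<beta> \<and> (\<forall>(g, \<tau>)\<in>#vertices f. \<tau> = deg g)"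

lemma vhomD: "vhom f \<alpha> \<beta> \<Longrightarrow> ok f" "vhom f \<alpha> \<beta> \<Longrightarrow> dom f = \<alpha>" "vhom f \<alpha> \<beta> \<Longrightarrow> cod f = \<beta>"
  by (auto simp: vhom_def)

lemma vhom_comp: "vhom g \<beta> \<gamma> \<Longrightarrow> vhom f \<alpha> \<beta> \<Longrightarrow> vhom (g \<cdot> f) \<alpha> \<gamma>"
  by (auto simp: vhom_def)

lemma vhom_whisker: "vhom f \<alpha> \<beta> \<Longrightarrow> vhom (whisker \<gamma> f \<delta>) (\<gamma> @ \<alpha> @ \<delta>) (\<gamma> @ \<beta> @ \<delta>)"
  by (auto simp: vhom_def)

lemma vhom_basic:
  "vhom (strands \<sigma>) \<sigma> \<sigma>" "vhom (cross a b) [a, b] [b, a]" "vhom (cap s) [s, neg s] []"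
  "vhom (cup s) [] [s, neg s]" "vhom (disc g \<sigma>) \<sigma> [] \<longleftrightarrow> \<sigma> = deg g"
  "vhom (mcoev \<sigma>) [] (\<sigma> @ dual \<sigma>)" "vhom (mev \<sigma>) (\<sigma> @ dual \<sigma>) []"
  by (auto simp: vhom_def)

lemma vhom_abs:
  assumes "vhom f \<alpha> \<beta>"
  obtains t where "f = abs_morph t" "wf_diagram t" "src t = \<alpha>" "tgt t = \<beta>" "\<forall>(g, \<tau>)\<in>set (discs t). \<tau> = deg g"
proof -
  obtain t where t: "f = abs_morph t" using Quotient3_abs_rep[OF Quotient3_morph] by metis
  with assms that show thesis
    by (auto simp: vhom_def ok.abs_eq dom.abs_eq cod.abs_eq vertices.abs_eq)
qed

definition q :: "'g morph \<Rightarrow> 'g diagram set \<Rightarrow> 'k" where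
  "q f = single (tangle_class (rep_morph f))"

lemma q_abs: "wf_diagram t \<Longrightarrow> q (abs_morph t) = single (tangle_class t)"
proof -
  assume t: "wf_diagram t"
  have "tangle_eqv (rep_morph (abs_morph t)) t"
    using Quotient3_rep_abs[OF Quotient3_morph, of t] tangle_eq.refl[OF t] by (simp add: tangle_eqv_def)
  then have "rep_morph (abs_morph t) \<approx>\<^sub>t t" using t by (simp add: tangle_eqv_def)
  then show ?thesis unfolding q_def using tangle_class_eq by metis
qed

lemma q_in: "vhom f \<sigma> [] \<Longrightarrow> q f \<in> finsupp (vertex_tangles deg \<sigma>)"
  by (erule vhom_abs) (auto simp: q_abs vertex_tangles_eq vertex_diagrams_def)

definition lin :: "('k \<times> 'g morph) list \<Rightarrow> 'g diagram set \<Rightarrow> 'k" where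
  "lin xs = (\<lambda>c. \<Sum>(a, f)\<leftarrow>xs. a * q f c)"

lemma lin_simps [simp]: "lin [] = (\<lambda>_. 0)" "lin ((a, f) # xs) = (\<lambda>c. a * q f c + lin xs c)"
  by (simp_all add: lin_def)

lemma lin_in: "(\<And>a f. (a, f) \<in> set xs \<Longrightarrow> vhom f \<sigma> []) \<Longrightarrow> lin xs \<in> finsupp (vertex_tangles deg \<sigma>)"
proof (induction xs)
  case (Cons p xs)
  then show ?case by (cases p) (auto intro!: finsupp_lincomb q_in)
qed simp

text \<open>Elements of the ideal have their outputs bent down. The context \<open>C\<close> bends
  them up again, and by \<open>mev_mcoev\<close> the morphism \<open>f\<close> reappears between
  \<open>z\<close> and \<open>y\<close>.\<close>

lemma context_map:
  assumes y: "vhom y (\<gamma> @ \<beta> @ \<delta>) []" and z: "vhom z \<zeta> (\<gamma> @ \<alpha> @ \<delta>)"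
  shows "\<exists>\<Phi>. ideal_map (\<alpha> @ dual \<beta>) \<zeta> \<Phi> \<and>
    (\<forall>f. vhom f \<alpha> \<beta> \<longrightarrow> \<Phi> (q (mev \<beta> \<cdot> whisker [] f (dual \<beta>))) = q (y \<cdot> whisker \<gamma> f \<delta> \<cdot> z))"
proof -
  obtain ty where ty: "y = abs_morph ty" "wf_diagram ty" "src ty = \<gamma> @ \<beta> @ \<delta>" "tgt ty = []"
    "\<forall>(g, \<tau>)\<in>set (discs ty). \<tau> = deg g" using y by (rule vhom_abs)
  obtain tz where tz: "z = abs_morph tz" "wf_diagram tz" "src tz = \<zeta>" "tgt tz = \<gamma> @ \<alpha> @ \<delta>"
    "\<forall>(g, \<tau>)\<in>set (discs tz). \<tau> = deg g" using z by (rule vhom_abs)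
  define C where "C = map_diagram Some ty \<circ>\<^sub>t
    (Strands \<gamma> \<otimes>\<^sub>t ((Disc None (\<alpha> @ dual \<beta>) \<otimes>\<^sub>t Strands \<beta>) \<circ>\<^sub>t (Strands \<alpha> \<otimes>\<^sub>t coev (dual \<beta>))) \<otimes>\<^sub>t Strands \<delta>) \<circ>\<^sub>t
    map_diagram Some tz"
  have "filter (\<lambda>p. fst p = None) (map (map_prod Some id) xs) = []" for xs :: "('g \<times> sign list) list"
    by (auto simp: filter_empty_conv)
  then have C: "hole_context deg (\<alpha> @ dual \<beta>) C" "src C = \<zeta>"
    using ty tz unfolding hole_context_def C_def by (auto simp: typed)
  obtain \<Phi> where \<Phi>: "ideal_map (\<alpha> @ dual \<beta>) \<zeta> \<Phi>"
    "\<And>u. u \<in> vertex_diagrams deg (\<alpha> @ dual \<beta>) \<Longrightarrow> \<Phi> (single (tangle_class u)) = single (tangle_class (fill (plug u) C))"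
    using hole_map[OF C(1)] C(2) by blast
  show ?thesis
  proof (intro exI[of _ \<Phi>] conjI allI impI)
    fix f assume f: "vhom f \<alpha> \<beta>"
    obtain t where t: "f = abs_morph t" "wf_diagram t" "src t = \<alpha>" "tgt t = \<beta>"
      "\<forall>(g, \<tau>)\<in>set (discs t). \<tau> = deg g" using f by (rule vhom_abs)
    let ?u = "bend_down t"
    have u: "?u \<in> vertex_diagrams deg (\<alpha> @ dual \<beta>)"
      using t by (auto simp: bend_down_def vertex_diagrams_def typed)
    have au: "abs_morph ?u = mev \<beta> \<cdot> whisker [] f (dual \<beta>)"
      using t by (simp add: bend_down_def abs_morph_simps whisker_def)
    have "fill (plug ?u) C = ty \<circ>\<^sub>t (Strands \<gamma> \<otimes>\<^sub>t ((?u \<otimes>\<^sub>t Strands \<beta>) \<circ>\<^sub>t (Strands \<alpha> \<otimes>\<^sub>t coev (dual \<beta>))) \<otimes>\<^sub>t Strands \<delta>) \<circ>\<^sub>t tz"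
      by (simp add: C_def)
    then have "abs_morph (fill (plug ?u) C) =
        y \<cdot> whisker \<gamma> (whisker [] (mev \<beta> \<cdot> whisker [] f (dual \<beta>)) \<beta> \<cdot> whisker \<alpha> (mcoev (dual \<beta>)) []) \<delta> \<cdot> z"
      using au ty(1) tz(1) by (simp add: abs_morph_simps whisker_def)
    also have "whisker [] (mev \<beta> \<cdot> whisker [] f (dual \<beta>)) \<beta> \<cdot> whisker \<alpha> (mcoev (dual \<beta>)) [] = f"
    proof -
      have "whisker [] f (dual \<beta> @ \<beta>) \<cdot> whisker \<alpha> (mcoev (dual \<beta>)) [] = whisker \<beta> (mcoev (dual \<beta>)) [] \<cdot> f"
        using exchange[of f "mcoev (dual \<beta>)" "[]" "[]" "[]"] vhomD[OF f] by simp
      then show ?thesis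
        using vhomD[OF f] by (simp add: whisker_norm comp_tail[OF mev_mcoev])
    qed
    finally have e: "abs_morph (fill (plug ?u) C) = y \<cdot> whisker \<gamma> f \<delta> \<cdot> z" .
    have "ok (y \<cdot> whisker \<gamma> f \<delta> \<cdot> z)" using vhomD[OF f] vhomD[OF y] vhomD[OF z] by simp
    then have "wf_diagram (fill (plug ?u) C)" unfolding e[symmetric] by (simp add: ok.abs_eq)
    then have "single (tangle_class (fill (plug ?u) C)) = q (y \<cdot> whisker \<gamma> f \<delta> \<cdot> z)"
      using q_abs e by metis
    moreover have "q (mev \<beta> \<cdot> whisker [] f (dual \<beta>)) = single (tangle_class ?u)"
      using q_abs[of ?u] u au by (simp add: vertex_diagrams_def)
    ultimately show "\<Phi> (q (mev \<beta> \<cdot> whisker [] f (dual \<beta>))) = q (y \<cdot> whisker \<gamma> f \<delta> \<cdot> z)"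
      using \<Phi>(2)[OF u] by simp
  qed (rule \<Phi>(1))
qed

lemma lin_map:
  assumes im: "ideal_map \<tau> \<zeta> \<Phi>"
    and h: "\<And>a f. (a, f) \<in> set xs \<Longrightarrow> vhom (h f) \<tau> [] \<and> \<Phi> (q (h f)) = q (k f)"
  shows "\<Phi> (lin (map (\<lambda>(a, f). (a, h f)) xs)) = lin (map (\<lambda>(a, f). (a, k f)) xs)"
  using h
proof (induction xs)
  note \<Phi> = im[unfolded ideal_map_def, THEN conjunct1, rule_format]
  case Nil
  show ?case using \<Phi>[of "\<lambda>_. 0" "\<lambda>_. 0" "-1"] by simp
next
  case (Cons p xs)
  obtain a f where p: "p = (a, f)" by (cases p)
  have "lin (map (\<lambda>(a, f). (a, h f)) xs) \<in> finsupp (vertex_tangles deg \<tau>)"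
    using Cons.prems by (intro lin_in) auto
  moreover have "q (h f) \<in> finsupp (vertex_tangles deg \<tau>)"
    using Cons.prems[of a f] p by (auto intro: q_in)
  ultimately have "\<Phi> (\<lambda>c. a * q (h f) c + lin (map (\<lambda>(a, f). (a, h f)) xs) c) =
      (\<lambda>c. a * \<Phi> (q (h f)) c + \<Phi> (lin (map (\<lambda>(a, f). (a, h f)) xs)) c)"
    using im unfolding ideal_map_def by blast
  moreover have "\<Phi> (q (h f)) = q (k f)" "\<Phi> (lin (map (\<lambda>(a, f). (a, h f)) xs)) = lin (map (\<lambda>(a, f). (a, k f)) xs)"
    using Cons p by auto
  ultimately show ?case using p by simp
qed

text \<open>A linear relation is asked to hold in every closed context, below \<open>y\<close>,
  above \<open>z\<close> and beside further strands; its stability under composition and whiskering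
  then comes by regrouping the context.\<close>

definition rel :: "sign list \<Rightarrow> sign list \<Rightarrow> ('k \<times> 'g morph) list \<Rightarrow> bool" where
  "rel \<alpha> \<beta> xs \<longleftrightarrow> (\<forall>(a, f)\<in>set xs. vhom f \<alpha> \<beta>) \<and>
     (\<forall>\<gamma> \<delta> \<zeta> y z. vhom y (\<gamma> @ \<beta> @ \<delta>) [] \<longrightarrow> vhom z \<zeta> (\<gamma> @ \<alpha> @ \<delta>) \<longrightarrow>
        lin (map (\<lambda>(a, f). (a, y \<cdot> whisker \<gamma> f \<delta> \<cdot> z)) xs) \<in> I \<zeta>)"

text \<open>It is enough to test the context that bends the outputs down, because
  \<open>context_map\<close> reaches all others from it.\<close>

lemma rel_intro:
  assumes xs: "\<And>a f. (a, f) \<in> set xs \<Longrightarrow> vhom f \<alpha> \<beta>"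
    and I: "lin (map (\<lambda>(a, f). (a, mev \<beta> \<cdot> whisker [] f (dual \<beta>))) xs) \<in> I (\<alpha> @ dual \<beta>)"
  shows "rel \<alpha> \<beta> xs"
  unfolding rel_def
proof (intro conjI allI impI)
  fix \<gamma> \<delta> \<zeta> y z assume "vhom y (\<gamma> @ \<beta> @ \<delta>) []" "vhom z \<zeta> (\<gamma> @ \<alpha> @ \<delta>)"
  then obtain \<Phi> where \<Phi>: "ideal_map (\<alpha> @ dual \<beta>) \<zeta> \<Phi>"
    "\<And>f. vhom f \<alpha> \<beta> \<Longrightarrow> \<Phi> (q (mev \<beta> \<cdot> whisker [] f (dual \<beta>))) = q (y \<cdot> whisker \<gamma> f \<delta> \<cdot> z)"
    using context_map by blast
  have "vhom (mev \<beta> \<cdot> whisker [] f (dual \<beta>)) (\<alpha> @ dual \<beta>) [] \<and>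
      \<Phi> (q (mev \<beta> \<cdot> whisker [] f (dual \<beta>))) = q (y \<cdot> whisker \<gamma> f \<delta> \<cdot> z)" if "(a, f) \<in> set xs" for a f
    using xs[OF that] \<Phi>(2) vhom_whisker[of f \<alpha> \<beta> "[]" "dual \<beta>"] by (auto intro!: vhom_comp vhom_basic)
  then have "\<Phi> (lin (map (\<lambda>(a, f). (a, mev \<beta> \<cdot> whisker [] f (dual \<beta>))) xs)) =
      lin (map (\<lambda>(a, f). (a, y \<cdot> whisker \<gamma> f \<delta> \<cdot> z)) xs)"
    by (rule lin_map[OF \<Phi>(1)])
  moreover have "\<Phi> (lin (map (\<lambda>(a, f). (a, mev \<beta> \<cdot> whisker [] f (dual \<beta>))) xs)) \<in> I \<zeta>"
    using \<Phi>(1) I unfolding ideal_map_def by blast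
  ultimately show "lin (map (\<lambda>(a, f). (a, y \<cdot> whisker \<gamma> f \<delta> \<cdot> z)) xs) \<in> I \<zeta>" by simp
qed (use xs in auto)

lemma precompose_map:
  assumes z: "vhom z \<zeta> \<alpha>"
  shows "\<exists>\<Phi>. ideal_map \<alpha> \<zeta> \<Phi> \<and> (\<forall>f. vhom f \<alpha> [] \<longrightarrow> \<Phi> (q f) = q (f \<cdot> z))"
proof -
  have "vhom (strands []) ([] @ [] @ []) []" "vhom z \<zeta> ([] @ \<alpha> @ [])"
    using z vhom_basic(1)[of "[]"] by auto
  then obtain \<Phi> where \<Phi>: "ideal_map (\<alpha> @ dual []) \<zeta> \<Phi>"
    "\<And>f. vhom f \<alpha> [] \<Longrightarrow> \<Phi> (q (mev [] \<cdot> whisker [] f (dual []))) = q (strands [] \<cdot> whisker [] f [] \<cdot> z)"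
    using context_map by blast
  have "\<Phi> (q f) = q (f \<cdot> z)" if f: "vhom f \<alpha> []" for f
  proof -
    have "ok (f \<cdot> z)" "cod (f \<cdot> z) = []" using vhomD[OF f] vhomD[OF z] by auto
    with \<Phi>(2)[OF f] vhomD[OF f] show ?thesis by simp
  qed
  with \<Phi>(1) show ?thesis by auto
qed

text \<open>\<open>t\<close> is \<open>a\<close> times \<open>t'\<close> modulo the ideal. Except
  for removing a crossing, every reduction turns one diagram into a multiple of one diagram, so most
  rewriting uses this relation; the scalar 0 records vanishing.\<close>

definition scaled :: "'g morph \<Rightarrow> 'k \<Rightarrow> 'g morph \<Rightarrow> bool" where
  "scaled t a t' \<longleftrightarrow> rel (dom t) (cod t) [(1, t), (- a, t')]"

lemma scaled_iff:
  assumes "vhom t \<alpha> \<beta>" "vhom t' \<alpha> \<beta>"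
  shows "scaled t a t' \<longleftrightarrow> (\<forall>\<gamma> \<delta> \<zeta> y z. vhom y (\<gamma> @ \<beta> @ \<delta>) [] \<longrightarrow> vhom z \<zeta> (\<gamma> @ \<alpha> @ \<delta>) \<longrightarrow>
     (\<lambda>c. q (y \<cdot> whisker \<gamma> t \<delta> \<cdot> z) c - a * q (y \<cdot> whisker \<gamma> t' \<delta> \<cdot> z) c) \<in> I \<zeta>)"
  using assms vhomD[OF assms(1)] by (simp add: scaled_def rel_def)

lemma scaledE: "scaled t a t' \<Longrightarrow> vhom t (dom t) (cod t) \<and> vhom t' (dom t) (cod t)"
  by (simp add: scaled_def rel_def)

lemma scaled_refl: "vhom t \<alpha> \<beta> \<Longrightarrow> scaled t 1 t"
  by (subst scaled_iff) (auto simp: I_zero)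

lemma scaled_trans:
  assumes "scaled t a t'" "scaled t' b t''" "c = a * b"
  shows "scaled t c t''"
proof -
  obtain \<alpha> \<beta> where t: "vhom t \<alpha> \<beta>" "vhom t' \<alpha> \<beta>" using scaledE[OF assms(1)] by blast
  then have t'': "vhom t'' \<alpha> \<beta>" using scaledE[OF assms(2)] by (simp add: vhom_def)
  show ?thesis
    unfolding scaled_iff[OF t(1) t'']
  proof (intro allI impI)
    fix \<gamma> \<delta> \<zeta> y z assume yz: "vhom y (\<gamma> @ \<beta> @ \<delta>) []" "vhom z \<zeta> (\<gamma> @ \<alpha> @ \<delta>)"
    let ?q = "\<lambda>t. q (y \<cdot> whisker \<gamma> t \<delta> \<cdot> z)"
    have "(\<lambda>c. ?q t c - a * ?q t' c) \<in> I \<zeta>" "(\<lambda>c. ?q t' c - b * ?q t'' c) \<in> I \<zeta>"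
      using assms(1,2) yz unfolding scaled_iff[OF t] scaled_iff[OF t(2) t''] by blast+
    from I_lin[OF this(2,1), of a] show "(\<lambda>d. ?q t d - c * ?q t'' d) \<in> I \<zeta>"
      by (simp add: assms(3) algebra_simps)
  qed
qed

lemma scaled_sym:
  assumes "scaled t a t'" "a * b = 1"
  shows "scaled t' b t"
proof -
  obtain \<alpha> \<beta> where t: "vhom t \<alpha> \<beta>" "vhom t' \<alpha> \<beta>" using scaledE[OF assms(1)] by blast
  show ?thesis
    unfolding scaled_iff[OF t(2,1)]
  proof (intro allI impI)
    fix \<gamma> \<delta> \<zeta> y z assume yz: "vhom y (\<gamma> @ \<beta> @ \<delta>) []" "vhom z \<zeta> (\<gamma> @ \<alpha> @ \<delta>)"
    let ?q = "\<lambda>t. q (y \<cdot> whisker \<gamma> t \<delta> \<cdot> z)"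
    have 1: "(\<lambda>c. ?q t c - a * ?q t' c) \<in> I \<zeta>"
      using assms(1) yz unfolding scaled_iff[OF t] by blast
    have "- b * (?q t c - a * ?q t' c) + 0 = ?q t' c - b * ?q t c" for c
      using assms(2) by (simp add: algebra_simps)
    with I_lin[OF 1 I_zero, of "- b"] show "(\<lambda>c. ?q t' c - b * ?q t c) \<in> I \<zeta>" by simp
  qed
qed

lemma scaled_context:
  assumes "scaled t a t'" and t: "vhom t \<alpha> \<beta>"
    and y: "vhom y (\<gamma> @ \<beta> @ \<delta>) \<beta>'" and z: "vhom z \<alpha>' (\<gamma> @ \<alpha> @ \<delta>)"
  shows "scaled (y \<cdot> whisker \<gamma> t \<delta> \<cdot> z) a (y \<cdot> whisker \<gamma> t' \<delta> \<cdot> z)"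
proof -
  have t': "vhom t' \<alpha> \<beta>" using scaledE[OF assms(1)] t by (simp add: vhom_def)
  have v: "vhom (y \<cdot> whisker \<gamma> s \<delta> \<cdot> z) \<alpha>' \<beta>'" if "vhom s \<alpha> \<beta>" for s
    using vhom_comp[OF y vhom_comp[OF vhom_whisker[OF that] z]] .
  show ?thesis
    unfolding scaled_iff[OF v[OF t] v[OF t']]
  proof (intro allI impI)
    fix \<gamma>' \<delta>' \<zeta> y' z' assume y': "vhom y' (\<gamma>' @ \<beta>' @ \<delta>') []" and z': "vhom z' \<zeta> (\<gamma>' @ \<alpha>' @ \<delta>')"
    let ?y = "y' \<cdot> whisker \<gamma>' y \<delta>'" and ?z = "whisker \<gamma>' z \<delta>' \<cdot> z'"
    have yz: "vhom ?y ((\<gamma>' @ \<gamma>) @ \<beta> @ (\<delta> @ \<delta>')) []" "vhom ?z \<zeta> ((\<gamma>' @ \<gamma>) @ \<alpha> @ (\<delta> @ \<delta>'))"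
      using y y' z z' by (auto simp: vhom_def)
    have eq: "y' \<cdot> whisker \<gamma>' (y \<cdot> whisker \<gamma> s \<delta> \<cdot> z) \<delta>' \<cdot> z' = ?y \<cdot> whisker (\<gamma>' @ \<gamma>) s (\<delta> @ \<delta>') \<cdot> ?z"
      if s: "vhom s \<alpha> \<beta>" for s
    proof -
      have "ok (y \<cdot> whisker \<gamma> s \<delta> \<cdot> z)" "ok (whisker \<gamma> s \<delta> \<cdot> z)"
        using s y z by (auto simp: vhom_def)
      then show ?thesis by (simp add: whisker_comp whisker_whisker comp_assoc)
    qed
    have "(\<lambda>c. q (?y \<cdot> whisker (\<gamma>' @ \<gamma>) t (\<delta> @ \<delta>') \<cdot> ?z) c -
        a * q (?y \<cdot> whisker (\<gamma>' @ \<gamma>) t' (\<delta> @ \<delta>') \<cdot> ?z) c) \<in> I \<zeta>"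
      using assms(1)[unfolded scaled_iff[OF t t']] yz by blast
    then show "(\<lambda>c. q (y' \<cdot> whisker \<gamma>' (y \<cdot> whisker \<gamma> t \<delta> \<cdot> z) \<delta>' \<cdot> z') c -
        a * q (y' \<cdot> whisker \<gamma>' (y \<cdot> whisker \<gamma> t' \<delta> \<cdot> z) \<delta>' \<cdot> z') c) \<in> I \<zeta>"
      by (simp only: eq[OF t] eq[OF t'])
  qed
qed

lemma scaled_comp:
  assumes "scaled t a t'" "scaled s b s'" "dom t = cod s" "c = a * b"
  shows "scaled (t \<cdot> s) c (t' \<cdot> s')"
proof -
  obtain \<alpha> \<beta> \<gamma> where t: "vhom t \<beta> \<gamma>" "vhom t' \<beta> \<gamma>" and s: "vhom s \<alpha> \<beta>" "vhom s' \<alpha> \<beta>"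
    using scaledE[OF assms(1)] scaledE[OF assms(2)] assms(3) by metis
  have "scaled (strands \<gamma> \<cdot> whisker [] t [] \<cdot> s) a (strands \<gamma> \<cdot> whisker [] t' [] \<cdot> s)"
    using t s by (intro scaled_context[OF assms(1) t(1), where \<beta>' = \<gamma> and \<alpha>' = \<alpha>]) (auto simp: vhom_basic)
  then have 1: "scaled (t \<cdot> s) a (t' \<cdot> s)"
    using t s by (simp add: vhom_def)
  have "scaled (t' \<cdot> whisker [] s [] \<cdot> strands \<alpha>) b (t' \<cdot> whisker [] s' [] \<cdot> strands \<alpha>)"
    using t s by (intro scaled_context[OF assms(2) s(1), where \<beta>' = \<gamma> and \<alpha>' = \<alpha>]) (auto simp: vhom_basic)
  then have 2: "scaled (t' \<cdot> s) b (t' \<cdot> s')"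
    using t s by (simp add: vhom_def)
  show ?thesis using scaled_trans[OF 1 2 assms(4)] .
qed

lemma scaled_whisker:
  assumes "scaled t a t'"
  shows "scaled (whisker \<gamma> t \<delta>) a (whisker \<gamma> t' \<delta>)"
proof -
  obtain \<alpha> \<beta> where t: "vhom t \<alpha> \<beta>" "vhom t' \<alpha> \<beta>" using scaledE[OF assms] by blast
  have "scaled (strands (\<gamma> @ \<beta> @ \<delta>) \<cdot> whisker \<gamma> t \<delta> \<cdot> strands (\<gamma> @ \<alpha> @ \<delta>)) a
      (strands (\<gamma> @ \<beta> @ \<delta>) \<cdot> whisker \<gamma> t' \<delta> \<cdot> strands (\<gamma> @ \<alpha> @ \<delta>))"
    by (rule scaled_context[OF assms t(1) vhom_basic(1) vhom_basic(1)])
  then show ?thesis using t by (simp add: vhom_def)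
qed

lemma scaled_comp_left: "scaled s b s' \<Longrightarrow> vhom t \<beta> \<gamma> \<Longrightarrow> cod s = \<beta> \<Longrightarrow> scaled (t \<cdot> s) b (t \<cdot> s')"
  using scaled_comp[OF scaled_refl] by (auto simp: vhom_def)

lemma scaled_comp_right: "scaled t a t' \<Longrightarrow> vhom s \<alpha> \<beta> \<Longrightarrow> dom t = \<beta> \<Longrightarrow> scaled (t \<cdot> s) a (t' \<cdot> s)"
  using scaled_comp[OF _ scaled_refl] by (auto simp: vhom_def)

lemma scaled_I:
  assumes "scaled t a t'" "vhom t \<sigma> []"
  shows "(\<lambda>c. q t c - a * q t' c) \<in> I \<sigma>"
proof -
  have t': "vhom t' \<sigma> []" using scaledE[OF assms(1)] assms(2) by (simp add: vhom_def)
  have "vhom (strands []) ([] @ [] @ []) []" "vhom (strands \<sigma>) \<sigma> ([] @ \<sigma> @ [])"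
    by (auto simp: vhom_basic)
  with assms(1)[unfolded scaled_iff[OF assms(2) t']]
  have "(\<lambda>c. q (strands [] \<cdot> whisker [] t [] \<cdot> strands \<sigma>) c -
      a * q (strands [] \<cdot> whisker [] t' [] \<cdot> strands \<sigma>) c) \<in> I \<sigma>" by blast
  then show ?thesis using vhomD[OF assms(2)] vhomD[OF t'] by simp
qed

lemma combination_lin:
  assumes "\<And>a t. (a, t) \<in> set xs \<Longrightarrow> wf_diagram t \<and> tgt t = \<beta>"
  shows "combination xs = lin (map (\<lambda>(a, t). (a, mev \<beta> \<cdot> whisker [] (abs_morph t) (dual \<beta>))) xs)"
  using assms
proof (induction xs)
  case (Cons p xs)
  obtain a t where p: "p = (a, t)" by (cases p)
  then have t: "wf_diagram t" "tgt t = \<beta>" using Cons.prems by auto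
  then have "wf_diagram (bend_down t)" by (simp add: bend_down_def typed)
  moreover have "abs_morph (bend_down t) = mev \<beta> \<cdot> whisker [] (abs_morph t) (dual \<beta>)"
    using t by (simp add: bend_down_def abs_morph_simps whisker_def)
  ultimately have "q (mev \<beta> \<cdot> whisker [] (abs_morph t) (dual \<beta>)) = single (tangle_class (bend_down t))"
    using q_abs by metis
  with Cons p show ?case by (auto simp: combination_def single_def fun_eq_iff)
qed (simp add: combination_def)

text \<open>Turns a defining relation, an element given by bent diagrams, into a relation between
  morphisms that applies in any context.\<close>

lemma rel_combination:
  assumes t: "\<forall>(a, t)\<in>set xs. vhom (abs_morph t) \<alpha> \<beta>" and I: "combination xs \<in> I (\<alpha> @ dual \<beta>)"
  shows "rel \<alpha> \<beta> (map (\<lambda>(a, t). (a, abs_morph t)) xs)"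
proof (rule rel_intro)
  have "wf_diagram t \<and> tgt t = \<beta>" if "(a, t) \<in> set xs" for a t
    using t that by (fastforce simp: vhom_def ok.abs_eq cod.abs_eq)
  then show "lin (map (\<lambda>(a, f). (a, mev \<beta> \<cdot> whisker [] f (dual \<beta>))) (map (\<lambda>(a, t). (a, abs_morph t)) xs)) \<in> I (\<alpha> @ dual \<beta>)"
    using I combination_lin[of xs \<beta>] by (simp add: o_def case_prod_unfold)
qed (use t in auto)

end

section \<open>Generators and relations as morphisms\<close>

lemma abs_vertex:
  "abs_morph (vertex g \<alpha> \<beta>) = whisker [] (disc g (\<alpha> @ dual \<beta>)) \<beta> \<cdot> whisker \<alpha> (mcoev (dual \<beta>)) []"
  by (simp add: vertex_def abs_morph_simps whisker_def)

text \<open>\<open>gl\<close>, \<open>gc\<close> and \<open>gd\<close> are the vertices with all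
  strands at the bottom, a functional on V and caps on two copies of V and of its dual.
  \<open>g2\<close> and \<open>g3\<close> have their last strand bent up. \<open>gu\<close> and
  \<open>gy\<close> are the two cups made from \<open>g3\<close>, which will turn out to differ by a
  sign.\<close>

definition gl :: "generator morph" where "gl = disc Gen1 [Pos]"
definition gc :: "generator morph" where "gc = disc Gen2 [Pos, Pos]"
definition gd :: "generator morph" where "gd = disc Gen3 [Neg, Neg]"
definition g2 :: "generator morph" where "g2 = whisker [] gc [Neg] \<cdot> whisker [Pos] (cup Pos) []"
definition g3 :: "generator morph" where "g3 = whisker [] gd [Pos] \<cdot> whisker [Neg] (cup Neg) []"
definition gu :: "generator morph" where "gu = whisker [Pos] g3 [] \<cdot> cup Pos"
definition gy :: "generator morph" where "gy = whisker [] g3 [Pos] \<cdot> cup Neg"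

lemma gen_typed [simp]:
  "ok gl" "dom gl = [Pos]" "cod gl = []" "vertices gl = {#(Gen1, [Pos])#}"
  "ok gc" "dom gc = [Pos, Pos]" "cod gc = []" "vertices gc = {#(Gen2, [Pos, Pos])#}"
  "ok gd" "dom gd = [Neg, Neg]" "cod gd = []" "vertices gd = {#(Gen3, [Neg, Neg])#}"
  "ok g2" "dom g2 = [Pos]" "cod g2 = [Neg]" "vertices g2 = {#(Gen2, [Pos, Pos])#}"
  "ok g3" "dom g3 = [Neg]" "cod g3 = [Pos]" "vertices g3 = {#(Gen3, [Neg, Neg])#}"
  "ok gu" "dom gu = []" "cod gu = [Pos, Pos]" "vertices gu = {#(Gen3, [Neg, Neg])#}"
  "ok gy" "dom gy = []" "cod gy = [Pos, Pos]" "vertices gy = {#(Gen3, [Neg, Neg])#}"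
  by (simp_all add: gl_def gc_def gd_def g2_def g3_def gu_def gy_def)

lemma abs_generators:
  "abs_morph G1 = gl" "abs_morph G2 = g2" "abs_morph G3 = g3"
  by (simp_all add: abs_vertex gl_def gc_def gd_def g2_def g3_def whisker_strands)

lemma cap_g2: "cap Neg \<cdot> whisker [] g2 [Pos] = gc"
proof -
  have e: "cap Neg \<cdot> whisker [] gc [Neg, Pos] = gc \<cdot> whisker [Pos, Pos] (cap Neg) []"
    using exchange[of gc "cap Neg" "[]" "[]" "[]"] by simp
  have z: "whisker [Pos, Pos] (cap Neg) [] \<cdot> whisker [Pos] (cup Pos) [Pos] = (strands [Pos, Pos] :: generator morph)"
    using zigzag_left[where 'a = generator, of "[Pos]" Pos "[]"] by simp
  show ?thesis by (simp add: g2_def whisker_norm comp_tail2[OF e] z)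
qed

text \<open>Rotation by a half turn amounts to bending the first leg of \<open>gc\<close> up on the
  left, whereas \<open>g2\<close> bends the second leg up on the right. \<open>E4\<close> thus
  compares the two legs.\<close>

lemma abs_G2_star: "abs_morph G2_star = whisker [Neg] gc [] \<cdot> whisker [] (cup Neg) [Pos]"
proof -
  have c: "cross Pos Neg \<cdot> cup Pos = (cup Neg :: generator morph)"
    using cross_cup_turn[where 'a = generator, of Neg] by simp
  have "abs_morph G2_star = whisker [Neg] (cap Neg \<cdot> whisker [] g2 [Pos]) [] \<cdot> whisker [] (cup Neg) [Pos]"
    by (simp add: G2_star_def abs_morph_simps abs_generators flip: whisker_def)
      (simp add: abs_generators c whisker_def juxt_assoc juxt_strands comp_assoc juxt_strands_comp)
  then show ?thesis by (simp add: cap_g2)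
qed

locale generator_calculus = diagram_calculus generator_degree I
  for I :: "sign list \<Rightarrow> (generator diagram set \<Rightarrow> complex) set" +
  assumes relations: "relations \<sigma> \<subseteq> I \<sigma>"
begin

lemma scaled_E1: "scaled (g2 \<cdot> g3) 1 (strands [Neg])"
proof -
  have "E1 \<in> relations ([Neg] @ dual [Neg])" by (simp add: relations_def)
  then have "combination [(1, G2 \<circ>\<^sub>t G3), (- 1, id_Vd)] \<in> I ([Neg] @ dual [Neg])"
    using relations by (auto simp: E1_def)
  moreover have "abs_morph (G2 \<circ>\<^sub>t G3) = g2 \<cdot> g3" "abs_morph id_Vd = (strands [Neg] :: generator morph)"
    by (simp_all add: abs_morph_simps abs_generators)
  ultimately show ?thesis
    using rel_combination[of "[(1, G2 \<circ>\<^sub>t G3), (- 1, id_Vd)]" "[Neg]" "[Neg]"]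
    by (auto simp: scaled_def vhom_def)
qed

lemma scaled_E2: "scaled (gl \<cdot> g3 \<cdot> whisker [] gl [Neg] \<cdot> cup Pos) 0 (strands [])"
proof -
  have "E2 \<in> relations ([] @ dual [])" by (simp add: relations_def)
  then have "combination [(1, G1 \<circ>\<^sub>t G3 \<circ>\<^sub>t G1_star)] \<in> I ([] @ dual [])"
    using relations by (auto simp: E2_def)
  moreover have "abs_morph (G1 \<circ>\<^sub>t G3 \<circ>\<^sub>t G1_star) = gl \<cdot> g3 \<cdot> whisker [] gl [Neg] \<cdot> cup Pos"
    by (simp add: G1_star_def abs_morph_simps abs_generators whisker_def)
  ultimately have "rel [] [] [(1, gl \<cdot> g3 \<cdot> whisker [] gl [Neg] \<cdot> cup Pos)]"
    using rel_combination[of "[(1, G1 \<circ>\<^sub>t G3 \<circ>\<^sub>t G1_star)]" "[]" "[]"]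
    by (auto simp: vhom_def)
  then show ?thesis by (auto simp: scaled_def rel_def vhom_def)
qed

lemma scaled_E3: "scaled (cap Neg \<cdot> cup Neg) 2 (strands [])"
proof -
  have c: "cross Pos Neg \<cdot> cup Pos = (cup Neg :: generator morph)"
    using cross_cup_turn[where 'a = generator, of Neg] by simp
  have "E3 \<in> relations ([] @ dual [])" by (simp add: relations_def)
  then have "combination [(1, eps \<circ>\<^sub>t Crossing Pos Neg \<circ>\<^sub>t eta), (- 2, Strands [])] \<in> I ([] @ dual [])"
    using relations by (auto simp: E3_def)
  moreover have "abs_morph (eps \<circ>\<^sub>t Crossing Pos Neg \<circ>\<^sub>t eta) = cap Neg \<cdot> (cup Neg :: generator morph)"
    "abs_morph (Strands []) = (strands [] :: generator morph)"
    by (simp_all add: abs_morph_simps c)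
  ultimately show ?thesis
    using rel_combination[of "[(1, eps \<circ>\<^sub>t Crossing Pos Neg \<circ>\<^sub>t eta), (- 2, Strands [])]" "[]" "[]"]
    by (auto simp: scaled_def vhom_def)
qed

lemma scaled_E4: "scaled (whisker [Neg] gc [] \<cdot> whisker [] (cup Neg) [Pos]) (-1) g2"
proof -
  have "E4 \<in> relations ([Pos] @ dual [Neg])" by (simp add: relations_def)
  then have "combination [(1, G2_star), (1, G2)] \<in> I ([Pos] @ dual [Neg])"
    using relations by (auto simp: E4_def)
  then show ?thesis
    using rel_combination[of "[(1, G2_star), (1, G2)]" "[Pos]" "[Neg]"]
    by (auto simp: scaled_def vhom_def abs_generators abs_G2_star)
qed

lemma rel_E5: "rel [Pos, Pos] [Pos, Pos] [(1, cross Pos Pos), (-1, strands [Pos, Pos]), (-1, gu \<cdot> gc)]"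
proof -
  let ?xs = "[(1, Crossing Pos Pos), (- 1, id_V \<otimes>\<^sub>t id_V),
     (- 1 :: complex, (id_V \<otimes>\<^sub>t G3) \<circ>\<^sub>t eta \<circ>\<^sub>t eps \<circ>\<^sub>t (G2 \<otimes>\<^sub>t id_V))]"
  have "E5 \<in> relations ([Pos, Pos] @ dual [Pos, Pos])" by (simp add: relations_def)
  then have "combination ?xs \<in> I ([Pos, Pos] @ dual [Pos, Pos])"
    using relations by (auto simp: E5_def)
  moreover have "abs_morph (Crossing Pos Pos) = (cross Pos Pos :: generator morph)"
    "abs_morph (id_V \<otimes>\<^sub>t id_V) = (strands [Pos, Pos] :: generator morph)"
    by (simp_all add: abs_morph_simps juxt_strands)
  moreover have "abs_morph ((id_V \<otimes>\<^sub>t G3) \<circ>\<^sub>t eta \<circ>\<^sub>t eps \<circ>\<^sub>t (G2 \<otimes>\<^sub>t id_V)) =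
      whisker [Pos] g3 [] \<cdot> cup Pos \<cdot> cap Neg \<cdot> whisker [] g2 [Pos]"
    by (simp add: abs_morph_simps abs_generators whisker_def)
  then have "abs_morph ((id_V \<otimes>\<^sub>t G3) \<circ>\<^sub>t eta \<circ>\<^sub>t eps \<circ>\<^sub>t (G2 \<otimes>\<^sub>t id_V)) = gu \<cdot> gc"
    by (simp add: cap_g2 gu_def comp_assoc)
  ultimately show ?thesis
    using rel_combination[of ?xs "[Pos, Pos]" "[Pos, Pos]"]
    by (auto simp: vhom_def)
qed

text \<open>Hence \<open>gc\<close> and \<open>gu\<close> satisfy the Temperley--Lieb relations with loop value \<open>-2\<close>.\<close>

lemma scaled_cap_g2: "scaled (cap Pos \<cdot> whisker [Pos] g2 []) (-1) gc"
proof -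
  have e: "cap Pos \<cdot> whisker [Pos, Neg] gc [] = gc \<cdot> whisker [] (cap Pos) [Pos, Pos]"
    using exchange[of "cap Pos" gc "[]" "[]" "[]"] by simp
  have z: "whisker [] (cap Pos) [Pos, Pos] \<cdot> whisker [Pos] (cup Neg) [Pos] = (strands [Pos, Pos] :: generator morph)"
    using zigzag_right[where 'a = generator, of "[]" Pos "[Pos]"] by simp
  have "scaled (cap Pos \<cdot> whisker [Pos] g2 []) (-1)
      (cap Pos \<cdot> whisker [Pos] (whisker [Neg] gc [] \<cdot> whisker [] (cup Neg) [Pos]) [])"
    by (intro scaled_comp_left scaled_whisker scaled_sym[OF scaled_E4]) (auto simp: vhom_def)
  then show ?thesis by (simp add: whisker_norm comp_tail2[OF e] z)
qed

text \<open>Writing \<open>gc\<close> as a cap above \<open>g2\<close> brings \<open>g2\<close> onto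
  the \<open>g3\<close> of \<open>gu\<close>; \<open>E1\<close> cancels them and the ordinary zigzag
  remains.\<close>

lemma scaled_zigzag_left: "scaled (whisker [Pos] gc [] \<cdot> whisker [] gu [Pos]) 1 (strands [Pos])"
proof -
  have z: "whisker [Pos] (cap Neg) [] \<cdot> whisker [] (cup Pos) [Pos] = (strands [Pos] :: generator morph)"
    using zigzag_left[where 'a = generator, of "[]" Pos "[]"] by simp
  have "scaled (whisker [Pos] (cap Neg) [] \<cdot> whisker [Pos] (g2 \<cdot> g3) [Pos] \<cdot> whisker [] (cup Pos) [Pos]) 1
      (whisker [Pos] (cap Neg) [] \<cdot> whisker [Pos] (strands [Neg]) [Pos] \<cdot> whisker [] (cup Pos) [Pos])"
    by (rule scaled_context[OF scaled_E1]) (auto simp: vhom_def)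
  moreover have "whisker [Pos] gc [] = whisker [Pos] (cap Neg) [] \<cdot> whisker [Pos] g2 [Pos]"
    using arg_cong[OF cap_g2, of "\<lambda>t. whisker [Pos] t []"] by (simp add: whisker_norm)
  ultimately show ?thesis by (simp add: gu_def whisker_norm z)
qed

text \<open>Here \<open>g3\<close> meets the other leg of \<open>gc\<close>. By
  \<open>scaled_cap_g2\<close> using that leg costs the sign of \<open>E4\<close>, after which
  \<open>E1\<close> cancels as before.\<close>

lemma scaled_zigzag_gy: "scaled (whisker [] gc [Pos] \<cdot> whisker [Pos] gy []) (-1) (strands [Pos])"
proof -
  have z: "whisker [] (cap Pos) [Pos] \<cdot> whisker [Pos] (cup Neg) [] = (strands [Pos] :: generator morph)"
    using zigzag_right[where 'a = generator, of "[]" Pos "[]"] by simp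
  have 1: "scaled (whisker [] gc [Pos] \<cdot> whisker [Pos] gy []) (-1)
      (whisker [] (cap Pos \<cdot> whisker [Pos] g2 []) [Pos] \<cdot> whisker [Pos] gy [])"
    by (intro scaled_comp_right scaled_whisker scaled_sym[OF scaled_cap_g2]) (auto simp: vhom_def)
  have "scaled (whisker [] (cap Pos) [Pos] \<cdot> whisker [Pos] (g2 \<cdot> g3) [Pos] \<cdot> whisker [Pos] (cup Neg) []) 1
      (whisker [] (cap Pos) [Pos] \<cdot> whisker [Pos] (strands [Neg]) [Pos] \<cdot> whisker [Pos] (cup Neg) [])"
    by (rule scaled_context[OF scaled_E1]) (auto simp: vhom_def)
  then have 2: "scaled (whisker [] (cap Pos \<cdot> whisker [Pos] g2 []) [Pos] \<cdot> whisker [Pos] gy []) 1 (strands [Pos])"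
    by (simp add: gy_def whisker_norm z)
  show ?thesis using scaled_trans[OF 1 2] by simp
qed

text \<open>Join \<open>gu\<close> and \<open>gy\<close> by a \<open>gc\<close> in the middle: the
  zigzag with \<open>gu\<close> returns \<open>gy\<close>, and the zigzag with \<open>gy\<close>
  returns - \<open>gu\<close>. This is the uniqueness argument for duals.\<close>

lemma scaled_gy_gu: "scaled gy (-1) gu"
proof -
  have ex: "whisker [] gu [Pos, Pos] \<cdot> gy = whisker [Pos, Pos] gy [] \<cdot> gu"
    using exchange[of gu gy "[]" "[]" "[]"] by simp
  have "scaled (whisker [] (whisker [Pos] gc [] \<cdot> whisker [] gu [Pos]) [Pos] \<cdot> gy) 1 (whisker [] (strands [Pos]) [Pos] \<cdot> gy)"
    by (intro scaled_comp_right scaled_whisker scaled_zigzag_left) (auto simp: vhom_def)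
  then have 1: "scaled (whisker [Pos] gc [Pos] \<cdot> whisker [] gu [Pos, Pos] \<cdot> gy) 1 gy"
    by (simp add: whisker_norm)
  have "scaled (whisker [Pos] (whisker [] gc [Pos] \<cdot> whisker [Pos] gy []) [] \<cdot> gu) (-1) (whisker [Pos] (strands [Pos]) [] \<cdot> gu)"
    by (intro scaled_comp_right scaled_whisker scaled_zigzag_gy) (auto simp: vhom_def)
  then have 2: "scaled (whisker [Pos] gc [Pos] \<cdot> whisker [] gu [Pos, Pos] \<cdot> gy) (-1) gu"
    by (simp add: whisker_norm ex)
  show ?thesis by (rule scaled_trans[OF scaled_sym[OF 1, of 1] 2]) auto
qed

lemma scaled_zigzag_right: "scaled (whisker [] gc [Pos] \<cdot> whisker [Pos] gu []) 1 (strands [Pos])"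
proof -
  have "scaled (whisker [] gc [Pos] \<cdot> whisker [Pos] gu []) (-1) (whisker [] gc [Pos] \<cdot> whisker [Pos] gy [])"
    by (intro scaled_comp_left scaled_whisker scaled_sym[OF scaled_gy_gu]) (auto simp: vhom_def)
  from scaled_trans[OF this scaled_zigzag_gy] show ?thesis by simp
qed

text \<open>\<open>E1\<close> makes \<open>g3\<close> only a right inverse of \<open>g2\<close>.
  This composite is the other zigzag of \<open>gc\<close> and \<open>gu\<close>, so it is an
  identity as well.\<close>

lemma scaled_g3_g2: "scaled (g3 \<cdot> g2) 1 (strands [Pos])"
proof -
  have ex: "whisker [] gc [Pos] \<cdot> whisker [Pos, Pos] g3 [] = g3 \<cdot> whisker [] gc [Neg]"
    using exchange[of gc g3 "[]" "[]" "[]"] by simp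
  have "g3 \<cdot> g2 = whisker [] gc [Pos] \<cdot> whisker [Pos] gu []"
    by (simp add: g2_def gu_def whisker_norm comp_tail2[OF ex])
  then show ?thesis using scaled_zigzag_right by simp
qed

text \<open>Replacing \<open>gu\<close> by - \<open>gy\<close> lets \<open>g2\<close> and
  \<open>g3\<close> cancel and leaves the oriented circle: -2 is the sign of \<open>E4\<close> times
  the value 2 in \<open>E3\<close>.\<close>

lemma scaled_loop: "scaled (gc \<cdot> gu) (-2) (strands [])"
proof -
  have 1: "scaled (gc \<cdot> gu) (-1) (gc \<cdot> gy)"
    by (intro scaled_comp_left scaled_sym[OF scaled_gy_gu]) (auto simp: vhom_def)
  have "scaled (cap Neg \<cdot> whisker [] (g2 \<cdot> g3) [Pos] \<cdot> cup Neg) 1 (cap Neg \<cdot> whisker [] (strands [Neg]) [Pos] \<cdot> cup Neg)"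
    by (rule scaled_context[OF scaled_E1]) (auto simp: vhom_def)
  moreover have "cap Neg \<cdot> whisker [] (strands [Neg]) [Pos] \<cdot> cup Neg = (cap Neg \<cdot> cup Neg :: generator morph)"
    by (simp add: whisker_strands)
  moreover have "cap Neg \<cdot> whisker [] (g2 \<cdot> g3) [Pos] \<cdot> cup Neg = gc \<cdot> gy"
    by (simp add: gy_def whisker_comp comp_tail[OF cap_g2] comp_assoc)
  ultimately have 2: "scaled (gc \<cdot> gy) 1 (cap Neg \<cdot> cup Neg)" by simp
  show ?thesis using scaled_trans[OF scaled_trans[OF 1 2] scaled_E3] by simp
qed

text \<open>The invariant vector of V dual to \<open>gl\<close> under \<open>gu\<close>;
  \<open>E2\<close> says that \<open>gl\<close> vanishes on it.\<close>

definition gv :: "generator morph" where "gv = whisker [Pos] gl [] \<cdot> gu"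

lemma gv_typed [simp]: "ok gv" "dom gv = []" "cod gv = [Pos]" "vertices gv = {#(Gen1, [Pos]), (Gen3, [Neg, Neg])#}"
  by (simp_all add: gv_def)

lemma scaled_gl_gv: "scaled (gl \<cdot> gv) 0 (strands [])"
proof -
  have e1: "gl \<cdot> whisker [Pos] gl [] = gl \<cdot> whisker [] gl [Pos]"
    using exchange[of gl gl "[]" "[]" "[]"] by simp
  have e2: "whisker [] gl [Pos] \<cdot> whisker [Pos] g3 [] = g3 \<cdot> whisker [] gl [Neg]"
    using exchange[of gl g3 "[]" "[]" "[]"] by simp
  have "gl \<cdot> gv = gl \<cdot> g3 \<cdot> whisker [] gl [Neg] \<cdot> cup Pos"
    by (simp add: gv_def gu_def comp_tail2[OF e1] comp_tail2[OF e2])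
  then show ?thesis using scaled_E2 by simp
qed

text \<open>Naturality moves \<open>gl\<close> one strand to the right at the cost of a crossing.
  Repeated, it brings \<open>gl\<close> to the far right, where \<open>nf_snoc\<close> absorbs
  it.\<close>

lemma slide_gl: "whisker [] gl [s] = whisker [s] gl [] \<cdot> cross Pos s"
proof -
  have "whisker [] gl [s] \<cdot> cross s Pos = whisker [s] gl []"
    using slide_box[of gl "[Pos]" s] by (simp add: mpass_Cons whisker_strands)
  then have "whisker [s] gl [] \<cdot> cross Pos s = whisker [] gl [s] \<cdot> cross s Pos \<cdot> cross Pos s"
    by (simp flip: comp_assoc)
  then show ?thesis by (simp add: Reidemeister_2)
qed

end

section \<open>Normal forms\<close>

definition pos :: "nat \<Rightarrow> sign list" where "pos n = replicate n Pos"

lemma pos_simps [simp]: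
  "pos 0 = []" "length (pos n) = n" "Pos # pos n = pos (Suc n)" "pos m @ pos n = pos (m + n)"
  "pos m @ Pos # \<sigma> = pos (Suc m) @ \<sigma>" "pos m = pos n \<longleftrightarrow> m = n"
  "pos m @ pos n @ \<sigma> = pos (m + n) @ \<sigma>"
  by (simp_all add: pos_def replicate_add replicate_app_Cons_same)

lemma pos_small: "[Pos] = pos (Suc 0)" "[Pos, Pos] = pos (Suc (Suc 0))"
  by (simp_all add: pos_def)

text \<open>
  A word over \<open>True\<close> (opening) and \<open>False\<close> (closing) describes a planar diagram: a closing letter
  is joined by \<open>gc\<close> to the matching opening letter, and each unmatched opening letter ends in \<open>gl\<close>.
  The number \<open>i\<close> counts the strands that are still open on the left.
\<close>

primrec gl_power :: "nat \<Rightarrow> generator morph" where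
  "gl_power 0 = strands []"
| "gl_power (Suc i) = gl_power i \<cdot> whisker (pos i) gl []"

fun nf :: "nat \<Rightarrow> bool list \<Rightarrow> generator morph" where
  "nf i [] = gl_power i"
| "nf i (True # r) = nf (Suc i) r"
| "nf 0 (False # r) = strands []"
| "nf (Suc i) (False # r) = nf i r \<cdot> whisker (pos i) gc (pos (length r))"

fun ballot :: "nat \<Rightarrow> bool list \<Rightarrow> bool" where
  "ballot i [] = True"
| "ballot i (True # r) = ballot (Suc i) r"
| "ballot 0 (False # r) = False"
| "ballot (Suc i) (False # r) = ballot i r"

lemma gl_power_typed [simp]:
  "ok (gl_power i) \<and> dom (gl_power i) = pos i \<and> cod (gl_power i) = [] \<and>
   (\<forall>(g, \<tau>)\<in>#vertices (gl_power i). \<tau> = generator_degree g)"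
  by (induction i) auto

lemma nf_typed:
  "ballot i r \<Longrightarrow> ok (nf i r) \<and> dom (nf i r) = pos (i + length r) \<and> cod (nf i r) = [] \<and>
   (\<forall>(g, \<tau>)\<in>#vertices (nf i r). \<tau> = generator_degree g)"
  by (induction i r rule: nf.induct) auto

text \<open>Open strands on the left can be written as leading opening letters, which brings every
  result back to the index 0.\<close>

lemma nf_replicate [simp]: "nf j (replicate i True @ r) = nf (j + i) r"
  and ballot_replicate [simp]: "ballot j (replicate i True @ r) = ballot (j + i) r"
  by (induction i arbitrary: j) auto

text \<open>The new cap is exchanged past the caps already below it until it reaches its place; it
  then reads as a pair of adjacent letters.\<close>

lemma nf_insert:
  "ballot i (r1 @ r2) \<Longrightarrow> nf i (r1 @ r2) \<cdot> whisker (pos (i + length r1)) gc (pos (length r2)) =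
     nf i (r1 @ True # False # r2) \<and> ballot i (r1 @ True # False # r2)"
proof (induction i r1 rule: nf.induct)
  case (4 k r)
  have e: "whisker (pos k) gc (pos (length r + length r2)) \<cdot> whisker (pos (Suc (Suc (k + length r)))) gc (pos (length r2)) =
      whisker (pos (k + length r)) gc (pos (length r2)) \<cdot> whisker (pos k) gc (pos (Suc (Suc (length r + length r2))))"
    using exchange[of gc gc "pos k" "pos (length r)" "pos (length r2)"] by (simp add: pos_small)
  show ?case using 4 by (simp add: comp_assoc e comp_tail)
qed auto

text \<open>At the far right no cap encloses the new \<open>gl\<close>, so it becomes an unmatched
  opening letter.\<close>

lemma nf_snoc:
  "ballot i r \<Longrightarrow> nf i r \<cdot> whisker (pos (i + length r)) gl [] = nf i (r @ [True]) \<and> ballot i (r @ [True])"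
proof (induction i r rule: nf.induct)
  case (4 k r)
  have e: "whisker (pos k) gc (pos (length r)) \<cdot> whisker (pos (Suc (Suc (k + length r)))) gl [] =
      whisker (pos (k + length r)) gl [] \<cdot> whisker (pos k) gc (pos (Suc (length r)))"
    using exchange[of gc gl "pos k" "pos (length r)" "[]"] by (simp add: pos_small)
  have IH: "nf k r \<cdot> whisker (pos (k + length r)) gl [] = nf k (r @ [True])" "ballot k (r @ [True])"
    using 4 by auto
  show ?case using IH by (simp add: comp_assoc e comp_tail[OF IH(1)])
qed auto

context generator_calculus
begin

text \<open>Two neighbouring copies of \<open>gl\<close> joined by \<open>gu\<close> form
  \<open>gl\<close> on \<open>gv\<close>, which is 0 by \<open>E2\<close>. The induction removes the
  copies of \<open>gl\<close> to the right of the cup.\<close>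

lemma gl_power_gu: "scaled (gl_power (p + m + 2) \<cdot> whisker (pos p) gu (pos m)) 0 (gl_power (p + m))"
proof (induction m)
  case 0
  have e: "gl \<cdot> whisker [Pos] gl [] = gl \<cdot> whisker [] gl [Pos]"
    using exchange[of gl gl "[]" "[]" "[]"] by simp
  have "scaled (gl_power p \<cdot> whisker (pos p) (gl \<cdot> gv) []) 0 (gl_power p \<cdot> whisker (pos p) (strands []) [])"
    by (intro scaled_comp_left scaled_whisker scaled_gl_gv) (auto simp: vhom_def)
  moreover have "whisker (pos (Suc p)) gl [] \<cdot> whisker (pos p) gu [] = whisker (pos p) gv []"
    using arg_cong[OF gv_def, of "\<lambda>t. whisker (pos p) t []"] by (simp add: whisker_norm)
  ultimately show ?case by (simp add: whisker_norm)
next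
  case (Suc m)
  have e: "whisker (pos (p + m + 2)) gl [] \<cdot> whisker (pos p) gu (pos (Suc m)) =
      whisker (pos p) gu (pos m) \<cdot> whisker (pos (p + m)) gl []"
    using exchange[of gu gl "pos p" "pos m" "[]"] by (simp add: pos_small)
  have "scaled ((gl_power (p + m + 2) \<cdot> whisker (pos p) gu (pos m)) \<cdot> whisker (pos (p + m)) gl []) 0
      (gl_power (p + m) \<cdot> whisker (pos (p + m)) gl [])"
    by (intro scaled_comp_right Suc.IH) (auto simp: vhom_def pos_small)
  then show ?case using e by (simp add: comp_assoc)
qed

text \<open>The cap of the first closing letter is the lowest piece, so a cup attached below meets
  it first. At the same position they form a loop, one strand apart a zigzag, and further apart they
  are exchanged and the induction continues. Without closing letters \<open>gl_power_gu\<close>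
  applies. In each case the result is a multiple of a single normal form.\<close>

lemma nf_gu:
  "ballot i r \<Longrightarrow> i + length r = p + m + 2 \<Longrightarrow>
     \<exists>a r'. length r' = p + m \<and> ballot 0 r' \<and> scaled (nf i r \<cdot> whisker (pos p) gu (pos m)) a (nf 0 r')"
proof (induction i r arbitrary: p m rule: nf.induct)
  case (1 i)
  then have "scaled (nf i [] \<cdot> whisker (pos p) gu (pos m)) 0 (nf 0 (replicate (p + m) True @ []))"
    unfolding nf_replicate using gl_power_gu[of p m] by simp
  then show ?case by (intro exI[of _ 0] exI[of _ "replicate (p + m) True @ []"]) (simp del: append_Nil2)
next
  case (2 i r)
  then show ?case by simp
next
  case (3 r)
  then show ?case by simp
next
  case (4 k r)
  have b: "ballot k r" using 4 by simp
  have len: "k + length r = p + m" using 4(3) by simp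
  note v = nf_typed[OF b]
  \<comment> \<open>A normal form with \<open>k\<close> open strands is one of index 0 whose word
    begins with \<open>k\<close> opening letters.\<close>
  have shift: ?case if "scaled (nf (Suc k) (False # r) \<cdot> whisker (pos p) gu (pos m)) a (nf k r)" for a
    using that b len by (intro exI[of _ a] exI[of _ "replicate k True @ r"]) simp
  consider "p = k" | "p = Suc k" | "k = Suc p" | "p \<ge> k + 2" | "k \<ge> p + 2" by linarith
  then show ?case
  proof cases
    case 1
    have "scaled (nf k r \<cdot> whisker (pos k) (gc \<cdot> gu) (pos (length r))) (-2) (nf k r \<cdot> whisker (pos k) (strands []) (pos (length r)))"
      using v by (intro scaled_comp_left scaled_whisker scaled_loop) (auto simp: vhom_def)
    then show ?thesis
      using v 1 len by (intro shift[of "-2"]) (simp add: whisker_norm)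
  next
    case 2
    have "scaled (nf k r \<cdot> whisker (pos k) (whisker [] gc [Pos] \<cdot> whisker [Pos] gu []) (pos m)) 1
        (nf k r \<cdot> whisker (pos k) (strands [Pos]) (pos m))"
      using v 2 len by (intro scaled_comp_left scaled_whisker scaled_zigzag_right) (auto simp: vhom_def)
    then show ?thesis
      using v 2 len by (intro shift[of 1]) (simp add: whisker_norm)
  next
    case 3
    have "scaled (nf k r \<cdot> whisker (pos p) (whisker [Pos] gc [] \<cdot> whisker [] gu [Pos]) (pos (length r))) 1
        (nf k r \<cdot> whisker (pos p) (strands [Pos]) (pos (length r)))"
      using v 3 len by (intro scaled_comp_left scaled_whisker scaled_zigzag_left) (auto simp: vhom_def)
    then show ?thesis
      using v 3 len by (intro shift[of 1]) (simp add: whisker_norm)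
  next
    case 4
    \<comment> \<open>\<open>j\<close> strands separate the cap from the cup. Once the induction has
      absorbed the cup, \<open>nf_insert\<close> puts the cap back as a pair of adjacent letters
      after the first \<open>k\<close> letters.\<close>
    define j where "j = p - k - 2"
    have p: "p = k + j + 2" "length r = j + m + 2" using 4 len by (auto simp: j_def)
    obtain a r' where r': "length r' = k + j + m" "ballot 0 r'" "scaled (nf k r \<cdot> whisker (pos (k + j)) gu (pos m)) a (nf 0 r')"
      using "4.IH"[OF b, of "k + j" m] p by auto
    have e: "whisker (pos k) gc (pos (length r)) \<cdot> whisker (pos p) gu (pos m) =
        whisker (pos (k + j)) gu (pos m) \<cdot> whisker (pos k) gc (pos (j + m))"
      using exchange[of gc gu "pos k" "pos j" "pos m"] p by (simp add: pos_small)
    have "scaled ((nf k r \<cdot> whisker (pos (k + j)) gu (pos m)) \<cdot> whisker (pos k) gc (pos (j + m))) a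
        (nf 0 r' \<cdot> whisker (pos k) gc (pos (j + m)))"
      using v p by (intro scaled_comp_right r'(3)) (auto simp: vhom_def pos_small)
    moreover have "nf 0 r' \<cdot> whisker (pos k) gc (pos (j + m)) = nf 0 (take k r' @ True # False # drop k r') \<and>
        ballot 0 (take k r' @ True # False # drop k r')"
      using nf_insert[of 0 "take k r'" "drop k r'"] r'(1,2) by simp
    ultimately show ?thesis
      using r'(1) p by (intro exI[of _ a] exI[of _ "take k r' @ True # False # drop k r'"])
        (simp add: comp_assoc e[unfolded p, simplified])
  next
    case 5
    define j where "j = k - p - 2"
    have p: "k = p + j + 2" "m = j + length r + 2" using 5 len by (auto simp: j_def)
    obtain a r' where r': "length r' = p + (j + length r)" "ballot 0 r'"
        "scaled (nf k r \<cdot> whisker (pos p) gu (pos (j + length r))) a (nf 0 r')"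
      using "4.IH"[OF b, of p "j + length r"] p by (auto simp: add.assoc)
    have e: "whisker (pos k) gc (pos (length r)) \<cdot> whisker (pos p) gu (pos m) =
        whisker (pos p) gu (pos (j + length r)) \<cdot> whisker (pos (p + j)) gc (pos (length r))"
      using exchange[of gu gc "pos p" "pos j" "pos (length r)"] p by (simp add: pos_small)
    have "scaled ((nf k r \<cdot> whisker (pos p) gu (pos (j + length r))) \<cdot> whisker (pos (p + j)) gc (pos (length r))) a
        (nf 0 r' \<cdot> whisker (pos (p + j)) gc (pos (length r)))"
      using v p by (intro scaled_comp_right r'(3)) (auto simp: vhom_def pos_small)
    moreover have "nf 0 r' \<cdot> whisker (pos (p + j)) gc (pos (length r)) =
        nf 0 (take (p + j) r' @ True # False # drop (p + j) r') \<and>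
        ballot 0 (take (p + j) r' @ True # False # drop (p + j) r')"
      using nf_insert[of 0 "take (p + j) r'" "drop (p + j) r'"] r'(1,2) by simp
    ultimately show ?thesis
      using r'(1) p by (intro exI[of _ a] exI[of _ "take (p + j) r' @ True # False # drop (p + j) r'"])
        (simp add: comp_assoc e[unfolded p, simplified])
  qed
qed

end

primrec straighten :: "sign list \<Rightarrow> generator morph" where
  "straighten [] = strands []"
| "straighten (s # \<sigma>) = (case s of Pos \<Rightarrow> strands [Pos] | Neg \<Rightarrow> g3) \<boxtimes> straighten \<sigma>"

lemma straighten_typed [simp]:
  "ok (straighten \<sigma>) \<and> dom (straighten \<sigma>) = \<sigma> \<and> cod (straighten \<sigma>) = pos (length \<sigma>) \<and>
   (\<forall>(g, \<tau>)\<in>#vertices (straighten \<sigma>). \<tau> = generator_degree g)"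
  by (induction \<sigma>) (auto split: sign.splits)

lemma straighten_vertices: "(g, \<tau>) \<in># vertices (straighten \<sigma>) \<Longrightarrow> \<tau> = generator_degree g"
  using straighten_typed[of \<sigma>] by blast

lemma straighten_append: "straighten (\<alpha> @ \<beta>) = straighten \<alpha> \<boxtimes> straighten \<beta>"
  by (induction \<alpha>) (auto simp: juxt_assoc)

lemma straighten_pos [simp]: "straighten (pos n) = strands (pos n)"
  by (induction n) (auto simp: juxt_strands simp flip: pos_simps(3))

lemma straighten_single [simp]: "straighten [Pos] = strands [Pos]" "straighten [Neg] = g3"
  by simp_all

lemma interchange3:
  assumes "ok (f \<cdot> g)" "ok (f' \<cdot> g')" "ok (f'' \<cdot> g'')"
  shows "(f \<boxtimes> f' \<boxtimes> f'') \<cdot> (g \<boxtimes> g' \<boxtimes> g'') = (f \<cdot> g) \<boxtimes> (f' \<cdot> g') \<boxtimes> (f'' \<cdot> g'')"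
  using assms interchange[of f g "f' \<boxtimes> f''" "g' \<boxtimes> g''"] interchange[of f' g' f'' g''] by simp

lemma straighten_whisker:
  assumes "ok t" "dom t = \<alpha>" "cod t = \<beta>" "ok t'" "dom t' = pos (length \<alpha>)" "cod t' = pos (length \<beta>)"
    and "straighten \<beta> \<cdot> t = t' \<cdot> straighten \<alpha>"
  shows "straighten (\<gamma> @ \<beta> @ \<delta>) \<cdot> whisker \<gamma> t \<delta> =
    whisker (pos (length \<gamma>)) t' (pos (length \<delta>)) \<cdot> straighten (\<gamma> @ \<alpha> @ \<delta>)"
  using assms(1-6) unfolding whisker_def straighten_append
  by (simp add: interchange3 assms(7))

context generator_calculus
begin

section \<open>Normal forms span the quotient\<close>

definition spanned :: "sign list \<Rightarrow> (generator diagram set \<Rightarrow> complex) \<Rightarrow> bool" where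
  "spanned \<sigma> x \<longleftrightarrow> (\<exists>xs. (\<forall>(a, r)\<in>set xs. ballot 0 r \<and> length r = length \<sigma>) \<and>
     (\<lambda>c. x c - lin (map (\<lambda>(a, r). (a, nf 0 r \<cdot> straighten \<sigma>)) xs) c) \<in> I \<sigma>)"

lemma vhom_straighten: "vhom (straighten \<sigma>) \<sigma> (pos (length \<sigma>))"
  by (simp add: vhom_def)

lemma vhom_nf_straighten: "ballot 0 r \<Longrightarrow> length r = length \<sigma> \<Longrightarrow> vhom (nf 0 r \<cdot> straighten \<sigma>) \<sigma> []"
  using nf_typed[of 0 r] by (auto simp: vhom_def dest: straighten_vertices)

lemma lin_append: "lin (xs @ ys) = (\<lambda>c. lin xs c + lin ys c)"
  by (simp add: lin_def)

lemma lin_scale: "lin (map (\<lambda>(b, f). (a * b, f)) xs) = (\<lambda>c. a * lin xs c)"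
  by (induction xs) (auto simp: algebra_simps)

lemma spanned_lincomb:
  assumes "spanned \<sigma> x" "spanned \<sigma> y"
  shows "spanned \<sigma> (\<lambda>c. a * x c + y c)"
proof -
  let ?m = "map (\<lambda>(a, r). (a, nf 0 r \<cdot> straighten \<sigma>))"
  obtain xs where xs: "\<forall>(a, r)\<in>set xs. ballot 0 r \<and> length r = length \<sigma>" "(\<lambda>c. x c - lin (?m xs) c) \<in> I \<sigma>"
    using assms(1) by (auto simp: spanned_def)
  obtain ys where ys: "\<forall>(a, r)\<in>set ys. ballot 0 r \<and> length r = length \<sigma>" "(\<lambda>c. y c - lin (?m ys) c) \<in> I \<sigma>"
    using assms(2) by (auto simp: spanned_def)
  let ?zs = "map (\<lambda>(b, r). (a * b, r)) xs @ ys"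
  have "lin (?m ?zs) = (\<lambda>c. a * lin (?m xs) c + lin (?m ys) c)"
    using lin_scale[of a "?m xs"] by (simp add: lin_append o_def case_prod_unfold)
  then have "(\<lambda>c. (a * x c + y c) - lin (?m ?zs) c) \<in> I \<sigma>"
    using I_lin[OF xs(2) ys(2), of a] by (simp add: algebra_simps)
  moreover have "\<forall>(a, r)\<in>set ?zs. ballot 0 r \<and> length r = length \<sigma>" using xs(1) ys(1) by auto
  ultimately show ?thesis unfolding spanned_def by blast
qed

lemma spanned_I: "x \<in> I \<sigma> \<Longrightarrow> spanned \<sigma> x"
  unfolding spanned_def by (rule exI[of _ "[]"]) simp

lemma spanned_diff: "spanned \<sigma> y \<Longrightarrow> (\<lambda>c. x c - a * y c) \<in> I \<sigma> \<Longrightarrow> spanned \<sigma> x"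
  using spanned_lincomb[OF _ spanned_I, of \<sigma> y "\<lambda>c. x c - a * y c" a] by simp

lemma spanned_nf: "ballot 0 r \<Longrightarrow> length r = length \<sigma> \<Longrightarrow> spanned \<sigma> (q (nf 0 r \<cdot> straighten \<sigma>))"
  unfolding spanned_def by (rule exI[of _ "[(1, r)]"]) (simp add: I_zero)

lemma spanned_scaled: "scaled t a t' \<Longrightarrow> vhom t \<sigma> [] \<Longrightarrow> spanned \<sigma> (q t') \<Longrightarrow> spanned \<sigma> (q t)"
  using spanned_diff scaled_I by blast

lemma spanned_lin: "(\<And>a f. (a, f) \<in> set xs \<Longrightarrow> spanned \<sigma> (q f)) \<Longrightarrow> spanned \<sigma> (lin xs)"
proof (induction xs)
  case Nil
  then show ?case by (simp add: spanned_I I_zero)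
next
  case (Cons p xs)
  obtain a f where p: "p = (a, f)" by (cases p)
  have "spanned \<sigma> (lin xs)" by (intro Cons.IH) (meson Cons.prems list.set_intros(2))
  moreover have "spanned \<sigma> (q f)" using Cons.prems[of a f] p by simp
  ultimately show ?case using spanned_lincomb p by simp
qed

text \<open>Attaching \<open>z\<close> below is linear and preserves the ideal, so it suffices to
  know the result for the normal forms of which \<open>f\<close> is a combination.\<close>

lemma spanned_precompose:
  assumes f: "vhom f \<beta> []" "spanned \<beta> (q f)" and z: "vhom z \<alpha> \<beta>"
    and nf: "\<And>r. ballot 0 r \<Longrightarrow> length r = length \<beta> \<Longrightarrow> spanned \<alpha> (q (nf 0 r \<cdot> straighten \<beta> \<cdot> z))"
  shows "spanned \<alpha> (q (f \<cdot> z))"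
proof -
  let ?m = "map (\<lambda>(a, r). (a, nf 0 r \<cdot> straighten \<beta>))"
  obtain \<Phi> where \<Phi>: "ideal_map \<beta> \<alpha> \<Phi>" "\<And>f. vhom f \<beta> [] \<Longrightarrow> \<Phi> (q f) = q (f \<cdot> z)"
    using precompose_map[OF z] by blast
  obtain xs where xs: "\<forall>(a, r)\<in>set xs. ballot 0 r \<and> length r = length \<beta>" "(\<lambda>c. q f c - lin (?m xs) c) \<in> I \<beta>"
    using f(2) by (auto simp: spanned_def)
  have v: "vhom g \<beta> []" if "(a, g) \<in> set (?m xs)" for a g
    using that xs(1) vhom_nf_straighten by auto
  have "\<Phi> (lin (map (\<lambda>(a, f). (a, f)) (?m xs))) = lin (map (\<lambda>(a, f). (a, f \<cdot> z)) (?m xs))"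
    by (rule lin_map[OF \<Phi>(1)]) (use v \<Phi>(2) in auto)
  then have 1: "\<Phi> (lin (?m xs)) = lin (map (\<lambda>(a, r). (a, nf 0 r \<cdot> straighten \<beta> \<cdot> z)) xs)"
    by (simp add: o_def case_prod_unfold comp_assoc)
  have "spanned \<alpha> (\<Phi> (lin (?m xs)))"
    unfolding 1 by (rule spanned_lin) (use xs(1) nf in auto)
  moreover have "lin (?m xs) \<in> finsupp (vertex_tangles generator_degree \<beta>)"
    by (rule lin_in) (rule v)
  then have "\<Phi> (\<lambda>c. -1 * lin (?m xs) c + q f c) = (\<lambda>c. -1 * \<Phi> (lin (?m xs)) c + \<Phi> (q f) c)"
    using \<Phi>(1) q_in[OF f(1)] unfolding ideal_map_def by blast
  moreover have "lin (?m xs) \<in> finsupp (vertex_tangles generator_degree \<beta>)"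
    by (rule lin_in) (rule v)
  then have "\<Phi> (\<lambda>c. -1 * lin (?m xs) c + q f c) \<in> I \<alpha>"
    using \<Phi>(1) xs(2) unfolding ideal_map_def by simp
  ultimately show ?thesis
    using spanned_diff[of \<alpha> "\<Phi> (lin (?m xs))" "q (f \<cdot> z)" 1] \<Phi>(2)[OF f(1)] by simp
qed

text \<open>Attaching \<open>t\<close> below a normal form, at any position, stays in the span of
  normal forms. The free \<open>\<gamma>\<close> and \<open>\<delta>\<close> give closure under
  whiskering and \<open>spanned_precompose\<close> gives closure under composition, so only the
  elementary pieces have to be examined.\<close>

definition good :: "generator morph \<Rightarrow> bool" where
  "good t \<longleftrightarrow> vhom t (dom t) (cod t) \<and> (\<forall>\<gamma> \<delta> r. ballot 0 r \<longrightarrow> length r = length (\<gamma> @ cod t @ \<delta>) \<longrightarrow>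
     spanned (\<gamma> @ dom t @ \<delta>) (q (nf 0 r \<cdot> straighten (\<gamma> @ cod t @ \<delta>) \<cdot> whisker \<gamma> t \<delta>)))"

lemma goodD: "good t \<Longrightarrow> ballot 0 r \<Longrightarrow> length r = length (\<gamma> @ cod t @ \<delta>) \<Longrightarrow>
     spanned (\<gamma> @ dom t @ \<delta>) (q (nf 0 r \<cdot> straighten (\<gamma> @ cod t @ \<delta>) \<cdot> whisker \<gamma> t \<delta>))"
  and good_vhom: "good t \<Longrightarrow> vhom t (dom t) (cod t)"
  by (simp_all add: good_def)

lemma good_strands: "good (strands \<sigma>)"
  unfolding good_def
proof (intro conjI allI impI)
  fix \<gamma> \<delta> r assume r: "ballot 0 r" "length r = length (\<gamma> @ cod (strands \<sigma> :: generator morph) @ \<delta>)"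
  have "ok (nf 0 r \<cdot> straighten (\<gamma> @ \<sigma> @ \<delta>))" using vhomD[OF vhom_nf_straighten[OF r]] by simp
  then show "spanned (\<gamma> @ dom (strands \<sigma> :: generator morph) @ \<delta>)
      (q (nf 0 r \<cdot> straighten (\<gamma> @ cod (strands \<sigma> :: generator morph) @ \<delta>) \<cdot> whisker \<gamma> (strands \<sigma>) \<delta>))"
    using spanned_nf[OF r] by (simp add: whisker_strands)
qed (simp add: vhom_def)

lemma good_comp:
  assumes "good g" "good f" "dom g = cod f"
  shows "good (g \<cdot> f)"
proof -
  have ok: "ok g" "ok f" "ok (g \<cdot> f)" using good_vhom[OF assms(1)] good_vhom[OF assms(2)] assms(3) by (auto simp: vhom_def)
  have v: "vhom (g \<cdot> f) (dom f) (cod g)"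
    using vhom_comp[OF good_vhom[OF assms(1), unfolded assms(3)] good_vhom[OF assms(2)]] .
  show ?thesis
    unfolding good_def
  proof (intro conjI allI impI)
    fix \<gamma> \<delta> r assume r: "ballot 0 r" "length r = length (\<gamma> @ cod (g \<cdot> f) @ \<delta>)"
    have r': "length r = length (\<gamma> @ cod g @ \<delta>)" using r ok by simp
    have "vhom ((nf 0 r \<cdot> straighten (\<gamma> @ cod g @ \<delta>)) \<cdot> whisker \<gamma> g \<delta>) (\<gamma> @ cod f @ \<delta>) []"
      using vhom_comp[OF vhom_nf_straighten[OF r(1) r'] vhom_whisker[OF good_vhom[OF assms(1)]]] assms(3) by simp
    then have v': "vhom (nf 0 r \<cdot> straighten (\<gamma> @ cod g @ \<delta>) \<cdot> whisker \<gamma> g \<delta>) (\<gamma> @ cod f @ \<delta>) []"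
      by (simp add: comp_assoc)
    have "spanned (\<gamma> @ dom f @ \<delta>) (q ((nf 0 r \<cdot> straighten (\<gamma> @ cod g @ \<delta>) \<cdot> whisker \<gamma> g \<delta>) \<cdot> whisker \<gamma> f \<delta>))"
    proof (rule spanned_precompose[OF v'])
      show "spanned (\<gamma> @ cod f @ \<delta>) (q (nf 0 r \<cdot> straighten (\<gamma> @ cod g @ \<delta>) \<cdot> whisker \<gamma> g \<delta>))"
        using goodD[OF assms(1) r(1) r'] assms(3) by simp
      show "vhom (whisker \<gamma> f \<delta>) (\<gamma> @ dom f @ \<delta>) (\<gamma> @ cod f @ \<delta>)"
        by (rule vhom_whisker[OF good_vhom[OF assms(2)]])
    qed (simp_all add: comp_assoc goodD[OF assms(2)])
    then show "spanned (\<gamma> @ dom (g \<cdot> f) @ \<delta>) (q (nf 0 r \<cdot> straighten (\<gamma> @ cod (g \<cdot> f) @ \<delta>) \<cdot> whisker \<gamma> (g \<cdot> f) \<delta>))"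
      using ok by (simp add: whisker_comp comp_assoc)
  qed (use v ok in simp)
qed

lemma good_whisker: "good t \<Longrightarrow> good (whisker \<gamma> t \<delta>)"
proof -
  assume t: "good t"
  then have ok: "ok t" by (auto dest: good_vhom simp: vhom_def)
  show "good (whisker \<gamma> t \<delta>)"
    unfolding good_def
  proof (intro conjI allI impI)
    show "vhom (whisker \<gamma> t \<delta>) (dom (whisker \<gamma> t \<delta>)) (cod (whisker \<gamma> t \<delta>))"
      using vhom_whisker[OF good_vhom[OF t]] ok by simp
    fix \<gamma>' \<delta>' r assume "ballot 0 r" "length r = length (\<gamma>' @ cod (whisker \<gamma> t \<delta>) @ \<delta>')"
    then show "spanned (\<gamma>' @ dom (whisker \<gamma> t \<delta>) @ \<delta>')
        (q (nf 0 r \<cdot> straighten (\<gamma>' @ cod (whisker \<gamma> t \<delta>) @ \<delta>') \<cdot> whisker \<gamma>' (whisker \<gamma> t \<delta>) \<delta>'))"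
      using goodD[OF t, of r "\<gamma>' @ \<gamma>" "\<delta> @ \<delta>'"] ok by (simp add: whisker_whisker)
  qed
qed

lemma good_juxt: "good f \<Longrightarrow> good g \<Longrightarrow> good (f \<boxtimes> g)"
proof -
  assume fg: "good f" "good g"
  then have ok: "ok f" "ok g" by (auto dest: good_vhom simp: vhom_def)
  show "good (f \<boxtimes> g)"
    using ok fg by (simp add: juxt_whisker) (intro good_comp good_whisker; simp)
qed

lemma vhom_good_context:
  assumes "vhom t \<alpha> \<beta>" "ballot 0 r" "length r = length (\<gamma> @ \<beta> @ \<delta>)"
  shows "vhom (nf 0 r \<cdot> straighten (\<gamma> @ \<beta> @ \<delta>) \<cdot> whisker \<gamma> t \<delta>) (\<gamma> @ \<alpha> @ \<delta>) []"
  using vhom_comp[OF vhom_nf_straighten[OF assms(2,3)] vhom_whisker[OF assms(1)]] by (simp add: comp_assoc)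

lemma good_scaled:
  assumes "scaled t a t'" "good t'"
  shows "good t"
proof -
  have t: "vhom t (dom t) (cod t)" "dom t' = dom t" "cod t' = cod t"
    using scaledE[OF assms(1)] by (auto simp: vhom_def)
  show ?thesis
    unfolding good_def
  proof (intro conjI allI impI)
    fix \<gamma> \<delta> r assume r: "ballot 0 r" "length r = length (\<gamma> @ cod t @ \<delta>)"
    have "scaled ((nf 0 r \<cdot> straighten (\<gamma> @ cod t @ \<delta>)) \<cdot> whisker \<gamma> t \<delta>) a ((nf 0 r \<cdot> straighten (\<gamma> @ cod t @ \<delta>)) \<cdot> whisker \<gamma> t' \<delta>)"
      using scaled_comp_left[OF scaled_whisker[OF assms(1)] vhom_nf_straighten[OF r]] t by (simp add: vhom_def)
    then have sc: "scaled (nf 0 r \<cdot> straighten (\<gamma> @ cod t @ \<delta>) \<cdot> whisker \<gamma> t \<delta>) a (nf 0 r \<cdot> straighten (\<gamma> @ cod t @ \<delta>) \<cdot> whisker \<gamma> t' \<delta>)"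
      by (simp add: comp_assoc)
    show "spanned (\<gamma> @ dom t @ \<delta>) (q (nf 0 r \<cdot> straighten (\<gamma> @ cod t @ \<delta>) \<cdot> whisker \<gamma> t \<delta>))"
      using goodD[OF assms(2) r(1), of \<gamma> \<delta>] r(2) t
      by (intro spanned_scaled[OF sc vhom_good_context[OF t(1) r]]) auto
  qed (rule t(1))
qed

lemma good_gc: "good gc"
  unfolding good_def
proof (intro conjI allI impI)
  fix \<gamma> \<delta> r assume r: "ballot 0 r" "length r = length (\<gamma> @ cod gc @ \<delta>)"
  let ?r = "take (length \<gamma>) r @ True # False # drop (length \<gamma>) r"
  have s: "straighten (\<gamma> @ [] @ \<delta>) \<cdot> whisker \<gamma> gc \<delta> =
      whisker (pos (length \<gamma>)) gc (pos (length \<delta>)) \<cdot> straighten (\<gamma> @ [Pos, Pos] @ \<delta>)"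
    by (rule straighten_whisker) (simp_all add: pos_small)
  have n: "nf 0 r \<cdot> whisker (pos (length \<gamma>)) gc (pos (length \<delta>)) = nf 0 ?r \<and> ballot 0 ?r"
    using nf_insert[of 0 "take (length \<gamma>) r" "drop (length \<gamma>) r"] r by simp
  have "spanned (\<gamma> @ [Pos, Pos] @ \<delta>) (q (nf 0 ?r \<cdot> straighten (\<gamma> @ [Pos, Pos] @ \<delta>)))"
    using n r(2) by (intro spanned_nf) auto
  then show "spanned (\<gamma> @ dom gc @ \<delta>) (q (nf 0 r \<cdot> straighten (\<gamma> @ cod gc @ \<delta>) \<cdot> whisker \<gamma> gc \<delta>))"
    using s n by (simp flip: comp_assoc)
qed (simp add: vhom_def)

lemma good_gu: "good gu"
  unfolding good_def
proof (intro conjI allI impI)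
  fix \<gamma> \<delta> r assume r: "ballot 0 r" "length r = length (\<gamma> @ cod gu @ \<delta>)"
  have s: "straighten (\<gamma> @ [Pos, Pos] @ \<delta>) \<cdot> whisker \<gamma> gu \<delta> =
      whisker (pos (length \<gamma>)) gu (pos (length \<delta>)) \<cdot> straighten (\<gamma> @ [] @ \<delta>)"
    by (rule straighten_whisker) (simp_all add: pos_small)
  obtain a r' where r': "length r' = length \<gamma> + length \<delta>" "ballot 0 r'"
    "scaled (nf 0 r \<cdot> whisker (pos (length \<gamma>)) gu (pos (length \<delta>))) a (nf 0 r')"
    using nf_gu[of 0 r "length \<gamma>" "length \<delta>"] r by auto
  have "scaled ((nf 0 r \<cdot> whisker (pos (length \<gamma>)) gu (pos (length \<delta>))) \<cdot> straighten (\<gamma> @ \<delta>)) a (nf 0 r' \<cdot> straighten (\<gamma> @ \<delta>))"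
    using r nf_typed[OF r(1)] scaled_comp_right[OF r'(3) vhom_straighten[of "\<gamma> @ \<delta>"]] by (simp add: pos_small)
  then have "scaled (nf 0 r \<cdot> straighten (\<gamma> @ [Pos, Pos] @ \<delta>) \<cdot> whisker \<gamma> gu \<delta>) a (nf 0 r' \<cdot> straighten (\<gamma> @ \<delta>))"
    using s by (simp add: comp_assoc)
  then show "spanned (\<gamma> @ dom gu @ \<delta>) (q (nf 0 r \<cdot> straighten (\<gamma> @ cod gu @ \<delta>) \<cdot> whisker \<gamma> gu \<delta>))"
    using vhom_good_context[of gu "[]" "[Pos, Pos]" r \<gamma> \<delta>] r spanned_nf[of r' "\<gamma> @ \<delta>"] r'(1,2)
    by - (rule spanned_scaled[of _ a "nf 0 r' \<cdot> straighten (\<gamma> @ \<delta>)"], auto simp: vhom_def)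
qed (simp add: vhom_def)

lemma good_g3: "good g3"
  unfolding good_def
proof (intro conjI allI impI)
  fix \<gamma> \<delta> r assume r: "ballot 0 r" "length r = length (\<gamma> @ cod g3 @ \<delta>)"
  have "straighten (\<gamma> @ [Pos] @ \<delta>) \<cdot> whisker \<gamma> g3 \<delta> = straighten (\<gamma> @ [Neg] @ \<delta>)"
    using straighten_whisker[of g3 "[Neg]" "[Pos]" "strands [Pos]" \<gamma> \<delta>]
    by (simp add: whisker_strands pos_small)
  then show "spanned (\<gamma> @ dom g3 @ \<delta>) (q (nf 0 r \<cdot> straighten (\<gamma> @ cod g3 @ \<delta>) \<cdot> whisker \<gamma> g3 \<delta>))"
    using spanned_nf[of r "\<gamma> @ [Neg] @ \<delta>"] r by simp
qed (simp add: vhom_def)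

text \<open>The output of \<open>g2\<close> meets the \<open>g3\<close> that
  \<open>straighten\<close> places on a dual strand; \<open>scaled_g3_g2\<close> cancels the two and
  leaves the same word over the new type.\<close>

lemma good_g2: "good g2"
  unfolding good_def
proof (intro conjI allI impI)
  fix \<gamma> \<delta> r assume r: "ballot 0 r" "length r = length (\<gamma> @ cod g2 @ \<delta>)"
  have s: "straighten (\<gamma> @ [Pos] @ \<delta>) \<cdot> whisker \<gamma> g3 \<delta> = straighten (\<gamma> @ [Neg] @ \<delta>)"
    using straighten_whisker[of g3 "[Neg]" "[Pos]" "strands [Pos]" \<gamma> \<delta>]
    by (simp add: whisker_strands pos_small)
  have v: "vhom (nf 0 r \<cdot> straighten (\<gamma> @ [Pos] @ \<delta>)) (\<gamma> @ [Pos] @ \<delta>) []"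
    using r by (intro vhom_nf_straighten) auto
  have "scaled ((nf 0 r \<cdot> straighten (\<gamma> @ [Pos] @ \<delta>)) \<cdot> whisker \<gamma> (g3 \<cdot> g2) \<delta>) 1
      ((nf 0 r \<cdot> straighten (\<gamma> @ [Pos] @ \<delta>)) \<cdot> whisker \<gamma> (strands [Pos]) \<delta>)"
    by (intro scaled_comp_left[OF scaled_whisker[OF scaled_g3_g2] v]) simp
  then have "scaled (nf 0 r \<cdot> straighten (\<gamma> @ [Neg] @ \<delta>) \<cdot> whisker \<gamma> g2 \<delta>) 1 (nf 0 r \<cdot> straighten (\<gamma> @ [Pos] @ \<delta>))"
    using vhomD[OF v] s by (simp add: whisker_comp whisker_strands comp_assoc comp_tail[OF s[simplified]])
  then show "spanned (\<gamma> @ dom g2 @ \<delta>) (q (nf 0 r \<cdot> straighten (\<gamma> @ cod g2 @ \<delta>) \<cdot> whisker \<gamma> g2 \<delta>))"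
    using vhom_good_context[of g2 "[Pos]" "[Neg]" r \<gamma> \<delta>] r spanned_nf[of r "\<gamma> @ [Pos] @ \<delta>"]
    by - (rule spanned_scaled[of _ 1 "nf 0 r \<cdot> straighten (\<gamma> @ [Pos] @ \<delta>)"], auto simp: vhom_def)
qed (simp add: vhom_def)

text \<open>\<open>E1\<close> read backwards: a downward strand is routed through V, which expresses
  all caps and cups by \<open>gc\<close>, \<open>gu\<close>, \<open>g2\<close> and
  \<open>g3\<close>.\<close>

lemma scaled_insert: "scaled (strands [Neg]) 1 (g2 \<cdot> g3)"
  by (rule scaled_sym[OF scaled_E1]) simp

lemma good_cap: "good (cap s)"
proof (cases s)
  case Pos
  have "scaled (cap Pos \<cdot> whisker [Pos] (strands [Neg]) []) 1 (cap Pos \<cdot> whisker [Pos] (g2 \<cdot> g3) [])"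
    by (intro scaled_comp_left scaled_whisker scaled_insert) (auto simp: vhom_def)
  then have 1: "scaled (cap Pos) 1 ((cap Pos \<cdot> whisker [Pos] g2 []) \<cdot> whisker [Pos] g3 [])"
    by (simp add: whisker_norm)
  have 2: "scaled ((cap Pos \<cdot> whisker [Pos] g2 []) \<cdot> whisker [Pos] g3 []) (-1) (gc \<cdot> whisker [Pos] g3 [])"
    by (intro scaled_comp_right scaled_cap_g2) (auto simp: vhom_def)
  show ?thesis
    unfolding Pos by (rule good_scaled[OF scaled_trans[OF 1 2 HOL.refl]])
      (intro good_comp good_gc good_whisker good_g3, simp)
next
  case Neg
  have "scaled (cap Neg \<cdot> whisker [] (strands [Neg]) [Pos]) 1 (cap Neg \<cdot> whisker [] (g2 \<cdot> g3) [Pos])"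
    by (intro scaled_comp_left scaled_whisker scaled_insert) (auto simp: vhom_def)
  then have "scaled (cap Neg) 1 (gc \<cdot> whisker [] g3 [Pos])"
    by (simp add: whisker_norm comp_tail[OF cap_g2])
  then show ?thesis
    unfolding Neg by (rule good_scaled) (intro good_comp good_gc good_whisker good_g3, simp)
qed

lemma good_cup: "good (cup s)"
proof (cases s)
  case Pos
  have "scaled (whisker [Pos] (strands [Neg]) [] \<cdot> cup Pos) 1 (whisker [Pos] (g2 \<cdot> g3) [] \<cdot> cup Pos)"
    by (intro scaled_comp_right scaled_whisker scaled_insert) (auto simp: vhom_def)
  then have "scaled (cup Pos) 1 (whisker [Pos] g2 [] \<cdot> gu)"
    by (simp add: whisker_norm gu_def)
  then show ?thesis
    unfolding Pos by (rule good_scaled) (intro good_comp good_gu good_whisker good_g2, simp)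
next
  case Neg
  have "scaled (whisker [] (strands [Neg]) [Pos] \<cdot> cup Neg) 1 (whisker [] (g2 \<cdot> g3) [Pos] \<cdot> cup Neg)"
    by (intro scaled_comp_right scaled_whisker scaled_insert) (auto simp: vhom_def)
  then have 1: "scaled (cup Neg) 1 (whisker [] g2 [Pos] \<cdot> gy)"
    by (simp add: whisker_norm gy_def)
  have 2: "scaled (whisker [] g2 [Pos] \<cdot> gy) (-1) (whisker [] g2 [Pos] \<cdot> gu)"
    by (intro scaled_comp_left scaled_gy_gu) (auto simp: vhom_def)
  show ?thesis
    unfolding Neg by (rule good_scaled[OF scaled_trans[OF 1 2 HOL.refl]])
      (intro good_comp good_gu good_whisker good_g2, simp)
qed

lemma good_cross_pos: "good (cross Pos Pos)"
  unfolding good_def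
proof (intro conjI allI impI)
  fix \<gamma> \<delta> r assume r: "ballot 0 r" "length r = length (\<gamma> @ cod (cross Pos Pos :: generator morph) @ \<delta>)"
  let ?\<sigma> = "\<gamma> @ [Pos, Pos] @ \<delta>"
  let ?y = "nf 0 r \<cdot> straighten ?\<sigma>"
  have y: "vhom ?y ?\<sigma> []" using r by (intro vhom_nf_straighten) auto
  have "lin (map (\<lambda>(a, f). (a, ?y \<cdot> whisker \<gamma> f \<delta> \<cdot> strands ?\<sigma>))
      [(1, cross Pos Pos), (-1, strands [Pos, Pos]), (-1, gu \<cdot> gc)]) \<in> I ?\<sigma>"
    using rel_E5 y vhom_basic(1)[of ?\<sigma>] unfolding rel_def by blast
  then have 1: "(\<lambda>c. q (nf 0 r \<cdot> straighten ?\<sigma> \<cdot> whisker \<gamma> (cross Pos Pos) \<delta>) c - 1 *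
      (1 * q (nf 0 r \<cdot> straighten ?\<sigma> \<cdot> whisker \<gamma> (strands [Pos, Pos]) \<delta>) c +
       q (nf 0 r \<cdot> straighten ?\<sigma> \<cdot> whisker \<gamma> (gu \<cdot> gc) \<delta>) c)) \<in> I ?\<sigma>"
    by (simp add: comp_assoc algebra_simps)
  have 2: "spanned ?\<sigma> (q (nf 0 r \<cdot> straighten ?\<sigma> \<cdot> whisker \<gamma> (strands [Pos, Pos]) \<delta>))"
    using goodD[OF good_strands, of r \<gamma> "[Pos, Pos]" \<delta>] r by simp
  have "good (gu \<cdot> gc)" by (intro good_comp good_gu good_gc) simp
  from goodD[OF this r(1), of \<gamma> \<delta>] r(2)
  have 3: "spanned ?\<sigma> (q (nf 0 r \<cdot> straighten ?\<sigma> \<cdot> whisker \<gamma> (gu \<cdot> gc) \<delta>))" by simp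
  show "spanned (\<gamma> @ dom (cross Pos Pos :: generator morph) @ \<delta>)
      (q (nf 0 r \<cdot> straighten (\<gamma> @ cod (cross Pos Pos :: generator morph) @ \<delta>) \<cdot> whisker \<gamma> (cross Pos Pos) \<delta>))"
    using spanned_diff[OF spanned_lincomb[OF 2 3] 1] by simp
qed (simp add: vhom_def)

text \<open>\<open>E5\<close> treats the crossing of two upward strands only. Three successive
  quarter turns lead from it to the other three orientations.\<close>

lemma good_turn: "good (cross b a) \<Longrightarrow> good (cross (neg a) b)"
  unfolding turn_crossing[symmetric] by (intro good_comp good_whisker good_cap good_cup) simp_all

lemma good_cross: "good (cross a b)"
proof -
  have np: "good (cross Neg Pos)" using good_turn[of Pos Pos] good_cross_pos by simp
  have nn: "good (cross Neg Neg)" using good_turn[of Neg Pos] np by simp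
  have "good (cross Pos Neg)" using good_turn[of Neg Neg] nn by simp
  with np nn good_cross_pos show ?thesis by (cases a; cases b) simp_all
qed

text \<open>Induction on the strands to the right of \<open>gl\<close>: \<open>slide_gl\<close>
  trades one of them for a crossing, which is good, and with none left \<open>nf_snoc\<close>
  applies.\<close>

lemma good_gl: "good gl"
proof -
  have "spanned (\<gamma> @ [Pos] @ \<delta>) (q (nf 0 r \<cdot> straighten (\<gamma> @ \<delta>) \<cdot> whisker \<gamma> gl \<delta>))"
    if "ballot 0 r" "length r = length (\<gamma> @ \<delta>)" for \<gamma> \<delta> r
    using that
  proof (induction \<delta> arbitrary: \<gamma> r)
    case Nil
    have s: "straighten (\<gamma> @ [] @ []) \<cdot> whisker \<gamma> gl [] = whisker (pos (length \<gamma>)) gl (pos (length ([] :: sign list))) \<cdot> straighten (\<gamma> @ [Pos] @ [])"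
      by (rule straighten_whisker) (simp_all add: pos_small)
    have n: "nf 0 r \<cdot> whisker (pos (length \<gamma>)) gl [] = nf 0 (r @ [True]) \<and> ballot 0 (r @ [True])"
      using nf_snoc[of 0 r] Nil by simp
    have "spanned (\<gamma> @ [Pos]) (q (nf 0 (r @ [True]) \<cdot> straighten (\<gamma> @ [Pos])))"
      using n Nil by (intro spanned_nf) auto
    then show ?case using s n by (simp flip: comp_assoc)
  next
    case (Cons s \<delta>)
    have v: "vhom gl [Pos] []" by (simp add: vhom_def)
    have "whisker \<gamma> (whisker [] gl [s]) \<delta> = whisker \<gamma> (whisker [s] gl [] \<cdot> cross Pos s) \<delta>"
      using slide_gl by simp
    then have e: "whisker \<gamma> gl (s # \<delta>) = whisker (\<gamma> @ [s]) gl \<delta> \<cdot> whisker \<gamma> (cross Pos s) \<delta>"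
      by (simp add: whisker_norm)
    have "spanned (\<gamma> @ [Pos, s] @ \<delta>) (q ((nf 0 r \<cdot> straighten (\<gamma> @ s # \<delta>) \<cdot> whisker (\<gamma> @ [s]) gl \<delta>) \<cdot> whisker \<gamma> (cross Pos s) \<delta>))"
    proof (rule spanned_precompose)
      show "vhom (nf 0 r \<cdot> straighten (\<gamma> @ s # \<delta>) \<cdot> whisker (\<gamma> @ [s]) gl \<delta>) (\<gamma> @ [s, Pos] @ \<delta>) []"
        using vhom_good_context[OF v Cons.prems(1), of "\<gamma> @ [s]" \<delta>] Cons.prems by simp
      show "spanned (\<gamma> @ [s, Pos] @ \<delta>) (q (nf 0 r \<cdot> straighten (\<gamma> @ s # \<delta>) \<cdot> whisker (\<gamma> @ [s]) gl \<delta>))"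
        using Cons.IH[of r "\<gamma> @ [s]"] Cons.prems by simp
      show "vhom (whisker \<gamma> (cross Pos s) \<delta>) (\<gamma> @ [Pos, s] @ \<delta>) (\<gamma> @ [s, Pos] @ \<delta>)"
        by (simp add: vhom_def)
      fix r' assume "ballot 0 r'" "length r' = length (\<gamma> @ [s, Pos] @ \<delta>)"
      then show "spanned (\<gamma> @ [Pos, s] @ \<delta>) (q (nf 0 r' \<cdot> straighten (\<gamma> @ [s, Pos] @ \<delta>) \<cdot> whisker \<gamma> (cross Pos s) \<delta>))"
        using goodD[OF good_cross[of Pos s], of r' \<gamma> \<delta>] by simp
    qed
    then show ?case by (simp add: e comp_assoc)
  qed
  then show ?thesis by (simp add: good_def vhom_def)
qed

text \<open>Bending the output of \<open>g3\<close> down again recovers the vertex, so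
  \<open>gd\<close> is a composite of good pieces.\<close>

lemma good_gd: "good gd"
proof -
  have e: "cap Pos \<cdot> whisker [] gd [Pos, Neg] = gd \<cdot> whisker [Neg, Neg] (cap Pos) []"
    using exchange[of gd "cap Pos" "[]" "[]" "[]"] by simp
  have z: "whisker [Neg, Neg] (cap Pos) [] \<cdot> whisker [Neg] (cup Neg) [Neg] = (strands [Neg, Neg] :: generator morph)"
    using zigzag_left[where 'a = generator, of "[Neg]" Neg "[]"] by simp
  have gd: "gd = cap Pos \<cdot> whisker [] g3 [Neg]"
    by (simp add: g3_def whisker_norm comp_tail2[OF e] z)
  show ?thesis unfolding gd by (intro good_comp good_whisker good_cap good_g3) simp
qed

theorem good_all: "vhom f \<alpha> \<beta> \<Longrightarrow> good f"
proof -
  have "ok f \<Longrightarrow> (\<forall>(g, \<tau>)\<in>#vertices f. \<tau> = generator_degree g) \<longrightarrow> good f"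
  proof (induction f rule: morph_induct)
    case (disc g \<sigma>)
    then show ?case
      using good_gl good_gc good_gd by (cases g) (auto simp: gl_def gc_def gd_def)
  qed (auto simp: good_strands good_cross good_cap good_cup intro: good_comp good_juxt)
  then show "vhom f \<alpha> \<beta> \<Longrightarrow> good f" by (simp add: vhom_def)
qed

theorem spanned_all:
  assumes "x \<in> finsupp (vertex_tangles generator_degree \<sigma>)"
  shows "spanned \<sigma> x"
proof -
  have single: "spanned \<sigma> (single c)" if c: "c \<in> vertex_tangles generator_degree \<sigma>" for c
  proof -
    obtain t where t: "t \<in> vertex_diagrams generator_degree \<sigma>" "c = tangle_class t"
      using c by (auto simp: vertex_tangles_eq)
    let ?f = "abs_morph t"
    have f: "vhom ?f \<sigma> []"
      using t by (auto simp: vhom_def vertex_diagrams_def ok.abs_eq dom.abs_eq cod.abs_eq vertices.abs_eq)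
    \<comment> \<open>Goodness is applied with the empty word, whose normal form is the empty
      diagram, and no strands beside \<open>?f\<close>.\<close>
    have "spanned ([] @ dom ?f @ []) (q (nf 0 [] \<cdot> straighten ([] @ cod ?f @ []) \<cdot> whisker [] ?f []))"
      using vhomD[OF f] by (intro goodD[OF good_all[OF f]]) auto
    then have "spanned \<sigma> (q ?f)" using vhomD[OF f] by simp
    then show ?thesis using t q_abs[of t] by (simp add: vertex_diagrams_def)
  qed
  have "finite S \<Longrightarrow> S \<subseteq> vertex_tangles generator_degree \<sigma> \<Longrightarrow> (\<forall>x. support x \<subseteq> S \<longrightarrow> spanned \<sigma> x)" for S
  proof (induction S rule: finite_induct)
    case empty
    have "x = (\<lambda>_. 0)" if "support x \<subseteq> {}" for x :: "generator diagram set \<Rightarrow> complex"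
      using that by (auto simp: support_def)
    then show ?case using spanned_I[OF I_zero] by metis
  next
    case (insert b S)
    show ?case
    proof (intro allI impI)
      fix x :: "generator diagram set \<Rightarrow> complex" assume x: "support x \<subseteq> insert b S"
      have "support (x(b := 0)) \<subseteq> S" using x by (auto simp: support_def)
      then have "spanned \<sigma> (x(b := 0))" using insert.IH insert.prems by blast
      moreover have "spanned \<sigma> (single b)" using insert.prems by (intro single) simp
      ultimately have "spanned \<sigma> (\<lambda>c. x b * single b c + (x(b := 0)) c)"
        by (intro spanned_lincomb)
      moreover have "(\<lambda>c. x b * single b c + (x(b := 0)) c) = x" by (auto simp: single_def)
      ultimately show "spanned \<sigma> x" by simp
    qed
  qed
  with assms show ?thesis unfolding finsupp_def by blast
qed

end

section \<open>Ballot words and unipotent invariants\<close>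

definition ballots :: "nat \<Rightarrow> bool list set" where
  "ballots n = {r. length r = n \<and> ballot 0 r}"

lemma finite_ballots [simp]: "finite (ballots n)"
  by (rule finite_subset[OF _ finite_lists[of n]]) (auto simp: ballots_def)

lemma ballot_snoc_True [simp]: "ballot i (r @ [True]) \<longleftrightarrow> ballot i r"
  by (induction i r rule: ballot.induct) auto

lemma ballot_snoc_False: "ballot i (r @ [False]) \<Longrightarrow> ballot i r"
  by (induction i r rule: ballot.induct) auto

lemma ballots_0: "ballots 0 = {[]}"
  by (auto simp: ballots_def)

lemma sum_ballots_Suc:
  "(\<Sum>r\<in>ballots (Suc n). f r) = (\<Sum>r\<in>ballots n. f (r @ [True])) +
     (\<Sum>r\<in>ballots n. if ballot 0 (r @ [False]) then f (r @ [False]) else (0::'a::comm_monoid_add))"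
proof -
  let ?T = "(\<lambda>r. r @ [True]) ` ballots n"
  let ?F = "(\<lambda>r. r @ [False]) ` {r \<in> ballots n. ballot 0 (r @ [False])}"
  have "ballots (Suc n) = ?T \<union> ?F"
  proof (intro Set.set_eqI iffI)
    fix r assume "r \<in> ballots (Suc n)"
    then obtain r' b where "r = r' @ [b]" "length r' = n" "ballot 0 r"
      by (cases r rule: rev_cases) (auto simp: ballots_def)
    then show "r \<in> ?T \<union> ?F"
      using ballot_snoc_False by (cases b) (auto simp: ballots_def)
  qed (auto simp: ballots_def)
  moreover have "?T \<inter> ?F = {}" by auto
  ultimately have "(\<Sum>r\<in>ballots (Suc n). f r) = sum f ?T + sum f ?F"
    by (simp add: sum.union_disjoint)
  also have "sum f ?T = (\<Sum>r\<in>ballots n. f (r @ [True]))"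
    by (subst sum.reindex) (auto simp: inj_on_def)
  also have "sum f ?F = (\<Sum>r | r \<in> ballots n \<and> ballot 0 (r @ [False]). f (r @ [False]))"
    by (subst sum.reindex) (auto simp: inj_on_def)
  finally show ?thesis by (simp add: sum.inter_filter)
qed

definition omega :: "2 \<Rightarrow> 2 \<Rightarrow> complex" where
  "omega i j = (if i = 1 \<and> j = 2 then 1 else if i = 2 \<and> j = 1 then -1 else 0)"

text \<open>
  The value of the normal form of a ballot word on basis vectors; the first argument is the stack of
  the basis vectors on the strands that are still open.
\<close>

fun weight :: "2 list \<Rightarrow> bool list \<Rightarrow> 2 list \<Rightarrow> complex" where
  "weight S [] K = (if set S \<subseteq> {2} then 1 else 0)"
| "weight S (True # r) (k # K) = weight (k # S) r K"
| "weight (s # S) (False # r) (k # K) = omega s k * weight S r K"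
| "weight S r K = 0"

lemma weight_snoc_True:
  "ballot (length S) r \<Longrightarrow> length K = length r \<Longrightarrow> weight S (r @ [True]) (K @ [k]) = (if k = 2 then weight S r K else 0)"
  by (induction S r K rule: weight.induct) auto

text \<open>The last letter closes the rightmost open strand, which in \<open>r\<close> ends in
  \<open>gl\<close> and so requires the basis vector 2 there. Pairing it with 1 imposes the same
  condition, with value \<open>omega 2 1 = -1\<close>.\<close>

lemma weight_snoc_False:
  "ballot (length S) (r @ [False]) \<Longrightarrow> length K = length r \<Longrightarrow> weight S (r @ [False]) (K @ [1]) = - weight S r K"
proof (induction S r K rule: weight.induct)
  case (1 S K)
  then show ?case by (cases S) (use exhaust_2 in \<open>auto simp: omega_def\<close>)
qed auto

lemma cnj_weight [simp]: "cnj (weight S r K) = weight S r K"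
  by (induction S r K rule: weight.induct) (auto simp: omega_def)

fun matrix_prod :: "('n \<Rightarrow> 'n \<Rightarrow> complex) \<Rightarrow> 'n list \<Rightarrow> 'n list \<Rightarrow> complex" where
  "matrix_prod M (i # I) (j # J) = M i j * matrix_prod M I J"
| "matrix_prod M I J = 1"

lemma matrix_prod_snoc:
  "length I = length J \<Longrightarrow> matrix_prod M (I @ [i]) (J @ [j]) = matrix_prod M I J * M i j"
  by (induction I J rule: list_induct2) (auto simp: mult_ac)

lemma sum_2': "(\<Sum>i\<in>UNIV. f i) = f 1 + f (2::2)"
  by (simp add: UNIV_2)

text \<open>Matched letters need \<open>M\<close> to preserve \<open>omega\<close>, unmatched ones
  need it to fix the second coordinate. If no closing letter can be appended, every letter is
  matched and the first condition alone is enough. The sum over the stack \<open>S'\<close> is what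
  the induction on the word requires.\<close>

lemma weight_equivariant:
  assumes M: "\<And>i j. (\<Sum>k\<in>UNIV. \<Sum>l\<in>UNIV. omega k l * M k i * M l j) = omega i j"
    and r: "ballot (length S) r" "length K = length r"
    and "\<not> ballot (length S) (r @ [False]) \<or> (\<forall>i. M 2 i = (if i = 2 then 1 else 0))"
  shows "(\<Sum>S' | length S' = length S. \<Sum>K' | length K' = length r.
    weight S' r K' * matrix_prod M S' S * matrix_prod M K' K) = weight S r K"
  using r assms(4)
proof (induction S r K rule: weight.induct)
  case (1 S K)
  show ?case
  proof (cases "S = []")
    case False
    then obtain s S0 where "S = s # S0" by (cases S) auto
    then have M2: "\<forall>i. M 2 i = (if i = 2 then 1 else 0)" using 1 by auto
    have "(\<Sum>S' | length S' = length S. weight S' [] [] * matrix_prod M S' S) = weight S [] []" for S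
    proof (induction S)
      case (Cons s S)
      have w: "weight (i # S') [] [] = (if i = 2 then weight S' [] [] else 0)" for i S' by simp
      have "(\<Sum>S' | length S' = length (s # S). weight S' [] [] * matrix_prod M S' (s # S)) =
          M 2 s * (\<Sum>S' | length S' = length S. weight S' [] [] * matrix_prod M S' S)"
        by (simp add: sum_lists_Suc sum_2' w sum_distrib_left mult_ac del: weight.simps)
      then show ?case using Cons M2 by auto
    qed simp
    then show ?thesis using 1 by simp
  qed (use 1 in simp)
next
  case (2 S r k K)
  have "(\<Sum>S' | length S' = length (k # S). \<Sum>K' | length K' = length r.
      weight S' r K' * matrix_prod M S' (k # S) * matrix_prod M K' K) = weight (k # S) r K"
    using 2 by simp
  then have *: "(\<Sum>i\<in>UNIV. \<Sum>S' | length S' = length S. \<Sum>K' | length K' = length r.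
      weight (i # S') r K' * M i k * matrix_prod M S' S * matrix_prod M K' K) = weight (k # S) r K"
    by (simp add: sum_lists_Suc mult_ac)
  show ?case
    by (simp add: sum_lists_Suc flip: *) (subst sum.swap, simp add: mult_ac)
next
  case (3 s S r k K)
  have IH: "(\<Sum>S' | length S' = length S. \<Sum>K' | length K' = length r.
      weight S' r K' * matrix_prod M S' S * matrix_prod M K' K) = weight S r K"
    using 3 by simp
  have "(\<Sum>S' | length S' = length (s # S). \<Sum>K' | length K' = length (False # r).
      weight S' (False # r) K' * matrix_prod M S' (s # S) * matrix_prod M K' (k # K)) =
      (\<Sum>i\<in>UNIV. \<Sum>S' | length S' = length S. \<Sum>j\<in>UNIV. \<Sum>K' | length K' = length r.
        (omega i j * M i s * M j k) * (weight S' r K' * matrix_prod M S' S * matrix_prod M K' K))"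
    by (simp add: sum_lists_Suc mult_ac)
  also have "\<dots> = (\<Sum>i\<in>UNIV. \<Sum>j\<in>UNIV. \<Sum>S' | length S' = length S. \<Sum>K' | length K' = length r.
        (omega i j * M i s * M j k) * (weight S' r K' * matrix_prod M S' S * matrix_prod M K' K))"
    by (intro sum.cong HOL.refl) (rule sum.swap)
  also have "\<dots> = (\<Sum>i\<in>UNIV. \<Sum>j\<in>UNIV. (omega i j * M i s * M j k) * weight S r K)"
    by (simp only: IH flip: sum_distrib_left)
  also have "\<dots> = omega s k * weight S r K"
    by (simp only: M flip: sum_distrib_right)
  finally show ?case by simp
qed auto

text \<open>With \<open>v\<^sub>1\<close> in the last position the words ending in an opening letter
  vanish, so the coefficients of the other words are killed first; \<open>v\<^sub>2\<close> in the
  last position then deals with the rest.\<close>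

lemma ballots_independent:
  assumes "\<And>J. length J = n \<Longrightarrow> (\<Sum>r\<in>ballots n. a r * weight [] r J) = 0" and "r \<in> ballots n"
  shows "a r = 0"
  using assms
proof (induction n arbitrary: a r)
  case 0
  then show ?case by (simp add: ballots_0)
next
  case (Suc n)
  have s: "length J = n \<Longrightarrow> (\<Sum>r\<in>ballots n. a (r @ [True]) * weight [] (r @ [True]) (J @ [x])) +
      (\<Sum>r\<in>ballots n. if ballot 0 (r @ [False]) then a (r @ [False]) * weight [] (r @ [False]) (J @ [x]) else 0) = 0" for J x
    using Suc.prems(1)[of "J @ [x]"] by (simp add: sum_ballots_Suc)
  define b where "b r = (if ballot 0 (r @ [False]) then a (r @ [False]) else 0)" for r
  have "(\<Sum>r\<in>ballots n. b r * weight [] r J) = 0" if J: "length J = n" for J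
  proof -
    have "(\<Sum>r\<in>ballots n. a (r @ [True]) * weight [] (r @ [True]) (J @ [1])) = 0"
      using J by (intro sum.neutral) (auto simp: ballots_def weight_snoc_True)
    moreover have "(\<Sum>r\<in>ballots n. if ballot 0 (r @ [False]) then a (r @ [False]) * weight [] (r @ [False]) (J @ [1]) else 0) =
        (\<Sum>r\<in>ballots n. - (b r * weight [] r J))"
      using J by (intro sum.cong) (auto simp: ballots_def weight_snoc_False b_def)
    ultimately show ?thesis using s[OF J, of 1] by (simp add: sum_negf)
  qed
  then have b: "b r = 0" if "r \<in> ballots n" for r using Suc.IH that by blast
  then have aF: "a (r @ [False]) = 0" if "r \<in> ballots n" "ballot 0 (r @ [False])" for r
    using that by (force simp: b_def)
  have "(\<Sum>r\<in>ballots n. a (r @ [True]) * weight [] r J) = 0" if J: "length J = n" for J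
  proof -
    have "(\<Sum>r\<in>ballots n. if ballot 0 (r @ [False]) then a (r @ [False]) * weight [] (r @ [False]) (J @ [2]) else 0) = 0"
      using aF by (intro sum.neutral) auto
    moreover have "(\<Sum>r\<in>ballots n. a (r @ [True]) * weight [] (r @ [True]) (J @ [2])) =
        (\<Sum>r\<in>ballots n. a (r @ [True]) * weight [] r J)"
      using J by (intro sum.cong) (auto simp: ballots_def weight_snoc_True)
    ultimately show ?thesis using s[OF J, of 2] by simp
  qed
  then have t: "a (r @ [True]) = 0" if "r \<in> ballots n" for r
    using Suc.IH[of "\<lambda>r. a (r @ [True])"] that by blast
  obtain r' x where r: "r = r' @ [x]" "r' \<in> ballots n" "ballot 0 r"
    using Suc.prems(2) ballot_snoc_False by (cases r rule: rev_cases; cases "last r") (auto simp: ballots_def)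
  then show ?case using t[OF r(2)] b[OF r(2)] by (cases x) (auto simp: b_def)
qed

section \<open>Functionals invariant under a single shear\<close>

definition shear :: "2 \<Rightarrow> 2 \<Rightarrow> complex" where
  "shear i j = (if i = 2 \<and> j = 1 then 0 else 1)"

text \<open>\<open>shear\<close> is the matrix of the group element x = 1, and invariance under this
  element already forces a functional into the span of the weights
  (\<open>ballots_span\<close>).\<close>

definition shear_invariant :: "nat \<Rightarrow> (2 list \<Rightarrow> complex) \<Rightarrow> bool" where
  "shear_invariant n c \<longleftrightarrow> (\<forall>J. length J = n \<longrightarrow> (\<Sum>I | length I = n. c I * matrix_prod shear I J) = c J)"

lemma weight_shear_invariant: "r \<in> ballots n \<Longrightarrow> shear_invariant n (weight [] r)"
  unfolding shear_invariant_def
proof (intro allI impI)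
  fix J :: "2 list" assume r: "r \<in> ballots n" and J: "length J = n"
  have "(\<Sum>k\<in>UNIV. \<Sum>l\<in>UNIV. omega k l * shear k i * shear l j) = omega i j" for i j
    using exhaust_2[of i] exhaust_2[of j] by (auto simp: sum_2' omega_def shear_def)
  moreover have "shear 2 i = (if i = 2 then 1 else 0)" for i
    using exhaust_2[of i] by (auto simp: shear_def)
  ultimately show "(\<Sum>I | length I = n. weight [] r I * matrix_prod shear I J) = weight [] r J"
    using weight_equivariant[of shear "[]" r J] r J by (simp add: ballots_def)
qed

text \<open>The transpose of \<open>shear\<close> preserves \<open>omega\<close> but not the second
  coordinate. For a completely matched word preserving \<open>omega\<close> is enough, so its
  weights are invariant as a vector as well as a functional.\<close>

lemma weight_shear_vector:
  assumes "r \<in> ballots n" "\<not> ballot 0 (r @ [False])" "length I = n"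
  shows "(\<Sum>J | length J = n. matrix_prod shear I J * weight [] r J) = weight [] r I"
proof -
  have flip: "matrix_prod (\<lambda>i j. shear j i) J I = matrix_prod shear I J" for I J
    by (induction shear I J rule: matrix_prod.induct) auto
  have "(\<Sum>k\<in>UNIV. \<Sum>l\<in>UNIV. omega k l * shear i k * shear j l) = omega i j" for i j
    using exhaust_2[of i] exhaust_2[of j] by (auto simp: sum_2' omega_def shear_def)
  from weight_equivariant[of "\<lambda>i j. shear j i", OF this, of "[]" r I] assms
  show ?thesis by (simp add: ballots_def flip mult.commute)
qed

lemma sum_lists_snoc:
  "(\<Sum>K | length K = Suc n. f (K :: 'n::finite list)) = (\<Sum>K | length K = n. \<Sum>i\<in>UNIV. f (K @ [i]))"
  using sum_lists_append[of f n 1] by (simp add: sum_lists_1)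

lemma shear_invariant_Suc:
  assumes c: "shear_invariant (Suc n) c" and J: "length J = n"
  shows "(\<Sum>I | length I = n. c (I @ [1]) * matrix_prod shear I J) = c (J @ [1])"
    and "(\<Sum>I | length I = n. c (I @ [1]) * matrix_prod shear I J) +
      (\<Sum>I | length I = n. c (I @ [2]) * matrix_prod shear I J) = c (J @ [2])"
proof -
  have *: "(\<Sum>I | length I = n. \<Sum>i\<in>UNIV. c (I @ [i]) * (matrix_prod shear I J * shear i j)) = c (J @ [j])" for j
  proof -
    have "(\<Sum>I | length I = n. \<Sum>i\<in>UNIV. c (I @ [i]) * (matrix_prod shear I J * shear i j)) =
        (\<Sum>I | length I = n. \<Sum>i\<in>UNIV. c (I @ [i]) * matrix_prod shear (I @ [i]) (J @ [j]))"
      using J by (intro sum.cong) (auto simp: matrix_prod_snoc)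
    also have "\<dots> = c (J @ [j])"
      using c J unfolding shear_invariant_def sum_lists_snoc by simp
    finally show ?thesis .
  qed
  show "(\<Sum>I | length I = n. c (I @ [1]) * matrix_prod shear I J) = c (J @ [1])"
    using *[of 1] by (simp add: sum_2' shear_def)
  show "(\<Sum>I | length I = n. c (I @ [1]) * matrix_prod shear I J) +
      (\<Sum>I | length I = n. c (I @ [2]) * matrix_prod shear I J) = c (J @ [2])"
    using *[of 2] by (simp add: sum_2' shear_def sum.distrib)
qed

lemma shear_invariant_lincomb:
  assumes "shear_invariant n c" "\<And>r. r \<in> A \<Longrightarrow> shear_invariant n (f r)"
  shows "shear_invariant n (\<lambda>J. c J + (\<Sum>r\<in>A. a r * f r J))"
  unfolding shear_invariant_def
proof (intro allI impI)
  fix J :: "2 list" assume J: "length J = n"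
  have "(\<Sum>I | length I = n. (\<Sum>r\<in>A. a r * f r I) * matrix_prod shear I J) =
      (\<Sum>r\<in>A. a r * (\<Sum>I | length I = n. f r I * matrix_prod shear I J))"
    by (simp add: sum_distrib_left sum_distrib_right mult.assoc) (rule sum.swap)
  then show "(\<Sum>I | length I = n. (c I + (\<Sum>r\<in>A. a r * f r I)) * matrix_prod shear I J) = c J + (\<Sum>r\<in>A. a r * f r J)"
    using assms J by (simp add: shear_invariant_def distrib_right sum.distrib)
qed

theorem ballots_span:
  assumes "shear_invariant n c"
  shows "\<exists>a. \<forall>J. length J = n \<longrightarrow> c J = (\<Sum>r\<in>ballots n. a r * weight [] r J)"
  using assms
proof (induction n arbitrary: c)
  case 0
  show ?case by (rule exI[of _ "\<lambda>_. c []"]) (simp add: ballots_0)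
next
  case (Suc n)
  have "shear_invariant n (\<lambda>J. c (J @ [1]))"
    using shear_invariant_Suc(1)[OF Suc.prems] by (simp add: shear_invariant_def)
  then obtain a where a: "\<And>J. length J = n \<Longrightarrow> c (J @ [1]) = (\<Sum>r\<in>ballots n. a r * weight [] r J)"
    using Suc.IH by blast
  \<comment> \<open>\<open>B\<close> consists of the words with an open strand left,
    \<open>D\<close> of the completely matched ones.\<close>
  define B where "B = {r \<in> ballots n. ballot 0 (r @ [False])}"
  define D where "D = {r \<in> ballots n. \<not> ballot 0 (r @ [False])}"
  \<comment> \<open>Since \<open>weight_snoc_False\<close> carries a minus sign, adding these terms
    cancels the contribution of \<open>B\<close> to the component at the last index 1.\<close>
  define d where "d J = c J + (\<Sum>r\<in>B. a r * weight [] (r @ [False]) J)" for J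
  define e where "e J = d (J @ [1])" for J
  have d: "shear_invariant (Suc n) d"
    unfolding d_def using Suc.prems
    by (intro shear_invariant_lincomb weight_shear_invariant) (auto simp: B_def ballots_def)
  have e: "e J = (\<Sum>r\<in>D. a r * weight [] r J)" if J: "length J = n" for J
  proof -
    have "ballots n = B \<union> D" "B \<inter> D = {}" "finite B" "finite D"
      using finite_ballots[of n] by (auto simp: B_def D_def)
    then have "c (J @ [1]) = (\<Sum>r\<in>B. a r * weight [] r J) + (\<Sum>r\<in>D. a r * weight [] r J)"
      using a[OF J] by (simp add: sum.union_disjoint)
    moreover have "(\<Sum>r\<in>B. a r * weight [] (r @ [False]) (J @ [1])) = (\<Sum>r\<in>B. - (a r * weight [] r J))"
      using J by (intro sum.cong) (auto simp: B_def ballots_def weight_snoc_False)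
    ultimately show ?thesis by (simp add: e_def d_def sum_negf)
  qed
  \<comment> \<open>The weights are real, so \<open>u\<close> is again a combination of completely
    matched words, hence an invariant vector by \<open>weight_shear_vector\<close>.\<close>
  define u where "u J = cnj (e J)" for J
  have u: "(\<Sum>J | length J = n. matrix_prod shear I J * u J) = u I" if I: "length I = n" for I
  proof -
    have uw: "u J = (\<Sum>r\<in>D. cnj (a r) * weight [] r J)" if "length J = n" for J
      using e[OF that] by (simp add: u_def)
    have "(\<Sum>J | length J = n. matrix_prod shear I J * u J) =
        (\<Sum>J | length J = n. matrix_prod shear I J * (\<Sum>r\<in>D. cnj (a r) * weight [] r J))"
      by (intro sum.cong) (auto simp: uw)
    also have "\<dots> = (\<Sum>r\<in>D. cnj (a r) * (\<Sum>J | length J = n. matrix_prod shear I J * weight [] r J))"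
      by (simp add: sum_distrib_left mult_ac) (rule sum.swap)
    also have "\<dots> = u I"
      unfolding uw[OF I] using I by (intro sum.cong) (auto simp: D_def weight_shear_vector)
    finally show ?thesis .
  qed
  \<comment> \<open>As \<open>u\<close> is an invariant vector, invariance of \<open>d\<close> on \<open>u \<otimes> v\<^sub>2\<close> means that \<open>e\<close> vanishes on \<open>u\<close>.\<close>
  have "e J + (\<Sum>I | length I = n. d (I @ [2]) * matrix_prod shear I J) = d (J @ [2])" if "length J = n" for J
    using shear_invariant_Suc[OF d that] by (simp add: e_def)
  then have "(\<Sum>J | length J = n. (e J + (\<Sum>I | length I = n. d (I @ [2]) * matrix_prod shear I J)) * u J) =
      (\<Sum>J | length J = n. d (J @ [2]) * u J)"
    by (intro sum.cong) auto
  moreover have "(\<Sum>J | length J = n. (\<Sum>I | length I = n. d (I @ [2]) * matrix_prod shear I J) * u J) =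
      (\<Sum>I | length I = n. d (I @ [2]) * (\<Sum>J | length J = n. matrix_prod shear I J * u J))"
    by (simp add: sum_distrib_left sum_distrib_right mult.assoc) (rule sum.swap)
  ultimately have "(\<Sum>J | length J = n. e J * cnj (e J)) = 0"
    using u by (simp add: distrib_right sum.distrib) (simp add: u_def)
  \<comment> \<open>The pairing of \<open>e\<close> with \<open>u\<close> is the squared norm of
    \<open>e\<close>; the bilinear pairing of \<open>e\<close> with itself could vanish for nonzero
    \<open>e\<close>.\<close>
  then have "complex_of_real (\<Sum>J | length J = n. (cmod (e J))\<^sup>2) = 0"
    by (simp only: of_real_sum complex_norm_square)
  then have "(\<Sum>J | length J = n. (cmod (e J))\<^sup>2) = 0"
    using of_real_eq_0_iff by blast
  then have e0: "e J = 0" if "length J = n" for J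
    using that by (simp add: sum_nonneg_eq_0_iff)
  have "shear_invariant n (\<lambda>J. d (J @ [2]))"
    using shear_invariant_Suc[OF d] e0 by (simp add: shear_invariant_def e_def)
  then obtain b where b: "\<And>J. length J = n \<Longrightarrow> d (J @ [2]) = (\<Sum>r\<in>ballots n. b r * weight [] r J)"
    using Suc.IH by blast
  show ?case
  \<comment> \<open>Words ending in an opening letter carry the coefficients of \<open>d\<close>;
    those ending in a closing letter take back what was added to \<open>c\<close>, hence the minus
    sign.\<close>
  proof (intro exI[of _ "\<lambda>r. if last r then b (butlast r) else - a (butlast r)"] allI impI)
    fix K :: "2 list" assume "length K = Suc n"
    then obtain J k where K: "K = J @ [k]" "length J = n" by (cases K rule: rev_cases) auto
    have "d K = (\<Sum>r\<in>ballots n. b r * weight [] (r @ [True]) K)"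
    proof (cases "k = 2")
      case True
      then have "d K = (\<Sum>r\<in>ballots n. b r * weight [] r J)" using b K by simp
      also have "\<dots> = (\<Sum>r\<in>ballots n. b r * weight [] (r @ [True]) K)"
        using K True by (intro sum.cong) (auto simp: ballots_def weight_snoc_True)
      finally show ?thesis .
    next
      case False
      then have "d K = 0" using e0[OF K(2)] K exhaust_2[of k] by (simp add: e_def)
      moreover have "(\<Sum>r\<in>ballots n. b r * weight [] (r @ [True]) K) = 0"
        using K False by (intro sum.neutral) (auto simp: ballots_def weight_snoc_True)
      ultimately show ?thesis by simp
    qed
    then have "c K = (\<Sum>r\<in>ballots n. b r * weight [] (r @ [True]) K) + (\<Sum>r\<in>B. - a r * weight [] (r @ [False]) K)"
      by (simp add: d_def sum_negf algebra_simps)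
    then show "c K = (\<Sum>r\<in>ballots (Suc n). (if last r then b (butlast r) else - a (butlast r)) * weight [] r K)"
      by (simp add: sum_ballots_Suc B_def sum.inter_filter cong: if_cong)
  qed
qed

section \<open>Evaluation of tangles up to equality\<close>

lift_definition mentry :: "('l \<Rightarrow> ('n::finite list \<Rightarrow> 'k::field) \<Rightarrow> 'k) \<Rightarrow> 'l morph \<Rightarrow> 'n list \<Rightarrow> 'n list \<Rightarrow> 'k"
  is "\<lambda>v t. if wf_diagram t then entry v t else (\<lambda>_ _. 0)"
  by (auto simp: tangle_eqv_def dest: tangle_eq_typed entry_tangle_eq)

lemma mentry_abs: "wf_diagram t \<Longrightarrow> mentry v (abs_morph t) = entry v t"
  by (simp add: mentry.abs_eq)

lemma mentry_simps:
  "mentry v (strands \<sigma>) I J = (if I = J \<and> length I = length \<sigma> then 1 else 0)"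
  "mentry v (cup s) I J = (if J = [] \<and> (\<exists>i. I = [i, i]) then 1 else 0)"
  "mentry v (disc l \<sigma>) I J = (if I = [] \<and> length J = length \<sigma> then v l (basis_tensor J) else 0)"
  by (transfer; simp)+

lemma mentry_comp:
  "ok (g \<cdot> f) \<Longrightarrow> mentry v (g \<cdot> f) I J = (\<Sum>K | length K = length (dom g). mentry v g I K * mentry v f K J)"
  by transfer simp

lemma mentry_juxt:
  "ok f \<Longrightarrow> ok g \<Longrightarrow> mentry v (f \<boxtimes> g) I J = mentry v f (take (length (cod f)) I) (take (length (dom f)) J) *
     mentry v g (drop (length (cod f)) I) (drop (length (dom f)) J)"
  by transfer simp

lemma mentry_comp_whisker:
  fixes v :: "'l \<Rightarrow> ('n::finite list \<Rightarrow> 'k::field) \<Rightarrow> 'k"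
  assumes ok: "ok (y \<cdot> whisker \<gamma> f \<delta>)" and len: "length A = length \<gamma>" "length J = length (dom f)" "length B = length \<delta>"
  shows "mentry v (y \<cdot> whisker \<gamma> f \<delta>) I (A @ J @ B) =
    (\<Sum>K | length K = length (cod f). mentry v y I (A @ K @ B) * mentry v f K J)"
proof -
  have okf: "ok f" "dom y = \<gamma> @ cod f @ \<delta>" using ok by auto
  have w: "mentry v (whisker \<gamma> f \<delta>) (A' @ K @ B') (A @ J @ B) = (if A' = A then mentry v f K J * (if B' = B then 1 else 0) else 0)"
    if "length A' = length \<gamma>" "length K = length (cod f)" for A' K B'
    using okf len that by (auto simp: whisker_def mentry_juxt mentry_simps)
  have "mentry v (y \<cdot> whisker \<gamma> f \<delta>) I (A @ J @ B) =
      (\<Sum>A' | length A' = length \<gamma>. \<Sum>K | length K = length (cod f). \<Sum>B' | length B' = length \<delta>.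
        mentry v y I (A' @ K @ B') * mentry v (whisker \<gamma> f \<delta>) (A' @ K @ B') (A @ J @ B))"
    using okf by (simp add: mentry_comp[OF ok] sum_lists_append)
  also have "\<dots> = (\<Sum>A' | length A' = length \<gamma>. \<Sum>K | length K = length (cod f). \<Sum>B' | length B' = length \<delta>.
        if A' = A then if B' = B then mentry v y I (A @ K @ B) * mentry v f K J else 0 else 0)"
    by (intro sum.cong HOL.refl) (auto simp: w)
  also have "\<dots> = (\<Sum>A' | length A' = length \<gamma>. if A' = A then \<Sum>K | length K = length (cod f). \<Sum>B' | length B' = length \<delta>.
        if B' = B then mentry v y I (A @ K @ B) * mentry v f K J else 0 else 0)"
    by (intro sum.cong HOL.refl) auto
  also have "\<dots> = (\<Sum>K | length K = length (cod f). mentry v y I (A @ K @ B) * mentry v f K J)"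
    using len by simp
  finally show ?thesis .
qed

lemma entry_ev:
  fixes v :: "'l \<Rightarrow> ('n::finite list \<Rightarrow> 'k::field) \<Rightarrow> 'k"
  shows "length A = length \<sigma> \<Longrightarrow> entry v (ev \<sigma>) [] (A @ B) = (if B = rev A then 1 else 0)"
proof (induction \<sigma> arbitrary: A B)
  case (Cons s \<sigma>)
  obtain a A' where A: "A = a # A'" "length A' = length \<sigma>" using Cons.prems by (cases A) auto
  show ?case
  proof (cases "length B = Suc (length \<sigma>)")
    case True
    then obtain B' b where B: "B = B' @ [b]" "length B' = length \<sigma>" by (cases B rule: rev_cases) auto
    have "(\<Sum>K | length K = 2. entry v (Cap s) [] K * entry v (Strands [s] \<otimes>\<^sub>t ev \<sigma> \<otimes>\<^sub>t Strands [neg s]) K (a # A' @ B' @ [b])) =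
        (\<Sum>K | length K = 2. if K = [a, b] then (if a = b \<and> B' = rev A' then 1 else 0) else (0::'k))"
      using Cons.IH[OF A(2)] A(2) B(2) by (intro sum.cong) (auto simp: length_2 numeral_2_eq_2 typed)
    then show ?thesis using A B by (simp add: numeral_2_eq_2)
  next
    case False
    then show ?thesis
      using A entry_zero[of "ev (s # \<sigma>)" "[]" "A @ B" v] typed(2)[of "s # \<sigma>", where 'l = 'l] by auto
  qed
qed simp

text \<open>The nested caps meet the outputs in mirror order, whence \<open>rev K\<close>.\<close>

lemma entry_bend_down:
  fixes v :: "'l \<Rightarrow> ('n::finite list \<Rightarrow> 'k::field) \<Rightarrow> 'k"
  assumes t: "wf_diagram t" and J: "length J = length (src t)" and K: "length K = length (tgt t)"
  shows "entry v (bend_down t) [] (J @ K) = entry v t (rev K) J"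
proof -
  let ?n = "length (tgt t)"
  have "entry v (bend_down t) [] (J @ K) =
      (\<Sum>A | length A = ?n. \<Sum>B | length B = ?n. entry v (ev (tgt t)) [] (A @ B) * (entry v t A J * (if B = K then 1 else 0)))"
    using J K by (simp add: bend_down_def typed sum_lists_append)
  also have "\<dots> = (\<Sum>A | length A = ?n. \<Sum>B | length B = ?n. if B = K then (if K = rev A then entry v t A J else 0) else 0)"
    by (intro sum.cong) (auto simp: entry_ev)
  also have "\<dots> = (\<Sum>A | length A = ?n. if A = rev K then entry v t A J else 0)"
    using K by (intro sum.cong) auto
  finally show ?thesis using K by simp
qed

context evaluation
begin

lemma coeffs_combination:
  assumes "\<forall>(a, t)\<in>set xs. wf_diagram t \<and> src t = \<alpha> \<and> tgt t = \<beta> \<and> (\<forall>(g, \<tau>)\<in>set (discs t). \<tau> = deg g)"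
  shows "combination xs \<in> finsupp (vertex_tangles deg (\<alpha> @ dual \<beta>)) \<and>
    (\<forall>J K. length J = length \<alpha> \<longrightarrow> length K = length \<beta> \<longrightarrow>
       coeffs (combination xs) (J @ K) = (\<Sum>(a, t)\<leftarrow>xs. a * entry val t (rev K) J))"
  using assms
proof (induction xs)
  case Nil
  then show ?case by (simp add: combination_def coeffs_def support_def)
next
  case (Cons p xs)
  obtain a t where p: "p = (a, t)" by (cases p)
  have t: "wf_diagram t" "src t = \<alpha>" "tgt t = \<beta>" "\<forall>(g, \<tau>)\<in>set (discs t). \<tau> = deg g"
    using Cons.prems p by auto
  have e: "combination (p # xs) = (\<lambda>c. a * single (tangle_class (bend_down t)) c + combination xs c)"
    by (auto simp: combination_def single_def p)
  have b: "wf_diagram (bend_down t)" "bend_down t \<in> vertex_diagrams deg (\<alpha> @ dual \<beta>)"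
    using t by (auto simp: bend_down_def typed vertex_diagrams_def)
  then have s: "single (tangle_class (bend_down t)) \<in> finsupp (vertex_tangles deg (\<alpha> @ dual \<beta>))"
    by (simp add: vertex_tangles_eq)
  have IH: "combination xs \<in> finsupp (vertex_tangles deg (\<alpha> @ dual \<beta>)) \<and>
    (\<forall>J K. length J = length \<alpha> \<longrightarrow> length K = length \<beta> \<longrightarrow>
       coeffs (combination xs) (J @ K) = (\<Sum>(a, t)\<leftarrow>xs. a * entry val t (rev K) J))"
    using Cons.prems by (intro Cons.IH) simp
  show ?case
    unfolding e
  proof (intro conjI allI impI)
    show "(\<lambda>c. a * single (tangle_class (bend_down t)) c + combination xs c) \<in> finsupp (vertex_tangles deg (\<alpha> @ dual \<beta>))"
      using IH s by (intro finsupp_lincomb) auto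
    fix J K :: "'n list" assume "length J = length \<alpha>" "length K = length \<beta>"
    then show "coeffs (\<lambda>c. a * single (tangle_class (bend_down t)) c + combination xs c) (J @ K) =
        (\<Sum>(a, t)\<leftarrow>p # xs. a * entry val t (rev K) J)"
      using IH s t b by (subst coeffs_lincomb) (auto simp: finsupp_def coeffs_single entry_bend_down p)
  qed
qed

text \<open>Reduces a defining relation to an identity between the matrices of its diagrams, before
  any bending.\<close>

lemma combination_kernel:
  assumes "\<forall>(a, t)\<in>set xs. wf_diagram t \<and> src t = \<alpha> \<and> tgt t = \<beta> \<and> (\<forall>(g, \<tau>)\<in>set (discs t). \<tau> = deg g)"
    and "\<And>I J. length I = length \<beta> \<Longrightarrow> length J = length \<alpha> \<Longrightarrow> (\<Sum>(a, t)\<leftarrow>xs. a * entry val t I J) = 0"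
  shows "combination xs \<in> finsupp (vertex_tangles deg (\<alpha> @ dual \<beta>)) \<and>
    eval_map (\<alpha> @ dual \<beta>) (combination xs) = \<zero>\<^bsub>box_space A (\<alpha> @ dual \<beta>)\<^esub>"
proof
  note c = coeffs_combination[OF assms(1)]
  show "combination xs \<in> finsupp (vertex_tangles deg (\<alpha> @ dual \<beta>))"
    using c by blast
  have "coeffs (combination xs) J = 0" if J: "length J = length (\<alpha> @ dual \<beta>)" for J
  proof -
    have "coeffs (combination xs) (take (length \<alpha>) J @ drop (length \<alpha>) J) =
        (\<Sum>(a, t)\<leftarrow>xs. a * entry val t (rev (drop (length \<alpha>) J)) (take (length \<alpha>) J))"
      using c J by (intro c[THEN conjunct2, rule_format]) auto
    then show ?thesis using assms(2) J by simp
  qed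
  then show "eval_map (\<alpha> @ dual \<beta>) (combination xs) = \<zero>\<^bsub>box_space A (\<alpha> @ dual \<beta>)\<^esub>"
    by (simp add: eval_map_zero_iff)
qed

lemma mentry_equivariant:
  assumes "g \<in> carrier G" "ok t" "\<forall>(l, \<tau>)\<in>#vertices t. \<tau> = deg l" "length I = length (cod t)" "length J = length (dom t)"
  shows "(\<Sum>K | length K = length (dom t). mentry val t I K * tmat (dom t) g K J) =
    (\<Sum>K | length K = length (cod t). tmat (cod t) g I K * mentry val t K J)"
proof -
  obtain t' where t': "t = abs_morph t'" by (metis Quotient_morph Quotient_abs_rep)
  have wf: "wf_diagram t'" using assms(2) by (simp add: t' ok.abs_eq)
  then have "dom t = src t'" "cod t = tgt t'" "vertices t = mset (discs t')"
    by (simp_all add: t' dom.abs_eq cod.abs_eq vertices.abs_eq)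
  then show ?thesis
    using assms wf entry_equivariant[of g t' val I J] invariant_coeffs[OF val_invariant]
    by (force simp: t' mentry_abs)
qed

end

section \<open>The two planar algebras are isomorphic\<close>

lemma inv_additive_complex [simp]: "inv\<^bsub>additive_complex\<^esub> x = - x"
  unfolding m_inv_def additive_complex_def
  by (rule the_equality) (auto dest: minus_unique)

lemma unipotent_rep_entry:
  "unipotent_rep x $ i $ j = (if i = j then 1 else if i = 1 then x else 0)"
  using exhaust_2[of i] exhaust_2[of j] by (auto simp: unipotent_rep_def)

interpretation U: matrix_rep additive_complex unipotent_rep
proof
  fix x
  show "unipotent_rep (inv\<^bsub>additive_complex\<^esub> x) ** unipotent_rep x = mat 1"
    by (simp add: vec_eq_iff forall_2 matrix_matrix_mult_def sum_2' unipotent_rep_entry mat_def)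
qed

text \<open>The group fixes \<open>v\<^sub>1\<close>, so the coordinate along
  \<open>v\<^sub>2\<close> is the invariant one. The sign at \<open>Gen3\<close> is dictated by
  \<open>E1\<close>, because the matrix of \<open>omega\<close> squares to -1.\<close>

definition generator_value :: "generator \<Rightarrow> (2 list \<Rightarrow> complex) \<Rightarrow> complex" where
  "generator_value g = functional (generator_degree g)
     (case g of Gen1 \<Rightarrow> (\<lambda>I. if I = [2] then 1 else 0) | Gen2 \<Rightarrow> (\<lambda>I. omega (I ! 0) (I ! 1))
      | Gen3 \<Rightarrow> (\<lambda>I. - omega (I ! 0) (I ! 1)))"

interpretation U: evaluation additive_complex unipotent_rep generator_degree generator_value
proof
  fix g
  show "generator_value g \<in> invariant_functionals additive_complex unipotent_rep (generator_degree g)"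
    unfolding generator_value_def
  proof (rule U.functional_invariant)
    fix x and J :: "2 list" assume "length J = length (generator_degree g)"
    then obtain i j where J: "if g = Gen1 then J = [j] else J = [i, j]"
      by (cases g) (auto simp: length_1 length_2)
    show "(\<Sum>I | length I = length (generator_degree g). (case g of Gen1 \<Rightarrow> (\<lambda>I. if I = [2] then 1 else 0)
        | Gen2 \<Rightarrow> (\<lambda>I. omega (I ! 0) (I ! 1)) | Gen3 \<Rightarrow> (\<lambda>I. - omega (I ! 0) (I ! 1))) I *
          U.tmat (generator_degree g) x I J) =
        (case g of Gen1 \<Rightarrow> (\<lambda>I. if I = [2] then 1 else 0)
        | Gen2 \<Rightarrow> (\<lambda>I. omega (I ! 0) (I ! 1)) | Gen3 \<Rightarrow> (\<lambda>I. - omega (I ! 0) (I ! 1))) J"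
      using J exhaust_2[of i] exhaust_2[of j]
      by (cases g) (auto simp: sum_lists_Suc sum_2' signed_rep_def unipotent_rep_entry omega_def transpose_def)
  qed
qed

abbreviation matrix_of where "matrix_of \<equiv> mentry generator_value"

lemma mat_generators:
  "matrix_of gl I J = (if I = [] \<and> J = [2] then 1 else 0)"
  "matrix_of gc [] [i, j] = omega i j" "matrix_of gd [] [i, j] = - omega i j"
  by (auto simp: gl_def gc_def gd_def mentry_simps generator_value_def length_1)

lemma mat_g2: "matrix_of g2 [i] [j] = omega j i"
proof -
  have "matrix_of g2 [i] [j] = (\<Sum>a\<in>UNIV. \<Sum>b\<in>UNIV. \<Sum>c\<in>UNIV. matrix_of (whisker [] gc [Neg]) [i] [a, b, c] * matrix_of (whisker [Pos] (cup Pos) []) [a, b, c] [j])"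
    by (simp add: g2_def mentry_comp sum_lists_Suc)
  also have "\<dots> = (\<Sum>a\<in>UNIV. \<Sum>b\<in>UNIV. \<Sum>c\<in>UNIV. (omega a b * (if i = c then 1 else 0)) * ((if a = j then 1 else 0) * (if c = b then 1 else 0)))"
    by (simp add: whisker_def mentry_juxt mentry_simps mat_generators)
  also have "\<dots> = omega j i"
    using exhaust_2[of i] exhaust_2[of j] by (auto simp: sum_2')
  finally show ?thesis .
qed

lemma mat_g3: "matrix_of g3 [i] [j] = - omega j i"
proof -
  have "matrix_of g3 [i] [j] = (\<Sum>a\<in>UNIV. \<Sum>b\<in>UNIV. \<Sum>c\<in>UNIV. matrix_of (whisker [] gd [Pos]) [i] [a, b, c] * matrix_of (whisker [Neg] (cup Neg) []) [a, b, c] [j])"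
    by (simp add: g3_def mentry_comp sum_lists_Suc)
  also have "\<dots> = (\<Sum>a\<in>UNIV. \<Sum>b\<in>UNIV. \<Sum>c\<in>UNIV. (- omega a b * (if i = c then 1 else 0)) * ((if a = j then 1 else 0) * (if c = b then 1 else 0)))"
    by (simp add: whisker_def mentry_juxt mentry_simps mat_generators)
  also have "\<dots> = - omega j i"
    using exhaust_2[of i] exhaust_2[of j] by (auto simp: sum_2')
  finally show ?thesis .
qed

lemma vertex_typed [simp]:
  "wf_diagram (vertex g \<alpha> \<beta>)" "src (vertex g \<alpha> \<beta>) = \<alpha>" "tgt (vertex g \<alpha> \<beta>) = \<beta>"
  "discs (vertex g \<alpha> \<beta>) = [(g, \<alpha> @ dual \<beta>)]"
  by (simp_all add: vertex_def typed)

lemma entry_G: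
  "entry generator_value G1 [] [j] = (if j = 2 then 1 else 0)"
  "entry generator_value G2 [i] [j] = omega j i"
  "entry generator_value G3 [i] [j] = - omega j i"
proof -
  have "entry generator_value (vertex g \<alpha> \<beta>) = matrix_of (abs_morph (vertex g \<alpha> \<beta>))" for g \<alpha> \<beta>
    by (simp add: mentry_abs)
  then show "entry generator_value G1 [] [j] = (if j = 2 then 1 else 0)"
    "entry generator_value G2 [i] [j] = omega j i" "entry generator_value G3 [i] [j] = - omega j i"
    by (simp_all add: abs_generators mat_generators mat_g2 mat_g3)
qed

lemma entry_G2_star: "entry generator_value G2_star [i] [j] = omega i j"
proof -
  have "entry generator_value G2_star = matrix_of (abs_morph G2_star)"
    by (simp add: mentry_abs G2_star_def)
  then have "entry generator_value G2_star [i] [j] = (\<Sum>a\<in>UNIV. \<Sum>b\<in>UNIV. \<Sum>c\<in>UNIV.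
      matrix_of (whisker [Neg] gc []) [i] [a, b, c] * matrix_of (whisker [] (cup Neg) [Pos]) [a, b, c] [j])"
    by (simp add: abs_G2_star mentry_comp sum_lists_Suc)
  also have "\<dots> = (\<Sum>a\<in>UNIV. \<Sum>b\<in>UNIV. \<Sum>c\<in>UNIV. ((if i = a then 1 else 0) * omega b c) * ((if b = a then 1 else 0) * (if c = j then 1 else 0)))"
    by (simp add: whisker_def mentry_juxt mentry_simps mat_generators)
  also have "\<dots> = omega i j"
    using exhaust_2[of i] exhaust_2[of j] by (auto simp: sum_2')
  finally show ?thesis .
qed

text \<open>The last diagram of \<open>E5\<close> factors through the empty sequence, so its matrix
  is the product of a column and a row.\<close>

lemma entry_comp_scalar: "src h = [] \<Longrightarrow> entry v (g \<circ>\<^sub>t h \<circ>\<^sub>t x) I J = entry v (g \<circ>\<^sub>t h) I [] * entry v x [] J"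
  by (simp add: sum_distrib_right mult.assoc)

lemma entry_E5:
  "entry generator_value ((id_V \<otimes>\<^sub>t G3) \<circ>\<^sub>t eta \<circ>\<^sub>t eps \<circ>\<^sub>t (G2 \<otimes>\<^sub>t id_V)) [i, j] [k, l] = - omega i j * omega k l"
proof -
  have "entry generator_value (eps \<circ>\<^sub>t (G2 \<otimes>\<^sub>t id_V)) [] [k, l] = omega k l"
    using exhaust_2[of l] by (auto simp: sum_lists_Suc sum_2' entry_G)
  moreover have "entry generator_value ((id_V \<otimes>\<^sub>t G3) \<circ>\<^sub>t eta) [i, j] [] = - omega i j"
    using exhaust_2[of i] by (auto simp: sum_lists_Suc sum_2' entry_G)
  ultimately show ?thesis by (subst entry_comp_scalar) simp_all
qed

lemma relation_zero:
  assumes "r \<in> relations \<sigma>"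
  shows "r \<in> finsupp (vertex_tangles generator_degree \<sigma>)" "U.eval_map \<sigma> r = \<zero>\<^bsub>box_space U.A \<sigma>\<^esub>"
proof -
  let ?P = "\<lambda>\<sigma> r. r \<in> finsupp (vertex_tangles generator_degree \<sigma>) \<and> U.eval_map \<sigma> r = \<zero>\<^bsub>box_space U.A \<sigma>\<^esub>"
  have "?P ([Neg] @ dual [Neg]) E1"
    unfolding E1_def
  proof (rule U.combination_kernel)
    fix I J :: "2 list" assume "length I = length [Neg]" "length J = length [Neg]"
    then obtain i j where "I = [i]" "J = [j]" by (auto simp: length_1)
    then show "(\<Sum>(a, t)\<leftarrow>[(1, G2 \<circ>\<^sub>t G3), (- 1, id_Vd)]. a * entry generator_value t I J) = 0"
      using exhaust_2[of i] exhaust_2[of j] by (auto simp: sum_lists_Suc sum_2' entry_G omega_def)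
  qed auto
  moreover have "?P ([] @ dual []) E2"
    unfolding E2_def
  proof (rule U.combination_kernel)
    fix I J :: "2 list" assume "length I = length ([] :: sign list)" "length J = length ([] :: sign list)"
    then show "(\<Sum>(a, t)\<leftarrow>[(1, G1 \<circ>\<^sub>t G3 \<circ>\<^sub>t G1_star)]. a * entry generator_value t I J) = 0"
      by (simp add: G1_star_def sum_lists_Suc sum_2' entry_G omega_def)
  qed (auto simp: G1_star_def)
  moreover have "?P ([] @ dual []) E3"
    unfolding E3_def
  proof (rule U.combination_kernel)
    fix I J :: "2 list" assume "length I = length ([] :: sign list)" "length J = length ([] :: sign list)"
    then show "(\<Sum>(a, t)\<leftarrow>[(1, eps \<circ>\<^sub>t Crossing Pos Neg \<circ>\<^sub>t eta), (- 2, Strands [])]. a * entry generator_value t I J) = 0"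
      by (simp add: sum_lists_Suc sum_2')
  qed auto
  moreover have "?P ([Pos] @ dual [Neg]) E4"
    unfolding E4_def
  proof (rule U.combination_kernel)
    fix I J :: "2 list" assume "length I = length [Neg]" "length J = length [Pos]"
    then obtain i j where "I = [i]" "J = [j]" by (auto simp: length_1)
    then show "(\<Sum>(a, t)\<leftarrow>[(1, G2_star), (1, G2)]. a * entry generator_value t I J) = 0"
      using exhaust_2[of i] exhaust_2[of j] by (auto simp: entry_G2_star entry_G omega_def)
  qed (auto simp: G2_star_def)
  moreover have "?P ([Pos, Pos] @ dual [Pos, Pos]) E5"
    unfolding E5_def
  proof (rule U.combination_kernel)
    fix I J :: "2 list" assume "length I = length [Pos, Pos]" "length J = length [Pos, Pos]"
    then obtain i j k l where IJ: "I = [i, j]" "J = [k, l]" by (auto simp: length_2)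
    define x y :: complex where "x = (if i = l \<and> j = k then 1 else 0)" and "y = (if i = k \<and> j = l then 1 else 0)"
    have "entry generator_value (Crossing Pos Pos) I J = x" "entry generator_value (id_V \<otimes>\<^sub>t id_V) I J = y"
      by (auto simp: IJ x_def y_def)
    \<comment> \<open>The contraction identity of the two-dimensional alternating symbol, checked on
      its 16 index values; it is the matrix form of \<open>E5\<close>.\<close>
    moreover have "x - y + omega i j * omega k l = 0"
      using exhaust_2[of i] exhaust_2[of j] exhaust_2[of k] exhaust_2[of l]
      unfolding x_def y_def by (elim disjE) (simp_all add: omega_def)
    moreover have "entry generator_value ((id_V \<otimes>\<^sub>t G3) \<circ>\<^sub>t eta \<circ>\<^sub>t eps \<circ>\<^sub>t (G2 \<otimes>\<^sub>t id_V)) I J = - (omega i j * omega k l)"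
      unfolding IJ entry_E5 by simp
    ultimately show "(\<Sum>(a, t)\<leftarrow>[(1, Crossing Pos Pos), (- 1, id_V \<otimes>\<^sub>t id_V),
        (- 1, (id_V \<otimes>\<^sub>t G3) \<circ>\<^sub>t eta \<circ>\<^sub>t eps \<circ>\<^sub>t (G2 \<otimes>\<^sub>t id_V))]. a * entry generator_value t I J) = 0"
      by (simp add: algebra_simps del: entry.simps)
  qed auto
  ultimately have "?P \<sigma> r" using assms by (auto simp: relations_def)
  then show "r \<in> finsupp (vertex_tangles generator_degree \<sigma>)" "U.eval_map \<sigma> r = \<zero>\<^bsub>box_space U.A \<sigma>\<^esub>"
    by auto
qed

lemma relations_carrier: "relations \<sigma> \<subseteq> carrier (box_space (free_ospa generator_degree) \<sigma>)"
  using relation_zero(1) by (auto simp: carrier_free)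

abbreviation diag_ideal where "diag_ideal \<equiv> generated_ideal (free_ospa generator_degree) relations"

interpretation D: generator_calculus diag_ideal
proof
  show "planar_ideal (free_ospa generator_degree) diag_ideal"
    by (rule ospa.planar_ideal_generated[OF ospa_free relations_carrier])
  show "relations \<sigma> \<subseteq> diag_ideal \<sigma>" for \<sigma>
    by (rule generated_ideal_superset)
qed

lemma coeffs_q: "D.vhom f \<sigma> [] \<Longrightarrow> U.coeffs (D.q f) J = matrix_of f [] J"
  by (erule D.vhom_abs) (simp add: D.q_abs U.coeffs_single mentry_abs)

lemma coeffs_lin:
  assumes "\<forall>(a, f)\<in>set xs. D.vhom f \<sigma> []"
  shows "U.coeffs (D.lin xs) J = (\<Sum>(a, f)\<leftarrow>xs. a * matrix_of f [] J)"
  using assms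
proof (induction xs)
  case Nil
  then show ?case by (simp add: U.coeffs_def support_def)
next
  case (Cons p xs)
  obtain a f where p: "p = (a, f)" by (cases p)
  have f: "D.vhom f \<sigma> []" and xs: "\<forall>(a, f)\<in>set xs. D.vhom f \<sigma> []" using Cons.prems p by auto
  have "D.lin xs \<in> finsupp (vertex_tangles generator_degree \<sigma>)"
    by (rule D.lin_in) (use xs in auto)
  then show ?case
    using Cons.IH[OF xs] D.q_in[OF f] coeffs_q[OF f] by (simp add: p U.coeffs_lincomb finsupp_def)
qed

lemma mat_gl_power: "matrix_of (gl_power (length S)) [] (rev S) = (if set S \<subseteq> {2} then 1 else 0)"
proof (induction S)
  case (Cons s S)
  have "matrix_of (gl_power (length S) \<cdot> whisker (pos (length S)) gl []) [] (rev S @ [s] @ []) =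
      (\<Sum>K | length K = length (cod gl). matrix_of (gl_power (length S)) [] (rev S @ K @ []) * matrix_of gl K [s])"
    by (rule mentry_comp_whisker) simp_all
  then show ?case using Cons by (simp add: mat_generators)
qed (simp add: mentry_simps)

text \<open>The stack lists the open strands from right to left, hence \<open>rev S\<close>: a
  closing letter pairs the top of the stack, the rightmost open strand, with the next index.\<close>

lemma mat_nf:
  "ballot i r \<Longrightarrow> length S = i \<Longrightarrow> length K = length r \<Longrightarrow> matrix_of (nf i r) [] (rev S @ K) = weight S r K"
proof (induction i r arbitrary: S K rule: nf.induct)
  case (1 i)
  then show ?case using mat_gl_power[of S] by auto
next
  case (2 i r)
  then obtain k K' where K: "K = k # K'" by (cases K) auto
  then show ?case using 2(1)[of "k # S" K'] 2(2-) by simp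
next
  case (4 i r)
  obtain s S' where S: "S = s # S'" "length S' = i" using 4(3) by (cases S) auto
  obtain k K' where K: "K = k # K'" "length K' = length r" using 4(4) by (cases K) auto
  have "matrix_of (nf i r \<cdot> whisker (pos i) gc (pos (length r))) [] (rev S' @ [s, k] @ K') =
      (\<Sum>L | length L = length (cod gc). matrix_of (nf i r) [] (rev S' @ L @ K') * matrix_of gc L [s, k])"
    using nf_typed[of i r] 4(2) S K by (intro mentry_comp_whisker) (simp_all add: pos_def replicate_app_Cons_same replicate_add)
  then show ?case using 4(1)[of S' K'] 4(2) S K by (simp add: mat_generators)
qed auto

text \<open>The matrices of \<open>straighten\<close> and \<open>unstraighten\<close> are inverse to
  each other, which transports statements about powers of V, where the ballot words live, to
  arbitrary types.\<close>

primrec unstraighten :: "sign list \<Rightarrow> generator morph" where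
  "unstraighten [] = strands []"
| "unstraighten (s # \<sigma>) = (case s of Pos \<Rightarrow> strands [Pos] | Neg \<Rightarrow> g2) \<boxtimes> unstraighten \<sigma>"

lemma unstraighten_typed [simp]:
  "ok (unstraighten \<sigma>)" "dom (unstraighten \<sigma>) = pos (length \<sigma>)" "cod (unstraighten \<sigma>) = \<sigma>"
  by (induction \<sigma>) (auto split: sign.splits)

lemma unstraighten_vertices: "(g, \<tau>) \<in># vertices (unstraighten \<sigma>) \<Longrightarrow> \<tau> = generator_degree g"
  by (induction \<sigma>) (auto split: sign.splits)

lemma mat_straighten_unstraighten:
  "length I = length \<sigma> \<Longrightarrow> length J = length \<sigma> \<Longrightarrow> matrix_of (straighten \<sigma> \<cdot> unstraighten \<sigma>) I J = (if I = J then 1 else 0)"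
proof (induction \<sigma> arbitrary: I J)
  case (Cons s \<sigma>)
  obtain i I' j J' where IJ: "I = i # I'" "J = j # J'" "length I' = length \<sigma>" "length J' = length \<sigma>"
    using Cons.prems by (cases I; cases J) auto
  let ?f = "case s of Pos \<Rightarrow> strands [Pos] | Neg \<Rightarrow> g3" and ?g = "case s of Pos \<Rightarrow> strands [Pos] | Neg \<Rightarrow> g2"
  have ok: "ok (?f \<cdot> ?g)" "dom (?f \<cdot> ?g) = [Pos]" "cod (?f \<cdot> ?g) = [Pos]" by (cases s; simp)+
  have "matrix_of (?f \<cdot> ?g) [i] [j] = (if i = j then 1 else 0)"
    using exhaust_2[of i] exhaust_2[of j]
    by (cases s) (auto simp: mentry_simps mentry_comp sum_lists_Suc sum_2' mat_g2 mat_g3 omega_def)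
  moreover have "straighten (s # \<sigma>) \<cdot> unstraighten (s # \<sigma>) = (?f \<cdot> ?g) \<boxtimes> (straighten \<sigma> \<cdot> unstraighten \<sigma>)"
    using interchange[of ?f ?g "straighten \<sigma>" "unstraighten \<sigma>"] ok by simp
  ultimately show ?case using Cons.IH[of I' J'] IJ ok by (simp add: mentry_juxt)
qed (simp add: mentry_simps)

lemma mat_unstraighten_straighten:
  "length I = length \<sigma> \<Longrightarrow> length J = length \<sigma> \<Longrightarrow> matrix_of (unstraighten \<sigma> \<cdot> straighten \<sigma>) I J = (if I = J then 1 else 0)"
proof (induction \<sigma> arbitrary: I J)
  case (Cons s \<sigma>)
  obtain i I' j J' where IJ: "I = i # I'" "J = j # J'" "length I' = length \<sigma>" "length J' = length \<sigma>"
    using Cons.prems by (cases I; cases J) auto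
  let ?f = "case s of Pos \<Rightarrow> strands [Pos] | Neg \<Rightarrow> g2" and ?g = "case s of Pos \<Rightarrow> strands [Pos] | Neg \<Rightarrow> g3"
  have ok: "ok (?f \<cdot> ?g)" "dom (?f \<cdot> ?g) = [s]" "cod (?f \<cdot> ?g) = [s]" by (cases s; simp)+
  have "matrix_of (?f \<cdot> ?g) [i] [j] = (if i = j then 1 else 0)"
    using exhaust_2[of i] exhaust_2[of j]
    by (cases s) (auto simp: mentry_simps mentry_comp sum_lists_Suc sum_2' mat_g2 mat_g3 omega_def)
  moreover have "unstraighten (s # \<sigma>) \<cdot> straighten (s # \<sigma>) = (?f \<cdot> ?g) \<boxtimes> (unstraighten \<sigma> \<cdot> straighten \<sigma>)"
    using interchange[of ?f ?g "unstraighten \<sigma>" "straighten \<sigma>"] ok by simp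
  ultimately show ?case using Cons.IH[of I' J'] IJ ok by (simp add: mentry_juxt)
qed (simp add: mentry_simps)

lemma mat_nf_straighten:
  assumes "r \<in> ballots (length \<sigma>)"
  shows "matrix_of (nf 0 r \<cdot> straighten \<sigma>) [] J = (\<Sum>K | length K = length \<sigma>. weight [] r K * matrix_of (straighten \<sigma>) K J)"
proof -
  have r: "ballot 0 r" "length r = length \<sigma>" using assms by (auto simp: ballots_def)
  then show ?thesis
    using nf_typed[OF r(1)] mat_nf[of 0 r "[]"] by (simp add: mentry_comp)
qed

text \<open>The list obtained from \<open>spanned\<close> may repeat a word; linear independence
  applies to the collected coefficients.\<close>

lemma sum_list_collect:
  fixes h :: "'b \<Rightarrow> 'a::comm_ring_1"
  assumes "finite B" "\<forall>(a, r)\<in>set xs. r \<in> B"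
  shows "(\<Sum>(a, r)\<leftarrow>xs. a * h r) = (\<Sum>r\<in>B. (\<Sum>(a, r')\<leftarrow>xs. if r' = r then a else 0) * h r)"
  using assms(2)
proof (induction xs)
  case (Cons p xs)
  obtain a r0 where p: "p = (a, r0)" by (cases p)
  have "(\<Sum>r\<in>B. (if r0 = r then a else 0) * h r) = (\<Sum>r\<in>B. if r = r0 then a * h r0 else 0)"
    by (intro sum.cong) auto
  then show ?case using Cons p assms(1) by (simp add: distrib_right sum.distrib)
qed simp

text \<open>Modulo the ideal \<open>x\<close> is a combination of normal forms. The ideal evaluates
  to 0, hence so does this combination, and independence of the weights kills its collected
  coefficients.\<close>

lemma eval_injective:
  assumes x: "x \<in> finsupp (vertex_tangles generator_degree \<sigma>)" and 0: "U.eval_map \<sigma> x = \<zero>\<^bsub>box_space U.A \<sigma>\<^esub>"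
  shows "x \<in> diag_ideal \<sigma>"
proof -
  let ?n = "length \<sigma>" and ?nf = "\<lambda>r. nf 0 r \<cdot> straighten \<sigma>"
  obtain xs where xs: "\<forall>(a, r)\<in>set xs. ballot 0 r \<and> length r = ?n"
    and d: "(\<lambda>c. x c - D.lin (map (\<lambda>(a, r). (a, ?nf r)) xs) c) \<in> diag_ideal \<sigma>"
    using D.spanned_all[OF x] unfolding D.spanned_def by blast
  let ?l = "D.lin (map (\<lambda>(a, r). (a, ?nf r)) xs)"
  define A where "A r = (\<Sum>(a, r')\<leftarrow>xs. if r' = r then a else 0)" for r
  have collect: "(\<Sum>(a, r)\<leftarrow>xs. a * h r) = (\<Sum>r\<in>ballots ?n. A r * h r)" for h :: "bool list \<Rightarrow> complex"
    unfolding A_def using xs by (intro sum_list_collect) (auto simp: ballots_def)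
  have v: "\<forall>(a, f)\<in>set (map (\<lambda>(a, r). (a, ?nf r)) xs). D.vhom f \<sigma> []"
    using xs D.vhom_nf_straighten by auto
  have l: "?l \<in> finsupp (vertex_tangles generator_degree \<sigma>)"
    by (rule D.lin_in) (use v in auto)
  have "U.eval_map \<sigma> (\<lambda>c. x c - ?l c) = \<zero>\<^bsub>box_space U.A \<sigma>\<^esub>"
    using generated_ideal_least[OF U.kernel_ideal, of relations \<sigma>] relation_zero d
    by (auto simp: carrier_free)
  then have zero: "(\<Sum>r\<in>ballots ?n. A r * matrix_of (?nf r) [] J) = 0" if J: "length J = ?n" for J
  proof -
    have "U.coeffs (\<lambda>c. -1 * ?l c + x c) J = - U.coeffs ?l J + U.coeffs x J"
      using x l by (subst U.coeffs_lincomb) (auto simp: finsupp_def)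
    moreover have "U.coeffs (\<lambda>c. x c - ?l c) J = 0" "U.coeffs x J = 0"
      using \<open>U.eval_map \<sigma> (\<lambda>c. x c - ?l c) = _\<close> 0 J by (auto simp: U.eval_map_zero_iff)
    ultimately have "U.coeffs ?l J = 0" by simp
    then show ?thesis
      using coeffs_lin[OF v, of J] collect[of "\<lambda>r. matrix_of (?nf r) [] J"] by (simp add: o_def case_prod_unfold)
  qed
  have "A r = 0" if "r \<in> ballots ?n" for r
  proof (rule ballots_independent[OF _ that])
    fix L :: "2 list" assume L: "length L = ?n"
    \<comment> \<open>Composition with \<open>unstraighten\<close> cancels \<open>straighten\<close>
      and leaves the weight of the word.\<close>
    have w: "(\<Sum>J | length J = ?n. matrix_of (?nf r) [] J * matrix_of (unstraighten \<sigma>) J L) = weight [] r L" if r: "r \<in> ballots ?n" for r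
    proof -
      have "(\<Sum>J | length J = ?n. matrix_of (?nf r) [] J * matrix_of (unstraighten \<sigma>) J L) =
          (\<Sum>K | length K = ?n. weight [] r K * (\<Sum>J | length J = ?n. matrix_of (straighten \<sigma>) K J * matrix_of (unstraighten \<sigma>) J L))"
        by (simp add: mat_nf_straighten[OF r] sum_distrib_left sum_distrib_right mult.assoc) (rule sum.swap)
      also have "\<dots> = (\<Sum>K | length K = ?n. if K = L then weight [] r K else 0)"
        using mat_straighten_unstraighten[of _ \<sigma> L] L by (intro sum.cong) (auto simp: mentry_comp)
      finally show ?thesis using L by simp
    qed
    have "(\<Sum>r\<in>ballots ?n. A r * weight [] r L) =
        (\<Sum>r\<in>ballots ?n. A r * (\<Sum>J | length J = ?n. matrix_of (?nf r) [] J * matrix_of (unstraighten \<sigma>) J L))"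
      by (intro sum.cong) (auto simp: w)
    also have "\<dots> = (\<Sum>J | length J = ?n. (\<Sum>r\<in>ballots ?n. A r * matrix_of (?nf r) [] J) * matrix_of (unstraighten \<sigma>) J L)"
      by (simp add: sum_distrib_left sum_distrib_right mult.assoc) (rule sum.swap)
    finally show "(\<Sum>r\<in>ballots ?n. A r * weight [] r L) = 0" using zero by simp
  qed
  \<comment> \<open>With all collected coefficients zero the combination itself vanishes in the free
    box space, not only its value, so \<open>d\<close> places \<open>x\<close> in the ideal.\<close>
  then have "?l c = 0" for c
    using collect[of "\<lambda>r. D.q (?nf r) c"] by (simp add: D.lin_def o_def case_prod_unfold)
  then show ?thesis using d by simp
qed

lemma tmat_pos: "length I = n \<Longrightarrow> length J = n \<Longrightarrow> U.tmat (pos n) 1 I J = matrix_prod shear I J"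
proof (induction I arbitrary: J n)
  case (Cons i I)
  then obtain j J' m where *: "J = j # J'" "n = Suc m" "length I = m" "length J' = m" by (cases J; cases n) auto
  have "signed_rep additive_complex unipotent_rep Pos 1 $ i $ j = shear i j"
    using exhaust_2[of i] exhaust_2[of j] by (auto simp: signed_rep_def unipotent_rep_entry shear_def)
  then show ?case
    using Cons.IH[OF *(3,4)] unfolding *(1,2) pos_simps(3)[symmetric] U.tmat_simps by simp
qed simp

lemma eval_surjective:
  assumes f: "f \<in> invariant_functionals additive_complex unipotent_rep \<sigma>"
  shows "\<exists>x\<in>finsupp (vertex_tangles generator_degree \<sigma>). U.eval_map \<sigma> x = f"
proof -
  let ?n = "length \<sigma>" and ?nf = "\<lambda>r. nf 0 r \<cdot> straighten \<sigma>"
  define c where "c J = f (basis_tensor J)" for J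
  \<comment> \<open>The coordinates of \<open>f\<close> pulled back to a power of V; they stay
    invariant because \<open>unstraighten\<close> is equivariant.\<close>
  define c' where "c' K = (\<Sum>J | length J = ?n. c J * matrix_of (unstraighten \<sigma>) J K)" for K
  have "shear_invariant ?n c'"
    unfolding shear_invariant_def
  proof (intro allI impI)
    fix L :: "2 list" assume L: "length L = ?n"
    have "(\<Sum>K | length K = ?n. c' K * matrix_prod shear K L) =
        (\<Sum>J | length J = ?n. c J * (\<Sum>K | length K = ?n. matrix_of (unstraighten \<sigma>) J K * U.tmat (pos ?n) 1 K L))"
      using L by (simp add: c'_def tmat_pos sum_distrib_left sum_distrib_right mult.assoc) (rule sum.swap)
    also have "\<dots> = (\<Sum>J | length J = ?n. c J * (\<Sum>M | length M = ?n. U.tmat \<sigma> 1 J M * matrix_of (unstraighten \<sigma>) M L))"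
      using U.mentry_equivariant[of 1 "unstraighten \<sigma>" _ L] L
      by (intro sum.cong) (auto simp: additive_complex_def dest: unstraighten_vertices)
    also have "\<dots> = (\<Sum>M | length M = ?n. (\<Sum>J | length J = ?n. c J * U.tmat \<sigma> 1 J M) * matrix_of (unstraighten \<sigma>) M L)"
      by (simp add: sum_distrib_left sum_distrib_right mult.assoc) (rule sum.swap)
    also have "\<dots> = c' L"
      unfolding c'_def c_def using U.invariant_coeffs[OF f, of 1]
      by (intro sum.cong) (auto simp: additive_complex_def)
    finally show "(\<Sum>K | length K = ?n. c' K * matrix_prod shear K L) = c' L" .
  qed
  then obtain a where a: "\<And>K. length K = ?n \<Longrightarrow> c' K = (\<Sum>r\<in>ballots ?n. a r * weight [] r K)"
    using ballots_span by blast
  obtain rs where rs: "set rs = ballots ?n" "distinct rs"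
    using finite_distinct_list[OF finite_ballots] by blast
  let ?xs = "map (\<lambda>r. (a r, ?nf r)) rs"
  have v: "\<forall>(a, f)\<in>set ?xs. D.vhom f \<sigma> []"
    using rs D.vhom_nf_straighten by (auto simp: ballots_def)
  have "U.coeffs (D.lin ?xs) J = c J" if J: "length J = ?n" for J
  proof -
    have "U.coeffs (D.lin ?xs) J = (\<Sum>r\<in>ballots ?n. a r * matrix_of (?nf r) [] J)"
      using coeffs_lin[OF v, of J] rs by (simp add: o_def sum_list_distinct_conv_sum_set)
    also have "\<dots> = (\<Sum>K | length K = ?n. (\<Sum>r\<in>ballots ?n. a r * weight [] r K) * matrix_of (straighten \<sigma>) K J)"
      by (simp add: mat_nf_straighten sum_distrib_left sum_distrib_right mult.assoc) (rule sum.swap)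
    also have "\<dots> = (\<Sum>K | length K = ?n. c' K * matrix_of (straighten \<sigma>) K J)"
      by (intro sum.cong) (auto simp: a)
    \<comment> \<open>The pullback by \<open>unstraighten\<close> now meets the
      \<open>straighten\<close> of the normal forms; they cancel and return the coordinates of
      \<open>f\<close>.\<close>
    also have "\<dots> = (\<Sum>M | length M = ?n. c M * (\<Sum>K | length K = ?n. matrix_of (unstraighten \<sigma>) M K * matrix_of (straighten \<sigma>) K J))"
      by (simp add: c'_def sum_distrib_left sum_distrib_right mult.assoc) (rule sum.swap)
    also have "\<dots> = (\<Sum>M | length M = ?n. if M = J then c M else 0)"
      using mat_unstraighten_straighten[of _ \<sigma> J] J by (intro sum.cong) (auto simp: mentry_comp)
    finally show ?thesis using J by simp
  qed
  then have "U.eval_map \<sigma> (D.lin ?xs) = f"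
    unfolding U.eval_map_def by (subst U.invariant_functional[OF f], intro functional_eqI) (simp add: c_def)
  moreover have "D.lin ?xs \<in> finsupp (vertex_tangles generator_degree \<sigma>)"
    by (rule D.lin_in) (use v in auto)
  ultimately show ?thesis by blast
qed

theorem theorem1:
  shows "\<exists>\<phi>. ospa_iso Diag0 Alg0 \<phi>"
  unfolding Diag0_def Alg0_def
  using U.presented_iso[OF relations_carrier relation_zero(2) eval_surjective eval_injective] .

end
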